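(* Let $Q=\{F=0\}\subset\mathbb{P}^2$ be an irreducible quartic such that $Q\cup L_\infty$ is one of the thirteen irreducible $QL$-configurations $(1),\dots,(13)$ listed in the context, and let $f(x,y)=F(x,y,1)$. \begin{enumerate} \item If $Q$ is of type $(13)$, then $Q$ has no $(2,3)$ torus decomposition. \item If $Q$ is of type $(5)$, then $Q$ has exactly five $(2,3)$ torus decompositions (up to the equivalence in the context); three of them are visible and two are invisible. \item If $Q$ is of one of the types $(1),(2),(3),(4),(6),(7),(8),(9),(10),(11),(12)$, then $Q$ has exactly one $(2,3)$ torus decomposition (up to equivalence). \end{enumerate}
   Context: Work in $\mathbb{P}^2$ with homogeneous coordinates $[X:Y:Z]$; $L_\infty=\{Z=0\}$ is the line at infinity and $\mathbb{C}^2=\mathbb{P}^2\setminus L_\infty$ with affine coordinates $x=X/Z$, $y=Y/Z$. For $n\ge1$, $a_n$ denotes the topological type of the plane curve germ $x^2+y^{n+1}=0$ at the origin, and $e_6$ that of $x^3+y^4=0$. Positions of a quartic $Q$ relative to $L_\infty$: (i) $Q\cap L_\infty$ consists of two distinct smooth points of $Q$ at each of which $L_\infty$ is tangent to $Q$ (bitangent); (ii) $Q\cap L_\infty$ consists of two points, $L_\infty$ being tangent to $Q$ at a smooth point and passing through a singular point of $Q$; (iv) $Q\cap L_\infty$ is a single smooth point of $Q$ with intersection multiplicity $4$; (v) $Q\cap L_\infty$ is a single singular point of $Q$ with intersection multiplicity $4$. The irreducible $QL$-configurations are the following, where the list gives all singular points of $Q$, a superscript $\infty$ means the singular point lies on $L_\infty$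 and singularities without superscript lie off $L_\infty$: (1) $2a_2$, (i); (2) $2a_2$, (iv); (3) $2a_2+a_1$, (i); (4) $2a_2+a_1$, (iv); (5) $3a_2$, (i); (6) $a_2+a_3^\infty$, (ii); (7) $a_5$, (i); (8) $a_5$, (iv); (9) $a_6^\infty$, (ii); (10) $a_4^\infty+a_2$, (v); (11) $e_6$, (i); (12) $e_6$, (iv); (13) $a_4+a_2^\infty$, (ii). A $(2,3)$ torus decomposition of $Q$ (with respect to $L_\infty$) is a pair $(f_2,f_3)$ of coprime nonconstant polynomials in $\mathbb{C}[x,y]$ with $\deg f_2\le 2$, $\deg f_3\le 3$ and $c\,f=f_2^3+f_3^2$ for some nonzero constant $c$. Equivalently, with $F_2=Z^2f_2(X/Z,Y/Z)$ and $F_3=Z^3f_3(X/Z,Y/Z)$ one has $F_2^3+F_3^2=c\,Z^2F$. The decomposition is called visible if $Z$ divides $F_2$ (i.e. $\deg f_2\le1$; then $F_2=ZF_1'$, $F_3=ZF_2'$ and $cF=F_2'^2+F_1'^3Z$), and invisible otherwise. Two decompositions $(f_2,f_3)$ and $(f_2',f_3')$ are considered the same if $f_2'=\alpha f_2$ and $f_3'=\beta f_3$ for nonzero constants $\alpha,\beta$. *)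

theory Defs
  imports "HOL-Analysis.Analysis" "HOL-Computational_Algebra.Polynomial_Factorial"
begin

text \<open>A polynomial in C[x,y] is a complex poly poly: outer variable y, inner variable x.
  The coefficient of x^i y^j of p is coeff (coeff p j) i.\<close>

definition eval2 :: "complex poly poly \<Rightarrow> complex \<Rightarrow> complex \<Rightarrow> complex" where
  "eval2 p x y = poly (map_poly (\<lambda>q. poly q x) p) y"

definition totdeg :: "complex poly poly \<Rightarrow> nat" where
  "totdeg p = Max ({0} \<union> {i + degree (coeff p i) | i. coeff p i \<noteq> 0})"

definition cpoly2 :: "complex \<Rightarrow> complex poly poly" where
  "cpoly2 c = [:[:c:]:]"

type_synonym pt3 = "complex \<times> complex \<times> complex"

definition homog :: "nat \<Rightarrow> complex poly poly \<Rightarrow> pt3 \<Rightarrow> complex" where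
  "homog d p v = (case v of (X, Y, Z) \<Rightarrow>
     (\<Sum>j\<le>d. \<Sum>i\<le>d - j. coeff (coeff p j) i * X ^ i * Y ^ j * Z ^ (d - i - j)))"

definition zcoord :: "pt3 \<Rightarrow> complex" where
  "zcoord v = snd (snd v)"

definition smul3 :: "complex \<Rightarrow> pt3 \<Rightarrow> pt3" where
  "smul3 c v = (case v of (a, b, e) \<Rightarrow> (c * a, c * b, c * e))"

definition proj_same :: "pt3 \<Rightarrow> pt3 \<Rightarrow> bool" where
  "proj_same v w \<longleftrightarrow> (\<exists>c. c \<noteq> 0 \<and> w = smul3 c v)"

definition det3 :: "pt3 \<Rightarrow> pt3 \<Rightarrow> pt3 \<Rightarrow> complex" where
  "det3 u v w = (case u of (a1, a2, a3) \<Rightarrow> case v of (b1, b2, b3) \<Rightarrow> case w of (c1, c2, c3) \<Rightarrow>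
     a1 * (b2 * c3 - b3 * c2) - a2 * (b1 * c3 - b3 * c1) + a3 * (b1 * c2 - b2 * c1))"

definition on_curve :: "(pt3 \<Rightarrow> complex) \<Rightarrow> pt3 \<Rightarrow> bool" where
  "on_curve F v \<longleftrightarrow> v \<noteq> 0 \<and> F v = 0"

definition sing_pt :: "(pt3 \<Rightarrow> complex) \<Rightarrow> pt3 \<Rightarrow> bool" where
  "sing_pt F v \<longleftrightarrow> on_curve F v \<and> (F has_derivative (\<lambda>_. 0)) (at v)"

definition smooth_pt :: "(pt3 \<Rightarrow> complex) \<Rightarrow> pt3 \<Rightarrow> bool" where
  "smooth_pt F v \<longleftrightarrow> on_curve F v \<and> \<not> sing_pt F v"

definition top_equiv_germ :: "(complex \<times> complex) set \<Rightarrow> (complex \<times> complex) set \<Rightarrow> bool" where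
  "top_equiv_germ V W \<longleftrightarrow>
     (\<exists>U U' \<phi> \<psi>. open U \<and> open U' \<and> (0, 0) \<in> U \<and> homeomorphism U U' \<phi> \<psi> \<and>
        \<phi> (0, 0) = (0, 0) \<and> \<phi> ` (V \<inter> U) = W \<inter> U')"

definition germ_A :: "nat \<Rightarrow> (complex \<times> complex) set" where
  "germ_A n = {(x, y). x ^ 2 + y ^ (n + 1) = 0}"

definition germ_E6 :: "(complex \<times> complex) set" where
  "germ_E6 = {(x, y). x ^ 3 + y ^ 4 = 0}"

definition aff3 :: "pt3 \<Rightarrow> complex \<Rightarrow> pt3 \<Rightarrow> complex \<Rightarrow> pt3 \<Rightarrow> pt3" where
  "aff3 v s u t w = (case v of (v1, v2, v3) \<Rightarrow> case u of (u1, u2, u3) \<Rightarrow> case w of (w1, w2, w3) \<Rightarrow>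
     (v1 + s * u1 + t * w1, v2 + s * u2 + t * w2, v3 + s * u3 + t * w3))"

text \<open>The germ of Q at the point [v] has topological type T: read in an affine chart
  (s,t) \<mapsto> [v + s u + t w] centred at [v] (any such chart gives the same type).\<close>
definition has_type :: "(pt3 \<Rightarrow> complex) \<Rightarrow> pt3 \<Rightarrow> (complex \<times> complex) set \<Rightarrow> bool" where
  "has_type F v T \<longleftrightarrow>
     (\<exists>u w. det3 v u w \<noteq> 0 \<and> top_equiv_germ {(s, t). F (aff3 v s u t w) = 0} T)"

text \<open>For a point [a:b:0] of L_inf, the restriction F(X,Y,0) = f_4(X,Y) (top homogeneous part of f)
  is pulled back along t \<mapsto> (a,b) + t(c,d), with (c,d) independent of (a,b); the intersection
  multiplicity is the order of vanishing at t = 0.\<close>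
definition linf_restr :: "complex poly poly \<Rightarrow> pt3 \<Rightarrow> complex poly" where
  "linf_restr p v = (case v of (a, b, _) \<Rightarrow>
     (let (c, d) = (if a \<noteq> 0 then (0, 1) else (1, 0)) in
       (\<Sum>j\<le>4. smult (coeff (coeff p j) (4 - j)) ([:a, c:] ^ (4 - j) * [:b, d:] ^ j))))"

definition imult_inf :: "complex poly poly \<Rightarrow> pt3 \<Rightarrow> nat" where
  "imult_inf p v = order 0 (linf_restr p v)"

definition on_linf :: "complex poly poly \<Rightarrow> pt3 \<Rightarrow> bool" where
  "on_linf p v \<longleftrightarrow> on_curve (homog 4 p) v \<and> zcoord v = 0"

definition sing_list :: "complex poly poly \<Rightarrow> ((complex \<times> complex) set \<times> bool) list \<Rightarrow> bool" where
  "sing_list p L \<longleftrightarrow> (let F = homog 4 p in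
     (\<exists>vs. length vs = length L \<and>
        (\<forall>k < length L. sing_pt F (vs ! k) \<and> has_type F (vs ! k) (fst (L ! k)) \<and>
                          (zcoord (vs ! k) = 0 \<longleftrightarrow> snd (L ! k))) \<and>
        (\<forall>k < length L. \<forall>l < length L. k \<noteq> l \<longrightarrow> \<not> proj_same (vs ! k) (vs ! l)) \<and>
        (\<forall>v. sing_pt F v \<longrightarrow> (\<exists>k < length L. proj_same (vs ! k) v))))"

definition pos_i :: "complex poly poly \<Rightarrow> bool" where
  "pos_i p \<longleftrightarrow> (let F = homog 4 p in \<exists>v w. on_linf p v \<and> on_linf p w \<and> \<not> proj_same v w \<and>
     (\<forall>u. on_linf p u \<longrightarrow> proj_same v u \<or> proj_same w u) \<and>
     smooth_pt F v \<and> smooth_pt F w \<and> imult_inf p v = 2 \<and> imult_inf p w = 2)"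

definition pos_ii :: "complex poly poly \<Rightarrow> bool" where
  "pos_ii p \<longleftrightarrow> (let F = homog 4 p in \<exists>v w. on_linf p v \<and> on_linf p w \<and> \<not> proj_same v w \<and>
     (\<forall>u. on_linf p u \<longrightarrow> proj_same v u \<or> proj_same w u) \<and>
     smooth_pt F v \<and> imult_inf p v \<ge> 2 \<and> sing_pt F w)"

definition pos_iv :: "complex poly poly \<Rightarrow> bool" where
  "pos_iv p \<longleftrightarrow> (let F = homog 4 p in \<exists>v. on_linf p v \<and>
     (\<forall>u. on_linf p u \<longrightarrow> proj_same v u) \<and> smooth_pt F v \<and> imult_inf p v = 4)"

definition pos_v :: "complex poly poly \<Rightarrow> bool" where
  "pos_v p \<longleftrightarrow> (let F = homog 4 p in \<exists>v. on_linf p v \<and>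
     (\<forall>u. on_linf p u \<longrightarrow> proj_same v u) \<and> sing_pt F v \<and> imult_inf p v = 4)"

definition QL_config :: "nat \<Rightarrow> complex poly poly \<Rightarrow> bool" where
  "QL_config k p = (
     if k = 1 then sing_list p [(germ_A 2, False), (germ_A 2, False)] \<and> pos_i p
     else if k = 2 then sing_list p [(germ_A 2, False), (germ_A 2, False)] \<and> pos_iv p
     else if k = 3 then sing_list p [(germ_A 2, False), (germ_A 2, False), (germ_A 1, False)] \<and> pos_i p
     else if k = 4 then sing_list p [(germ_A 2, False), (germ_A 2, False), (germ_A 1, False)] \<and> pos_iv p
     else if k = 5 then sing_list p [(germ_A 2, False), (germ_A 2, False), (germ_A 2, False)] \<and> pos_i p
     else if k = 6 then sing_list p [(germ_A 2, False), (germ_A 3, True)] \<and> pos_ii p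
     else if k = 7 then sing_list p [(germ_A 5, False)] \<and> pos_i p
     else if k = 8 then sing_list p [(germ_A 5, False)] \<and> pos_iv p
     else if k = 9 then sing_list p [(germ_A 6, True)] \<and> pos_ii p
     else if k = 10 then sing_list p [(germ_A 4, True), (germ_A 2, False)] \<and> pos_v p
     else if k = 11 then sing_list p [(germ_E6, False)] \<and> pos_i p
     else if k = 12 then sing_list p [(germ_E6, False)] \<and> pos_iv p
     else if k = 13 then sing_list p [(germ_A 4, False), (germ_A 2, True)] \<and> pos_ii p
     else False)"

definition torus_decs :: "complex poly poly \<Rightarrow> (complex poly poly \<times> complex poly poly) set" where
  "torus_decs f = {(f2, f3). coprime f2 f3 \<and> 0 < totdeg f2 \<and> 0 < totdeg f3 \<and>
       totdeg f2 \<le> 2 \<and> totdeg f3 \<le> 3 \<and>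
       (\<exists>c. c \<noteq> 0 \<and> cpoly2 c * f = f2 ^ 3 + f3 ^ 2)}"

definition visible_decs :: "complex poly poly \<Rightarrow> (complex poly poly \<times> complex poly poly) set" where
  "visible_decs f = {d \<in> torus_decs f. totdeg (fst d) \<le> 1}"

definition invisible_decs :: "complex poly poly \<Rightarrow> (complex poly poly \<times> complex poly poly) set" where
  "invisible_decs f = {d \<in> torus_decs f. \<not> totdeg (fst d) \<le> 1}"

definition dec_equiv :: "((complex poly poly \<times> complex poly poly) \<times> (complex poly poly \<times> complex poly poly)) set" where
  "dec_equiv = {((a, b), (a', b')). \<exists>\<alpha> \<beta>. \<alpha> \<noteq> 0 \<and> \<beta> \<noteq> 0 \<and> a' = cpoly2 \<alpha> * a \<and> b' = cpoly2 \<beta> * b}"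

end

theory Submission
 imports Defs "HOL-Complex_Analysis.Complex_Analysis" "HOL-Number_Theory.Cong" "HOL-Real_Asymp.Real_Asymp"
  "HOL-Computational_Algebra.Fundamental_Theorem_Algebra" "HOL-Computational_Algebra.Field_as_Ring"
begin

text \<open>All configurations restrict to a square on the line at infinity, and a visible decomposition is an identity
\<open>f = q\<^sup>2 + l\<^sup>3\<close>. Two inequivalent visible decompositions, or an invisible one, force \<open>f\<close> into the normal form of the
tricuspidal quartic with its bitangent at infinity; hence there is at most one decomposition outside type (5), and in type (5)
the normal form can be used to list all of them. For existence, take coordinates adapted to the singular points: every
coefficient that obstructs \<open>f = q\<^sup>2 + l\<^sup>3\<close> would yield a line component or a singular point of another topological type.
The topological types are told apart by the number of branches, by linking numbers of branches, and, for unibranch germs,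
by the action of the deck transformation of the infinite cyclic cover of the complement on circle-valued functions.\<close>

section \<open>Local homeomorphisms and normal forms of plane curve germs\<close>

text \<open>Types are defined by homeomorphisms alone, so every algebraic degeneration must be
  refuted by an invariant of such maps. The main separations are \<open>germ_A\<close> n, n at most
  4, from A5 and E6; n at most 5 from A6; and triple points with a simple tangent from A5 and E6.
  Connectedness decides the parity of n, divisibility of linking numbers separates odd indices; only
  A2, A4 against A6 and even A_n against E6 need the cyclic cover. The lists of singularities meet
  uniqueness through cusps: both normal forms that a second decomposition produces have three affine
  cusps, while the lists outside (5) have at most two points or a node in third place. In type (5)
  two pairs of cusps give two visible decompositions, whence the normal form. There q is quadratic
  in the second line, so exactly two lines pair with l, making three visible classes; the invisible
  form is, after scaling, symmetric in its two lines, making two more. The square at infinity turns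
  coefficient comparisons into matching two squares, and it controls the quartic part of an
  invisible decomposition, where the terms of degree 6 and 5 cancel.\<close>

lemma top_equiv_germ_sym:
 assumes "top_equiv_germ V W" shows "top_equiv_germ W V"
proof -
 obtain U U' \<phi> \<psi> where *: "open U" "open U'" "(0, 0) \<in> U" "homeomorphism U U' \<phi> \<psi>"
   "\<phi> (0, 0) = (0, 0)" "\<phi> ` (V \<inter> U) = W \<inter> U'"
  using assms unfolding top_equiv_germ_def by blast
 have h: "homeomorphism U' U \<psi> \<phi>" using *(4) homeomorphism_symD by blast
 have "\<psi> (0, 0) = (0, 0)" using *(3,4,5) by (metis homeomorphism_apply1)
 moreover have "(0, 0) \<in> U'" using *(3,4,5) by (metis homeomorphism_image1 image_eqI)
 moreover have "\<psi> ` (W \<inter> U') = V \<inter> U"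
 proof -
  have "\<psi> ` (\<phi> ` (V \<inter> U)) = V \<inter> U"
   using homeomorphism_apply1[OF *(4)] by (force simp: image_image)
  then show ?thesis unfolding *(6) .
 qed
 ultimately show ?thesis
  using * h unfolding top_equiv_germ_def by blast
qed

lemma top_equiv_germ_trans:
 assumes "top_equiv_germ V W" "top_equiv_germ W T" shows "top_equiv_germ V T"
proof -
 obtain U U' \<phi> \<psi> where 1: "open U" "open U'" "(0, 0) \<in> U" "homeomorphism U U' \<phi> \<psi>"
   "\<phi> (0, 0) = (0, 0)" "\<phi> ` (V \<inter> U) = W \<inter> U'"
  using assms unfolding top_equiv_germ_def by blast
 obtain X X' \<alpha> \<beta> where 2: "open X" "open X'" "(0, 0) \<in> X" "homeomorphism X X' \<alpha> \<beta>"
   "\<alpha> (0, 0) = (0, 0)" "\<alpha> ` (W \<inter> X) = T \<inter> X'"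
  using assms unfolding top_equiv_germ_def by blast
 define Y where "Y = U' \<inter> X"
 have oY: "open Y" unfolding Y_def using 1 2 by auto
 have hY: "homeomorphism (\<psi> ` Y) Y \<phi> \<psi>"
  using homeomorphism_of_subsets[OF homeomorphism_symD[OF 1(4)], of Y "\<psi> ` Y"] 1(4)
  by (metis Int_lower1 Y_def homeomorphism_image2 homeomorphism_symD image_mono)
 have hY2: "homeomorphism Y (\<alpha> ` Y) \<alpha> \<beta>"
  using homeomorphism_of_subsets[OF 2(4), of Y "\<alpha> ` Y"] 2(4)
  by (metis Int_lower2 Y_def homeomorphism_image1 image_mono)
 have o1: "open (\<psi> ` Y)"
  using homeomorphism_imp_open_map[OF homeomorphism_symD[OF 1(4)], of Y] 1 oY
  by (metis Int_lower1 Y_def open_subset openin_open_trans)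
 have o2: "open (\<alpha> ` Y)"
  using homeomorphism_imp_open_map[OF 2(4), of Y] 2 oY
  by (metis Int_lower2 Y_def open_subset openin_open_trans)
 have hh: "homeomorphism (\<psi> ` Y) (\<alpha> ` Y) (\<alpha> \<circ> \<phi>) (\<psi> \<circ> \<beta>)"
  using homeomorphism_compose[OF hY hY2] .
 have 0: "(0, 0) \<in> Y" using 1 2 unfolding Y_def by (metis IntI homeomorphism_image1 image_eqI)
 have 00: "(0, 0) \<in> \<psi> ` Y" using 0 1 by (metis homeomorphism_apply1 image_eqI)
 have "(\<alpha> \<circ> \<phi>) ` (V \<inter> \<psi> ` Y) = T \<inter> \<alpha> ` Y"
 proof -
  have "\<phi> ` (V \<inter> \<psi> ` Y) = W \<inter> Y"
  proof
   show "\<phi> ` (V \<inter> \<psi> ` Y) \<subseteq> W \<inter> Y"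
   proof
    fix y assume "y \<in> \<phi> ` (V \<inter> \<psi> ` Y)"
    then obtain v where v: "v \<in> V" "v \<in> \<psi> ` Y" "y = \<phi> v" by blast
    then have "y \<in> Y" using homeomorphism_image1[OF hY] by blast
    moreover have "v \<in> U" using v homeomorphism_image2[OF 1(4)] unfolding Y_def by blast
    ultimately show "y \<in> W \<inter> Y" using v 1(6) by blast
   qed
   show "W \<inter> Y \<subseteq> \<phi> ` (V \<inter> \<psi> ` Y)"
   proof
    fix y assume y: "y \<in> W \<inter> Y"
    then have "y \<in> W \<inter> U'" unfolding Y_def by auto
    then obtain v where v: "v \<in> V" "v \<in> U" "y = \<phi> v" using 1(6) by blast
    then have "v = \<psi> y" using 1(4) by (simp add: homeomorphism_apply1)
    then show "y \<in> \<phi> ` (V \<inter> \<psi> ` Y)" using v y by blast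
   qed
  qed
  moreover have "\<alpha> ` (W \<inter> Y) = T \<inter> \<alpha> ` Y"
  proof
   show "\<alpha> ` (W \<inter> Y) \<subseteq> T \<inter> \<alpha> ` Y" using 2 unfolding Y_def by blast
   show "T \<inter> \<alpha> ` Y \<subseteq> \<alpha> ` (W \<inter> Y)"
   proof
    fix y assume y: "y \<in> T \<inter> \<alpha> ` Y"
    then obtain z where z: "z \<in> Y" "y = \<alpha> z" by blast
    then have "y \<in> T \<inter> X'" using y 2(4) unfolding Y_def by (auto simp: homeomorphism_def)
    then obtain v where v: "v \<in> W" "v \<in> X" "y = \<alpha> v" using 2(6) by blast
    then have "v = z" using z 2(4) unfolding Y_def by (metis IntD2 homeomorphism_apply1)
    then show "y \<in> \<alpha> ` (W \<inter> Y)" using v z by blast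
   qed
  qed
  ultimately show ?thesis by (metis image_comp)
 qed
 moreover have "(\<alpha> \<circ> \<phi>) (0, 0) = (0, 0)" using 1 2 by simp
 ultimately show ?thesis
  unfolding top_equiv_germ_def using o1 o2 00 hh by blast
qed

text \<open>Strict differentiability at the origin is all that is needed to get a local homeomorphism
 from invariance of domain, and unlike continuous differentiability it is trivial to propagate.\<close>

definition sdiff :: "(complex \<times> complex => complex) => complex => complex => bool" where
 "sdiff g a b \<longleftrightarrow> (\<forall>e>0. \<exists>d>0. \<forall>p\<in>ball 0 d. \<forall>q\<in>ball 0 d.
   norm (g p - g q - (a*(fst p - fst q)+b*(snd p - snd q))) \<le> e*norm (p - q))"

lemma sdiffD:
 assumes "sdiff g a b" "e > 0"
 obtains d where "d > 0" "\<And>p q. p \<in> ball 0 d ==> q \<in> ball 0 d ==>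
   norm (g p - g q - (a*(fst p - fst q)+b*(snd p - snd q))) \<le> e*norm (p - q)"
 using assms unfolding sdiff_def by blast

lemma sdiff_const: "sdiff (%_. c) 0 0"
 unfolding sdiff_def by (auto intro: exI[of _ 1])

lemma sdiff_fst: "sdiff fst 1 0"
 unfolding sdiff_def by (auto intro: exI[of _ 1])

lemma sdiff_snd: "sdiff snd 0 1"
 unfolding sdiff_def by (auto intro: exI[of _ 1])

lemma sdiff_add:
 assumes "sdiff g a b" "sdiff h c d" shows "sdiff (%z. g z+h z) (a + c) (b+d)"
 unfolding sdiff_def
proof (intro allI impI)
 fix e :: real assume "e > 0"
 then have e2: "e/2 > 0" by simp
 obtain d1 where d1: "d1 > 0" "\<And>p q. p \<in> ball 0 d1 ==> q \<in> ball 0 d1 ==>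
   norm (g p - g q - (a*(fst p - fst q)+b*(snd p - snd q))) \<le> e/2*norm (p - q)"
  using sdiffD[OF assms(1) e2] by blast
 obtain d2 where d2: "d2 > 0" "\<And>p q. p \<in> ball 0 d2 ==> q \<in> ball 0 d2 ==>
   norm (h p - h q - (c*(fst p - fst q)+d*(snd p - snd q))) \<le> e/2*norm (p - q)"
  using sdiffD[OF assms(2) e2] by blast
 show "\<exists>d'>0. \<forall>p\<in>ball 0 d'. \<forall>q\<in>ball 0 d'.
   norm (g p+h p - (g q+h q) - ((a + c)*(fst p - fst q)+(b+d)*(snd p - snd q)))
    \<le> e*norm (p - q)"
 proof (intro exI[of _ "min d1 d2"] conjI ballI)
  show "min d1 d2 > 0" using d1 d2 by simp
  fix p q :: "complex \<times> complex" assume "p \<in> ball 0 (min d1 d2)" "q \<in> ball 0 (min d1 d2)"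
  then have "norm (g p - g q - (a*(fst p - fst q)+b*(snd p - snd q))) \<le> e/2*norm (p - q)"
   "norm (h p - h q - (c*(fst p - fst q)+d*(snd p - snd q))) \<le> e/2*norm (p - q)"
   using d1 d2 by auto
  moreover have "g p+h p - (g q+h q) - ((a + c)*(fst p - fst q)+(b+d)*(snd p - snd q))
    = (g p - g q - (a*(fst p - fst q)+b*(snd p - snd q)))
   +(h p - h q - (c*(fst p - fst q)+d*(snd p - snd q)))"
   by (simp add: algebra_simps)
  ultimately show "norm (g p+h p - (g q+h q) - ((a + c)*(fst p - fst q)+(b+d)*(snd p - snd q)))
    \<le> e*norm (p - q)"
   using norm_triangle_ineq[of "g p - g q - (a*(fst p - fst q)+b*(snd p - snd q))"
    "h p - h q - (c*(fst p - fst q)+d*(snd p - snd q))"] by (simp add: field_simps)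
 qed
qed

lemma sdiff_lipschitz:
 assumes "sdiff g a b"
 obtains d where "d > 0" "\<And>p q. p \<in> ball 0 d ==> q \<in> ball 0 d ==>
   norm (g p - g q) \<le> (1+norm a+norm b)*norm (p - q)"
proof -
 obtain d where d: "d > 0" "\<And>p q. p \<in> ball 0 d ==> q \<in> ball 0 d ==>
   norm (g p - g q - (a*(fst p - fst q)+b*(snd p - snd q))) \<le> 1*norm (p - q)"
  using sdiffD[OF assms, of 1] by auto
 show ?thesis
 proof (rule that[OF d(1)])
  fix p q :: "complex \<times> complex" assume pq: "p \<in> ball 0 d" "q \<in> ball 0 d"
  have "norm (a*(fst p - fst q)+b*(snd p - snd q)) \<le> norm a*norm (fst p - fst q)+norm b*norm (snd p - snd q)"
   by (metis norm_mult norm_triangle_ineq)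
  also have "\<dots> \<le> norm a*norm (p - q)+norm b*norm (p - q)"
   by (intro add_mono mult_left_mono) (metis fst_diff norm_fst_le norm_ge_zero snd_diff norm_snd_le prod.collapse)+
  finally have 1: "norm (a*(fst p - fst q)+b*(snd p - snd q)) \<le> (norm a+norm b)*norm (p - q)"
   by (simp add: distrib_right)
  have "norm (g p - g q) \<le> norm (g p - g q - (a*(fst p - fst q)+b*(snd p - snd q)))
    +norm (a*(fst p - fst q)+b*(snd p - snd q))"
   by (metis diff_add_cancel norm_triangle_ineq)
  then show "norm (g p - g q) \<le> (1+norm a+norm b)*norm (p - q)"
   using 1 d(2)[OF pq] by (simp add: algebra_simps)
 qed
qed

lemma sdiff_continuous:
 assumes "sdiff g a b"
 obtains d where "d > 0" "continuous_on (ball 0 d) g"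
proof -
 obtain d where d: "d > 0" "\<And>p q. p \<in> ball 0 d ==> q \<in> ball 0 d ==>
   norm (g p - g q) \<le> (1+norm a+norm b)*norm (p - q)"
  using sdiff_lipschitz[OF assms] by blast
 have "(1+norm a+norm b)-lipschitz_on (ball 0 d) g"
  by (rule lipschitz_onI) (use d in \<open>auto simp: dist_norm\<close>)
 then show ?thesis using that d lipschitz_on_continuous_on by blast
qed

text \<open>Mean value bound for \<open>\<phi>\<close> minus its linear part at \<open>z0\<close>:
  the derivative of the difference is small near \<open>z0\<close> because
  \<open>deriv \<phi>\<close> is continuous.\<close>

lemma holomorphic_strictly_differentiable:
 assumes "\<phi> holomorphic_on S" "open S" "z0 \<in> S" "e > 0"
 obtains d where "d > 0" "ball z0 d \<subseteq> S" "\<And>u v. u \<in> ball z0 d ==> v \<in> ball z0 d ==>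
   norm (\<phi> u - \<phi> v - deriv \<phi> z0*(u - v)) \<le> e*norm (u - v)"
proof -
 have "continuous_on S (deriv \<phi>)"
  using assms holomorphic_deriv holomorphic_on_imp_continuous_on by blast
 then obtain d1 where d1: "d1 > 0" "\<And>z. z \<in> S ==> dist z z0 < d1 ==> dist (deriv \<phi> z) (deriv \<phi> z0) < e"
  using assms unfolding continuous_on_iff by metis
 obtain d2 where d2: "d2 > 0" "ball z0 d2 \<subseteq> S" using assms open_contains_ball by blast
 define d where "d = min d1 d2"
 have *: "norm ((\<phi> u - deriv \<phi> z0*u) - (\<phi> v - deriv \<phi> z0 * v)) \<le> e*norm (u - v)"
  if "u \<in> ball z0 d" "v \<in> ball z0 d" for u v
 proof (rule field_differentiable_bound[of "ball z0 d" _ "%z. deriv \<phi> z - deriv \<phi> z0"])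
  fix z assume z: "z \<in> ball z0 d"
  then have "z \<in> S" using d2 unfolding d_def by auto
  then have "(\<phi> has_field_derivative deriv \<phi> z) (at z within ball z0 d)"
   using assms has_field_derivative_at_within holomorphic_derivI by blast
  then show "((%u. \<phi> u - deriv \<phi> z0*u) has_field_derivative deriv \<phi> z - deriv \<phi> z0) (at z within ball z0 d)"
   by (auto intro!: derivative_eq_intros)
  show "norm (deriv \<phi> z - deriv \<phi> z0) \<le> e"
   using d1(2)[OF \<open>z \<in> S\<close>] z unfolding d_def by (auto simp: dist_norm norm_minus_commute)
 qed (use that in auto)
 show ?thesis
  by (rule that[of d]) (use d1 d2 * in \<open>auto simp: d_def algebra_simps\<close>)
qed

lemma sdiff_compose:
 assumes "\<phi> holomorphic_on S" "open S" "g 0 \<in> S" "sdiff g a b"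
 shows "sdiff (%z. \<phi> (g z)) (deriv \<phi> (g 0)*a) (deriv \<phi> (g 0)*b)"
 unfolding sdiff_def
proof (intro allI impI)
 fix e :: real assume e: "e > 0"
 define K where "K = 1+norm a+norm b"
 define c where "c = deriv \<phi> (g 0)"
 have K: "K > 0" unfolding K_def by (simp add: add_pos_nonneg)
 define e1 where "e1 = e/(2*K)"
 define e2 where "e2 = e/(2*(norm c+1))"
 have nc: "norm c+1 > 0" by (simp add: add_nonneg_pos)
 have e1: "e1 > 0" and e2: "e2 > 0" unfolding e1_def e2_def using e K nc by auto
 obtain d1 where d1: "d1 > 0" "ball (g 0) d1 \<subseteq> S" "\<And>u v. u \<in> ball (g 0) d1 ==> v \<in> ball (g 0) d1 ==>
   norm (\<phi> u - \<phi> v - c*(u - v)) \<le> e1*norm (u - v)"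
  using holomorphic_strictly_differentiable[OF assms(1,2,3) e1] unfolding c_def by blast
 obtain d2 where d2: "d2 > 0" "\<And>p q. p \<in> ball 0 d2 ==> q \<in> ball 0 d2 ==>
   norm (g p - g q - (a*(fst p - fst q)+b*(snd p - snd q))) \<le> e2*norm (p - q)"
  using sdiffD[OF assms(4) e2] by blast
 obtain d3 where d3: "d3 > 0" "\<And>p q. p \<in> ball 0 d3 ==> q \<in> ball 0 d3 ==>
   norm (g p - g q) \<le> K*norm (p - q)"
  using sdiff_lipschitz[OF assms(4)] unfolding K_def by blast
 define d where "d = min d2 (min d3 (d1/K))"
 have d: "d > 0" unfolding d_def using d1 d2 d3 K by auto
 have inb: "g p \<in> ball (g 0) d1" if "p \<in> ball 0 d" for p
 proof -
  have "norm (g p - g 0) \<le> K*norm (p - 0)" using d3(2)[of p 0] that d3(1) unfolding d_def by auto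
  also have "\<dots> < K*(d1/K)" using that K unfolding d_def by (intro mult_strict_left_mono) auto
  finally show ?thesis using K by (simp add: dist_norm norm_minus_commute)
 qed
 show "\<exists>d>0. \<forall>p\<in>ball 0 d. \<forall>q\<in>ball 0 d. norm (\<phi> (g p) - \<phi> (g q) -
    (deriv \<phi> (g 0)*a*(fst p - fst q)+deriv \<phi> (g 0)*b*(snd p - snd q))) \<le> e*norm (p - q)"
 proof (intro exI[of _ d] conjI ballI d)
  fix p q :: "complex \<times> complex" assume pq: "p \<in> ball 0 d" "q \<in> ball 0 d"
  have "norm (\<phi> (g p) - \<phi> (g q) - c*(g p - g q)) \<le> e1*norm (g p - g q)"
   using d1(3) inb pq by blast
  also have "\<dots> \<le> e1*(K*norm (p - q))"
   using d3(2)[of p q] pq e1 unfolding d_def by (intro mult_left_mono) auto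
  also have "\<dots> = e/2*norm (p - q)" unfolding e1_def using K by simp
  finally have 1: "norm (\<phi> (g p) - \<phi> (g q) - c*(g p - g q)) \<le> e/2*norm (p - q)" .
  have "norm (c*(g p - g q - (a*(fst p - fst q)+b*(snd p - snd q)))) \<le> norm c*(e2*norm (p - q))"
   unfolding norm_mult using d2(2)[of p q] pq unfolding d_def by (intro mult_left_mono) auto
  also have "\<dots> \<le> (norm c+1)*(e2*norm (p - q))"
   using e2 by (intro mult_right_mono) auto
  also have "\<dots> = e/2*norm (p - q)" unfolding e2_def using nc by (simp add: divide_simps)
  finally have 2: "norm (c*(g p - g q - (a*(fst p - fst q)+b*(snd p - snd q)))) \<le> e/2*norm (p - q)" .
  have "\<phi> (g p) - \<phi> (g q) - (c*a*(fst p - fst q) + c*b*(snd p - snd q)) =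
    (\<phi> (g p) - \<phi> (g q) - c*(g p - g q)) + c*(g p - g q - (a*(fst p - fst q)+b*(snd p - snd q)))"
   by (simp add: algebra_simps)
  then have "norm (\<phi> (g p) - \<phi> (g q) - (c*a*(fst p - fst q) + c*b*(snd p - snd q)))
    \<le> e/2*norm (p - q)+e/2*norm (p - q)"
   using 1 2 norm_triangle_ineq[of "\<phi> (g p) - \<phi> (g q) - c*(g p - g q)"] by (smt (verit))
  then show "norm (\<phi> (g p) - \<phi> (g q) - (deriv \<phi> (g 0)*a*(fst p - fst q)+deriv \<phi> (g 0)*b*(snd p - snd q)))
    \<le> e*norm (p - q)"
   unfolding c_def by (simp add: field_simps)
 qed
qed

lemma sdiff_cmult:
 assumes "sdiff g a b" shows "sdiff (%z. c*g z) (c*a) (c*b)"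
proof -
 have "deriv (%u. c*u) z = c" for z :: complex
  by (rule DERIV_imp_deriv) (auto intro!: derivative_eq_intros)
 then show ?thesis
  using sdiff_compose[of "%u. c*u" UNIV g a b] assms by (auto intro!: holomorphic_intros)
qed

text \<open>Polarisation g h = ((g + h)^2 - (g - h)^2) / 4 reduces the product rule to sums and to
  the chain rule for the holomorphic function squaring, so no separate estimate is made.\<close>

lemma sdiff_mult:
 assumes "sdiff g a b" "sdiff h c d"
 shows "sdiff (%z. g z*h z) (a*h 0+g 0 * c) (b*h 0+g 0*d)"
proof -
 have dd: "deriv (%u. u\<^sup>2) z = 2*z" for z :: complex
  by (rule DERIV_imp_deriv) (auto intro!: derivative_eq_intros)
 have sq: "sdiff (%z. (k z)\<^sup>2) (2 * k 0*x) (2 * k 0*y)" if "sdiff k x y" for k x y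
  using sdiff_compose[of "%u. u\<^sup>2" UNIV k x y, OF _ open_UNIV _ that] unfolding dd
  by (simp add: holomorphic_on_power)
 have p: "sdiff (%z. (g z+h z)\<^sup>2) (2*(g 0+h 0)*(a + c)) (2*(g 0+h 0)*(b+d))"
  using sq[OF sdiff_add[OF assms]] .
 have m: "sdiff (%z. (g z+(-1)*h z)\<^sup>2) (2*(g 0+(-1)*h 0)*(a+(-1) * c)) (2*(g 0+(-1)*h 0)*(b+(-1)*d))"
  using sq[OF sdiff_add[OF assms(1) sdiff_cmult[OF assms(2), of "-1"]]] .
 have "sdiff (%z. (1/4)*(g z+h z)\<^sup>2+(-1/4)*(g z+(-1)*h z)\<^sup>2)
   ((1/4)*(2*(g 0+h 0)*(a + c))+(-1/4)*(2*(g 0+(-1)*h 0)*(a+(-1) * c)))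
   ((1/4)*(2*(g 0+h 0)*(b+d))+(-1/4)*(2*(g 0+(-1)*h 0)*(b+(-1)*d)))"
  by (intro sdiff_add sdiff_cmult p m)
 also have "(%z. (1/4)*(g z+h z)\<^sup>2+(-1/4)*(g z+(-1)*h z)\<^sup>2) = (%z. g z*h z)"
  by (rule ext) (simp add: power2_eq_square algebra_simps)
 also have "(1/4)*(2*(g 0+h 0)*(a + c))+(-1/4)*(2*(g 0+(-1)*h 0)*(a+(-1) * c)) = a*h 0+g 0 * c"
  by (simp add: algebra_simps)
 also have "(1/4)*(2*(g 0+h 0)*(b+d))+(-1/4)*(2*(g 0+(-1)*h 0)*(b+(-1)*d)) = b*h 0+g 0*d"
  by (simp add: algebra_simps)
 finally show ?thesis .
qed

text \<open>Coefficients of normal forms enter only through their values at the origin; the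
  derivative is therefore hidden, and membership follows syntactically from
  \<open>sd_intros\<close>.\<close>

definition sd :: "(complex \<times> complex => complex) => bool" where
 "sd g \<longleftrightarrow> (\<exists>a b. sdiff g a b)"

lemma sd_const: "sd (%_. c)" using sdiff_const unfolding sd_def by blast
lemma sd_fst: "sd fst" using sdiff_fst unfolding sd_def by blast
lemma sd_snd: "sd snd" using sdiff_snd unfolding sd_def by blast
lemma sd_add: "sd g ==> sd h ==> sd (%z. g z+h z)" using sdiff_add unfolding sd_def by blast
lemma sd_mult: "sd g ==> sd h ==> sd (%z. g z*h z)" using sdiff_mult unfolding sd_def by blast
lemma sd_uminus: "sd g ==> sd (%z. - g z)" using sdiff_cmult[of g _ _ "-1"] unfolding sd_def by fastforce
lemma sd_diff: "sd g ==> sd h ==> sd (%z. g z - h z)" using sd_add[OF _ sd_uminus, of g h] by simp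
lemma sd_power: "sd g ==> sd (%z. g z^n)" by (induction n) (auto intro: sd_const sd_mult)
lemma sd_inverse: assumes "sd g" "g 0 \<noteq> 0" shows "sd (%z. inverse (g z))"
proof -
 obtain a b where "sdiff g a b" using assms unfolding sd_def by blast
 then have "sdiff (%z. inverse (g z)) (deriv inverse (g 0)*a) (deriv inverse (g 0)*b)"
  using assms by (intro sdiff_compose[of inverse "- {0}"]) (auto intro!: holomorphic_intros)
 then show ?thesis unfolding sd_def by blast
qed
lemma sd_divide: "sd g ==> sd h ==> h 0 \<noteq> 0 ==> sd (%z. g z/h z)"
 using sd_mult[OF _ sd_inverse, of g h] by (simp add: divide_inverse)

lemmas sd_intros = sd_const sd_fst sd_snd sd_add sd_mult sd_uminus sd_diff sd_power sd_divide

text \<open>Dividing by \<open>g 0\<close> moves the value at the origin to 1, away from the cut of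
  \<open>Ln\<close>, so the root is strictly differentiable there; the constant \<open>c\<close>
  restores the root of \<open>g 0\<close>. The power identity holds across the cut as well, since
  exp (Ln z) = z for every nonzero z.\<close>

lemma sd_root:
 assumes "sd g" "g 0 \<noteq> 0" "n > 0"
 obtains r where "sd r" "r 0 \<noteq> 0" "\<And>z. g z \<noteq> 0 ==> r z^n = g z"
proof -
 define c where "c = exp (Ln (g 0) / of_nat n)"
 have c: "c^n = g 0" unfolding c_def using assms by (simp flip: exp_of_nat_mult)
 define r where "r = (%z. exp (Ln (g z/g 0) / of_nat n) * c)"
 have "sd (%z. g z/g 0)" using assms by (intro sd_intros) auto
 then obtain a b where ab: "sdiff (%z. g z/g 0) a b" unfolding sd_def by blast
 have "sd (%z. exp (Ln (g z/g 0) / of_nat n))"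
  unfolding sd_def
 proof (intro exI)
  show "sdiff (%z. exp (Ln (g z/g 0) / of_nat n))
    (deriv (%u. exp (Ln u / of_nat n)) (g 0/g 0)*a) (deriv (%u. exp (Ln u / of_nat n)) (g 0/g 0)*b)"
   using assms ab by (intro sdiff_compose[of "%u. exp (Ln u / of_nat n)" "- \<real>\<^sub>\<le>\<^sub>0" "%z. g z/g 0"])
    (auto intro!: holomorphic_intros)
 qed
 then have "sd r" unfolding r_def by (intro sd_intros)
 moreover have "r 0 \<noteq> 0" unfolding r_def c_def by simp
 moreover have "r z^n = g z" if "g z \<noteq> 0" for z
  unfolding r_def using that assms c by (simp add: power_mult_distrib flip: exp_of_nat_mult)
 ultimately show ?thesis using that by blast
qed

text \<open>Injectivity comes from Cramer's rule applied to two approximate linear equations for the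
  difference of two points with equal image; openness and the continuous inverse come from
  invariance of domain.\<close>

lemma local_homeomorphism:
 assumes X: "sdiff X a b" and Y: "sdiff Y c d" and det: "a*d - b * c \<noteq> 0"
  and N: "open N" "0 \<in> N"
 obtains U \<psi> where "open U" "0 \<in> U" "U \<subseteq> N" "open ((%p. (X p, Y p)) ` U)"
  "homeomorphism U ((%p. (X p, Y p)) ` U) (%p. (X p, Y p)) \<psi>"
proof -
 define K where "K = norm a+norm b+norm c+norm d+1"
 define D where "D = norm (a*d - b * c)"
 have K: "K > 0" unfolding K_def by (simp add: add_nonneg_pos)
 have D: "D > 0" unfolding D_def using det by simp
 \<comment> \<open>With this tolerance the Cramer estimate reads D |p - q| \<le> (D/2) |p - q|,
   which forces p = q.\<close>
 define e where "e = D/(2*K)"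
 have e: "e > 0" unfolding e_def using D K by simp
 obtain d1 where d1: "d1 > 0" "\<And>p q. p \<in> ball 0 d1 ==> q \<in> ball 0 d1 ==>
   norm (X p - X q - (a*(fst p - fst q)+b*(snd p - snd q))) \<le> e*norm (p - q)"
  using sdiffD[OF X e] by blast
 obtain d2 where d2: "d2 > 0" "\<And>p q. p \<in> ball 0 d2 ==> q \<in> ball 0 d2 ==>
   norm (Y p - Y q - (c*(fst p - fst q)+d*(snd p - snd q))) \<le> e*norm (p - q)"
  using sdiffD[OF Y e] by blast
 obtain d3 where d3: "d3 > 0" "continuous_on (ball 0 d3) X" using sdiff_continuous[OF X] by blast
 obtain d4 where d4: "d4 > 0" "continuous_on (ball 0 d4) Y" using sdiff_continuous[OF Y] by blast
 obtain d5 where d5: "d5 > 0" "ball 0 d5 \<subseteq> N" using N open_contains_ball by blast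
 define r where "r = min d1 (min d2 (min d3 (min d4 d5)))"
 define U where "U = ball (0::complex \<times> complex) r"
 have r: "r > 0" unfolding r_def using d1 d2 d3 d4 d5 by auto
 have inj: "inj_on (%p. (X p, Y p)) U"
 proof (rule inj_onI)
  fix p q assume pq: "p \<in> U" "q \<in> U" and "(X p, Y p) = (X q, Y q)"
  then have eq: "X p = X q" "Y p = Y q" by auto
  define u where "u = fst p - fst q"
  define v where "v = snd p - snd q"
  have 1: "norm (a*u+b * v) \<le> e*norm (p - q)"
   using d1(2)[of p q] pq eq norm_minus_cancel[of "a*u+b * v"] unfolding U_def r_def u_def v_def by simp
  have 2: "norm (c*u+d * v) \<le> e*norm (p - q)"
   using d2(2)[of p q] pq eq norm_minus_cancel[of "c*u+d * v"] unfolding U_def r_def u_def v_def by simp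
  have "(a*d - b * c)*u = d*(a*u+b * v) - b*(c*u+d * v)" by (simp add: algebra_simps)
  then have "D*norm u \<le> norm (d*(a*u+b * v))+norm (b*(c*u+d * v))"
   unfolding D_def by (metis norm_mult norm_triangle_ineq4)
  also have "\<dots> \<le> norm d*(e*norm (p - q))+norm b*(e*norm (p - q))"
   unfolding norm_mult by (intro add_mono mult_left_mono 1 2) auto
  finally have u: "D*norm u \<le> (norm d+norm b)*(e*norm (p - q))" by (simp add: algebra_simps)
  have "(a*d - b * c) * v = a*(c*u+d * v) - c*(a*u+b * v)" by (simp add: algebra_simps)
  then have "D*norm v \<le> norm (a*(c*u+d * v))+norm (c*(a*u+b * v))"
   unfolding D_def by (metis norm_mult norm_triangle_ineq4)
  also have "\<dots> \<le> norm a*(e*norm (p - q))+norm c*(e*norm (p - q))"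
   unfolding norm_mult by (intro add_mono mult_left_mono 1 2) auto
  finally have v: "D*norm v \<le> (norm a+norm c)*(e*norm (p - q))" by (simp add: algebra_simps)
  have "norm (p - q) \<le> norm u+norm v"
   unfolding u_def v_def by (metis fst_diff snd_diff norm_Pair_le prod.collapse)
  then have "D*norm (p - q) \<le> D*norm u+D*norm v"
   using D by (simp flip: distrib_left)
  also have "\<dots> \<le> K*(e*norm (p - q))"
  proof -
   have "0 \<le> e*norm (p - q)" using e by simp
   then show ?thesis using u v unfolding K_def by (simp add: algebra_simps)
  qed
  also have "\<dots> = D/2*norm (p - q)" unfolding e_def using K by simp
  finally have "norm (p - q) \<le> 0" using D by (simp add: field_simps)
  then show "p = q" by simp
 qed
 have cont: "continuous_on U (%p. (X p, Y p))"
  by (intro continuous_on_Pair continuous_on_subset[OF d3(2)] continuous_on_subset[OF d4(2)])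
   (auto simp: U_def r_def)
 have oU: "open U" unfolding U_def by simp
 obtain \<psi> where h: "homeomorphism U ((%p. (X p, Y p)) ` U) (%p. (X p, Y p)) \<psi>"
  using invariance_of_domain_homeomorphism[OF oU cont _ inj] by auto
 have "open ((%p. (X p, Y p)) ` U)"
  using invariance_of_domain[OF cont oU inj] .
 moreover have "0 \<in> U" "U \<subseteq> N" using r d5 unfolding U_def r_def by auto
 ultimately show ?thesis using that oU h by blast
qed

lemma top_equiv_germ_chart:
 assumes X: "sdiff X a b" and Y: "sdiff Y c d" and det: "a*d - b * c \<noteq> 0"
  and 0: "X 0 = 0" "Y 0 = 0" and N: "open N" "0 \<in> N"
  and VT: "\<And>z. z \<in> N ==> z \<in> V \<longleftrightarrow> (X z, Y z) \<in> T"
 shows "top_equiv_germ V T"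
proof -
 obtain U \<psi> where U: "open U" "0 \<in> U" "U \<subseteq> N" "open ((%p. (X p, Y p)) ` U)"
  "homeomorphism U ((%p. (X p, Y p)) ` U) (%p. (X p, Y p)) \<psi>"
  by (rule local_homeomorphism[OF X Y det N])
 have "(%p. (X p, Y p)) ` (V \<inter> U) = T \<inter> (%p. (X p, Y p)) ` U"
  using VT U(3) by (auto simp: image_iff subset_iff)
 then show ?thesis
  unfolding top_equiv_germ_def
  by (intro exI[of _ U] exI[of _ "(%p. (X p, Y p)) ` U"] exI[of _ "%p. (X p, Y p)"] exI[of _ \<psi>] conjI)
   (use U 0 in \<open>simp_all add: zero_prod_def\<close>)
qed

lemma sdiff_snd_power: "\<exists>c. sdiff (%z. snd z^n) 0 c"
proof (induction n)
 case 0 then show ?case using sdiff_const[of 1] by auto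
next
 case (Suc n)
 then obtain c where "sdiff (%z. snd z^n) 0 c" by blast
 from sdiff_mult[OF sdiff_snd this] show ?case by auto
qed

text \<open>Completing the square turns the equation into A (w + B y^k/(2A))^2 + E y^p with E = C -
  B^2 y^(2k-p)/(4A). Roots of A and E absorb these units and give X^2 + Y^p. The factor
  \<open>0^(2 * k - p)\<close> is 1 exactly when 2k = p, so the hypothesis \<open>E0\<close> says
  E(0) is nonzero both in the balanced case, where it is a discriminant condition, and in the case p
  < 2k.\<close>

theorem germ_A_normal_form:
 assumes A: "sd A" and B: "sd B" and C: "sd C" and w: "sdiff w wx wy"
  and w0: "w 0 = 0" and A0: "A 0 \<noteq> 0" and wx: "wx \<noteq> 0"
  and p: "p \<ge> 1" and k: "k \<ge> 1" "p \<le> 2 * k"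
  and E0: "4*A 0*C 0 \<noteq> (B 0)\<^sup>2*0^(2 * k - p)"
  and N: "open N" "0 \<in> N"
  and eq: "\<And>z. z \<in> N ==> \<phi> z = A z*(w z)\<^sup>2+B z * snd z ^ k*w z+C z * snd z^p"
 shows "top_equiv_germ {z. \<phi> z = 0} (germ_A (p - 1))"
proof -
 define E where "E = (%z. C z - (B z)\<^sup>2 * snd z^(2 * k - p)/(4*A z))"
 have sE: "sd E" unfolding E_def using A B C A0 by (intro sd_intros) auto
 have EE: "E 0 \<noteq> 0" using E0 A0 unfolding E_def by (auto simp: field_simps)
 obtain R where R: "sd R" "R 0 \<noteq> 0" "\<And>z. A z \<noteq> 0 ==> R z^2 = A z"
  using sd_root[OF A A0, of 2] by auto
 obtain S where S: "sd S" "S 0 \<noteq> 0" "\<And>z. E z \<noteq> 0 ==> S z^p = E z"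
  using sd_root[OF sE EE, of p] p by auto
 obtain sa sb where Sab: "sdiff S sa sb" using S(1) unfolding sd_def by blast
 obtain ra rb where Rab: "sdiff R ra rb" using R(1) unfolding sd_def by blast
 have "sd (%z. B z/(2*A z))" using A B A0 by (intro sd_intros) auto
 then obtain ba bb where BA: "sdiff (%z. B z/(2*A z)) ba bb" unfolding sd_def by blast
 obtain c where c: "sdiff (%z. snd z ^ k) 0 c" using sdiff_snd_power by blast
 define X where "X = (%z. R z*(w z+B z/(2*A z) * snd z ^ k))"
 define Y where "Y = (%z. snd z*S z)"
 have k0: "(0::complex) ^ k = 0" using k by auto
 from sdiff_mult[OF Rab sdiff_add[OF w sdiff_mult[OF BA c]]]
 obtain xb where X: "sdiff X (R 0*wx) xb"
  unfolding X_def by (simp add: w0 k0)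
 from sdiff_mult[OF sdiff_snd Sab] have Y: "sdiff Y 0 (S 0)" unfolding Y_def by simp
 obtain aa ab where "sdiff A aa ab" using A unfolding sd_def by blast
 then obtain d1 where d1: "d1 > 0" "continuous_on (ball 0 d1) A" using sdiff_continuous by blast
 obtain ea eb where "sdiff E ea eb" using sE unfolding sd_def by blast
 then obtain d2 where d2: "d2 > 0" "continuous_on (ball 0 d2) E" using sdiff_continuous by blast
 have o1: "open (ball 0 d1 \<inter> A -` (- {0}))"
  using continuous_open_preimage[OF d1(2) open_ball, of "- {0}"] by (simp add: open_Compl)
 have o2: "open (ball 0 d2 \<inter> E -` (- {0}))"
  using continuous_open_preimage[OF d2(2) open_ball, of "- {0}"] by (simp add: open_Compl)
 define M where "M = N \<inter> (ball 0 d1 \<inter> A -` (- {0})) \<inter> (ball 0 d2 \<inter> E -` (- {0}))"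
 have M: "open M" "0 \<in> M" unfolding M_def using N o1 o2 d1(1) d2(1) A0 EE by auto
 have "z \<in> {z. \<phi> z = 0} \<longleftrightarrow> (X z, Y z) \<in> germ_A (p - 1)" if z: "z \<in> M" for z
 proof -
  have nz: "A z \<noteq> 0" "E z \<noteq> 0" and zN: "z \<in> N" using z unfolding M_def by auto
  have pp: "snd z^(2 * k - p) * snd z^p = (snd z ^ k)\<^sup>2"
   using k by (simp flip: power_add power_mult add: mult.commute)
  have "(X z)\<^sup>2+(Y z)^p = A z*(w z+B z/(2*A z) * snd z ^ k)\<^sup>2 + snd z^p*E z"
   unfolding X_def Y_def using R(3)[OF nz(1)] S(3)[OF nz(2)] by (simp add: power_mult_distrib)
  also have "snd z^p*E z = C z * snd z^p - (B z)\<^sup>2*(snd z^(2 * k - p) * snd z^p)/(4*A z)"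
   unfolding E_def by (simp add: algebra_simps)
  also have "A z*(w z+B z/(2*A z) * snd z ^ k)\<^sup>2+\<dots> = \<phi> z"
   unfolding pp eq[OF zN] using nz(1) by (simp add: field_simps power2_eq_square)
  finally show ?thesis unfolding germ_A_def using p by simp
 qed
 then show ?thesis
  using top_equiv_germ_chart[OF X Y _ _ _ M] R(2) S(2) wx w0 k0 unfolding X_def Y_def by simp
qed

section \<open>Branches and linking numbers\<close>

lemma continuous_log_of_one_constant:
 assumes "connected S" "continuous_on S L" "\<And>x. x \<in> S ==> exp (L x) = (1::complex)"
  "x \<in> S" "y \<in> S"
 shows "L x = L y"
proof -
 have "\<exists>e>0. \<forall>y. y \<in> S \<and> L y \<noteq> L x --> e \<le> norm (L y - L x)" if x: "x \<in> S" for x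
 proof (intro exI[of _ "2*pi"] conjI allI impI)
  fix y assume y: "y \<in> S \<and> L y \<noteq> L x"
  have "exp (L y - L x) = 1" using assms(3)[of x] assms(3)[of y] x y by (simp add: exp_diff)
  then obtain n :: int where n: "Re (L y - L x) = 0" "Im (L y - L x) = of_int (2*n)*pi"
   unfolding exp_eq_1 by auto
  have "n \<noteq> 0" using n y by (auto simp: complex_eq_iff)
  then have "1 \<le> \<bar>real_of_int n\<bar>" by linarith
  then have "2*pi*1 \<le> 2*pi*\<bar>real_of_int n\<bar>" by (intro mult_left_mono) auto
  also have "\<dots> = \<bar>Im (L y - L x)\<bar>" unfolding n(2) by (simp add: abs_mult)
  also have "\<dots> \<le> norm (L y - L x)" by (rule abs_Im_le_cmod)
  finally show "2*pi \<le> norm (L y - L x)" by simp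
 qed simp
 then have "L constant_on S"
  using assms(1,2) continuous_discrete_range_constant[OF assms(1,2)] by blast
 then show ?thesis using assms unfolding constant_on_def by metis
qed

text \<open>Defined by a continuous logarithm instead of an integral: loops need only be continuous,
  and products and integer powers of functions add and scale winding numbers.\<close>

definition wn :: "(real => complex) => int => bool" where
 "wn c k \<longleftrightarrow> (\<exists>l. continuous_on {0..1} l \<and> (\<forall>t\<in>{0..1}. c t = exp (l t)) \<and>
   l 1 - l 0 = 2 * of_real pi*\<i> * of_int k)"

lemma wn_unique:
 assumes "wn c k" "wn c m" shows "k = m"
proof -
 obtain l where l: "continuous_on {0..1} l" "\<forall>t\<in>{0..1}. c t = exp (l t)" "l 1 - l 0 = 2 * of_real pi*\<i> * of_int k"
  using assms unfolding wn_def by blast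
 obtain l' where l': "continuous_on {0..1} l'" "\<forall>t\<in>{0..1}. c t = exp (l' t)" "l' 1 - l' 0 = 2 * of_real pi*\<i> * of_int m"
  using assms unfolding wn_def by blast
 have "(%t. l t - l' t) 0 = (%t. l t - l' t) 1"
 proof (rule continuous_log_of_one_constant[of "{0..1::real}"])
  show "continuous_on {0..1} (%t. l t - l' t)" using l l' by (intro continuous_intros)
  show "exp (l t - l' t) = 1" if "t \<in> {0..1}" for t
   using l(2) l'(2) that by (metis divide_self exp_diff exp_not_eq_zero)
 qed auto
 then have "2 * of_real pi*\<i> * of_int k = 2 * of_real pi*\<i>*(of_int m :: complex)"
  using l(3) l'(3) by (simp add: algebra_simps)
 then show ?thesis by simp
qed

lemma wn_cong: "wn c k ==> (\<And>t. t \<in> {0..1} ==> d t = c t) ==> wn d k"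
 unfolding wn_def by auto

lemma wn_exists:
 assumes "continuous_on {0..1} c" "\<And>t. t \<in> {0..1} ==> c t \<noteq> 0" "c 0 = c 1"
 obtains k where "wn c k"
proof -
 obtain l where l: "continuous_on {0..1} l" "\<And>t. t \<in> {0..1} ==> c t = exp (l t)"
  using continuous_logarithm_on_contractible[of "{0..1::real}" c] assms convex_imp_contractible
  by (metis convex_real_interval(5))
 have "exp (l 1) = exp (l 0)" using l(2)[of 0] l(2)[of 1] assms(3) by simp
 then obtain k :: int where "l 1 = l 0+(of_int (2 * k)*pi)*\<i>"
  unfolding exp_eq by blast
 then show ?thesis using l that[of k] unfolding wn_def by (auto simp: algebra_simps intro!: exI[of _ l])
qed

lemma wn_mult:
 assumes "wn c k" "wn d m" shows "wn (%t. c t*d t) (k+m)"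
proof -
 obtain l where l: "continuous_on {0..1} l" "\<forall>t\<in>{0..1}. c t = exp (l t)" "l 1 - l 0 = 2 * of_real pi*\<i> * of_int k"
  using assms unfolding wn_def by blast
 obtain l' where l': "continuous_on {0..1} l'" "\<forall>t\<in>{0..1}. d t = exp (l' t)" "l' 1 - l' 0 = 2 * of_real pi*\<i> * of_int m"
  using assms unfolding wn_def by blast
 show ?thesis unfolding wn_def
  by (rule exI[of _ "%t. l t+l' t"]) (use l l' in \<open>auto intro!: continuous_intros simp: exp_add algebra_simps\<close>)
qed

lemma exp_of_int_mult: "exp (of_int n*z) = exp (z::complex) powi n"
proof (cases "n \<ge> 0")
 case True
 then obtain k where "n = int k" by (metis nonneg_int_cases)
 then show ?thesis by (simp add: exp_of_nat_mult)
next
 case False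
 then obtain k where "n = - int k" by (metis int_cases2 linorder_not_le of_nat_0_le_iff)
 then show ?thesis by (simp add: exp_minus power_int_minus exp_of_nat_mult)
qed

lemma wn_powi:
 assumes "wn c k" shows "wn (%t. c t powi n) (n * k)"
proof -
 obtain l where l: "continuous_on {0..1} l" "\<forall>t\<in>{0..1}. c t = exp (l t)" "l 1 - l 0 = 2 * of_real pi*\<i> * of_int k"
  using assms unfolding wn_def by blast
 have "of_int n*l 1 - of_int n*l 0 = 2 * of_real pi*\<i> * of_int (n * k)"
  using l(3) by (simp flip: right_diff_distrib)
 then show ?thesis unfolding wn_def
  by (intro exI[of _ "%t. of_int n*l t"])
   (use l in \<open>auto intro!: continuous_intros simp: exp_of_int_mult\<close>)
qed

lemma wn_power: "wn c k ==> wn (%t. c t^n) (int n * k)"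
 using wn_powi[of c k "int n"] by simp

lemma wn_exp: "continuous_on {0..1} L ==> L 0 = L 1 ==> wn (%t. exp (L t)) 0"
 unfolding wn_def by (intro exI[of _ L]) auto

lemma wn_const: "c \<noteq> 0 ==> wn (%t. c) 0"
 using wn_exp[of "%_. Ln c"] by simp

lemma wn_circle:
 assumes "r \<noteq> 0" shows "wn (%t. r*exp (2 * of_real pi*\<i> * of_real t)) 1"
 unfolding wn_def
 by (rule exI[of _ "%t. Ln r+2 * of_real pi*\<i> * of_real t"])
  (use assms in \<open>auto intro!: continuous_intros simp: exp_add\<close>)

lemma wn_near_const:
 assumes "continuous_on {0..1} c" "c 0 = c 1" "\<And>t. t \<in> {0..1} ==> norm (c t - u) < norm u"
 shows "wn c 0"
proof -
 have u: "u \<noteq> 0" using assms(3)[of 0] by auto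
 have re: "Re (c t/u) > 0" if "t \<in> {0..1}" for t
 proof -
  have "norm (c t/u - 1) < 1" using assms(3)[OF that] u
   by (metis diff_divide_distrib divide_self_if divide_less_eq_1_pos norm_divide zero_less_norm_iff)
  then show ?thesis using abs_Re_le_cmod[of "c t/u - 1"] by auto
 qed
 then have nn: "c t/u \<notin> \<real>\<^sub>\<le>\<^sub>0" if "t \<in> {0..1}" for t
  using that complex_nonpos_Reals_iff by force
 have "wn (%t. exp (Ln (c t/u)+Ln u)) 0"
  by (rule wn_exp) (use assms u nn in \<open>auto intro!: continuous_intros\<close>)
 then show ?thesis
 proof (rule wn_cong)
  fix t :: real assume "t \<in> {0..1}"
  then have "c t/u \<noteq> 0" using re by fastforce
  then show "c t = exp (Ln (c t/u)+Ln u)" using u by (simp add: exp_add)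
 qed
qed


text \<open>Pulling \<open>w\<close> back along exp makes the domain convex, where a logarithm
  exists. Its increment under the deck translation by 2 pi i is a constant 2 pi i n, and subtracting
  n s makes it descend again. Convexity of the preimage of \<open>Z\<close> covers both the
  punctured disc and the punctured plane.\<close>

lemma punctured_product_log:
 fixes w :: "complex \<times> complex => complex"
 assumes D: "open D" "convex D" "D \<noteq> {}" and Z: "open Z" "Z \<noteq> {}" "0 \<notin> Z" "convex {s. exp s \<in> Z}"
  and w: "continuous_on (D \<times> Z) w" "\<And>q. q \<in> D \<times> Z ==> w q \<noteq> 0"
 obtains n L where "continuous_on (D \<times> Z) L"
  "\<And>a z. a \<in> D ==> z \<in> Z ==> w (a, z) = z powi n*exp (L (a, z))"
proof -
 define S where "S = {s. exp s \<in> Z}"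
 have cS: "convex (D \<times> S)" using D Z unfolding S_def by (intro convex_Times)
 have contw: "continuous_on (D \<times> S) (%q. w (fst q, exp (snd q)))"
  by (rule continuous_on_compose2[OF w(1)]) (auto intro!: continuous_intros simp: S_def)
 obtain L0 where L0: "continuous_on (D \<times> S) L0"
  "\<And>q. q \<in> D \<times> S ==> w (fst q, exp (snd q)) = exp (L0 q)"
 proof (rule continuous_logarithm_on_contractible[OF contw convex_imp_contractible[OF cS]])
  show "w (fst q, exp (snd q)) \<noteq> 0" if "q \<in> D \<times> S" for q
   using that w(2)[of "(fst q, exp (snd q))"] unfolding S_def by auto
 qed blast
 have shift: "s+2 * of_real pi*\<i> \<in> S \<longleftrightarrow> s \<in> S" for s
  unfolding S_def by (simp add: exp_add)
 obtain a0 where a0: "a0 \<in> D" using D by blast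
 obtain z0 where z0: "z0 \<in> Z" using Z by blast
 define s0 where "s0 = Ln z0"
 have s0: "s0 \<in> S" unfolding S_def s0_def using z0 Z(3) by (metis exp_Ln mem_Collect_eq)
 \<comment> \<open>Increment of the logarithm under the deck translation; its exponential is 1, so
   it is constant on the connected domain and supplies the exponent n.\<close>
 define K where "K = (%q. L0 (fst q, snd q+2 * of_real pi*\<i>) - L0 q)"
 have contK: "continuous_on (D \<times> S) K"
  unfolding K_def by (intro continuous_intros L0(1) continuous_on_compose2[OF L0(1)]) (auto simp: shift)
 have expK: "exp (K q) = 1" if "q \<in> D \<times> S" for q
 proof -
  have "exp (L0 (fst q, snd q+2 * of_real pi*\<i>)) = exp (L0 q)"
   using L0(2)[of q] L0(2)[of "(fst q, snd q+2 * of_real pi*\<i>)"] that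
   by (auto simp: shift exp_add)
  then show ?thesis unfolding K_def by (simp add: exp_diff)
 qed
 have Kc: "K q = K (a0, s0)" if "q \<in> D \<times> S" for q
  using continuous_log_of_one_constant[OF convex_connected[OF cS] contK expK that, of "(a0, s0)"] a0 s0 by auto
 obtain n :: int where n: "K (a0, s0) = of_int (2*n)*pi*\<i>"
  using expK[of "(a0, s0)"] a0 s0 unfolding exp_eq_1 by (auto simp: complex_eq_iff)
 define M where "M = (%q. L0 q - of_int n * snd q)"
 have contM: "continuous_on (D \<times> S) M" unfolding M_def by (intro continuous_intros L0(1))
 have M1: "M (a, s+2 * of_real pi*\<i>) = M (a, s)" if "a \<in> D" "s \<in> S" for a s
  using Kc[of "(a, s)"] that n unfolding M_def K_def by (simp add: algebra_simps)
 have M2: "M (a, s + of_nat k*(2 * of_real pi*\<i>)) = M (a, s) \<and> s + of_nat k*(2 * of_real pi*\<i>) \<in> S"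
  if "a \<in> D" "s \<in> S" for a s k
 proof (induction k)
  case (Suc k)
  have "s + of_nat (Suc k)*(2 * of_real pi*\<i>) = (s + of_nat k*(2 * of_real pi*\<i>))+2 * of_real pi*\<i>"
   by (simp add: algebra_simps)
  then show ?case using M1[OF that(1), of "s + of_nat k*(2 * of_real pi*\<i>)"] Suc shift by metis
 qed (use that in auto)
 have M3: "M (a, s) = M (a, s')" if "a \<in> D" "s \<in> S" "s' \<in> S" and eq: "exp s = exp s'" for a s s'
 proof -
  obtain k :: int where k: "s = s'+(of_int (2 * k)*pi)*\<i>" using eq unfolding exp_eq by blast
  show ?thesis
  proof (cases "k \<ge> 0")
   case True
   then obtain j where "k = int j" by (metis nonneg_int_cases)
   then have "s = s' + of_nat j*(2 * of_real pi*\<i>)" using k by simp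
   then show ?thesis using M2[OF that(1,3), of j] by simp
  next
   case False
   then obtain j where "k = - int j" by (metis int_cases2 linorder_not_le of_nat_0_le_iff)
   then have "s' = s + of_nat j*(2 * of_real pi*\<i>)" using k by simp
   then show ?thesis using M2[OF that(1,2), of j] by simp
  qed
 qed
 have LnS: "Ln z \<in> S" "Ln (- z) + of_real pi*\<i> \<in> S" if "z \<in> Z" for z
 proof -
  have "z \<noteq> 0" using that Z(3) by blast
  then show "Ln z \<in> S" "Ln (- z) + of_real pi*\<i> \<in> S" using that by (simp_all add: S_def exp_add)
 qed
 define L where "L = (%q. M (fst q, Ln (snd q)))"
 \<comment> \<open>\<open>Ln\<close> jumps on the negative axis, but \<open>M\<close> depends only
   on exp s; on the region avoiding the positive axis the shifted branch Ln (-z) + pi i therefore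
   gives the same function, and the two open regions cover \<open>Z\<close>.\<close>
 have "continuous_on (D \<times> (Z \<inter> - \<real>\<^sub>\<le>\<^sub>0) \<union> D \<times> (Z \<inter> - \<real>\<^sub>\<ge>\<^sub>0)) L"
 proof (rule continuous_on_open_Un)
  show "open (D \<times> (Z \<inter> - \<real>\<^sub>\<le>\<^sub>0))" "open (D \<times> (Z \<inter> - \<real>\<^sub>\<ge>\<^sub>0))"
   using D Z by (auto intro!: open_Times open_Int)
  show "continuous_on (D \<times> (Z \<inter> - \<real>\<^sub>\<le>\<^sub>0)) L"
   unfolding L_def by (rule continuous_on_compose2[OF contM])
    (auto intro!: continuous_intros LnS)
  have "continuous_on (D \<times> (Z \<inter> - \<real>\<^sub>\<ge>\<^sub>0)) (%q. M (fst q, Ln (- snd q) + of_real pi*\<i>))"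
   by (rule continuous_on_compose2[OF contM])
    (auto intro!: continuous_intros LnS simp: uminus_nonneg_Reals_iff)
  then show "continuous_on (D \<times> (Z \<inter> - \<real>\<^sub>\<ge>\<^sub>0)) L"
  proof (rule continuous_on_eq)
   fix q assume q: "q \<in> D \<times> (Z \<inter> - \<real>\<^sub>\<ge>\<^sub>0)"
   then have nz: "snd q \<noteq> 0" by auto
   show "M (fst q, Ln (- snd q) + of_real pi*\<i>) = L q"
    unfolding L_def by (rule M3) (use q nz LnS in \<open>auto simp: exp_add\<close>)
  qed
 qed
 moreover have "D \<times> (Z \<inter> - \<real>\<^sub>\<le>\<^sub>0) \<union> D \<times> (Z \<inter> - \<real>\<^sub>\<ge>\<^sub>0) = D \<times> Z"
 proof -
  have "z = 0" if "z \<in> \<real>\<^sub>\<le>\<^sub>0" "z \<in> \<real>\<^sub>\<ge>\<^sub>0" for z :: complex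
   using that by (auto simp: complex_nonpos_Reals_iff complex_nonneg_Reals_iff complex_eq_iff)
  then show ?thesis using Z(3) by auto
 qed
 ultimately have cL: "continuous_on (D \<times> Z) L" by simp
 show ?thesis
 proof (rule that[OF cL, of n])
  fix a z assume az: "a \<in> D" "z \<in> Z"
  then have nz: "z \<noteq> 0" using Z by auto
  have "Ln z \<in> S" unfolding S_def using nz az by simp
  then have "w (a, z) = exp (L0 (a, Ln z))" using L0(2)[of "(a, Ln z)"] az nz by simp
  also have "\<dots> = exp (of_int n*Ln z+L (a, z))" unfolding L_def M_def by simp
  also have "\<dots> = z powi n*exp (L (a, z))" using nz by (simp add: exp_add exp_of_int_mult)
  finally show "w (a, z) = z powi n*exp (L (a, z))" .
 qed
qed

lemma convex_exp_vimage_punctured_ball: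
 assumes "r > 0" shows "convex {s. exp s \<in> ball (0::complex) r - {0}}"
proof -
 have "{s. exp s \<in> ball (0::complex) r - {0}} = {s. Re s < ln r}"
 proof -
  have "exp (Re s) < r \<longleftrightarrow> Re s < ln r" for s
   using assms by (metis exp_less_cancel_iff exp_ln)
  then show ?thesis by auto
 qed
 then show ?thesis by (simp add: convex_halfspace_Re_lt)
qed

text \<open>Connectedness is required only for some arbitrarily small neighbourhoods, because an
  arbitrary neighbourhood may cut even an irreducible germ into several pieces.\<close>

definition unibranch :: "(complex \<times> complex) set => bool" where
 "unibranch V \<longleftrightarrow> (\<forall>U. open U \<and> 0 \<in> U -->
   (\<exists>W. open W \<and> 0 \<in> W \<and> W \<subseteq> U \<and> connected (V \<inter> W - {0})))"

text \<open>\<open>linked_branch j V\<close>: near 0 the set V is the union of a smooth branch, which is the zero set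
 of the second coordinate \<open>g\<close> of a chart, and of other branches, on which there are
 arbitrarily small loops around which \<open>g\<close> has winding number \<open>j\<close>.\<close>

definition branch_chart :: "int => (complex \<times> complex) set => (complex \<times> complex) set =>
  (complex \<times> complex) set => (complex \<times> complex => complex) => (complex \<times> complex => complex) =>
  (complex \<times> complex => complex \<times> complex) => (complex \<times> complex) set => bool" where
 "branch_chart j V U U' h g k O1 \<longleftrightarrow> open U \<and> 0 \<in> U \<and> open U' \<and>
   homeomorphism U U' (%z. (h z, g z)) k \<and> h 0 = 0 \<and> g 0 = 0 \<and>
   (\<forall>z\<in>U. g z = 0 --> z \<in> V) \<and>
   open O1 \<and> (\<forall>z\<in>V \<inter> U - {0}. g z = 0 \<longleftrightarrow> z \<in> O1) \<and>
   (\<forall>W. open W \<and> 0 \<in> W --> (\<exists>\<gamma>. continuous_on {0..1} \<gamma> \<and> \<gamma> 0 = \<gamma> 1 \<and>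
    \<gamma> ` {0..1} \<subseteq> V \<inter> W \<inter> U \<and> (\<forall>t\<in>{0..1}. g (\<gamma> t) \<noteq> 0) \<and> wn (%t. g (\<gamma> t)) j))"

definition linked_branch :: "int => (complex \<times> complex) set => bool" where
 "linked_branch j V \<longleftrightarrow> (\<exists>U U' h g k O1. branch_chart j V U U' h g k O1)"

lemma branch_chartD:
 assumes "branch_chart j V U U' h g k O1"
 shows "open U" "0 \<in> U" "open U'"
  "homeomorphism U U' (%z. (h z, g z)) k" "h 0 = 0" "g 0 = 0"
  "\<And>z. z \<in> U ==> g z = 0 ==> z \<in> V" "open O1"
  "\<And>z. z \<in> V ==> z \<in> U ==> z \<noteq> 0 ==> g z = 0 \<longleftrightarrow> z \<in> O1"
  "\<And>W. open W ==> 0 \<in> W ==> \<exists>\<gamma>. continuous_on {0..1} \<gamma> \<and> \<gamma> 0 = \<gamma> 1 \<and>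
    \<gamma> ` {0..1} \<subseteq> V \<inter> W \<inter> U \<and> (\<forall>t\<in>{0..1}. g (\<gamma> t) \<noteq> 0) \<and> wn (%t. g (\<gamma> t)) j"
proof -
 note a = assms[unfolded branch_chart_def]
 show "open U" "0 \<in> U" "open U'" "homeomorphism U U' (%z. (h z, g z)) k" "h 0 = 0" "g 0 = 0" "open O1"
  by (insert a, (elim conjE, assumption)+)
 show "z \<in> V" if "z \<in> U" "g z = 0" for z by (insert a that, elim conjE) (drule (1) bspec, drule (1) mp)
 show "g z = 0 \<longleftrightarrow> z \<in> O1" if "z \<in> V" "z \<in> U" "z \<noteq> 0" for z
  by (insert a that, elim conjE) (drule bspec[of _ _ z], simp_all)
 show "\<exists>\<gamma>. continuous_on {0..1} \<gamma> \<and> \<gamma> 0 = \<gamma> 1 \<and>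
    \<gamma> ` {0..1} \<subseteq> V \<inter> W \<inter> U \<and> (\<forall>t\<in>{0..1}. g (\<gamma> t) \<noteq> 0) \<and> wn (%t. g (\<gamma> t)) j"
  if "open W" "0 \<in> W" for W
 proof -
  have "\<forall>W. open W \<and> 0 \<in> W --> (\<exists>\<gamma>. continuous_on {0..1} \<gamma> \<and> \<gamma> 0 = \<gamma> 1 \<and>
    \<gamma> ` {0..1} \<subseteq> V \<inter> W \<inter> U \<and> (\<forall>t\<in>{0..1}. g (\<gamma> t) \<noteq> 0) \<and> wn (%t. g (\<gamma> t)) j)"
   by (insert a, elim conjE, assumption)
  from this[rule_format, OF conjI[OF that]] show ?thesis .
 qed
qed

lemma branch_chart_point:
 assumes "branch_chart j V U U' h g k O1" and W: "open W" "0 \<in> W"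
 shows "\<exists>q\<in>W \<inter> U. q \<noteq> 0 \<and> g q = 0"
proof -
 note * = branch_chartD[OF assms(1)]
 have 1: "open ((%z. (h z, g z)) ` (W \<inter> U))"
  using homeomorphism_imp_open_map[OF *(4), of "W \<inter> U"] *(1,3) W
  by (metis Int_lower2 open_Int open_subset openin_open_trans)
 moreover have "(0, 0) \<in> (%z. (h z, g z)) ` (W \<inter> U)" using *(2,5,6) W by force
 ultimately obtain e where e: "e > 0" "ball (0, 0) e \<subseteq> (%z. (h z, g z)) ` (W \<inter> U)"
  using open_contains_ball by blast
 have "(of_real (e/2), 0) \<in> ball (0::complex, 0::complex) e" using e by (simp add: dist_Pair_Pair)
 then have "(of_real (e/2), 0) \<in> (%z. (h z, g z)) ` (W \<inter> U)" using e(2) by (rule subsetD[rotated])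
 then obtain q where "(of_real (e/2), 0) = (h q, g q)" "q \<in> W \<inter> U" by (rule imageE)
 then show ?thesis using *(5) e(1) by (intro bexI[of _ q]) auto
qed

lemma branch_chart_continuous:
 assumes "branch_chart j V U U' h g k O1" shows "continuous_on U h" "continuous_on U g"
proof -
 have c: "continuous_on U (%z. (h z, g z))" using branch_chartD(4)[OF assms] by (simp add: homeomorphism_def)
 show "continuous_on U h" using continuous_on_fst[OF c] by simp
 show "continuous_on U g" using continuous_on_snd[OF c] by simp
qed

text \<open>Away from the origin, \<open>O1\<close> and the set where \<open>g\<close> is nonzero
  split the germ into two disjoint relatively open parts. Both meet every neighbourhood: the first
  by \<open>branch_chart_point\<close>, the second by the small loops. A homeomorphism would carry
  this splitting to a connected punctured germ.\<close>

theorem unibranch_not_equiv_linked_branch: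
 assumes "unibranch V" "linked_branch j W" "top_equiv_germ V W"
 shows False
proof -
 obtain U U' h g k O1 where bc: "branch_chart j W U U' h g k O1"
  using assms(2) unfolding linked_branch_def by blast
 note * = branch_chartD[OF bc] branch_chart_point[OF bc]
 obtain X X' \<phi> \<psi> where h: "open X" "open X'" "(0, 0) \<in> X" "homeomorphism X X' \<phi> \<psi>"
   "\<phi> (0, 0) = (0, 0)" "\<phi> ` (V \<inter> X) = W \<inter> X'"
  using assms(3) unfolding top_equiv_germ_def by blast
 have h0: "0 \<in> X" "\<phi> 0 = 0" using h(3,5) by (simp_all add: zero_prod_def)
 have c\<phi>: "continuous_on X \<phi>" using h(4) by (simp add: homeomorphism_def)
 have "open (X \<inter> \<phi> -` U)" using continuous_open_preimage[OF c\<phi> h(1) *(1)] .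
 then obtain Y where Y: "open Y" "0 \<in> Y" "Y \<subseteq> X \<inter> \<phi> -` U" "connected (V \<inter> Y - {0})"
  using assms(1) h0 *(2) unfolding unibranch_def by (metis IntI vimage_eq)
 define C where "C = \<phi> ` (V \<inter> Y - {0})"
 have cC: "connected C" unfolding C_def
  by (rule connected_continuous_image[OF continuous_on_subset[OF c\<phi>] Y(4)]) (use Y in auto)
 have inj: "inj_on \<phi> X" using homeomorphism_apply1[OF h(4)] by (rule inj_on_inverseI)
 have CW: "C \<subseteq> W \<inter> U - {0}"
 proof
  fix z assume "z \<in> C"
  then obtain v where v: "v \<in> V" "v \<in> Y" "v \<noteq> 0" "z = \<phi> v" unfolding C_def by blast
  have "z \<in> W" using v Y h(6) by blast
  moreover have "z \<noteq> 0" using v Y h0 inj by (metis IntD1 inj_onD subsetD)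
  ultimately show "z \<in> W \<inter> U - {0}" using v Y by auto
 qed
 have oY: "open (\<phi> ` Y)" using homeomorphism_imp_open_map[OF h(4), of Y] Y h(1,2)
  by (metis le_inf_iff open_subset openin_open_trans)
 have 0: "0 \<in> \<phi> ` Y" using Y(2) h0 by (metis image_eqI)
 have WC: "z \<in> C" if z: "z \<in> W" "z \<in> \<phi> ` Y" "z \<noteq> 0" for z
 proof -
  obtain v where v: "v \<in> Y" "z = \<phi> v" using z(2) by (metis imageE)
  have "z \<in> W \<inter> X'" using z v Y h(4) by (metis IntI homeomorphism_image1 image_eqI le_inf_iff subsetD)
  then obtain u where "u \<in> V" "u \<in> X" "z = \<phi> u" using h(6) by blast
  then have "u = v" using v Y inj by (metis IntD1 inj_onD subsetD)
  then show ?thesis unfolding C_def using \<open>u \<in> V\<close> v z h0 by blast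
 qed
 obtain q where q: "q \<in> \<phi> ` Y" "q \<in> U" "q \<noteq> 0" "g q = 0" using *(11)[OF oY 0] by blast
 obtain \<gamma> where \<gamma>: "\<gamma> ` {0..1} \<subseteq> W \<inter> \<phi> ` Y \<inter> U" "\<forall>t\<in>{0..1::real}. g (\<gamma> t) \<noteq> 0"
  using *(10)[OF oY 0] by blast
 define r where "r = \<gamma> 0"
 have r: "r \<in> W" "r \<in> \<phi> ` Y" "r \<in> U" "g r \<noteq> 0" unfolding r_def using \<gamma> by (auto simp: image_subset_iff)
 note cg = branch_chart_continuous(2)[OF bc]
 define O2 where "O2 = U \<inter> g -` (- {0})"
 have O2: "open O2" unfolding O2_def using continuous_open_preimage[OF cg *(1)] by (simp add: open_Compl)
 have "O1 \<inter> O2 \<inter> C = {}" using CW *(9) unfolding O2_def by blast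
 moreover have "C \<subseteq> O1 \<union> O2" using CW *(9) unfolding O2_def by blast
 moreover have "q \<in> O1 \<inter> C" using q *(7)[of q] *(9)[of q] WC by blast
 moreover have "r \<in> O2 \<inter> C" proof -
  have "r \<noteq> 0" using r(4) *(6) by auto
  then show ?thesis using r WC[of r] unfolding O2_def by auto
 qed
 ultimately show False using connectedD[OF cC *(8) O2] by blast
qed

text \<open>The exact norms of the two coordinates make the parameter preimage of the polydisc with
  radii r^a and r^b equal to the disc of radius r; the punctured germ is then a continuous image of
  a punctured disc.\<close>

lemma unibranch_param:
 fixes c1 c2 :: "complex => complex"
 assumes c: "continuous_on UNIV c1" "continuous_on UNIV c2"
  and n: "\<And>t. norm (c1 t) = norm t^a" "\<And>t. norm (c2 t) = norm t^b" "a \<ge> 1" "b \<ge> 1"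
  and V: "V = range (%t. (c1 t, c2 t))"
 shows "unibranch V"
 unfolding unibranch_def
proof (intro allI impI, elim conjE)
 fix U :: "(complex \<times> complex) set" assume U: "open U" "0 \<in> U"
 then obtain e where e: "e > 0" "ball 0 e \<subseteq> U" using open_contains_ball by blast
 define r where "r = min (1/2) (e/2)"
 have r: "r > 0" "r \<le> 1" "2*r \<le> e" unfolding r_def using e by auto
 define W where "W = ball (0::complex) (r^a) \<times> ball (0::complex) (r^b)"
 have "W \<subseteq> ball 0 e"
 proof
  fix z assume "z \<in> W"
  then have z: "norm (fst z) < r^a" "norm (snd z) < r^b" unfolding W_def by auto
  have "r^a \<le> r" "r^b \<le> r" using r n(3,4) power_decreasing[of 1 a r] power_decreasing[of 1 b r] by auto
  then have "norm (fst z)+norm (snd z) < e" using z r by linarith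
  then have "norm z < e" using norm_Pair_le[of "fst z" "snd z"] by simp
  then show "z \<in> ball 0 e" by simp
 qed
 moreover have "connected (V \<inter> W - {0})"
 proof -
  have "V \<inter> W - {0} = (%t. (c1 t, c2 t)) ` (ball 0 r - {0})"
  proof -
   have 1: "(c1 t, c2 t) \<in> W \<longleftrightarrow> t \<in> ball 0 r" for t
   proof -
    have "norm t^a < r^a \<longleftrightarrow> norm t < r" "norm t^b < r^b \<longleftrightarrow> norm t < r"
     using r n(3,4) by (auto simp: power_mono_iff power_less_imp_less_base
       intro: power_strict_mono dest!: power_less_imp_less_base)
    then show ?thesis unfolding W_def using n(1,2)[of t] by simp
   qed
   have 2: "(c1 t, c2 t) = 0 \<longleftrightarrow> t = 0" for t
   proof -
    have "c1 t = 0 \<longleftrightarrow> t = 0" "c2 t = 0 \<longleftrightarrow> t = 0"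
     using power_eq_0_iff[of "norm t" a] power_eq_0_iff[of "norm t" b] n(3,4)
     unfolding n(1,2)[symmetric] norm_eq_zero by auto
    then show ?thesis by (simp add: zero_prod_def)
   qed
   show ?thesis unfolding V using 1 2 by auto
  qed
  moreover have "connected ((%t. (c1 t, c2 t)) ` (ball 0 r - {0}))"
   by (intro connected_continuous_image continuous_on_Pair continuous_on_subset[OF c(1)]
     continuous_on_subset[OF c(2)] connected_punctured_ball) auto
  ultimately show ?thesis by simp
 qed
 moreover have "open W" "0 \<in> W" unfolding W_def zero_prod_def using r by (auto intro: open_Times)
 ultimately show "\<exists>W. open W \<and> 0 \<in> W \<and> W \<subseteq> U \<and> connected (V \<inter> W - {0})"
  using e by blast
qed

lemma unibranch_germ_A: "unibranch (germ_A (2 * k))"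
proof -
 have "germ_A (2 * k) = range (%t. (t^(2 * k+1), - (t^2)))"
 proof (intro set_eqI iffI)
  fix z assume z: "z \<in> germ_A (2 * k)"
  obtain x y where xy: "z = (x, y)" by (cases z)
  have eq: "x^2 = - (y^(2 * k+1))" using z xy by (simp add: germ_A_def eq_neg_iff_add_eq_0)
  show "z \<in> range (%t. (t^(2 * k+1), - (t^2)))"
  proof (cases "y = 0")
   case True then have "z = (0, 0)" using eq xy by simp
   then show ?thesis by (intro image_eqI[of _ _ 0]) auto
  next
   case False
   define t where "t = x/(- y) ^ k"
   have "t^2 = x^2/((- y) ^ k)^2" unfolding t_def by (simp add: power_divide)
   also have "((- y) ^ k)^2 = y^(2 * k)" by (simp add: mult.commute flip: power_mult)
   finally have t2: "t^2 = - y" using eq False by simp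
   have "t^(2 * k+1) = (t^2) ^ k*t" by (simp add: power_mult)
   also have "\<dots> = (- y) ^ k*t" unfolding t2 ..
   also have "\<dots> = x" unfolding t_def using False by simp
   finally show ?thesis using t2 xy by (intro image_eqI[of _ _ t]) auto
  qed
 next
  fix z :: "complex \<times> complex" assume "z \<in> range (%t. (t^(2 * k+1), - (t^2)))"
  then obtain t where t: "z = (t^(2 * k+1), - (t^2))" by blast
  have "(t^(2 * k+1))^2 = (t^2)^(2 * k+1)" by (metis mult.commute power_mult)
  moreover have "(- (t^2))^(2 * k+1) = - ((t^2)^(2 * k+1))" by (simp add: power_minus_odd)
  ultimately show "z \<in> germ_A (2 * k)" unfolding t germ_A_def by simp
 qed
 then show ?thesis
  by (intro unibranch_param[where a = "2 * k+1" and b = 2])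
   (auto intro!: continuous_intros simp: norm_power norm_mult)
qed

lemma unibranch_germ_E6: "unibranch germ_E6"
proof -
 have "germ_E6 = range (%t. (- (t^4), t^3))"
 proof (intro set_eqI iffI)
  fix z assume z: "z \<in> germ_E6"
  obtain x y where xy: "z = (x, y)" by (cases z)
  have eq: "x^3 = - (y^4)" using z xy by (simp add: germ_E6_def eq_neg_iff_add_eq_0)
  show "z \<in> range (%t. (- (t^4), t^3))"
  proof (cases "y = 0")
   case True then have "z = (0, 0)" using eq xy by simp
   then show ?thesis by (intro image_eqI[of _ _ 0]) auto
  next
   case False
   define t where "t = - x/y"
   have "t^3 = - (x^3)/y^3" unfolding t_def by (simp add: power_divide)
   also have "\<dots> = y" unfolding eq using False by (simp add: power_numeral_reduce)
   finally have t3: "t^3 = y" .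
   have "t^4 = t^3*t" by (simp add: power_numeral_reduce)
   also have "\<dots> = y*t" unfolding t3 ..
   also have "\<dots> = - x" unfolding t_def using False by simp
   finally show ?thesis using t3 xy by (intro image_eqI[of _ _ t]) auto
  qed
 qed (auto simp: germ_E6_def simp flip: power_mult)
 then show ?thesis
  by (intro unibranch_param[where a = 4 and b = 3])
   (auto intro!: continuous_intros simp: norm_power)
qed

text \<open>Factor x^2 + y^(2j) = (x - i y^j)(x + i y^j). On the second branch the equation of the
  first equals -2i y^j, which winds j times when y runs once around 0.\<close>

lemma linked_branch_germ_A:
 assumes "j \<ge> 1" shows "linked_branch (int j) (germ_A (2*j - 1))"
proof -
 define g where "g = (%z::complex \<times> complex. fst z - \<i> * snd z^j)"
 define k where "k = (%z::complex \<times> complex. (snd z+\<i>*fst z^j, fst z))"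
 have fac: "z \<in> germ_A (2*j - 1) \<longleftrightarrow> g z*(fst z+\<i> * snd z^j) = 0" for z
 proof -
  obtain x y where z: "z = (x, y)" by (cases z)
  have "y^(2*j - 1+1) = (y^j)^2" using assms by (simp add: power_mult mult.commute flip: power_mult)
  then show ?thesis unfolding germ_A_def g_def z by (simp add: algebra_simps power2_eq_square)
 qed
 have hom: "homeomorphism UNIV UNIV (%z. (snd z, g z)) k"
 proof (rule homeomorphismI)
  show "continuous_on UNIV (%z. (snd z, g z))" "continuous_on UNIV k"
   unfolding g_def k_def by (auto intro!: continuous_intros)
 qed (auto simp: g_def k_def)
 have sep: "\<forall>z\<in>germ_A (2*j - 1) \<inter> UNIV - {0}. g z = 0 \<longleftrightarrow> z \<in> {z. fst z+\<i> * snd z^j \<noteq> 0}"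
 proof
  fix z assume z: "z \<in> germ_A (2*j - 1) \<inter> UNIV - {0}"
  have "z = 0" if "fst z - \<i> * snd z^j = 0" "fst z+\<i> * snd z^j = 0"
  proof -
   have "2*fst z = 0" using that by (metis add_cancel_right_left add_diff_cancel_left' diff_add_cancel eq_iff_diff_eq_0 mult_2 neg_eq_iff_add_eq_0 add.inverse_inverse)
   then show ?thesis using that assms by (auto simp: zero_prod_def prod_eq_iff)
  qed
  then show "g z = 0 \<longleftrightarrow> z \<in> {z. fst z+\<i> * snd z^j \<noteq> 0}"
   using fac[of z] z unfolding g_def by auto
 qed
 have loops: "\<exists>\<gamma>. continuous_on {0..1} \<gamma> \<and> \<gamma> 0 = \<gamma> 1 \<and>
    \<gamma> ` {0..1} \<subseteq> germ_A (2*j - 1) \<inter> W \<inter> UNIV \<and> (\<forall>t\<in>{0..1}. g (\<gamma> t) \<noteq> 0) \<and> wn (%t. g (\<gamma> t)) (int j)"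
  if W: "open W" "0 \<in> W" for W
 proof -
  obtain e where e: "e > 0" "ball 0 e \<subseteq> W" using W open_contains_ball by blast
  define r where "r = min (1/2) (e/3)"
  have r: "r > 0" "r \<le> 1" "2*r < e" unfolding r_def using e by auto
  define c where "c = (%t::real. of_real r*exp (2 * of_real pi*\<i> * of_real t))"
  have nc: "norm (c t) = r" for t
   unfolding c_def norm_mult using r by (simp add: norm_exp_eq_Re)
  have c01: "c 0 = c 1" unfolding c_def by simp
  have cc: "continuous_on {0..1} c" unfolding c_def by (intro continuous_intros)
  define \<gamma> where "\<gamma> = (%t. (- \<i> * c t^j, c t))"
  have gg: "g (\<gamma> t) = (- 2*\<i>) * c t^j" for t unfolding g_def \<gamma>_def by simp
  have "\<gamma> t \<in> ball 0 e" for t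
  proof -
   have "norm (\<gamma> t) \<le> r^j+r" unfolding \<gamma>_def
    using norm_Pair_le[of "- \<i> * c t^j" "c t"] by (simp add: norm_mult norm_power nc)
   also have "r^j \<le> r" using r assms power_decreasing[of 1 j r] by auto
   finally show ?thesis using r by simp
  qed
  moreover have "\<gamma> t \<in> germ_A (2*j - 1)" for t unfolding fac unfolding \<gamma>_def by simp
  moreover have "wn (%t. g (\<gamma> t)) (int j)"
  proof -
   have "wn c 1" unfolding c_def by (rule wn_circle) (use r in auto)
   then have "wn (%t. c t^j) (int j)" using wn_power[of c 1 j] by simp
   then show ?thesis unfolding gg using wn_mult[OF wn_const[of "- 2*\<i>"], of "%t. c t^j"] by simp
  qed
  moreover have "g (\<gamma> t) \<noteq> 0" for t unfolding gg using nc[of t] r by auto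
  moreover have "continuous_on {0..1} \<gamma>" unfolding \<gamma>_def by (intro continuous_intros cc)
  moreover have "\<gamma> 0 = \<gamma> 1" unfolding \<gamma>_def c01 by simp
  ultimately show ?thesis using e by (intro exI[of _ \<gamma>]) blast
 qed
 have "open {z::complex \<times> complex. fst z+\<i> * snd z^j \<noteq> 0}"
  by (intro open_Collect_neq continuous_intros)
 moreover have "\<forall>z\<in>UNIV. g z = 0 --> z \<in> germ_A (2*j - 1)" using fac by simp
 moreover have "g 0 = 0" using assms unfolding g_def by simp
 moreover have "\<forall>W. open W \<and> 0 \<in> W --> (\<exists>\<gamma>. continuous_on {0..1} \<gamma> \<and> \<gamma> 0 = \<gamma> 1 \<and>
    \<gamma> ` {0..1} \<subseteq> germ_A (2*j - 1) \<inter> W \<inter> UNIV \<and> (\<forall>t\<in>{0..1}. g (\<gamma> t) \<noteq> 0) \<and> wn (%t. g (\<gamma> t)) (int j))"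
  by (intro allI impI, elim conjE) (rule loops)
 ultimately have "branch_chart (int j) (germ_A (2*j - 1)) UNIV UNIV snd g k {z. fst z+\<i> * snd z^j \<noteq> 0}"
  unfolding branch_chart_def using hom sep
  by (intro conjI) (assumption | rule open_UNIV UNIV_I snd_zero)+
 then show ?thesis unfolding linked_branch_def by (intro exI)
qed

lemma open_image_homeomorphism:
 assumes "homeomorphism S T f g" "open T" "open X" "X \<subseteq> S"
 shows "open (f ` X)"
 using homeomorphism_imp_open_map[OF assms(1), of X] assms(2-4)
 by (metis open_subset openin_open_trans)

text \<open>The branch g = 0 must correspond to one of the two branches x = s y^m, s = i or -i, with
  equation g'. Off that branch g' is a power n of g up to an exponential, and conversely, so n is a
  unit. The loops with winding number j land on the other branch, where g' = -2 s y^m has winding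
  number divisible by m.\<close>

theorem linked_branch_dvd:
 assumes lb: "linked_branch j V" and eq: "top_equiv_germ V (germ_A (2*m - 1))" and m: "m \<ge> 1"
 shows "int m dvd j"
proof -
 obtain U U' h g k O1 where bc: "branch_chart j V U U' h g k O1"
  using lb unfolding linked_branch_def by blast
 note * = branch_chartD[OF bc]
 note pt = branch_chart_point[OF bc]
 note cont = branch_chart_continuous[OF bc]
 obtain X X' \<phi> \<psi> where hh: "open X" "open X'" "(0, 0) \<in> X" "homeomorphism X X' \<phi> \<psi>"
   "\<phi> (0, 0) = (0, 0)" "\<phi> ` (V \<inter> X) = germ_A (2*m - 1) \<inter> X'"
  using eq unfolding top_equiv_germ_def by blast
 have h0: "0 \<in> X" "\<phi> 0 = 0" using hh(3,5) by (simp_all add: zero_prod_def)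
 note hs = homeomorphism_symD[OF hh(4)]
 have \<psi>\<phi>: "\<psi> (\<phi> z) = z" if "z \<in> X" for z using homeomorphism_apply1[OF hh(4) that] .
 have \<phi>\<psi>: "\<phi> (\<psi> z) = z" if "z \<in> X'" for z using homeomorphism_apply2[OF hh(4) that] .
 have X': "0 \<in> X'" using h0 homeomorphism_image1[OF hh(4)] by (metis image_eqI)
 have \<psi>0: "\<psi> 0 = 0" using \<psi>\<phi>[OF h0(1)] h0 by simp
 have \<psi>X: "\<psi> z \<in> X" if "z \<in> X'" for z using that homeomorphism_image2[OF hh(4)] by blast
 have \<phi>X: "\<phi> z \<in> X'" if "z \<in> X" for z using that homeomorphism_image1[OF hh(4)] by blast
 have c\<phi>: "continuous_on X \<phi>" and c\<psi>: "continuous_on X' \<psi>"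
  using hh(4) by (simp_all add: homeomorphism_def)
 have VA: "\<psi> z \<in> V \<longleftrightarrow> z \<in> germ_A (2*m - 1)" if zX: "z \<in> X'" for z
 proof
  assume "\<psi> z \<in> V"
  then have "\<phi> (\<psi> z) \<in> \<phi> ` (V \<inter> X)" using \<psi>X[OF zX] by blast
  then show "z \<in> germ_A (2*m - 1)" using hh(6) \<phi>\<psi>[OF zX] by auto
 next
  assume "z \<in> germ_A (2*m - 1)"
  then obtain v where "v \<in> V" "v \<in> X" "z = \<phi> v" using hh(6) zX by blast
  then show "\<psi> z \<in> V" using \<psi>\<phi> by simp
 qed
 define N0 where "N0 = \<phi> ` (X \<inter> U)"
 have "open N0" unfolding N0_def using hh *(1) by (intro open_image_homeomorphism[OF hh(4)]) auto
 moreover have "0 \<in> N0" unfolding N0_def using h0 *(2) by (metis IntI image_eqI)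
 ultimately obtain e where e: "e > 0" "ball 0 e \<subseteq> N0" using open_contains_ball by blast
 define r where "r = min (1/2) (e/2)"
 have r: "r > 0" "r \<le> 1" "2*r \<le> e" unfolding r_def using e by auto
 define W where "W = ball (0::complex) (r^m) \<times> ball (0::complex) r"
 have oW: "open W" unfolding W_def by (intro open_Times) auto
 have 0: "0 \<in> W" unfolding W_def zero_prod_def using r by auto
 have WN: "W \<subseteq> N0"
 proof
  fix z assume "z \<in> W"
  then have z: "norm (fst z) < r^m" "norm (snd z) < r" unfolding W_def by auto
  have "r^m \<le> r" using r m power_decreasing[of 1 m r] by auto
  then have "norm (fst z)+norm (snd z) < e" using z r by linarith
  then have "norm z < e" using norm_Pair_le[of "fst z" "snd z"] by simp
  then show "z \<in> N0" using e by auto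
 qed
 have NX: "z \<in> X'" "\<psi> z \<in> U" if zW: "z \<in> W" for z
 proof -
  obtain q where "q \<in> X" "q \<in> U" "z = \<phi> q" using zW WN unfolding N0_def by blast
  then show "z \<in> X'" "\<psi> z \<in> U" using \<phi>X \<psi>\<phi> by auto
 qed
 define B where "B = (%s::complex. (%y. (s*y^m, y)) ` (ball 0 r - {0}))"
 have cB: "connected (B s)" for s unfolding B_def
  by (intro connected_continuous_image continuous_intros connected_punctured_ball) auto
 have BW: "z \<in> B s \<longleftrightarrow> z \<in> W \<and> z \<noteq> 0 \<and> fst z = s * snd z^m" if s: "norm s = 1" for s z
 proof
  assume "z \<in> B s"
  then obtain y where yb: "y \<in> ball 0 r - {0}" and yz: "z = (s*y^m, y)" unfolding B_def by (rule imageE)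
  then have y: "z = (s*y^m, y)" "norm y < r" "y \<noteq> 0" by auto
  have "norm y^m < r^m" using y m by (intro power_strict_mono) auto
  then show "z \<in> W \<and> z \<noteq> 0 \<and> fst z = s * snd z^m"
   unfolding W_def using y s by (auto simp: norm_mult norm_power zero_prod_def)
 next
  assume z: "z \<in> W \<and> z \<noteq> 0 \<and> fst z = s * snd z^m"
  then have "snd z \<noteq> 0" using m by (auto simp: prod_eq_iff)
  then show "z \<in> B s" unfolding B_def using z
   by (intro image_eqI[of _ _ "snd z"]) (auto simp: prod_eq_iff W_def)
 qed
 have fac: "z \<in> germ_A (2*m - 1) \<longleftrightarrow> fst z = \<i> * snd z^m \<or> fst z = - \<i> * snd z^m" for z
 proof -
  obtain x y where z: "z = (x, y)" by (cases z)
  have "y^(2*m - 1+1) = (y^m)^2" using m by (simp add: mult.commute flip: power_mult)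
  then have "x^2+y^(2*m - 1+1) = (x - \<i>*y^m)*(x+\<i>*y^m)"
   by (simp add: algebra_simps power2_eq_square)
  then show ?thesis unfolding germ_A_def z by (simp add: eq_neg_iff_add_eq_0)
 qed
 \<comment> \<open>The punctured branch \<open>B s\<close> is connected, so it cannot meet both
   \<open>O1\<close> and the set where g is nonzero: it lies inside the zero set of g or avoids
   it.\<close>
 have side: "(\<forall>z\<in>B s. g (\<psi> z) = 0) \<or> (\<forall>z\<in>B s. g (\<psi> z) \<noteq> 0)" if s: "s = \<i> \<or> s = - \<i>" for s
 proof (rule ccontr)
  assume "\<not> ?thesis"
  then obtain z1 z2 where z: "z1 \<in> B s" "z2 \<in> B s" "g (\<psi> z1) = 0" "g (\<psi> z2) \<noteq> 0" by blast
  have ns: "norm s = 1" using s by auto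
  define C where "C = \<psi> ` B s"
  have CC: "C \<subseteq> V \<inter> U - {0}"
  proof
   fix q assume "q \<in> C"
   then obtain z where zB: "z \<in> B s" "q = \<psi> z" unfolding C_def by blast
   then have zW: "z \<in> W" "z \<noteq> 0" "fst z = s * snd z^m" using BW[OF ns] by auto
   then have "z \<in> germ_A (2*m - 1)" using fac s by auto
   then have "q \<in> V" using VA NX zW zB by blast
   moreover have "q \<noteq> 0" using zW zB \<phi>\<psi> NX h0 by metis
   ultimately show "q \<in> V \<inter> U - {0}" using NX zW zB by auto
  qed
  have cC: "connected C" unfolding C_def
   by (rule connected_continuous_image[OF continuous_on_subset[OF c\<psi>] cB]) (use BW[OF ns] NX in auto)
  define O2 where "O2 = U \<inter> g -` (- {0})"
  have O2: "open O2" unfolding O2_def using continuous_open_preimage[OF cont(2) *(1)] by (simp add: open_Compl)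
  have "O1 \<inter> O2 \<inter> C = {}" using CC *(9) unfolding O2_def by blast
  moreover have "C \<subseteq> O1 \<union> O2" using CC *(9) unfolding O2_def by blast
  moreover have "\<psi> z1 \<in> O1 \<inter> C" using z CC *(9) unfolding C_def by blast
  moreover have "\<psi> z2 \<in> O2 \<inter> C" using z CC unfolding C_def O2_def by blast
  ultimately show False using connectedD[OF cC *(8) O2] by blast
 qed
 define N1 where "N1 = \<psi> ` W"
 have oN1: "open N1" unfolding N1_def using NX by (intro open_image_homeomorphism[OF hs hh(1) oW]) auto
 have 0: "0 \<in> N1" unfolding N1_def using 0 \<psi>0 by (metis image_eqI)
 obtain q1 where q1: "q1 \<in> N1" "q1 \<in> U" "q1 \<noteq> 0" "g q1 = 0" using pt[OF oN1 0] by blast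
 obtain \<gamma>1 where g1: "\<gamma>1 ` {0..1} \<subseteq> V \<inter> N1 \<inter> U" "\<forall>t\<in>{0..1::real}. g (\<gamma>1 t) \<noteq> 0"
  using *(10)[OF oN1 0] by blast
 define q2 where "q2 = \<gamma>1 0"
 have q2: "q2 \<in> V" "q2 \<in> N1" "q2 \<in> U" "g q2 \<noteq> 0" unfolding q2_def using g1 by (auto simp: image_subset_iff)
 have inB: "\<exists>s. (s = \<i> \<or> s = - \<i>) \<and> \<phi> q \<in> B s" if q: "q \<in> V" "q \<in> N1" "q \<noteq> 0" for q
 proof -
  obtain z where z: "z \<in> W" "q = \<psi> z" using q(2) unfolding N1_def by blast
  then have zq: "\<phi> q = z" using NX \<phi>\<psi> by auto
  have "z \<in> germ_A (2*m - 1)" using VA NX z q by blast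
  then have "fst z = \<i> * snd z^m \<or> fst z = - \<i> * snd z^m" using fac by blast
  moreover have "z \<noteq> 0" using z q \<psi>0 by auto
  ultimately show ?thesis unfolding zq using BW[of \<i> z] BW[of "- \<i>" z] z by auto
 qed
 have N1X: "q \<in> X" "q \<in> U" if "q \<in> N1" for q using that NX \<psi>X unfolding N1_def by auto
 have q1V: "q1 \<in> V" using *(7) q1 by blast
 obtain s where s: "s = \<i> \<or> s = - \<i>" "\<phi> q1 \<in> B s" using inB[OF q1V q1(1,3)] by blast
 have q2n: "q2 \<noteq> 0" using q2(4) *(6) by auto
 obtain s' where s': "s' = \<i> \<or> s' = - \<i>" "\<phi> q2 \<in> B s'" using inB[OF q2(1,2) q2n] by blast
 have z0: "g (\<psi> z) = 0" if "z \<in> B s" for z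
  using side[OF s(1)] s(2) q1(4) \<psi>\<phi>[OF N1X(1)[OF q1(1)]] that by force
 have z1: "g (\<psi> z) \<noteq> 0" if "z \<in> B s'" for z
  using side[OF s'(1)] s'(2) q2(4) \<psi>\<phi>[OF N1X(1)[OF q2(2)]] that by force
 \<comment> \<open>The two branches play different roles: \<open>q1\<close> lies on the one where g
   vanishes, \<open>q2\<close> on the one where it does not.\<close>
 have ss: "s' = - s"
 proof -
  have "s' \<noteq> s" using z0 z1 s(2) s'(2) by blast
  then show ?thesis using s(1) s'(1) by auto
 qed
 have ns: "norm s = 1" "norm (- s) = 1" using s(1) by auto
 define g' where "g' = (%z::complex \<times> complex. fst z - s * snd z^m)"
 have zero: "g (\<psi> z) = 0 \<longleftrightarrow> g' z = 0" if z: "z \<in> W" for z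
 proof (cases "z = 0")
  case True then show ?thesis unfolding g'_def using \<psi>0 *(6) m by simp
 next
  case False
  show ?thesis
  proof
   assume g0: "g (\<psi> z) = 0"
   then have "\<psi> z \<in> V" using *(7) NX z by blast
   then have "z \<in> germ_A (2*m - 1)" using VA NX z by blast
   then have "fst z = s * snd z^m \<or> fst z = - s * snd z^m" using fac s(1) by auto
   then show "g' z = 0"
   proof
    assume "fst z = - s * snd z^m"
    then have "z \<in> B s'" unfolding ss using BW[OF ns(2)] z False by auto
    then show ?thesis using z1 g0 by blast
   qed (simp add: g'_def)
  next
   assume "g' z = 0"
   then have "z \<in> B s" using BW[OF ns(1)] z False unfolding g'_def by auto
   then show "g (\<psi> z) = 0" using z0 by blast
  qed
 qed
 have cg': "continuous_on A g'" for A unfolding g'_def by (intro continuous_intros)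
 have kU: "k q \<in> U" if "q \<in> U'" for q using that homeomorphism_image2[OF *(4)] by blast
 have hk: "h (k q) = fst q" "g (k q) = snd q" if "q \<in> U'" for q
  using arg_cong[OF homeomorphism_apply2[OF *(4) that], of fst] arg_cong[OF homeomorphism_apply2[OF *(4) that], of snd] by simp_all
 have kh: "k (h q, g q) = q" if "q \<in> U" for q using homeomorphism_apply1[OF *(4) that] .
 have k0: "k 0 = 0" using kh[OF *(2)] *(5,6) by (simp add: zero_prod_def)
 have ck: "continuous_on U' k" using *(4) by (simp add: homeomorphism_def)
 define N2 where "N2 = (%z. (h z, g z)) ` N1"
 have oN2: "open N2" unfolding N2_def using N1X by (intro open_image_homeomorphism[OF *(4,3) oN1]) auto
 have N2U: "N2 \<subseteq> U'" unfolding N2_def using N1X homeomorphism_image1[OF *(4)] by blast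
 have kN2: "k q \<in> N1" if q: "q \<in> N2" for q
 proof -
  obtain z where "z \<in> N1" "q = (h z, g z)" using q unfolding N2_def by blast
  then show ?thesis using kh N1X by simp
 qed
 have "(0, 0) \<in> N2" unfolding N2_def using 0 *(5,6) by (intro image_eqI[of _ _ 0]) auto
 then obtain d where d: "d > 0" "ball (0, 0) d \<subseteq> N2" using oN2 open_contains_ball by blast
 define \<rho> where "\<rho> = d/2"
 have \<rho>: "\<rho> > 0" unfolding \<rho>_def using d by simp
 define D where "D = ball (0::complex) \<rho>"
 have DD: "D \<times> D \<subseteq> N2"
 proof
  fix z assume "z \<in> D \<times> D"
  then have "norm (fst z)+norm (snd z) < d" unfolding D_def \<rho>_def by (auto simp: field_simps)
  then have "norm z < d" using norm_Pair_le[of "fst z" "snd z"] by simp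
  then show "z \<in> N2" using d by (auto simp flip: zero_prod_def)
 qed
 \<comment> \<open>The equation g' of the target branch, read in the chart (h, g) of the source
   branch; it is nonzero exactly where the second coordinate is, so the logarithm lemma gives its
   exponent \<open>n\<close>. Below, \<open>w'\<close> reads g in the chart of g' and gives
   \<open>n'\<close>.\<close>
 define w where "w = (%q. g' (\<phi> (k q)))"
 have cw: "continuous_on (D \<times> (D - {0})) w"
  unfolding w_def
 proof (rule continuous_on_compose2[OF cg'[of UNIV]])
  show "continuous_on (D \<times> (D - {0})) (%q. \<phi> (k q))"
  proof (rule continuous_on_compose2[OF c\<phi>])
   show "continuous_on (D \<times> (D - {0})) k" by (rule continuous_on_subset[OF ck]) (use DD N2U in auto)
   show "k ` (D \<times> (D - {0})) \<subseteq> X"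
    by (rule image_subsetI, rule N1X(1), rule kN2, rule subsetD[OF DD]) auto
  qed
 qed auto
 have \<phi>N1: "\<phi> q \<in> W" if "q \<in> N1" for q using that NX \<phi>\<psi> unfolding N1_def by auto
 have zero2: "g q = 0 \<longleftrightarrow> g' (\<phi> q) = 0" if "q \<in> N1" for q
  using zero[OF \<phi>N1[OF that]] \<psi>\<phi>[OF N1X(1)[OF that]] by simp
 have nw: "w q \<noteq> 0" if q: "q \<in> D \<times> (D - {0})" for q
 proof -
  have qN: "q \<in> N2" using q DD by auto
  have "g (k q) \<noteq> 0" using hk[of q] qN N2U q by auto
  then show ?thesis unfolding w_def using zero2[OF kN2[OF qN]] by simp
 qed
 have oD: "open D" "convex D" "D \<noteq> {}" "open (D - {0})" "0 \<notin> D - {0}" unfolding D_def using \<rho> by auto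
 have Dne: "D - {0} \<noteq> {}"
 proof -
  have "of_real (\<rho>/2) \<in> D - {0}" unfolding D_def using \<rho> by auto
  then show ?thesis by blast
 qed
 have "convex {s. exp s \<in> D - {0}}" unfolding D_def using convex_exp_vimage_punctured_ball[OF \<rho>] .
 then obtain n L where L: "continuous_on (D \<times> (D - {0})) L"
  "\<And>a z. a \<in> D ==> z \<in> D - {0} ==> w (a, z) = z powi n*exp (L (a, z))"
  by (rule punctured_product_log[OF oD(1-3) oD(4) Dne oD(5) _ cw nw]) (assumption, rule that, assumption, blast)
 define k' where "k' = (%q::complex \<times> complex. (snd q + s*fst q^m, fst q))"
 have ck': "continuous_on A k'" for A unfolding k'_def by (intro continuous_intros)
 have k'0: "k' 0 = 0" unfolding k'_def using m by (simp add: zero_prod_def)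
 have g'k': "g' (k' q) = snd q" for q unfolding g'_def k'_def by simp
 define N3 where "N3 = \<phi> ` k ` (D \<times> D)"
 have okD: "open (k ` (D \<times> D))"
  by (rule open_image_homeomorphism[OF homeomorphism_symD[OF *(4)] *(1)])
   (use oD DD N2U in \<open>auto intro: open_Times\<close>)
 have kDN: "k ` (D \<times> D) \<subseteq> N1" using DD kN2 by blast
 have oN3: "open N3" unfolding N3_def
  by (rule open_image_homeomorphism[OF hh(4,2) okD]) (use kDN N1X in auto)
 have D0: "(0, 0) \<in> D \<times> D" unfolding D_def using \<rho> by auto
 have "0 \<in> N3" unfolding N3_def using D0 k0 h0 by (metis image_eqI zero_prod_def)
 have "open (k' -` N3)" using oN3 ck'[of UNIV] by (simp add: continuous_on_open_vimage)
 moreover have "0 \<in> k' -` N3" using \<open>0 \<in> N3\<close> k'0 by simp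
 ultimately obtain d' where d': "d' > 0" "ball 0 d' \<subseteq> k' -` N3" using open_contains_ball by blast
 define \<sigma> where "\<sigma> = d'/2"
 have \<sigma>: "\<sigma> > 0" unfolding \<sigma>_def using d' by simp
 define E where "E = ball (0::complex) \<sigma>"
 have EE: "k' z \<in> N3" if "z \<in> E \<times> E" for z
 proof -
  have "norm (fst z)+norm (snd z) < d'" using that unfolding E_def \<sigma>_def by (auto simp: field_simps)
  then have "norm z < d'" using norm_Pair_le[of "fst z" "snd z"] by simp
  then show ?thesis using d' by auto
 qed
 have N3W: "z \<in> W" if "z \<in> N3" for z using that kDN \<phi>N1 unfolding N3_def by auto
 define w' where "w' = (%q. g (\<psi> (k' q)))"
 have cw': "continuous_on (E \<times> (E - {0})) w'"
  unfolding w'_def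
 proof (rule continuous_on_compose2[OF cont(2)])
  show "continuous_on (E \<times> (E - {0})) (%q. \<psi> (k' q))"
   by (rule continuous_on_compose2[OF c\<psi> ck'], rule image_subsetI, rule NX(1), rule N3W, rule EE) auto
  show "(%q. \<psi> (k' q)) ` (E \<times> (E - {0})) \<subseteq> U"
   by (rule image_subsetI, rule NX(2), rule N3W, rule EE) auto
 qed
 have nw': "w' q \<noteq> 0" if q: "q \<in> E \<times> (E - {0})" for q
 proof -
  have "q \<in> E \<times> E" using q by auto
  then show ?thesis unfolding w'_def using zero[OF N3W[OF EE]] g'k'[of q] q by auto
 qed
 have oE: "open E" "convex E" "E \<noteq> {}" "open (E - {0})" "0 \<notin> E - {0}" unfolding E_def using \<sigma> by auto
 have Ene: "E - {0} \<noteq> {}"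
 proof -
  have "of_real (\<sigma>/2) \<in> E - {0}" unfolding E_def using \<sigma> by auto
  then show ?thesis by blast
 qed
 have "convex {s. exp s \<in> E - {0}}" unfolding E_def using convex_exp_vimage_punctured_ball[OF \<sigma>] .
 then obtain n' L' where L': "continuous_on (E \<times> (E - {0})) L'"
  "\<And>a z. a \<in> E ==> z \<in> E - {0} ==> w' (a, z) = z powi n'*exp (L' (a, z))"
  by (rule punctured_product_log[OF oE(1-3) oE(4) Ene oE(5) _ cw' nw']) (assumption, rule that, assumption, blast)
 define c where "c = (%t::real. of_real (\<sigma>/2)*exp (2 * of_real pi*\<i> * of_real t))"
 have wc: "wn c 1" unfolding c_def by (rule wn_circle) (use \<sigma> in auto)
 have c01: "c 0 = c 1" unfolding c_def by simp
 have cc: "continuous_on {0..1} c" unfolding c_def by (intro continuous_intros)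
 have nc: "norm (c t) = \<sigma>/2" for t unfolding c_def norm_mult using \<sigma> by (simp add: norm_exp_eq_Re)
 have cE: "c t \<in> E - {0}" for t
 proof -
  have "c t \<noteq> 0" using nc[of t] \<sigma> by auto
  then show ?thesis unfolding E_def using nc[of t] \<sigma> by auto
 qed
 have E0: "0 \<in> E" unfolding E_def using \<sigma> by simp
 have 1: "wn (%t. w' (0, c t)) n'"
 proof -
  have "wn (%t. exp (L' (0, c t))) 0"
   by (rule wn_exp, rule continuous_on_compose2[OF L'(1)])
    (use cc cE E0 c01 in \<open>auto intro!: continuous_intros\<close>)
  then have "wn (%t. c t powi n'*exp (L' (0, c t))) (n'*1+0)" by (intro wn_mult wn_powi wc)
  then show ?thesis using L'(2)[OF E0 cE] by simp
 qed
 define \<alpha> where "\<alpha> = (%t. h (\<psi> (k' (0, c t))))"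
 have \<psi>N3: "\<psi> z \<in> U" "(h (\<psi> z), g (\<psi> z)) \<in> D \<times> D" if z: "z \<in> N3" for z
 proof -
  obtain q where q: "q \<in> D \<times> D" "z = \<phi> (k q)" using z unfolding N3_def by blast
  have "k q \<in> N1" using q kDN by blast
  then have 1: "\<psi> z = k q" using q \<psi>\<phi> N1X by simp
  then show "\<psi> z \<in> U" using \<open>k q \<in> N1\<close> N1X by simp
  have "q \<in> U'" using q DD N2U by blast
  then show "(h (\<psi> z), g (\<psi> z)) \<in> D \<times> D" unfolding 1 using hk q by auto
 qed
 have kN3: "k' (0, c t) \<in> N3" for t by (rule EE) (use cE[of t] E0 in auto)
 \<comment> \<open>Passing from g' to g and back is the identity; taking winding numbers around
   \<open>c\<close> yields n n' = 1.\<close>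
 have key: "c t = w' (0, c t) powi n*exp (L (\<alpha> t, w' (0, c t)))" for t
 proof -
  have kn: "k' (0, c t) \<in> N3" using kN3 .
  have a: "\<alpha> t \<in> D" "w' (0, c t) \<in> D - {0}"
   unfolding \<alpha>_def w'_def using \<psi>N3(2)[OF kn] nw'[of "(0, c t)"] cE[of t] E0 unfolding w'_def by auto
  have "w (\<alpha> t, w' (0, c t)) = g' (\<phi> (\<psi> (k' (0, c t))))"
   unfolding w_def \<alpha>_def w'_def using kh[OF \<psi>N3(1)[OF kn]] by simp
  also have "\<dots> = c t" using \<phi>\<psi>[OF NX(1)[OF N3W[OF kn]]] g'k' by simp
  finally show ?thesis using L(2)[OF a] by simp
 qed
 have aD: "\<alpha> t \<in> D" "w' (0, c t) \<in> D - {0}" for t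
  unfolding \<alpha>_def w'_def using \<psi>N3(2)[OF kN3, of t] nw'[of "(0, c t)"] cE[of t] E0 unfolding w'_def by auto
 have c\<alpha>: "continuous_on {0..1} \<alpha>" unfolding \<alpha>_def
 proof (rule continuous_on_compose2[OF cont(1)])
  show "continuous_on {0..1} (%t. \<psi> (k' (0, c t)))"
  proof (rule continuous_on_compose2[OF c\<psi>])
   show "continuous_on {0..1} (%t. k' (0, c t))"
    by (rule continuous_on_compose2[OF ck'[of UNIV]]) (use cc in \<open>auto intro!: continuous_intros\<close>)
   show "(%t. k' (0, c t)) ` {0..1} \<subseteq> X'" by (rule image_subsetI, rule NX(1), rule N3W, rule kN3)
  qed
  show "(%t. \<psi> (k' (0, c t))) ` {0..1} \<subseteq> U" by (rule image_subsetI, rule NX(2), rule N3W, rule kN3)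
 qed
 have cw'c: "continuous_on {0..1} (%t. w' (0, c t))"
  by (rule continuous_on_compose2[OF cw']) (use cc cE E0 in \<open>auto intro!: continuous_intros\<close>)
 have "wn (%t. exp (L (\<alpha> t, w' (0, c t)))) 0"
  by (rule wn_exp, rule continuous_on_compose2[OF L(1)])
   (use c\<alpha> cw'c aD c01 in \<open>auto intro!: continuous_intros simp: \<alpha>_def\<close>)
 then have "wn (%t. w' (0, c t) powi n*exp (L (\<alpha> t, w' (0, c t)))) (n*n'+0)"
  by (intro wn_mult wn_powi 1)
 then have "wn c (n*n')" using key by simp
 then have nn: "n*n' = 1" using wn_unique wc by blast
 have oV: "open (k ` (D \<times> D))" "0 \<in> k ` (D \<times> D)" using okD D0 k0 by (simp, metis image_eqI zero_prod_def)
 obtain \<gamma> where \<gamma>: "continuous_on {0..1} \<gamma>" "\<gamma> 0 = \<gamma> 1" "\<gamma> ` {0..1} \<subseteq> V \<inter> k ` (D \<times> D) \<inter> U"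
  "\<forall>t\<in>{0..1::real}. g (\<gamma> t) \<noteq> 0" "wn (%t. g (\<gamma> t)) j"
  using *(10)[OF oV] by blast
 have \<gamma>t: "\<gamma> t \<in> V" "\<gamma> t \<in> N1" "\<gamma> t \<in> U" "h (\<gamma> t) \<in> D" "g (\<gamma> t) \<in> D - {0}" if t: "t \<in> {0..1}" for t
 proof -
  have a: "\<gamma> t \<in> V" "\<gamma> t \<in> k ` (D \<times> D)" "\<gamma> t \<in> U" using \<gamma>(3) t by blast+
  obtain q where q: "q \<in> D \<times> D" "\<gamma> t = k q" using a by blast
  have qU: "q \<in> U'" using q DD N2U by blast
  show "\<gamma> t \<in> V" "\<gamma> t \<in> U" using a by auto
  show "\<gamma> t \<in> N1" using a kDN by blast
  have "g (\<gamma> t) \<noteq> 0" using \<gamma>(4) t by blast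
  then show "h (\<gamma> t) \<in> D" "g (\<gamma> t) \<in> D - {0}" using q hk[OF qU] by auto
 qed
 have "wn (%t. exp (L (h (\<gamma> t), g (\<gamma> t)))) 0"
 proof (rule wn_exp, rule continuous_on_compose2[OF L(1)])
  show "continuous_on {0..1} (%t. (h (\<gamma> t), g (\<gamma> t)))"
   by (intro continuous_on_Pair continuous_on_compose2[OF cont(1) \<gamma>(1)] continuous_on_compose2[OF cont(2) \<gamma>(1)])
    (use \<gamma>t in auto)
  show "(%t. (h (\<gamma> t), g (\<gamma> t))) ` {0..1} \<subseteq> D \<times> (D - {0})" using \<gamma>t by blast
 qed (use \<gamma>(2) in auto)
 then have "wn (%t. g (\<gamma> t) powi n*exp (L (h (\<gamma> t), g (\<gamma> t)))) (n*j+0)"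
  by (intro wn_mult wn_powi \<gamma>(5))
 moreover have "g' (\<phi> (\<gamma> t)) = g (\<gamma> t) powi n*exp (L (h (\<gamma> t), g (\<gamma> t)))" if t: "t \<in> {0..1}" for t
  using L(2)[OF \<gamma>t(4,5)[OF t]] kh[OF \<gamma>t(3)[OF t]] unfolding w_def by simp
 ultimately have w1: "wn (%t. g' (\<phi> (\<gamma> t))) (n*j)" using wn_cong by fastforce
 \<comment> \<open>The loops avoid the branch of \<open>s\<close>, hence run on that of
   \<open>-s\<close>, where g' is a constant times the m-th power of this coordinate.\<close>
 define y where "y = (%t. snd (\<phi> (\<gamma> t)))"
 have gy: "g' (\<phi> (\<gamma> t)) = (- 2 * s)*y t^m" and y0: "y t \<noteq> 0" if t: "t \<in> {0..1}" for t
 proof -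
  have gn: "g (\<gamma> t) \<noteq> 0" using \<gamma>(4) t by blast
  then have "\<gamma> t \<noteq> 0" using *(6) by auto
  then obtain u where u: "u = \<i> \<or> u = - \<i>" "\<phi> (\<gamma> t) \<in> B u" using inB \<gamma>t(1,2)[OF t] by blast
  have "u \<noteq> s" using z0[of "\<phi> (\<gamma> t)"] u(2) gn \<psi>\<phi> N1X \<gamma>t(2)[OF t] by auto
  then have us: "u = - s" using u(1) s(1) by auto
  then have b: "fst (\<phi> (\<gamma> t)) = - s*y t^m" "\<phi> (\<gamma> t) \<noteq> 0" using u(2) BW[OF ns(2)] unfolding y_def by auto
  then show "g' (\<phi> (\<gamma> t)) = (- 2 * s)*y t^m" unfolding g'_def y_def by simp
  show "y t \<noteq> 0" using b m unfolding y_def by (auto simp: prod_eq_iff)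
 qed
 have cy: "continuous_on {0..1} y" unfolding y_def
  by (intro continuous_intros continuous_on_compose2[OF c\<phi> \<gamma>(1)], rule image_subsetI, rule N1X(1), rule \<gamma>t(2))
 obtain i where "wn y i" using wn_exists[OF cy y0] \<gamma>(2) unfolding y_def by metis
 then have "wn (%t. (- 2 * s)*y t^m) (0+int m*i)"
  using s(1) by (intro wn_mult wn_power wn_const) auto
 then have "wn (%t. g' (\<phi> (\<gamma> t))) (int m*i)" using gy wn_cong by fastforce
 then have "n*j = int m*i" using w1 wn_unique by blast
 then have "n'*(n*j) = int m*(n'*i)" by simp
 then have "j = int m*(n'*i)" using nn by (metis mult.assoc mult.commute mult_1)
 then show ?thesis by simp
qed

text \<open>The tangent y = 0 of the cubic part x y (a x + b y) is simple because a is nonzero; it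
  carries a smooth branch, used as the distinguished one. Loops are taken on a branch tangent to x =
  0. If b is nonzero that tangent is simple too and the winding number is 1; if b = 0 the cubic part
  is a x^2 y and the branch is cuspidal with winding number 2. The conditions on \<open>c20\<close>
  and \<open>c02\<close> keep the axes from being components.\<close>

theorem linked_branch_triple_point:
 fixes a b c20 c11 c02 :: complex
 assumes a: "a \<noteq> 0" and c20: "c20 \<noteq> 0" and c02: "c02 \<noteq> 0"
 shows "\<exists>j\<in>{1, 2}. linked_branch j {z. fst z * snd z*(a*fst z+b * snd z) +
   (c20*fst z^2 + c11*fst z * snd z + c02 * snd z^2)^2 = 0}"
proof -
 define f where "f = (%x y. x*y*(a*x+b*y)+(c20*x^2 + c11*x*y + c02*y^2)^2)"
 define V where "V = {z. f (fst z) (snd z) = 0}"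
 define k1 where "k1 = (%m. (c20 + c11*m + c02*m^2)^2)"
 define k2 where "k2 = (%n. (c20*n^2 + c11*n + c02)^2)"
 have f1: "f x (m*x) = x^3*(m*(a+b*m)+x * k1 m)" for x m
  unfolding f_def k1_def by (simp add: algebra_simps power2_eq_square power3_eq_cube)
 have f2: "f (n*y) y = y^3*(n*(a*n+b)+y * k2 n)" for y n
  unfolding f_def k2_def by (simp add: algebra_simps power2_eq_square power3_eq_cube)
 \<comment> \<open>On the line y = m x the equation is x^3 (m (a + b m) + x k1(m)), so the branch is
   x = \<open>\<rho>\<close> m = m \<open>\<sigma>\<close> m. As \<open>\<sigma>\<close> 0 is
   nonzero, \<open>\<rho>\<close> is invertible near 0 and the slope becomes a function
   \<open>\<mu>\<close> of x.\<close>
 define \<sigma> where "\<sigma> = (%m. - (a+b*m) / k1 m)"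
 define \<rho> where "\<rho> = (%m. m*\<sigma> m)"
 define S where "S = {m. k1 m \<noteq> 0}"
 have oS: "open S" unfolding S_def k1_def by (intro open_Collect_neq continuous_intros)
 have 0: "0 \<in> S" unfolding S_def k1_def using c20 by simp
 have h\<sigma>: "\<sigma> holomorphic_on S" unfolding \<sigma>_def k1_def
  by (intro holomorphic_intros) (auto simp: S_def k1_def)
 have h\<rho>: "\<rho> holomorphic_on S" unfolding \<rho>_def by (intro holomorphic_intros h\<sigma>)
 have "(\<sigma> has_field_derivative deriv \<sigma> 0) (at 0)" using h\<sigma> 0 oS holomorphic_derivI by blast
 then have "(\<rho> has_field_derivative \<sigma> 0) (at 0)" unfolding \<rho>_def
  by (auto intro!: derivative_eq_intros)
 then have "deriv \<rho> 0 = \<sigma> 0" by (rule DERIV_imp_deriv)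
 moreover have "\<sigma> 0 \<noteq> 0" unfolding \<sigma>_def k1_def using a c20 by simp
 ultimately obtain r where r: "r > 0" "ball 0 r \<subseteq> S" "inj_on \<rho> (ball 0 r)"
  using has_complex_derivative_locally_injective[OF h\<rho> 0 oS] by auto
 define \<delta> where "\<delta> = min r 1"
 define B where "B = ball (0::complex) \<delta>"
 have \<delta>: "\<delta> > 0" "\<delta> \<le> 1" unfolding \<delta>_def using r by auto
 have BS: "B \<subseteq> S" unfolding B_def \<delta>_def using r by auto
 have oB: "open B" unfolding B_def by simp
 have c\<rho>: "continuous_on B \<rho>" using holomorphic_on_imp_continuous_on[OF h\<rho>] BS continuous_on_subset by blast
 have inj: "inj_on \<rho> B" by (rule inj_on_subset[OF r(3)]) (auto simp: B_def \<delta>_def)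
 obtain \<mu> where \<mu>: "homeomorphism B (\<rho> ` B) \<rho> \<mu>"
  using invariance_of_domain_homeomorphism[OF oB c\<rho> _ inj] by auto
 define R where "R = \<rho> ` B"
 have oR: "open R" unfolding R_def using invariance_of_domain[OF c\<rho> oB inj] .
 have B0: "0 \<in> B" unfolding B_def using \<delta> by simp
 have \<rho>0: "\<rho> 0 = 0" unfolding \<rho>_def by simp
 have R0: "0 \<in> R" unfolding R_def using B0 \<rho>0 by (metis image_eqI)
 have \<mu>\<rho>: "\<mu> (\<rho> m) = m" if "m \<in> B" for m using homeomorphism_apply1[OF \<mu> that] .
 have \<rho>\<mu>: "\<rho> (\<mu> x) = x" "\<mu> x \<in> B" if "x \<in> R" for x
  using homeomorphism_apply2[OF \<mu>, of x] homeomorphism_image2[OF \<mu>] that unfolding R_def by auto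
 have c\<mu>: "continuous_on R \<mu>" using \<mu> unfolding R_def by (simp add: homeomorphism_def)
 have \<rho>k: "\<rho> m * k1 m = - (m*(a+b*m))" if "m \<in> B" for m
 proof -
  have "k1 m \<noteq> 0" using BS that unfolding S_def by blast
  then show ?thesis unfolding \<rho>_def \<sigma>_def by (simp add: field_simps)
 qed
 define U where "U = R \<times> (UNIV :: complex set)"
 define g where "g = (%z. snd z - fst z*\<mu> (fst z))"
 define k where "k = (%z. (fst z, snd z+fst z*\<mu> (fst z)))"
 have c\<mu>f: "continuous_on U (%z. \<mu> (fst z))"
  by (rule continuous_on_compose2[OF c\<mu>]) (auto intro!: continuous_intros simp: U_def)
 have hom: "homeomorphism U U (%z. (fst z, g z)) k"
 proof (rule homeomorphismI)
  show "continuous_on U (%z. (fst z, g z))" unfolding g_def by (intro continuous_intros c\<mu>f)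
  show "continuous_on U k" unfolding k_def by (intro continuous_intros c\<mu>f)
 qed (auto simp: g_def k_def U_def)
 have gV: "z \<in> V" if zU: "z \<in> U" and g0: "g z = 0" for z
 proof -
  define m where "m = \<mu> (fst z)"
  have x: "fst z \<in> R" using zU unfolding U_def by auto
  have y: "snd z = m*fst z" using g0 unfolding g_def m_def by (simp add: mult.commute)
  have "fst z * k1 m = - (m*(a+b*m))" using \<rho>k[OF \<rho>\<mu>(2)[OF x]] \<rho>\<mu>(1)[OF x] unfolding m_def by simp
  then show ?thesis unfolding V_def using f1[of "fst z" m] y by simp
 qed
 \<comment> \<open>A cone of slopes smaller than \<open>\<delta>\<close>: points of the curve in it
   have slope in \<open>B\<close>, and there the equation forces x = \<open>\<rho>\<close> m, that
   is g = 0.\<close>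
 define O1 where "O1 = {z :: complex \<times> complex. norm (snd z) < \<delta>*norm (fst z)}"
 have oO1: "open O1" unfolding O1_def by (intro open_Collect_less continuous_intros)
 have sep: "g z = 0 \<longleftrightarrow> z \<in> O1" if zV: "z \<in> V" and zU: "z \<in> U" and z0: "z \<noteq> 0" for z
 proof
  assume g0: "g z = 0"
  have x: "fst z \<in> R" using zU unfolding U_def by auto
  have y: "snd z = fst z*\<mu> (fst z)" using g0 unfolding g_def by simp
  then have "fst z \<noteq> 0" using z0 by (auto simp: prod_eq_iff)
  moreover have "norm (\<mu> (fst z)) < \<delta>" using \<rho>\<mu>(2)[OF x] unfolding B_def by simp
  ultimately show "z \<in> O1" unfolding O1_def using y by (simp add: norm_mult mult.commute)
 next
  assume "z \<in> O1"
  then have lt: "norm (snd z) < \<delta>*norm (fst z)" unfolding O1_def by simp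
  then have x0: "fst z \<noteq> 0" by auto
  define m where "m = snd z/fst z"
  have mB: "m \<in> B" unfolding B_def m_def using lt x0 by (simp add: norm_divide field_simps)
  have y: "snd z = m*fst z" unfolding m_def using x0 by simp
  have "m*(a+b*m)+fst z * k1 m = 0" using zV f1[of "fst z" m] y x0 unfolding V_def by simp
  then have "fst z * k1 m = \<rho> m * k1 m" using \<rho>k[OF mB] by (metis add.commute eq_neg_iff_add_eq_0)
  moreover have "k1 m \<noteq> 0" using BS mB unfolding S_def by blast
  ultimately have "fst z = \<rho> m" by simp
  then have "\<mu> (fst z) = m" using \<mu>\<rho>[OF mB] by simp
  then show "g z = 0" unfolding g_def using y by simp
 qed
 \<comment> \<open>The remaining branch is parametrised by the inverse slope n = x/y, with y = -n (a
   n + b) / k2(n); \<open>j\<close> is the order of y in n, which jumps to 2 when b = 0.\<close>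
 define j :: nat where "j = (if b = 0 then 2 else 1)"
 define \<tau> where "\<tau> = (%n. (if b = 0 then - a else - (a*n+b)) / k2 n)"
 define Y where "Y = (%n. n^j*\<tau> n)"
 define X where "X = (%n. n*Y n)"
 define T where "T = {n. k2 n \<noteq> 0}"
 have oT: "open T" unfolding T_def k2_def by (intro open_Collect_neq continuous_intros)
 have T0: "0 \<in> T" unfolding T_def k2_def using c02 by simp
 have c\<tau>: "continuous_on T \<tau>" unfolding \<tau>_def k2_def
  by (cases "b = 0") (auto intro!: continuous_intros simp: T_def k2_def)
 have \<tau>0: "\<tau> 0 \<noteq> 0" unfolding \<tau>_def k2_def using a c02 by auto
 have cY: "continuous_on T Y" unfolding Y_def by (intro continuous_intros c\<tau>)
 have cX: "continuous_on T X" unfolding X_def by (intro continuous_intros cY)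
 have Yk: "Y n * k2 n = - (n*(a*n+b))" if "n \<in> T" for n
  using that unfolding Y_def \<tau>_def T_def j_def by (auto simp: power2_eq_square algebra_simps)
 have j0: "j \<noteq> 0" unfolding j_def by simp
 have XY0: "X 0 = 0" "Y 0 = 0" unfolding X_def Y_def using j0 by auto
 have XYV: "(X n, Y n) \<in> V" if "n \<in> T" for n
  unfolding V_def X_def using f2[of n "Y n"] Yk[OF that] by simp
 have loops: "\<exists>\<gamma>. continuous_on {0..1} \<gamma> \<and> \<gamma> 0 = \<gamma> 1 \<and>
    \<gamma> ` {0..1} \<subseteq> V \<inter> W \<inter> U \<and> (\<forall>t\<in>{0..1}. g (\<gamma> t) \<noteq> 0) \<and> wn (%t. g (\<gamma> t)) (int j)"
  if W: "open W" "0 \<in> W" for W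
 proof -
  define T1 where "T1 = T \<inter> (%n. (X n, Y n)) -` (W \<inter> U)"
  have oU: "open U" unfolding U_def using oR by (intro open_Times) auto
  have U0: "0 \<in> U" unfolding U_def using R0 by (simp add: zero_prod_def)
  have oT1: "open T1" unfolding T1_def
   by (rule continuous_open_preimage[OF _ oT]) (use W oU cX cY in \<open>auto intro!: continuous_intros\<close>)
  have T10: "0 \<in> T1" unfolding T1_def using T0 XY0 W U0 by (simp add: zero_prod_def)
  \<comment> \<open>Along the loop g equals n^j times this factor, which stays close to the nonzero
    number \<open>\<tau>\<close> 0 and so does not wind.\<close>
  define G where "G = (%n. \<tau> n*(1 - n*\<mu> (X n)))"
  have c\<mu>X: "continuous_on T1 (%n. \<mu> (X n))"
   by (rule continuous_on_compose2[OF c\<mu>], rule continuous_on_subset[OF cX]) (auto simp: T1_def U_def)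
  have cG: "continuous_on T1 G" unfolding G_def
   by (intro continuous_intros c\<mu>X continuous_on_subset[OF c\<tau>]) (auto simp: T1_def)
  define T2 where "T2 = T1 \<inter> G -` ball (\<tau> 0) (norm (\<tau> 0))"
  have oT2: "open T2" unfolding T2_def by (rule continuous_open_preimage[OF cG oT1]) simp
  have T20: "0 \<in> T2" unfolding T2_def using T10 \<tau>0 unfolding G_def by simp
  obtain s where s: "s > 0" "ball 0 s \<subseteq> T2" using oT2 T20 open_contains_ball by blast
  define c where "c = (%t::real. of_real (s/2)*exp (2 * of_real pi*\<i> * of_real t))"
  have wc: "wn c 1" unfolding c_def by (rule wn_circle) (use s in auto)
  have c01: "c 0 = c 1" unfolding c_def by simp
  have cc: "continuous_on {0..1} c" unfolding c_def by (intro continuous_intros)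
  have nc: "norm (c t) = s/2" for t unfolding c_def norm_mult using s by (simp add: norm_exp_eq_Re)
  have c0: "c t \<noteq> 0" for t using nc[of t] s by auto
  have cT2: "c t \<in> T2" for t using s nc[of t] by (intro subsetD[OF s(2)]) auto
  have cT: "c t \<in> T" "c t \<in> T1" "(X (c t), Y (c t)) \<in> W \<inter> U" for t using cT2[of t] unfolding T2_def T1_def by auto
  define \<gamma> where "\<gamma> = (%t. (X (c t), Y (c t)))"
  have gg: "g (\<gamma> t) = c t^j*G (c t)" for t
   unfolding g_def \<gamma>_def G_def X_def Y_def by (simp add: algebra_simps)
  have nG: "norm (G (c t) - \<tau> 0) < norm (\<tau> 0)" for t
   using cT2[of t] unfolding T2_def by (simp add: dist_norm norm_minus_commute)
  have "wn (%t. G (c t)) 0"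
  proof (rule wn_near_const)
   show "continuous_on {0..1} (%t. G (c t))" by (rule continuous_on_compose2[OF cG cc]) (use cT in auto)
  qed (use c01 nG in auto)
  then have "wn (%t. c t^j*G (c t)) (int j*1+0)" by (intro wn_mult wn_power wc)
  then have "wn (%t. g (\<gamma> t)) (int j)" using gg by simp
  moreover have "g (\<gamma> t) \<noteq> 0" for t
  proof -
   have "G (c t) \<noteq> 0" using nG[of t] by auto
   then show ?thesis unfolding gg using c0 by simp
  qed
  moreover have "continuous_on {0..1} \<gamma>" unfolding \<gamma>_def
   by (intro continuous_on_Pair continuous_on_compose2[OF cX cc] continuous_on_compose2[OF cY cc]) (use cT in auto)
  moreover have "\<gamma> 0 = \<gamma> 1" unfolding \<gamma>_def c01 by simp
  moreover have "\<gamma> ` {0..1} \<subseteq> V \<inter> W \<inter> U"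
   by (rule image_subsetI) (use XYV[OF cT(1)] cT(3) in \<open>simp add: \<gamma>_def\<close>)
  ultimately show ?thesis by (intro exI[of _ \<gamma>]) blast
 qed
 have "\<forall>W. open W \<and> 0 \<in> W --> (\<exists>\<gamma>. continuous_on {0..1} \<gamma> \<and> \<gamma> 0 = \<gamma> 1 \<and>
    \<gamma> ` {0..1} \<subseteq> V \<inter> W \<inter> U \<and> (\<forall>t\<in>{0..1}. g (\<gamma> t) \<noteq> 0) \<and> wn (%t. g (\<gamma> t)) (int j))"
  by (intro allI impI, elim conjE) (rule loops)
 moreover have "open U" unfolding U_def using oR by (intro open_Times) auto
 moreover have "0 \<in> U" unfolding U_def using R0 by (simp add: zero_prod_def)
 moreover have "g 0 = 0" unfolding g_def by simp
 moreover have "\<forall>z\<in>U. g z = 0 --> z \<in> V" using gV by blast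
 moreover have "\<forall>z\<in>V \<inter> U - {0}. g z = 0 \<longleftrightarrow> z \<in> O1"
  by (intro ballI) (rule sep, auto)
 ultimately have "branch_chart (int j) V U U fst g k O1"
  unfolding branch_chart_def using hom oO1 by (intro conjI) (assumption | rule fst_zero)+
 then have "linked_branch (int j) V" unfolding linked_branch_def by (intro exI)
 then show ?thesis unfolding V_def f_def j_def by (auto split: if_splits)
qed

section \<open>The monodromy of Brieskorn germs\<close>

definition bg :: "nat => nat => complex \<times> complex => complex" where
 "bg a b q = fst q^a + snd q^b"

definition bcomp :: "nat => nat => (complex \<times> complex) set" where
 "bcomp a b = {q. bg a b q \<noteq> 0}"

text \<open>The quasihomogeneous circle action: x has weight b and y weight a, so that x^a + y^b has
  weight ab. Time is measured in full periods.\<close>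

definition bflow :: "nat => nat => real => complex \<times> complex => complex \<times> complex" where
 "bflow a b t q = (exp (2 * of_real pi*\<i> * of_real (b*t))*fst q, exp (2 * of_real pi*\<i> * of_real (a*t)) * snd q)"

lemma bg_flow: "bg a b (bflow a b t q) = exp (2 * of_real pi*\<i> * of_real (a*b*t))*bg a b q"
 unfolding bg_def bflow_def
 by (simp add: power_mult_distrib algebra_simps flip: exp_of_nat_mult)

lemma open_bcomp: "open (bcomp a b)"
 unfolding bcomp_def bg_def by (intro open_Collect_neq continuous_intros)

lemma continuous_bg: "continuous_on A (bg a b)"
 unfolding bg_def by (intro continuous_intros)

lemma continuous_bflow: "continuous_on A (%p. bflow a b (f p) (h p))"
 if "continuous_on A f" "continuous_on A h"
 unfolding bflow_def by (intro continuous_intros that)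

lemma bflow_in: "q \<in> bcomp a b ==> bflow a b t q \<in> bcomp a b"
 unfolding bcomp_def by (simp add: bg_flow)

lemma bflow_0: "bflow a b 0 q = q"
 unfolding bflow_def by simp

lemma bflow_1: "bflow a b 1 q = q"
proof -
 have "exp (2 * of_real pi*\<i> * of_nat n) = 1" for n
  using exp_of_nat_mult[of n "2 * of_real pi*\<i>"] by (simp add: mult.commute)
 then show ?thesis unfolding bflow_def by simp
qed

text \<open>Lifting the homotopy through the covering exp, starting from the zero function, needs no
  assumption on the topology of \<open>S\<close>.\<close>

lemma homotopy_log:
 fixes H :: "real \<times> 'a::real_normed_vector => complex"
 assumes "continuous_on ({0..1} \<times> S) H" "\<And>z. z \<in> {0..1} \<times> S ==> H z \<noteq> 0" "\<And>q. q \<in> S ==> H (0, q) = 1"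
 obtains M where "continuous_on S M" "\<And>q. q \<in> S ==> H (1, q) = exp (M q)"
proof -
 obtain k where k: "continuous_on ({0..1} \<times> S) k" "\<And>z. z \<in> {0..1} \<times> S ==> H z = exp (k z)"
 proof (rule covering_space_lift_homotopy[OF covering_space_exp_punctured_plane assms(1), of "%_. 0"])
  show "H \<in> {0..1} \<times> S \<rightarrow> - {0}" using assms(2) by auto
  show "H (0, y) = exp 0" if "y \<in> S" for y using assms(3)[OF that] by simp
 qed (auto intro!: continuous_intros)
 show ?thesis
 proof (rule that[of "%q. k (1, q)"])
  show "continuous_on S (%q. k (1, q))"
   by (rule continuous_on_compose2[OF k(1)]) (auto intro!: continuous_intros)
 qed (use k(2) in auto)
qed

lemma open_map_power:
 assumes "n \<ge> 1" "open U" shows "open ((%z::complex. z^n) ` U)"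
proof (rule open_mapping_thm[of _ UNIV])
 show "\<not> (%z::complex. z^n) constant_on UNIV"
 proof
  assume "(%z::complex. z^n) constant_on UNIV"
  then have "(0::complex)^n = 1^n" unfolding constant_on_def by (metis UNIV_I)
  then show False using assms by (simp add: power_0_left split: if_splits)
 qed
qed (use assms in \<open>auto intro!: holomorphic_intros\<close>)

lemma complex_nth_roots_differ:
 fixes x x' :: complex
 assumes "n \<ge> 1" "x'^n = x^n"
 obtains i :: nat where "x' = exp (2 * of_real pi*\<i> * of_nat i / of_nat n)*x"
proof (cases "x = 0")
 case True
 then have "x' = 0" using assms by (simp add: power_0_left split: if_splits)
 then show ?thesis using True that[of 0] by simp
next
 case False
 then have "(x'/x)^n = 1" using assms by (simp add: power_divide)
 then obtain i where "x'/x = exp (2 * of_real pi*\<i> * of_nat i / of_nat n)"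
  using complex_roots_unity[OF assms(1)] by blast
 then show ?thesis using that False by (metis nonzero_eq_divide_eq)
qed

lemma exp_periodic_mod:
 assumes "n \<ge> 1" "k mod n = (l::nat) mod n"
 shows "exp (2 * of_real pi*\<i> * of_nat k / of_nat n) = exp (2 * of_real pi*\<i> * of_nat l / of_nat n)"
proof -
 have *: "exp (2 * of_real pi*\<i> * of_nat k / of_nat n) = exp (2 * of_real pi*\<i> * of_nat (k mod n) / of_nat n)" for k
 proof -
  have "of_nat k = (of_nat n * of_nat (k div n) + of_nat (k mod n) :: complex)"
   by (metis mult_div_mod_eq of_nat_add of_nat_mult)
  then have "2 * of_real pi*\<i> * of_nat k / of_nat n =
    of_nat (k div n)*(2 * of_real pi*\<i>)+2 * of_real pi*\<i> * of_nat (k mod n) / of_nat n"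
   using assms(1) by (simp add: field_simps)
  then show ?thesis by (simp add: exp_add exp_of_nat_mult)
 qed
 show ?thesis using *[of k] *[of l] assms(2) by simp
qed

text \<open>The first cohomology of the complement of \<open>x^a + y^b = 0\<close> is generated by the defining
 function: the norm of \<open>w\<close> over the torsion group \<open>\<mu>\<^sub>a \<times> \<mu>\<^sub>b\<close>, which lies in the circle action, is
 up to an exponential a power of \<open>w\<close>, and it is a function of \<open>(x^a, x^a + y^b)\<close>.\<close>

lemma bcomp_log:
 assumes ab: "a \<ge> 1" "b \<ge> 1" "coprime a b"
  and w: "continuous_on (bcomp a b) w" "\<And>q. q \<in> bcomp a b ==> w q \<noteq> 0"
 obtains \<nu> L where "continuous_on (bcomp a b) L"
  "\<And>q. q \<in> bcomp a b ==> w q = bg a b q powi \<nu>*exp (L q)"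
proof -
 define C where "C = bcomp a b"
 define c where "c = a*b"
 have c1: "c \<ge> 1" unfolding c_def using ab by simp
 \<comment> \<open>The flow joins the identity to its time-t map, so the quotient of
   \<open>w\<close> after and before is homotopic to 1 and has a logarithm.\<close>
 have "\<exists>M. continuous_on C M \<and> (\<forall>q\<in>C. w (bflow a b t q) = w q*exp (M q))" for t
 proof -
  define H where "H = (%p. w (bflow a b (fst p*t) (snd p))/w (snd p))"
  have H1: "continuous_on ({0..1} \<times> C) H" unfolding H_def
   by (intro continuous_intros continuous_on_compose2[OF w(1)] continuous_bflow)
    (use w(2) bflow_in in \<open>auto simp: C_def\<close>)
  have H2: "H z \<noteq> 0" if "z \<in> {0..1} \<times> C" for z
   using that w(2)[OF bflow_in] w(2) unfolding H_def C_def by auto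
  have H3: "H (0, q) = 1" if "q \<in> C" for q using that w(2) unfolding H_def C_def by (simp add: bflow_0)
  obtain M where M: "continuous_on C M" "\<And>q. q \<in> C ==> H (1, q) = exp (M q)"
   using homotopy_log[OF H1 H2 H3] by blast
  have "w (bflow a b t q) = w q*exp (M q)" if "q \<in> C" for q
   using M(2)[OF that] w(2) that unfolding H_def C_def by (simp add: field_simps)
  then show ?thesis using M(1) by blast
 qed
 then obtain M where M: "\<And>t. continuous_on C (M t)" "\<And>t q. q \<in> C ==> w (bflow a b t q) = w q*exp (M t q)"
  by metis
 \<comment> \<open>The flow at time k/(ab): it rotates the coordinates by k-th powers of primitive
   roots of unity of orders a and b. As a and b are coprime, every pair of such rotations
   occurs.\<close>
 define fl where "fl = (%k::nat. %q. (exp (2 * of_real pi*\<i> * of_nat k / of_nat a)*fst q,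
   exp (2 * of_real pi*\<i> * of_nat k / of_nat b) * snd q :: complex))"
 have fl: "fl k q = bflow a b (real k/real c) q" for k q
  unfolding fl_def bflow_def c_def using ab by (simp add: field_simps)
 have flC: "fl k q \<in> C" if "q \<in> C" for k q using that bflow_in unfolding fl C_def by blast
 define Nw where "Nw = (%q. \<Prod>k<c. w (fl k q))"
 have Nw: "Nw q = w q ^ c*exp (\<Sum>k<c. M (real k/real c) q)" if "q \<in> C" for q
  unfolding Nw_def fl using M(2)[OF that] by (simp add: prod.distrib exp_sum)
 have cNw: "continuous_on C Nw" unfolding Nw_def
 proof (intro continuous_on_prod continuous_on_compose2[OF w(1)])
  show "continuous_on C (fl k)" for k unfolding fl_def by (intro continuous_intros)
  show "fl k ` C \<subseteq> bcomp a b" for k using flC unfolding C_def by blast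
 qed
 have nNw: "Nw q \<noteq> 0" if "q \<in> C" for q unfolding Nw_def using w(2) flC[OF that] unfolding C_def by simp
 have flmod: "fl k q = fl l q" if "k mod c = l mod c" for k l q
 proof -
  have "k mod a = l mod a" "k mod b = l mod b" using that unfolding c_def
   by (metis mod_mod_cancel dvd_triv_left, metis mod_mod_cancel dvd_triv_right)
  then show ?thesis unfolding fl_def using exp_periodic_mod[OF ab(1)] exp_periodic_mod[OF ab(2)] by metis
 qed
 have fladd: "fl k (fl l q) = fl (k+l) q" for k l q
  unfolding fl_def by (simp add: exp_add add_divide_distrib distrib_left algebra_simps)
 have Nwfl: "Nw (fl l q) = Nw q" for l q
 proof -
  have "Nw (fl l q) = (\<Prod>k<c. w (fl ((k+l) mod c) q))"
   unfolding Nw_def fladd by (intro prod.cong refl) (metis flmod mod_mod_trivial)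
  also have "\<dots> = (\<Prod>k<c. w (fl k q))"
  proof (rule prod.reindex_bij_betw)
   have "inj_on (%k. (k+l) mod c) {..<c}"
   proof (rule inj_onI)
    fix x y assume xy: "x \<in> {..<c}" "y \<in> {..<c}" "(x+l) mod c = (y+l) mod c"
    then have "[x+l = y+l] (mod c)" by (simp add: cong_def)
    then have "[x = y] (mod c)" by (simp add: cong_add_rcancel_nat)
    then show "x = y" using xy by (simp add: cong_def)
   qed
   moreover have "(%k. (k+l) mod c) ` {..<c} \<subseteq> {..<c}" using c1 by auto
   ultimately show "bij_betw (%k. (k+l) mod c) {..<c} {..<c}"
    unfolding bij_betw_def by (simp add: endo_inj_surj)
  qed
  finally show ?thesis unfolding Nw_def .
 qed
 have Nwdep: "Nw q' = Nw q" if eq: "fst q'^a = fst q^a" "snd q'^b = snd q^b" for q q'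
 proof -
  obtain i where i: "fst q' = exp (2 * of_real pi*\<i> * of_nat i / of_nat a)*fst q"
   using complex_nth_roots_differ[OF ab(1) eq(1)] .
  obtain j where j: "snd q' = exp (2 * of_real pi*\<i> * of_nat j / of_nat b) * snd q"
   using complex_nth_roots_differ[OF ab(2) eq(2)] .
  obtain k where k: "[k = i] (mod a)" "[k = j] (mod b)" using binary_chinese_remainder_nat[OF ab(3)] by blast
  have "q' = fl k q" unfolding fl_def
   using i j exp_periodic_mod[OF ab(1), of k i] exp_periodic_mod[OF ab(2), of k j] k
   by (simp add: cong_def prod_eq_iff)
  then show ?thesis using Nwfl by simp
 qed
 \<comment> \<open>Any choice of roots works, continuous or not, since \<open>Nw\<close> depends
   only on the powers of the coordinates.\<close>
 define rt where "rt = (%n::nat. %z::complex. if z = 0 then 0 else exp (Ln z / of_nat n))"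
 have rt: "rt n z^n = z" if "n \<ge> 1" for n z
  using that unfolding rt_def by (auto simp flip: exp_of_nat_mult)
 define P where "P = (%q::complex \<times> complex. (fst q^a, bg a b q))"
 define N where "N = (%p::complex \<times> complex. Nw (rt a (fst p), rt b (snd p - fst p)))"
 have NP: "N (P q) = Nw q" for q
  unfolding N_def by (rule Nwdep) (use rt ab in \<open>auto simp: P_def bg_def\<close>)
 have PC: "P q \<in> UNIV \<times> (- {0}) \<longleftrightarrow> q \<in> C" for q unfolding P_def C_def bcomp_def by simp
 have Psurj: "\<exists>q\<in>C. p = P q" if "p \<in> UNIV \<times> (- {0})" for p
 proof -
  define q where "q = (rt a (fst p), rt b (snd p - fst p))"
  have "P q = p" unfolding P_def q_def bg_def using rt ab by (simp add: prod_eq_iff)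
  then show ?thesis using PC that by metis
 qed
 \<comment> \<open>Openness of \<open>P\<close> makes \<open>N\<close> continuous, although it was
   written with discontinuous roots: preimages under \<open>N\<close> are \<open>P\<close>-images of
   preimages under \<open>Nw\<close>.\<close>
 have Popen: "open (P ` T)" if T: "open T" for T
 proof -
  have "open ((%q. (fst q^a, snd q^b)) ` T)"
   unfolding open_prod_def
  proof (intro ballI)
   fix p assume "p \<in> (%q. (fst q^a, snd q^b)) ` T"
   then obtain q where q: "q \<in> T" "p = (fst q^a, snd q^b)" by blast
   obtain A B where AB: "open A" "open B" "q \<in> A \<times> B" "A \<times> B \<subseteq> T"
    by (rule open_prod_elim[OF T q(1)])
   show "\<exists>A B. open A \<and> open B \<and> p \<in> A \<times> B \<and> A \<times> B \<subseteq> (%q. (fst q^a, snd q^b)) ` T"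
   proof (intro exI conjI)
    show "open ((%z. z^a) ` A)" "open ((%z. z^b) ` B)" using open_map_power ab AB by auto
    show "p \<in> ((%z. z^a) ` A) \<times> ((%z. z^b) ` B)" using q AB(3) by auto
    show "((%z. z^a) ` A) \<times> ((%z. z^b) ` B) \<subseteq> (%q. (fst q^a, snd q^b)) ` T"
    proof
     fix z assume "z \<in> ((%z. z^a) ` A) \<times> ((%z. z^b) ` B)"
     then obtain x y where "x \<in> A" "y \<in> B" "z = (x^a, y^b)" by auto
     then show "z \<in> (%q. (fst q^a, snd q^b)) ` T" using AB(4) by (intro image_eqI[of _ _ "(x, y)"]) auto
    qed
   qed
  qed
  moreover have "P ` T = (%p. (fst p, snd p - fst p)) -` ((%q. (fst q^a, snd q^b)) ` T)"
  proof (intro set_eqI iffI)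
   fix p assume "p \<in> P ` T"
   then obtain q where q: "q \<in> T" "p = P q" by blast
   then have "(fst p, snd p - fst p) = (fst q^a, snd q^b)" unfolding P_def bg_def by simp
   then show "p \<in> (%p. (fst p, snd p - fst p)) -` ((%q. (fst q^a, snd q^b)) ` T)"
    using q(1) by (metis (mono_tags, lifting) image_eqI vimageI2)
  next
   fix p assume "p \<in> (%p. (fst p, snd p - fst p)) -` ((%q. (fst q^a, snd q^b)) ` T)"
   then obtain q where q: "q \<in> T" "fst p = fst q^a" "snd p - fst p = snd q^b" by auto
   then have "p = P q" unfolding P_def bg_def by (simp add: prod_eq_iff algebra_simps)
   then show "p \<in> P ` T" using q by blast
  qed
  moreover have "continuous_on UNIV (%p::complex \<times> complex. (fst p, snd p - fst p))"
   by (intro continuous_intros)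
  ultimately show ?thesis by (simp add: continuous_on_open_vimage)
 qed
 have oD: "open ((UNIV :: complex set) \<times> (- {0::complex}))" by (intro open_Times) auto
 have cN: "continuous_on (UNIV \<times> (- {0})) N"
  unfolding continuous_on_open_vimage[OF oD]
 proof (intro allI impI)
  fix B :: "complex set" assume B: "open B"
  have "N -` B \<inter> UNIV \<times> (- {0}) = P ` (C \<inter> Nw -` B)"
  proof (intro set_eqI iffI)
   fix p assume p: "p \<in> N -` B \<inter> UNIV \<times> (- {0})"
   then obtain q where q: "q \<in> C" "p = P q" using Psurj by blast
   then have "Nw q \<in> B" using p NP[of q] by auto
   then show "p \<in> P ` (C \<inter> Nw -` B)" using q by blast
  next
   fix p assume "p \<in> P ` (C \<inter> Nw -` B)"
   then obtain q where q: "q \<in> C" "Nw q \<in> B" "p = P q" by blast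
   then have "p \<in> UNIV \<times> (- {0})" using PC by blast
   then show "p \<in> N -` B \<inter> UNIV \<times> (- {0})" using NP[of q] q by simp
  qed
  moreover have "open (C \<inter> Nw -` B)"
   by (rule continuous_open_preimage[OF cNw _ B]) (simp add: C_def open_bcomp)
  ultimately show "open (N -` B \<inter> UNIV \<times> (- {0}))" using Popen by simp
 qed
 have nN: "N p \<noteq> 0" if "p \<in> UNIV \<times> (- {0})" for p
  using Psurj[OF that] NP nNw by auto
 have ne: "- {0::complex} \<noteq> {}" "0 \<notin> - {0::complex}" "convex {s. exp s \<in> - {0::complex}}" "(UNIV :: complex set) \<noteq> {}"
  by (auto intro: exI[of _ 1])
 have oC: "open (- {0::complex})" by auto
 obtain n L where L: "continuous_on (UNIV \<times> (- {0})) L"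
  "\<And>x z. x \<in> UNIV ==> z \<in> - {0} ==> N (x, z) = z powi n*exp (L (x, z))"
  by (rule punctured_product_log[OF open_UNIV convex_UNIV ne(4) oC ne(1-3) cN nN]) (assumption, rule that, assumption, blast)
 define K where "K = (%q. L (P q) - (\<Sum>k<c. M (real k/real c) q))"
 have cP: "continuous_on C P" unfolding P_def by (intro continuous_intros continuous_bg)
 have cK: "continuous_on C K" unfolding K_def
  by (intro continuous_intros M(1) continuous_on_compose2[OF L(1) cP]) (use PC in blast)
 have wK: "w q ^ c = bg a b q powi n*exp (K q)" if q: "q \<in> C" for q
 proof -
  have "w q ^ c*exp (\<Sum>k<c. M (real k/real c) q) = N (P q)" using Nw[OF q] NP by simp
  also have "\<dots> = bg a b q powi n*exp (L (P q))"
   unfolding P_def by (rule L(2)) (use q in \<open>auto simp: C_def bcomp_def\<close>)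
  finally show ?thesis unfolding K_def by (simp add: exp_diff field_simps)
 qed
 \<comment> \<open>The exponent found for w^c is the winding number of \<open>w\<close> itself along
   one orbit: along it the defining function winds c times, and c cancels.\<close>
 have orbit: "wn (%t. w (bflow a b t q)) n" if q: "q \<in> C" for q
 proof -
  have cf: "continuous_on {0..1} (%t. bflow a b t q)" by (intro continuous_bflow continuous_intros)
  have fC: "bflow a b t q \<in> C" for t using bflow_in q unfolding C_def by blast
  have "continuous_on {0..1} (%t. w (bflow a b t q))"
   by (rule continuous_on_compose2[OF w(1) cf]) (use fC in \<open>auto simp: C_def\<close>)
  then obtain d where d: "wn (%t. w (bflow a b t q)) d"
   using wn_exists[of "%t. w (bflow a b t q)"] w(2) fC bflow_0 bflow_1 unfolding C_def by metis
  have "wn (%t. exp (K (bflow a b t q))) 0"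
   by (rule wn_exp, rule continuous_on_compose2[OF cK cf]) (use fC bflow_0 bflow_1 in auto)
  moreover have "wn (%t. bg a b (bflow a b t q)) (int c)"
  proof -
   have "wn (%t. (1*exp (2 * of_real pi*\<i> * of_real t)) ^ c*bg a b q) (int c*1+0)"
    by (intro wn_mult wn_power wn_circle wn_const) (use q in \<open>auto simp: C_def bcomp_def\<close>)
   then show ?thesis unfolding bg_flow c_def
    by (simp add: algebra_simps flip: exp_of_nat_mult)
  qed
  ultimately have "wn (%t. bg a b (bflow a b t q) powi n*exp (K (bflow a b t q))) (n*int c+0)"
   by (intro wn_mult wn_powi)
  then have "wn (%t. w (bflow a b t q) ^ c) (n*int c)" using wK[OF fC] by simp
  moreover have "wn (%t. w (bflow a b t q) ^ c) (int c*d)" using wn_power[OF d] .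
  ultimately have "n*int c = int c*d" using wn_unique by blast
  then have "d = n" using c1 by simp
  then show ?thesis using d by simp
 qed
 \<comment> \<open>On a coordinate axis the orbit runs m times around a circle in the punctured
   line, so its winding number is a multiple of m. The two axes give m = a and m = b, hence ab
   divides n.\<close>
 have special: "int m dvd n" if m: "\<And>t. bflow a b t (p 1) = p ((1*exp (2 * of_real pi*\<i> * of_real t))^m)"
  and p: "continuous_on UNIV p" "\<And>z. z \<noteq> 0 ==> p z \<in> C" for p :: "complex => complex \<times> complex" and m :: nat
 proof -
  have c': "continuous_on (UNIV \<times> (- {0})) (%r :: complex \<times> complex. w (p (snd r)))"
  proof (rule continuous_on_compose2[OF w(1)])
   show "continuous_on (UNIV \<times> (- {0})) (%r :: complex \<times> complex. p (snd r))"
    by (rule continuous_on_compose2[OF p(1)]) (auto intro!: continuous_intros)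
   show "(%r. p (snd r)) ` (UNIV \<times> (- {0})) \<subseteq> bcomp a b"
    by (rule image_subsetI, rule p(2)[unfolded C_def]) auto
  qed
  have n': "w (p (snd r)) \<noteq> 0" if "r \<in> (UNIV :: complex set) \<times> (- {0})" for r
   by (rule w(2), rule p(2)[unfolded C_def]) (use that in auto)
  obtain i and J :: "complex \<times> complex => complex" where J: "continuous_on (UNIV \<times> (- {0})) J"
   "\<And>x z :: complex. x \<in> UNIV ==> z \<in> - {0} ==> w (p (snd (x, z))) = z powi i*exp (J (x, z))"
   by (rule punctured_product_log[OF open_UNIV convex_UNIV ne(4) oC ne(1-3) c' n']) (assumption, rule that, assumption, blast)
  define e where "e = (%t::real. (1*exp (2 * of_real pi*\<i> * of_real t :: complex))^m)"
  have we: "wn e (int m*1)" unfolding e_def by (intro wn_power wn_circle) auto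
  have e0: "e t \<noteq> 0" for t unfolding e_def by simp
  have ce: "continuous_on {0..1} e" unfolding e_def by (intro continuous_intros)
  have e01: "e 0 = e 1" unfolding e_def by simp
  have "wn (%t. exp (J (0, e t))) 0"
   by (rule wn_exp, rule continuous_on_compose2[OF J(1)]) (use ce e0 e01 in \<open>auto intro!: continuous_intros\<close>)
  then have "wn (%t. e t powi i*exp (J (0, e t))) (i*(int m*1)+0)" by (intro wn_mult wn_powi we)
  moreover have "w (bflow a b t (p 1)) = e t powi i*exp (J (0, e t))" for t
   using J(2)[of 0 "e t"] e0 m[of t] unfolding e_def by simp
  ultimately have "wn (%t. w (bflow a b t (p 1))) (i*int m)" by simp
  moreover have "wn (%t. w (bflow a b t (p 1))) n" by (rule orbit) (rule p(2), simp)
  ultimately have "n = i*int m" using wn_unique by blast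
  then show ?thesis by simp
 qed
 have "int a dvd n"
  by (rule special[of "%z. (0, z)"])
   (use ab in \<open>auto intro!: continuous_intros simp: bflow_def C_def bcomp_def bg_def power_0_left algebra_simps simp flip: exp_of_nat_mult\<close>)
 moreover have "int b dvd n"
  by (rule special[of "%z. (z, 0)"])
   (use ab in \<open>auto intro!: continuous_intros simp: bflow_def C_def bcomp_def bg_def power_0_left algebra_simps simp flip: exp_of_nat_mult\<close>)
 ultimately have "int a*int b dvd n" using ab(3) by (simp add: divides_mult)
 then obtain \<nu> where \<nu>: "n = int c*\<nu>" unfolding c_def by auto
 \<comment> \<open>The quotient takes values in the finite set of c-th roots of unity, where any
   function, in particular \<open>Ln\<close>, is continuous; it is therefore an exponential as
   well.\<close>
 define v where "v = (%q. w q/(bg a b q powi \<nu>*exp (K q / of_nat c)))"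
 have gne: "bg a b q \<noteq> 0" if "q \<in> C" for q using that unfolding C_def bcomp_def by simp
 have v1: "v q ^ c = 1" if q: "q \<in> C" for q
 proof -
  have "(bg a b q powi \<nu>*exp (K q / of_nat c)) ^ c = bg a b q powi n*exp (K q)"
  proof -
   have "exp (K q / of_nat c) ^ c = exp (K q)" using c1 by (simp flip: exp_of_nat_mult)
   moreover have "(bg a b q powi \<nu>) ^ c = bg a b q powi n"
    unfolding \<nu> by (metis mult.commute power_int_mult power_int_of_nat)
   ultimately show ?thesis by (simp add: power_mult_distrib)
  qed
  then show ?thesis unfolding v_def power_divide wK[OF q] using gne[OF q] by simp
 qed
 have cv: "continuous_on C v" unfolding v_def
  by (intro continuous_intros continuous_bg cK continuous_on_subset[OF w(1)]) (use gne c1 in \<open>auto simp: C_def\<close>)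
 have "finite {z::complex. z ^ c = 1}" using c1 by (intro finite_roots_unity)
 then have "continuous_on {z::complex. z ^ c = 1} Ln" by (rule continuous_on_finite)
 then have cl: "continuous_on C (%q. Ln (v q))"
  by (rule continuous_on_compose2[OF _ cv]) (use v1 in auto)
 show ?thesis
 proof (rule that[of "%q. Ln (v q)+K q / of_nat c" \<nu>])
  show "continuous_on (bcomp a b) (%q. Ln (v q)+K q / of_nat c)"
   unfolding C_def[symmetric] using c1 by (intro continuous_on_add cl continuous_on_divide cK continuous_on_const) auto
  fix q assume "q \<in> bcomp a b"
  then have q: "q \<in> C" unfolding C_def .
  have "v q \<noteq> 0" using v1[OF q] c1 by (metis one_neq_zero power_0_left not_one_le_zero)
  then show "w q = bg a b q powi \<nu>*exp (Ln (v q)+K q / of_nat c)"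
   using gne[OF q] unfolding exp_add by (simp add: v_def)
 qed
qed

text \<open>The closed sector of half-angle pi/(2n) around the positive real axis (for n \<ge> 2).
  On its boundary z^n is purely imaginary, and 1 is the only n-th root of unity inside.\<close>

definition sector :: "nat => complex set" where
 "sector n = {z. \<bar>Im z\<bar> \<le> tan (pi/(2*real n)) * Re z}"

lemma tan_sector_pos: "n \<ge> 2 ==> tan (pi/(2*real n)) > 0" "n \<ge> 2 ==> 0 < pi/(2*real n) \<and> pi/(2*real n) < pi/2"
proof -
 assume n: "n \<ge> 2"
 have "pi/(2*real n) \<le> pi/4" using n by (simp add: field_simps)
 then show b: "0 < pi/(2*real n) \<and> pi/(2*real n) < pi/2" using n pi_gt_zero by (auto simp: field_simps)
 then show "tan (pi/(2*real n)) > 0" by (simp add: tan_gt_zero)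
qed

lemma sector_boundary:
 assumes n: "n \<ge> 2" and z: "\<bar>Im z\<bar> = tan (pi/(2*real n)) * Re z"
 shows "Re (z^n) = 0"
proof -
 define \<alpha> where "\<alpha> = pi/(2*real n)"
 have \<alpha>: "0 < \<alpha>" "\<alpha> < pi/2" using tan_sector_pos(2)[OF n] unfolding \<alpha>_def by auto
 have c: "cos \<alpha> > 0" using \<alpha> by (intro cos_gt_zero_pi) auto
 define \<rho> where "\<rho> = Re z / cos \<alpha>"
 have re: "Re z = \<rho> * cos \<alpha>" unfolding \<rho>_def using c by simp
 have im: "\<bar>Im z\<bar> = \<rho> * sin \<alpha>" using z re c unfolding \<alpha>_def[symmetric] by (simp add: tan_def)
 define \<beta> where "\<beta> = (if Im z \<ge> 0 then \<alpha> else - \<alpha>)"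
 have "z = of_real \<rho> * cis \<beta>" using re im unfolding \<beta>_def by (auto simp: complex_eq_iff)
 then have "z^n = of_real (\<rho>^n) * cis (real n*\<beta>)" by (simp only: power_mult_distrib Complex.DeMoivre of_real_power)
 moreover have "cos (real n*\<beta>) = 0"
 proof -
  have "real n*\<alpha> = pi/2" unfolding \<alpha>_def using n by simp
  then have "real n*\<beta> = pi/2 \<or> real n*\<beta> = - (pi/2)" unfolding \<beta>_def by auto
  then show ?thesis by (elim disjE) (simp_all only: cos_minus cos_pi_half)
 qed
 ultimately show ?thesis by simp
qed

lemma root_of_unity_not_in_sector:
 assumes n: "n \<ge> 2" and e: "\<epsilon>^n = 1" "\<epsilon> \<noteq> 1" and r: "r > 0"
 shows "\<epsilon> * of_real r \<notin> sector n"
proof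
 assume "\<epsilon> * of_real r \<in> sector n"
 define \<alpha> where "\<alpha> = pi/(2*real n)"
 have \<alpha>: "0 < \<alpha>" "\<alpha> < pi/2" using tan_sector_pos(2)[OF n] unfolding \<alpha>_def by auto
 have "\<bar>Im \<epsilon>*r\<bar> \<le> tan \<alpha>*(Re \<epsilon>*r)"
  using \<open>\<epsilon> * of_real r \<in> sector n\<close> unfolding sector_def \<alpha>_def by simp
 then have "r*\<bar>Im \<epsilon>\<bar> \<le> r*(tan \<alpha> * Re \<epsilon>)" using r by (simp add: abs_mult algebra_simps)
 then have s: "\<bar>Im \<epsilon>\<bar> \<le> tan \<alpha> * Re \<epsilon>" using r by simp
 have ne: "norm \<epsilon> = 1" using e(1) n by (metis norm_power norm_one power_eq_1_iff not_numeral_le_zero norm_ge_zero)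
 define \<phi> where "\<phi> = Arg \<epsilon>"
 have ec: "\<epsilon> = cis \<phi>" unfolding \<phi>_def using ne by (metis Arg_eq cis_conv_exp mult_1 norm_zero of_real_1 zero_neq_one)
 have b: "- pi < \<phi>" "\<phi> \<le> pi" unfolding \<phi>_def by (simp_all add: mpi_less_Arg Arg_le_pi)
 have ta: "tan \<alpha> > 0" using \<alpha> tan_gt_zero by blast
 have re: "Re \<epsilon> > 0"
 proof (rule ccontr)
  assume "\<not> Re \<epsilon> > 0"
  then have "tan \<alpha> * Re \<epsilon> \<le> 0" using ta by (simp add: mult_le_0_iff)
  then have "Im \<epsilon> = 0" using s by simp
  moreover have "0 \<le> tan \<alpha> * Re \<epsilon>" using s abs_ge_zero[of "Im \<epsilon>"] by linarith
  then have "Re \<epsilon> \<ge> 0" using ta by (simp add: zero_le_mult_iff)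
  ultimately have "Im \<epsilon> = 0" "Re \<epsilon> \<ge> 0" by auto
  then have "\<epsilon> = 0" using \<open>\<not> Re \<epsilon> > 0\<close> by (auto simp: complex_eq_iff)
  then show False using ne by simp
 qed
 have cp: "cos \<phi> > 0" using re ec by simp
 have b2: "- (pi/2) < \<phi>" "\<phi> < pi/2"
 proof -
  show "\<phi> < pi/2"
  proof (rule ccontr)
   assume "\<not> \<phi> < pi/2"
   then have "cos \<phi> \<le> cos (pi/2)" using b by (intro cos_monotone_0_pi_le) auto
   then show False using cp by simp
  qed
  show "- (pi/2) < \<phi>"
  proof (rule ccontr)
   assume "\<not> - (pi/2) < \<phi>"
   then have "cos (- \<phi>) \<le> cos (pi/2)" using b by (intro cos_monotone_0_pi_le) auto
   then show False using cp by simp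
  qed
 qed
 have tt: "\<bar>tan \<phi>\<bar> \<le> tan \<alpha>"
 proof -
  have "\<bar>sin \<phi>\<bar> \<le> tan \<alpha> * cos \<phi>" using s ec by simp
  moreover have "tan \<phi> = sin \<phi> / cos \<phi>" by (simp add: tan_def)
  ultimately show ?thesis using cp by (simp add: abs_divide divide_le_eq)
 qed
 have "\<phi> \<le> \<alpha>"
 proof (rule ccontr)
  assume "\<not> \<phi> \<le> \<alpha>"
  then have "tan \<alpha> < tan \<phi>" using \<alpha> b2 by (intro tan_monotone) auto
  then show False using tt by simp
 qed
 moreover have "- \<alpha> \<le> \<phi>"
 proof (rule ccontr)
  assume "\<not> - \<alpha> \<le> \<phi>"
  then have "tan \<phi> < tan (- \<alpha>)" using \<alpha> b2 by (intro tan_monotone) auto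
  then show False using tt by simp
 qed
 ultimately have "\<bar>real n*\<phi>\<bar> \<le> real n*\<alpha>" using mult_left_mono[of "\<bar>\<phi>\<bar>" \<alpha> "real n"] by (simp add: abs_mult abs_le_iff)
 also have "\<dots> = pi/2" unfolding \<alpha>_def using n by simp
 finally have small: "\<bar>real n*\<phi>\<bar> \<le> pi/2" .
 have "cis (real n*\<phi>) = 1" using e(1) unfolding ec Complex.DeMoivre .
 then have sn: "sin (real n*\<phi>) = 0" by (metis cis.sel(2) one_complex.sel(2))
 have "real n*\<phi> = 0"
 proof (rule ccontr)
  assume "real n*\<phi> \<noteq> 0"
  then have "0 < \<bar>real n*\<phi>\<bar>" by simp
  moreover have "\<bar>real n*\<phi>\<bar> < pi" using small pi_gt_zero by linarith
  ultimately have "sin \<bar>real n*\<phi>\<bar> > 0" by (rule sin_gt_zero)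
  moreover have "sin \<bar>real n*\<phi>\<bar> = 0" using sn by (auto simp: abs_if)
  ultimately show False by simp
 qed
 then have "\<phi> = 0" using n by simp
 then show False using e(2) ec by simp
qed

text \<open>The two cases agree on the boundary of the sector. Along the ray through 1 the value is
  r^n, and on the rays through the other n-th roots of unity it is 0.\<close>

definition bump :: "nat => complex => real" where
 "bump n z = (if z \<in> sector n then Re (z^n) else 0)"

lemma closed_sector: "closed (sector n)" "closed {z. \<bar>Im z\<bar> \<ge> tan (pi/(2*real n)) * Re z}"
 unfolding sector_def by (intro closed_Collect_le continuous_intros)+

lemma continuous_bump:
 assumes "n \<ge> 2" shows "continuous_on UNIV (bump n)"
proof -
 have "continuous_on (sector n \<union> {z. \<bar>Im z\<bar> \<ge> tan (pi/(2*real n)) * Re z}) (%z. if z \<in> sector n then Re (z^n) else 0)"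
 proof (rule continuous_on_cases[OF closed_sector])
  show "\<forall>z. z \<in> sector n \<and> z \<notin> sector n \<or> z \<in> {z. \<bar>Im z\<bar> \<ge> tan (pi/(2*real n)) * Re z} \<and> z \<in> sector n --> Re (z^n) = 0"
   using sector_boundary[OF assms] unfolding sector_def by force
 qed (intro continuous_intros)+
 moreover have "sector n \<union> {z. \<bar>Im z\<bar> \<ge> tan (pi/(2*real n)) * Re z} = UNIV" unfolding sector_def by auto
 ultimately show ?thesis unfolding bump_def by simp
qed

text \<open>A circle-valued function on the Milnor fibre \<open>\<xi>^a + \<eta>^b = 1\<close>; the fibre retracts to the
 complete bipartite graph on \<open>\<mu>\<^sub>a\<close> and \<open>\<mu>\<^sub>b\<close>, and the function winds once along a single edge.\<close>

definition fibre_map :: "nat => nat => complex \<times> complex => complex" where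
 "fibre_map a b p = (if snd p \<in> sector b then exp (2 * of_real pi*\<i> * of_real (bump a (fst p))) else 1)"

lemma fibre_map_nonzero: "fibre_map a b p \<noteq> 0"
 unfolding fibre_map_def by simp

lemma continuous_fibre_map:
 assumes ab: "a \<ge> 2" "b \<ge> 2"
 shows "continuous_on {p. fst p^a + snd p^b = 1} (fibre_map a b)"
proof -
 define F where "F = {p :: complex \<times> complex. fst p^a + snd p^b = 1}"
 have cF: "closed F" unfolding F_def by (intro closed_Collect_eq continuous_intros)
 define S where "S = F \<inter> snd -` sector b"
 define T where "T = F \<inter> snd -` {z. \<bar>Im z\<bar> \<ge> tan (pi/(2*real b)) * Re z}"
 have cS: "closed S" "closed T" unfolding S_def T_def
  by (intro closed_Int cF closed_vimage closed_sector continuous_intros)+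
 have "continuous_on (S \<union> T) (%p. if snd p \<in> sector b then exp (2 * of_real pi*\<i> * of_real (bump a (fst p))) else 1)"
 proof (rule continuous_on_cases[OF cS])
  have "continuous_on S (%p. bump a (fst p))"
   by (rule continuous_on_compose2[OF continuous_bump[OF ab(1)]]) (auto intro!: continuous_intros)
  then show "continuous_on S (%p. exp (2 * of_real pi*\<i> * of_real (bump a (fst p))))"
   by (intro continuous_intros)
  \<comment> \<open>On the boundary of the sector for the second coordinate Re (snd p^b) = 0, so the
    fibre equation gives Re (fst p^a) = 1; the bump is then 0 or 1 and its exponential is 1.\<close>
  show "\<forall>p. p \<in> S \<and> snd p \<notin> sector b \<or> p \<in> T \<and> snd p \<in> sector b --> exp (2 * of_real pi*\<i> * of_real (bump a (fst p))) = 1"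
  proof (intro allI impI)
   fix p assume p: "p \<in> S \<and> snd p \<notin> sector b \<or> p \<in> T \<and> snd p \<in> sector b"
   then have "\<bar>Im (snd p)\<bar> = tan (pi/(2*real b)) * Re (snd p)" and pF: "p \<in> F"
    unfolding S_def T_def sector_def by auto
   then have "Re (snd p^b) = 0" using sector_boundary[OF ab(2)] by blast
   moreover have "Re (fst p^a) + Re (snd p^b) = Re (fst p^a + snd p^b)" by simp
   moreover have "fst p^a + snd p^b = 1" using pF unfolding F_def by simp
   ultimately have "Re (fst p^a) = 1" by (simp only: one_complex.sel add_0_right)
   then have "bump a (fst p) = 1 \<or> bump a (fst p) = 0" unfolding bump_def by auto
   then show "exp (2 * of_real pi*\<i> * of_real (bump a (fst p))) = 1" by auto
  qed
 qed (intro continuous_intros)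
 moreover have "S \<union> T = F" unfolding S_def T_def sector_def by auto
 ultimately show ?thesis unfolding fibre_map_def F_def by simp
qed

text \<open>As t runs over [0,1] these points trace the edge of the bipartite graph from (0,
  \<open>\<delta>\<close>) to (\<open>\<epsilon>\<close>, 0). Only the edge with both ends equal to
  1 meets the two sectors along its interior.\<close>

lemma fibre_map_edge:
 assumes ab: "a \<ge> 2" "b \<ge> 2" and e: "\<epsilon>^a = 1" "\<delta>^b = 1" and t: "t \<in> {0..1}"
 shows "fibre_map a b (\<epsilon> * of_real (root a t), \<delta> * of_real (root b (1 - t))) =
   (if \<epsilon> = 1 \<and> \<delta> = 1 then exp (2 * of_real pi*\<i> * of_real t) else 1)"
proof -
 have ra: "root a t^a = t" "root b (1 - t)^b = 1 - t" using t ab by (auto simp: real_root_pow_pos2)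
 have pos: "of_real x \<in> sector n" if "x \<ge> 0" "n \<ge> 2" for x n
  using that tan_sector_pos(1)[of n] unfolding sector_def by simp
 have b1: "bump a (\<epsilon> * of_real (root a t)) = (if \<epsilon> = 1 then t else if t = 0 then 0 else 0)"
  if "t < 1 \<or> \<epsilon> = 1 \<or> True"
 proof (cases "\<epsilon> = 1")
  case True
  have "Re (of_real (root a t)^a) = t" using ra(1) by (metis Re_complex_of_real of_real_power)
  then show ?thesis using True pos[of "root a t" a] t ab unfolding bump_def by simp
 next
  case False
  show ?thesis
  proof (cases "t = 0")
   case True
   then show ?thesis using ab unfolding bump_def by simp
  next
   case F: False
   then have "root a t > 0" using t ab by (simp add: real_root_gt_zero)
   then have "\<epsilon> * of_real (root a t) \<notin> sector a" using root_of_unity_not_in_sector[OF ab(1) e(1) False] by blast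
   then show ?thesis using False unfolding bump_def by simp
  qed
 qed
 show ?thesis
 proof (cases "\<delta> = 1")
  case True
  have "\<delta> * of_real (root b (1 - t)) \<in> sector b" using True pos[of "root b (1 - t)" b] t ab by simp
  then show ?thesis using b1 True unfolding fibre_map_def by simp
 next
  case False
  show ?thesis
  proof (cases "t = 1")
   case True
   have "bump a \<epsilon> = 1 \<or> bump a \<epsilon> = 0" unfolding bump_def using e(1) by auto
   then show ?thesis using False True ab unfolding fibre_map_def by auto
  next
   case F: False
   then have "root b (1 - t) > 0" using t ab by (simp add: real_root_gt_zero)
   then have "\<delta> * of_real (root b (1 - t)) \<notin> sector b" using root_of_unity_not_in_sector[OF ab(2) e(2) False] by blast
   then show ?thesis using False unfolding fibre_map_def by simp
  qed
 qed
qed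

text \<open>A weighted radial contraction by the real factors l^b and l^a multiplies the defining
  function by l^(ab) and so preserves the complement of its zero set. It turns functions given only
  near the origin into functions on the whole complement, unchanged near the origin.\<close>

lemma bcomp_shrink:
 assumes "\<rho> > 0" "a \<ge> 1" "b \<ge> 1"
 obtains c where "continuous_on UNIV c" "\<And>q. norm (c q) \<le> 2*\<rho>"
  "\<And>q. norm (fst q)+norm (snd q) \<le> \<rho> ==> c q = q"
  "\<And>q. q \<in> bcomp a b ==> c q \<in> bcomp a b"
proof -
 define l where "l = (%q::complex \<times> complex. \<rho>/max \<rho> (norm (fst q)+norm (snd q)))"
 define c where "c = (%q::complex \<times> complex. (of_real (l q^b)*fst q, of_real (l q^a) * snd q))"
 have m: "max \<rho> (norm (fst q)+norm (snd q)) > 0" for q :: "complex \<times> complex" using assms by auto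
 have l: "0 < l q" "l q \<le> 1" for q unfolding l_def using m[of q] assms by (auto simp: field_simps)
 have cl: "continuous_on UNIV l" unfolding l_def
  by (intro continuous_intros) (use m in \<open>metis less_irrefl\<close>)
 have cc: "continuous_on UNIV c" unfolding c_def by (intro continuous_intros cl)
 have bnd: "norm (c q) \<le> 2*\<rho>" for q
 proof -
  have p: "l q^n \<le> l q" if "n \<ge> 1" for n using power_decreasing[of 1 n "l q"] l[of q] that by auto
  have x: "l q*norm (fst q) \<le> \<rho>" "l q*norm (snd q) \<le> \<rho>"
  proof -
   define M where "M = max \<rho> (norm (fst q)+norm (snd q))"
   have M: "M > 0" "norm (fst q) \<le> M" "norm (snd q) \<le> M" unfolding M_def using m[of q] by (auto intro: max.coboundedI2)
   have "\<rho>/M*y \<le> \<rho>" if "y \<le> M" for y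
    using that M(1) assms(1) by (simp add: field_simps mult_left_mono)
   then show "l q*norm (fst q) \<le> \<rho>" "l q*norm (snd q) \<le> \<rho>" unfolding l_def M_def[symmetric] using M by auto
  qed
  have "norm (c q) \<le> l q^b*norm (fst q)+l q^a*norm (snd q)"
   unfolding c_def using norm_Pair_le[of "of_real (l q^b)*fst q" "of_real (l q^a) * snd q"] l[of q]
   by (simp add: norm_mult norm_power)
  also have "\<dots> \<le> l q*norm (fst q)+l q*norm (snd q)"
   using p assms by (intro add_mono mult_right_mono) auto
  finally show ?thesis using x by simp
 qed
 have id: "c q = q" if "norm (fst q)+norm (snd q) \<le> \<rho>" for q
 proof -
  have "l q = 1" unfolding l_def using that assms by (simp add: max_def)
  then show ?thesis unfolding c_def by simp
 qed
 have "bg a b (c q) = of_real (l q^(a*b))*bg a b q" for q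
  unfolding bg_def c_def by (simp add: power_mult_distrib algebra_simps flip: power_mult)
 then have "c q \<in> bcomp a b" if "q \<in> bcomp a b" for q
  using that l(1)[of q] unfolding bcomp_def by simp
 then show ?thesis using that cc bnd id by blast
qed

text \<open>On the infinite cyclic cover \<open>e^s = g\<close> of the complement of the first germ, the circle action
 makes the \<open>ab\<close>-th power of the deck transformation homotopic to the identity, so it acts
 trivially on circle-valued functions; on the cover of the second germ it does not.\<close>

theorem brieskorn_germs_not_equiv:
 assumes ab: "a \<ge> 1" "b \<ge> 1" "coprime a b"
  and cd: "c \<ge> 2" "d \<ge> 3" "coprime c d" and nd: "\<not> d dvd a*b"
  and eq: "top_equiv_germ {q. bg a b q = 0} {q. bg c d q = 0}"
 shows False
proof -
 define g where "g = bg a b"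
 define g' where "g' = bg c d"
 define C where "C = bcomp a b"
 define C' where "C' = bcomp c d"
 have Cg: "q \<in> C \<longleftrightarrow> g q \<noteq> 0" "q \<in> C' \<longleftrightarrow> g' q \<noteq> 0" for q
  unfolding C_def C'_def bcomp_def g_def g'_def by auto
 obtain U U' \<phi> \<psi> where hh: "open U" "open U'" "(0, 0) \<in> U" "homeomorphism U U' \<phi> \<psi>"
   "\<phi> (0, 0) = (0, 0)" "\<phi> ` ({q. bg a b q = 0} \<inter> U) = {q. bg c d q = 0} \<inter> U'"
  using eq unfolding top_equiv_germ_def by blast
 have h0: "0 \<in> U" "\<phi> 0 = 0" using hh(3,5) by (simp_all add: zero_prod_def)
 have \<psi>\<phi>: "\<psi> (\<phi> z) = z" if "z \<in> U" for z using homeomorphism_apply1[OF hh(4) that] .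
 have \<phi>\<psi>: "\<phi> (\<psi> z) = z" if "z \<in> U'" for z using homeomorphism_apply2[OF hh(4) that] .
 have \<psi>U: "\<psi> z \<in> U" if "z \<in> U'" for z using that homeomorphism_image2[OF hh(4)] by blast
 have \<phi>U: "\<phi> z \<in> U'" if "z \<in> U" for z using that homeomorphism_image1[OF hh(4)] by blast
 have U'0: "0 \<in> U'" using \<phi>U[OF h0(1)] h0(2) by simp
 have \<psi>0: "\<psi> 0 = 0" using \<psi>\<phi>[OF h0(1)] h0 by simp
 have c\<phi>: "continuous_on U \<phi>" and c\<psi>: "continuous_on U' \<psi>"
  using hh(4) by (simp_all add: homeomorphism_def)
 have V: "g' (\<phi> q) = 0 \<longleftrightarrow> g q = 0" if qU: "q \<in> U" for q
 proof
  assume "g' (\<phi> q) = 0"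
  then have "\<phi> q \<in> \<phi> ` ({q. bg a b q = 0} \<inter> U)" using hh(6) \<phi>U[OF qU] unfolding g'_def by auto
  then obtain v where "g v = 0" "v \<in> U" "\<phi> q = \<phi> v" unfolding g_def by auto
  then show "g q = 0" using \<psi>\<phi> qU by metis
 next
  assume "g q = 0"
  then have "\<phi> q \<in> \<phi> ` ({q. bg a b q = 0} \<inter> U)" using qU unfolding g_def by auto
  then show "g' (\<phi> q) = 0" using hh(6) unfolding g'_def by auto
 qed
 have V': "g (\<psi> q) = 0 \<longleftrightarrow> g' q = 0" if "q \<in> U'" for q
  using V[OF \<psi>U[OF that]] \<phi>\<psi>[OF that] by simp
 obtain e where e: "e > 0" "ball 0 e \<subseteq> U" using hh(1) h0(1) open_contains_ball by blast
 obtain e' where e': "e' > 0" "ball 0 e' \<subseteq> U'" using hh(2) U'0 open_contains_ball by blast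
 define \<rho> where "\<rho> = e/3"
 define \<rho>' where "\<rho>' = e'/3"
 have \<rho>: "\<rho> > 0" "\<rho>' > 0" unfolding \<rho>_def \<rho>'_def using e e' by auto
 have c1: "c \<ge> 1" "d \<ge> 1" using cd by auto
 obtain k where k: "continuous_on UNIV k" "\<And>q. norm (k q) \<le> 2*\<rho>"
  "\<And>q. norm (fst q)+norm (snd q) \<le> \<rho> ==> k q = q" "\<And>q. q \<in> bcomp a b ==> k q \<in> bcomp a b"
  using bcomp_shrink[OF \<rho>(1) ab(1,2)] by blast
 obtain k' where k': "continuous_on UNIV k'" "\<And>q. norm (k' q) \<le> 2*\<rho>'"
  "\<And>q. norm (fst q)+norm (snd q) \<le> \<rho>' ==> k' q = q" "\<And>q. q \<in> bcomp c d ==> k' q \<in> bcomp c d"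
  using bcomp_shrink[OF \<rho>(2) c1] by blast
 have kU: "k q \<in> U" for q by (rule subsetD[OF e(2)]) (use k(2)[of q] e(1) in \<open>simp add: \<rho>_def\<close>)
 have kU': "k' q \<in> U'" for q by (rule subsetD[OF e'(2)]) (use k'(2)[of q] e'(1) in \<open>simp add: \<rho>'_def\<close>)
 have c\<phi>k: "continuous_on A (%q. \<phi> (k q))" for A
  by (rule continuous_on_compose2[OF c\<phi> continuous_on_subset[OF k(1)]]) (use kU in blast)+
 have c\<psi>k: "continuous_on A (%q. \<psi> (k' q))" for A
  by (rule continuous_on_compose2[OF c\<psi> continuous_on_subset[OF k'(1)]]) (use kU' in blast)+
 have cw: "continuous_on (bcomp a b) (%q. g' (\<phi> (k q)))" unfolding g'_def
  by (rule continuous_on_compose2[OF continuous_bg[of UNIV] c\<phi>k]) auto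
 have nw: "g' (\<phi> (k q)) \<noteq> 0" if "q \<in> bcomp a b" for q
  using V[OF kU] k(4)[OF that] unfolding g_def bcomp_def by simp
 have cw': "continuous_on (bcomp c d) (%q. g (\<psi> (k' q)))" unfolding g_def
  by (rule continuous_on_compose2[OF continuous_bg[of UNIV] c\<psi>k]) auto
 have nw': "g (\<psi> (k' q)) \<noteq> 0" if "q \<in> bcomp c d" for q
  using V'[OF kU'] k'(4)[OF that] unfolding g'_def bcomp_def by simp
 obtain \<nu> L where L: "continuous_on C L" "\<And>q. q \<in> C ==> g' (\<phi> (k q)) = g q powi \<nu>*exp (L q)"
  using bcomp_log[OF ab cw nw] unfolding C_def g_def by blast
 obtain \<nu>' L' where L': "continuous_on C' L'" "\<And>q. q \<in> C' ==> g (\<psi> (k' q)) = g' q powi \<nu>'*exp (L' q)"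
  using bcomp_log[OF c1 cd(3) cw' nw'] unfolding C'_def g'_def by blast
 \<comment> \<open>On this neighbourhood both contractions act trivially, so \<open>\<phi>\<close>
   and \<open>\<psi>\<close> are recovered from their globalised versions.\<close>
 define N where "N = {q. norm (fst q)+norm (snd q) < \<rho>} \<inter> (U \<inter> \<phi> -` {q. norm (fst q)+norm (snd q) < \<rho>'})"
 have oN: "open N" unfolding N_def
  by (intro open_Int continuous_open_preimage[OF c\<phi> hh(1)] open_Collect_less continuous_intros)
 have N0: "0 \<in> N" unfolding N_def using \<rho> h0 by simp
 have Nk: "k q = q" "k' (\<phi> q) = \<phi> q" "q \<in> U" if "q \<in> N" for q
  using that k(3)[of q] k'(3)[of "\<phi> q"] unfolding N_def by auto
 \<comment> \<open>The defining functions correspond up to powers \<open>\<nu>\<close> and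
   \<open>\<nu>'\<close> and exponentials. Following a small loop around the first germ to the
   second and back shows that these powers are inverse integers.\<close>
 have \<nu>1: "\<nu>'*\<nu> = 1"
 proof -
  obtain r where r: "r > 0" "ball 0 r \<subseteq> N" using oN N0 open_contains_ball by blast
  define z where "z = (%t::real. of_real (r/2)*exp (2 * of_real pi*\<i> * of_real t))"
  define \<gamma> where "\<gamma> = (%t. (z t, 0::complex))"
  have wz: "wn z 1" unfolding z_def by (rule wn_circle) (use r in auto)
  have nz: "norm (z t) = r/2" for t unfolding z_def norm_mult using r by (simp add: norm_exp_eq_Re)
  have z0: "z t \<noteq> 0" for t using nz[of t] r by auto
  have cz: "continuous_on {0..1} \<gamma>" unfolding \<gamma>_def z_def by (intro continuous_intros)
  have z01: "\<gamma> 0 = \<gamma> 1" unfolding \<gamma>_def z_def by simp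
  have zN: "\<gamma> t \<in> N" for t by (rule subsetD[OF r(2)]) (use nz[of t] r in \<open>simp add: \<gamma>_def norm_Pair\<close>)
  have gz: "g (\<gamma> t) = z t^a" for t unfolding g_def bg_def \<gamma>_def using ab by (simp add: power_0_left)
  have zC: "\<gamma> t \<in> C" for t unfolding Cg gz using z0 by simp
  have \<phi>C: "\<phi> (\<gamma> t) \<in> C'" for t unfolding Cg using V[OF Nk(3)[OF zN]] zC Cg(1) by blast
  have wg: "wn (%t. g (\<gamma> t)) (int a*1)" unfolding gz by (rule wn_power[OF wz])
  have "wn (%t. exp (L (\<gamma> t))) 0"
   by (rule wn_exp, rule continuous_on_compose2[OF L(1) cz]) (use zC z01 in auto)
  then have "wn (%t. g (\<gamma> t) powi \<nu>*exp (L (\<gamma> t))) (\<nu>*(int a*1)+0)" by (intro wn_mult wn_powi wg)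
  then have w1: "wn (%t. g' (\<phi> (\<gamma> t))) (\<nu>*(int a*1)+0)" using L(2)[OF zC] Nk(1)[OF zN] by simp
  have c\<phi>z: "continuous_on {0..1} (%t. \<phi> (\<gamma> t))"
   by (rule continuous_on_compose2[OF c\<phi> cz]) (use Nk(3)[OF zN] in blast)
  have "wn (%t. exp (L' (\<phi> (\<gamma> t)))) 0"
   by (rule wn_exp, rule continuous_on_compose2[OF L'(1) c\<phi>z]) (use \<phi>C z01 in auto)
  then have "wn (%t. g' (\<phi> (\<gamma> t)) powi \<nu>'*exp (L' (\<phi> (\<gamma> t)))) (\<nu>'*(\<nu>*(int a*1)+0)+0)"
   by (intro wn_mult wn_powi w1)
  moreover have "g' (\<phi> (\<gamma> t)) powi \<nu>'*exp (L' (\<phi> (\<gamma> t))) = g (\<gamma> t)" for t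
   using L'(2)[OF \<phi>C] Nk[OF zN] \<psi>\<phi>[OF Nk(3)[OF zN]] by simp
  ultimately have "wn (%t. g (\<gamma> t)) (\<nu>'*(\<nu>*int a))" by simp
  then have "\<nu>'*(\<nu>*int a) = int a" using wg wn_unique by fastforce
  then have "(\<nu>'*\<nu>)*int a = 1*int a" by simp
  then show ?thesis using ab(1) by simp
 qed
 have \<nu>2: "\<nu> = 1 \<or> \<nu> = - 1" using \<nu>1 by (metis zmult_eq_1_iff)
 then have \<nu>\<nu>: "\<nu>*\<nu> = 1" by auto
 \<comment> \<open>A point q of the second complement with logarithm s of its defining function is
   moved to the fibre with value 1 by the factors exp (-s/c) and exp (-s/d);
   \<open>fibre_map\<close> then gives a circle-valued function on the cyclic cover.\<close>
 define u where "u = (%p :: (complex \<times> complex) \<times> complex. fibre_map c d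
   (fst (fst p)*exp (- snd p / of_nat c), snd (fst p)*exp (- snd p / of_nat d)))"
 define X' where "X' = {p. exp (snd p) = g' (fst p)}"
 have cu: "continuous_on X' u"
  unfolding u_def
 proof (rule continuous_on_compose2[OF continuous_fibre_map])
  show "2 \<le> c" "2 \<le> d" using cd by auto
  show "continuous_on X' (%p. (fst (fst p)*exp (- snd p / of_nat c), snd (fst p)*exp (- snd p / of_nat d)))"
   using cd by (intro continuous_intros) auto
  show "(%p. (fst (fst p)*exp (- snd p / of_nat c), snd (fst p)*exp (- snd p / of_nat d))) ` X'
    \<subseteq> {p. fst p ^ c + snd p^d = 1}"
  proof (rule image_subsetI)
   fix p :: "(complex \<times> complex) \<times> complex" assume p: "p \<in> X'"
   have 1: "exp (- snd p / of_nat n)^n = exp (- snd p)" if "n \<ge> 1" for n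
    using that by (simp flip: exp_of_nat_mult)
   have "fst (fst p) ^ c*exp (- snd p) + snd (fst p)^d*exp (- snd p) = g' (fst p)*exp (- snd p)"
    unfolding g'_def bg_def by (simp add: algebra_simps)
   also have "\<dots> = exp (snd p)*exp (- snd p)" using p unfolding X'_def by simp
   also have "\<dots> = 1" by (simp flip: exp_add)
   finally show "(fst (fst p)*exp (- snd p / of_nat c), snd (fst p)*exp (- snd p / of_nat d)) \<in> {p. fst p ^ c + snd p^d = 1}"
    using 1[OF c1(1)] 1[OF c1(2)] by (simp add: power_mult_distrib)
  qed
 qed
 define X where "X = {p. exp (snd p) = g (fst p)}"
 have XC: "fst p \<in> C" if "p \<in> X" for p using that unfolding X_def Cg by (metis (mono_tags, lifting) exp_not_eq_zero mem_Collect_eq)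
 \<comment> \<open>The pullback of \<open>u\<close> along the lift of \<open>\<phi>\<close> to the
   cyclic covers; \<open>L\<close> supplies the lift of the logarithm.\<close>
 define T where "T = (%p :: (complex \<times> complex) \<times> complex. u (\<phi> (k (fst p)), of_int \<nu> * snd p+L (fst p)))"
 have TX: "(\<phi> (k (fst p)), of_int \<nu> * snd p+L (fst p)) \<in> X'" if p: "p \<in> X" for p
  using L(2)[OF XC[OF p]] p unfolding X'_def X_def by (simp add: exp_add exp_of_int_mult)
 have cT: "continuous_on X T" unfolding T_def
 proof (rule continuous_on_compose2[OF cu])
  have "continuous_on X (%p. L (fst p))"
   by (rule continuous_on_compose2[OF L(1)]) (use XC in \<open>auto intro!: continuous_intros\<close>)
  moreover have "continuous_on X (%p. \<phi> (k (fst p)))"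
   by (rule continuous_on_compose2[OF c\<phi>k[of UNIV]]) (auto intro!: continuous_intros)
  ultimately show "continuous_on X (%p. (\<phi> (k (fst p)), of_int \<nu> * snd p+L (fst p)))"
   by (intro continuous_intros)
  show "(%p. (\<phi> (k (fst p)), of_int \<nu> * snd p+L (fst p))) ` X \<subseteq> X'" using TX by blast
 qed
 have nT: "T p \<noteq> 0" for p unfolding T_def u_def by (rule fibre_map_nonzero)
 \<comment> \<open>The circle action lifted to the cover: at time 1 it returns to the same base
   point but shifts the logarithm by 2 pi i ab.\<close>
 define fl where "fl = (%t::real. %p :: (complex \<times> complex) \<times> complex. (bflow a b t (fst p), snd p+2 * of_real pi*\<i> * of_real (real a*real b*t)))"
 have flX: "fl t p \<in> X" if "p \<in> X" for t p
  using that unfolding fl_def X_def g_def by (simp add: bg_flow exp_add mult.commute)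
 define H where "H = (%r :: real \<times> (complex \<times> complex) \<times> complex. T (fl (fst r) (snd r))/T (snd r))"
 have cfl: "continuous_on ({0..1} \<times> X) (%r. fl (fst r) (snd r))" unfolding fl_def
  by (intro continuous_intros continuous_bflow)
 have cH: "continuous_on ({0..1} \<times> X) H" unfolding H_def
 proof (rule continuous_on_divide)
  show "continuous_on ({0..1} \<times> X) (%r. T (fl (fst r) (snd r)))"
   by (rule continuous_on_compose2[OF cT cfl], rule image_subsetI, rule flX) auto
  show "continuous_on ({0..1::real} \<times> X) (%r. T (snd r))"
   by (rule continuous_on_compose2[OF cT]) (auto intro!: continuous_intros)
 qed (use nT in auto)
 obtain M where M: "continuous_on X M" "\<And>p. p \<in> X ==> H (1, p) = exp (M p)"
 proof (rule homotopy_log[OF cH])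
  show "H z \<noteq> 0" for z unfolding H_def using nT by simp
  show "H (0, p) = 1" for p unfolding H_def fl_def using nT by (simp add: bflow_0)
 qed blast
 \<comment> \<open>The shift by 2 pi i ab on the first cover becomes a shift by 2 pi i D on the
   second.\<close>
 define D where "D = \<nu>*int (a*b)"
 define N' where "N' = \<phi> ` N"
 have oN': "open N'" unfolding N'_def by (rule open_image_homeomorphism[OF hh(4,2) oN]) (use Nk in blast)
 have N'0: "0 \<in> N'" unfolding N'_def using N0 h0 by (metis image_eqI)
 \<comment> \<open>Inverse of the lifted map over \<open>N'\<close>; multiplying by
   \<open>\<nu>\<close> inverts multiplication by \<open>\<nu>\<close> because its square is
   1.\<close>
 define m where "m = (%p :: (complex \<times> complex) \<times> complex. (\<psi> (fst p), of_int \<nu>*(snd p - L (\<psi> (fst p)))))"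
 define Y where "Y = {p. p \<in> X' \<and> fst p \<in> N'}"
 have YN: "\<psi> (fst p) \<in> N" "\<phi> (\<psi> (fst p)) = fst p" "fst p \<in> U'" if p: "p \<in> Y" for p
 proof -
  obtain q where q: "q \<in> N" "fst p = \<phi> q" using p unfolding Y_def N'_def by blast
  then show "\<psi> (fst p) \<in> N" "\<phi> (\<psi> (fst p)) = fst p" "fst p \<in> U'" using \<psi>\<phi>[OF Nk(3)] \<phi>U[OF Nk(3)] by auto
 qed
 have YC: "\<psi> (fst p) \<in> C" if p: "p \<in> Y" for p
 proof -
  have "exp (snd p) = g' (fst p)" using p unfolding Y_def X'_def by simp
  then have "g' (fst p) \<noteq> 0" by (metis exp_not_eq_zero)
  then show ?thesis unfolding Cg using V'[OF YN(3)[OF p]] by simp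
 qed
 have mX: "m p \<in> X" and Tm: "of_int \<nu> * snd (m p)+L (fst (m p)) = snd p" "\<phi> (k (fst (m p))) = fst p" if p: "p \<in> Y" for p
 proof -
  define q where "q = \<psi> (fst p)"
  have 1: "exp (snd p) = g q powi \<nu>*exp (L q)"
   using p L(2)[OF YC[OF p]] Nk(1)[OF YN(1)[OF p]] YN(2)[OF p] unfolding Y_def X'_def q_def by simp
  have gq: "g q \<noteq> 0" using YC[OF p] Cg unfolding q_def by simp
  have "exp (of_int \<nu>*(snd p - L q)) = (exp (snd p)*exp (- L q)) powi \<nu>"
   unfolding exp_of_int_mult by (simp add: exp_diff exp_minus divide_inverse)
  also have "exp (snd p)*exp (- L q) = g q powi \<nu>" unfolding 1 by (simp add: exp_minus)
  also have "(g q powi \<nu>) powi \<nu> = g q" using \<nu>\<nu> by (metis power_int_1_right power_int_mult)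
  finally show "m p \<in> X" unfolding X_def m_def q_def by simp
  have "of_int \<nu> * of_int \<nu> = (1 :: complex)" using \<nu>\<nu> by (metis of_int_1 of_int_mult)
  then show "of_int \<nu> * snd (m p)+L (fst (m p)) = snd p"
   unfolding m_def q_def by (simp flip: mult.assoc)
  show "\<phi> (k (fst (m p))) = fst p" unfolding m_def using Nk(1)[OF YN(1)[OF p]] YN(2)[OF p] by simp
 qed
 have key: "u (fst p, snd p+2 * of_real pi*\<i> * of_int D)/u p = exp (M (m p))" if p: "p \<in> Y" for p
 proof -
  have "exp (M (m p)) = T (fl 1 (m p))/T (m p)" using M(2)[OF mX[OF p]] unfolding H_def by simp
  moreover have "T (m p) = u p" unfolding T_def using Tm[OF p] by simp
  moreover have "T (fl 1 (m p)) = u (fst p, snd p+2 * of_real pi*\<i> * of_int D)"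
  proof -
   have f: "fst (fl 1 (m p)) = fst (m p)" unfolding fl_def by (simp add: bflow_1)
   have "of_int \<nu> * snd (fl 1 (m p))+L (fst (m p)) = (of_int \<nu> * snd (m p)+L (fst (m p)))+2 * of_real pi*\<i> * of_int D"
    unfolding fl_def D_def by (simp add: algebra_simps)
   then show ?thesis unfolding T_def f using Tm[OF p] by simp
  qed
  ultimately show ?thesis by simp
 qed
 have cL\<psi>: "continuous_on Y (%p. L (\<psi> (fst p)))"
  by (intro continuous_on_compose2[OF L(1)] continuous_on_compose2[OF c\<psi>] continuous_intros)
   (use YN(3) YC in blast)+
 have cm: "continuous_on Y m" unfolding m_def
  by (intro continuous_intros cL\<psi> continuous_on_compose2[OF c\<psi>]) (use YN(3) in blast)
 have cMm: "continuous_on Y (%p. M (m p))"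
  by (rule continuous_on_compose2[OF M(1) cm]) (use mX in blast)
 obtain r where r: "r > 0" "ball 0 r \<subseteq> N'" using oN' N'0 open_contains_ball by blast
 \<comment> \<open>Over s = -K the fibre has equation x^c + y^d = exp (-K); for large K its
   bipartite graph lies in the small neighbourhood where the inverse lift is available.\<close>
 obtain K :: real where K: "exp (- K/real c)+exp (- K/real d) < r"
 proof -
  have "((%x. exp (- x/real c)+exp (- x/real d)) \<longlongrightarrow> 0+0) at_top"
  proof (rule tendsto_add)
   have "((%x. exp (- x/real n)) \<longlongrightarrow> 0) at_top" if "n \<ge> 1" for n
    using that by real_asymp
   then show "((%x. exp (- x/real c)) \<longlongrightarrow> 0) at_top" "((%x. exp (- x/real d)) \<longlongrightarrow> 0) at_top" using c1 by auto
  qed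
  then have "eventually (%x. exp (- x/real c)+exp (- x/real d) < r) at_top"
   using r(1) by (intro order_tendstoD(2)) auto
  then show ?thesis using that eventually_happens'[OF trivial_limit_at_top_linorder] by blast
 qed
 define E where "E = (%(\<epsilon>::complex) (\<delta>::complex) (t::real). ((exp (- of_real K / of_nat c)*(\<epsilon> * of_real (root c t)),
   exp (- of_real K / of_nat d)*(\<delta> * of_real (root d (1 - t)))), - of_real K :: complex))"
 have EY: "E \<epsilon> \<delta> t \<in> Y" if ed: "\<epsilon> ^ c = 1" "\<delta>^d = 1" and t: "t \<in> {0..1}" for \<epsilon> \<delta> t
 proof -
  have ra: "root c t ^ c = t" "root d (1 - t)^d = 1 - t" using t c1 by (auto simp: real_root_pow_pos2)
  have ee: "exp (- of_real K / of_nat n)^n = exp (- of_real K :: complex)" if "n \<ge> 1" for n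
   using that by (simp flip: exp_of_nat_mult)
  have "g' (fst (E \<epsilon> \<delta> t)) = exp (- of_real K) * of_real (root c t ^ c)+exp (- of_real K) * of_real (root d (1 - t)^d)"
   unfolding g'_def bg_def E_def using ed ee[OF c1(1)] ee[OF c1(2)] by (simp add: power_mult_distrib)
  also have "\<dots> = exp (- of_real K)" unfolding ra by (simp add: algebra_simps)
  finally have "E \<epsilon> \<delta> t \<in> X'" unfolding X'_def E_def by simp
  moreover have "fst (E \<epsilon> \<delta> t) \<in> N'"
  proof (rule subsetD[OF r(2)])
   have n1: "norm \<epsilon> = 1" "norm \<delta> = 1" using ed c1
    by (metis norm_power norm_one power_eq_1_iff not_one_le_zero norm_ge_zero)+
   have rb: "\<bar>root c t\<bar> \<le> 1" "\<bar>root d (1 - t)\<bar> \<le> 1" using t c1 by (auto simp: real_root_ge_zero)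
   have "norm (fst (E \<epsilon> \<delta> t)) \<le> exp (- K/real c)*\<bar>root c t\<bar>+exp (- K/real d)*\<bar>root d (1 - t)\<bar>"
    unfolding E_def using norm_Pair_le[of "exp (- of_real K / of_nat c)*(\<epsilon> * of_real (root c t))"
      "exp (- of_real K / of_nat d)*(\<delta> * of_real (root d (1 - t)))"] n1
    by (simp add: norm_mult norm_exp_eq_Re)
   also have "\<dots> \<le> exp (- K/real c)*1+exp (- K/real d)*1"
    by (intro add_mono mult_left_mono rb) auto
   finally show "fst (E \<epsilon> \<delta> t) \<in> ball 0 r" using K by simp
  qed
  ultimately show ?thesis unfolding Y_def by simp
 qed
 \<comment> \<open>The D-fold deck shift changes the normalising factors by these roots of unity. It
   is nontrivial on the second coordinate because d does not divide ab.\<close>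
 define \<zeta> where "\<zeta> = (%n::nat. exp (- (2 * of_real pi*\<i> * of_int D) / of_nat n) :: complex)"
 have \<zeta>1: "\<zeta> n^n = 1" if "n \<ge> 1" for n
 proof -
  have "\<zeta> n^n = exp (of_int (- D)*(2 * of_real pi*\<i>))"
   unfolding \<zeta>_def using that by (simp add: algebra_simps flip: exp_of_nat_mult)
  then show ?thesis unfolding exp_of_int_mult by simp
 qed
 have uE: "u (E \<epsilon> \<delta> t) = fibre_map c d (\<epsilon> * of_real (root c t), \<delta> * of_real (root d (1 - t)))" for \<epsilon> \<delta> t
 proof -
  have "exp (- of_real K / of_nat n)*exp (of_real K / of_nat n) = (1::complex)" for n
   by (simp flip: exp_add)
  then have q: "exp (- of_real K / of_nat n)*z*exp (of_real K / of_nat n) = z" for n and z :: complex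
   by (metis mult.commute mult.left_commute mult_1)
  show ?thesis by (simp only: u_def E_def fst_conv snd_conv minus_minus q)
 qed
 have uE': "u (fst (E \<epsilon> \<delta> t), snd (E \<epsilon> \<delta> t)+2 * of_real pi*\<i> * of_int D) =
   fibre_map c d (\<epsilon>*\<zeta> c * of_real (root c t), \<delta>*\<zeta> d * of_real (root d (1 - t)))" for \<epsilon> \<delta> t
 proof -
  have 1: "exp (- (- of_real K+2 * of_real pi*\<i> * of_int D) / of_nat n) = exp (of_real K / of_nat n)*\<zeta> n" for n
   unfolding \<zeta>_def exp_add[symmetric] by (simp add: diff_divide_distrib add_divide_distrib)
  have "exp (- of_real K / of_nat n)*exp (of_real K / of_nat n) = (1::complex)" for n
   by (simp flip: exp_add)
  then have "exp (- of_real K / of_nat n)*z*(exp (of_real K / of_nat n)*y) = z*y" for n and z y :: complex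
   by (metis mult.assoc mult.commute mult_1)
  then have q: "exp (- of_real K / of_nat n)*(\<epsilon>*z)*(exp (of_real K / of_nat n)*y) = \<epsilon>*y*z" for n and \<epsilon> z y :: complex
   by (metis mult.assoc mult.commute)
  show ?thesis by (simp only: u_def E_def fst_conv snd_conv 1 q)
 qed
 have zd: "\<zeta> d \<noteq> 1"
 proof
  assume "\<zeta> d = 1"
  then obtain n :: int where "Im (- (2 * of_real pi*\<i> * of_int D) / of_nat d) = of_int (2*n)*pi"
   unfolding \<zeta>_def exp_eq_1 by blast
  then have "- (2*pi * of_int D)/real d = of_int (2*n)*pi" by simp
  then have "pi*(- of_int D) = pi*(of_int n*real d)" using c1 by (simp add: field_simps)
  then have "- (of_int D :: real) = of_int n*real d" using mult_left_cancel[OF pi_neq_zero] by blast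
  then have "- D = n*int d" by (metis of_int_eq_iff of_int_minus of_int_mult of_int_of_nat_eq)
  then have "int d dvd D" by (metis dvd_minus_iff dvd_triv_right)
  then have "int d dvd int (a*b)" unfolding D_def using \<nu>2 by auto
  then show False using nd by (simp only: of_nat_dvd_iff)
 qed
 obtain e1 where e1: "e1 ^ c = 1" "e1 \<noteq> (1::complex)"
 proof -
  have "card {z::complex. z ^ c = 1} = c" using card_complex_roots_unity[of c] c1 by simp
  then have "\<not> {z::complex. z ^ c = 1} \<subseteq> {1}" using cd card_mono[of "{1::complex}" "{z::complex. z ^ c = 1}"] by auto
  then show ?thesis using that by blast
 qed
 \<comment> \<open>Two roots of unity must be avoided, 1 and the inverse of \<open>\<zeta>\<close>
   d; this is where d \<ge> 3 is used.\<close>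
 obtain d1 where d1: "d1^d = 1" "d1 \<noteq> (1::complex)" "d1*\<zeta> d \<noteq> 1"
 proof -
  have "card {z::complex. z^d = 1} = d" using card_complex_roots_unity[of d] c1 by simp
  moreover have "card {1, inverse (\<zeta> d)} \<le> 2" by (simp add: card_insert_if)
  ultimately have "\<not> {z::complex. z^d = 1} \<subseteq> {1, inverse (\<zeta> d)}"
   using cd card_mono[of "{1, inverse (\<zeta> d)}" "{z::complex. z^d = 1}"] by auto
  then obtain z where "z^d = 1" "z \<noteq> 1" "z \<noteq> inverse (\<zeta> d)" by blast
  then show ?thesis using that by (metis inverse_unique mult.commute)
 qed
 define J where "J = (%\<epsilon> \<delta> t. M (m (E \<epsilon> \<delta> t)))"
 have cd2: "c \<ge> 2" "d \<ge> 2" using cd by auto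
 have eJ: "exp (J \<epsilon> \<delta> t) = (if \<epsilon> = 1 \<and> \<delta> = 1 then exp (- (2 * of_real pi*\<i> * of_real t)) else 1)"
  if "\<epsilon> ^ c = 1" "\<delta>^d = 1" "\<delta>*\<zeta> d \<noteq> 1" "t \<in> {0..1}" for \<epsilon> \<delta> t
 proof -
  have "exp (J \<epsilon> \<delta> t) = fibre_map c d (\<epsilon>*\<zeta> c * of_real (root c t), \<delta>*\<zeta> d * of_real (root d (1 - t))) /
    fibre_map c d (\<epsilon> * of_real (root c t), \<delta> * of_real (root d (1 - t)))"
   unfolding J_def key[OF EY[OF that(1,2,4)], symmetric] uE uE' ..
  also have "fibre_map c d (\<epsilon>*\<zeta> c * of_real (root c t), \<delta>*\<zeta> d * of_real (root d (1 - t))) = 1"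
   using fibre_map_edge[OF cd2, of "\<epsilon>*\<zeta> c" "\<delta>*\<zeta> d" t] that \<zeta>1 c1 by (simp add: power_mult_distrib)
  also have "fibre_map c d (\<epsilon> * of_real (root c t), \<delta> * of_real (root d (1 - t))) =
    (if \<epsilon> = 1 \<and> \<delta> = 1 then exp (2 * of_real pi*\<i> * of_real t) else 1)"
   by (rule fibre_map_edge[OF cd2 that(1,2,4)])
  finally show ?thesis by (simp add: exp_minus divide_inverse)
 qed
 have cE: "continuous_on {0..1} (E \<epsilon> \<delta>)" for \<epsilon> \<delta> unfolding E_def
  using c1 by (intro continuous_intros) auto
 have cJ: "continuous_on {0..1} (J \<epsilon> \<delta>)" if "\<epsilon> ^ c = 1" "\<delta>^d = 1" for \<epsilon> \<delta>
  unfolding J_def by (rule continuous_on_compose2[OF cMm cE]) (use EY[OF that] in blast)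
 have Jc: "J \<epsilon> \<delta> 0 = J \<epsilon> \<delta> 1" if "\<epsilon> ^ c = 1" "\<delta>^d = 1" "\<delta>*\<zeta> d \<noteq> 1" "\<not> (\<epsilon> = 1 \<and> \<delta> = 1)" for \<epsilon> \<delta>
  by (rule continuous_log_of_one_constant[of "{0..1::real}"]) (use cJ eJ that in auto)
 have J11: "J 1 1 0+2 * of_real pi*\<i> * of_real 0 = J 1 1 1+2 * of_real pi*\<i> * of_real 1"
 proof (rule continuous_log_of_one_constant[of "{0..1::real}" "%t. J 1 1 t+2 * of_real pi*\<i> * of_real t"])
  show "continuous_on {0..1} (%t. J 1 1 t+2 * of_real pi*\<i> * of_real t)"
   by (intro continuous_intros cJ) auto
  show "exp (J 1 1 t+2 * of_real pi*\<i> * of_real t) = 1" if "t \<in> {0..1}" for t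
   unfolding exp_add using eJ[of 1 1 t] that zd by (simp flip: exp_add)
 qed auto
 have J0: "J \<epsilon> \<delta> 0 = J 1 \<delta> 0" "J \<epsilon> \<delta> 1 = J \<epsilon> 1 1" for \<epsilon> \<delta> unfolding J_def E_def by auto
 \<comment> \<open>The four edges between {1, e1} and {1, d1} form a cycle. Along three of them the
   logarithm is constant, so its values at both ends of the fourth edge agree; but along that edge
   it changes by 2 pi i.\<close>
 have "J 1 1 1 = J 1 d1 1" by (rule J0(2)[symmetric])
 also have "\<dots> = J 1 d1 0" using Jc[of 1 d1] d1 by simp
 also have "\<dots> = J e1 d1 0" by (rule J0(1)[symmetric])
 also have "\<dots> = J e1 d1 1" using Jc[of e1 d1] d1 e1 by simp
 also have "\<dots> = J e1 1 1" by (rule J0(2))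
 also have "\<dots> = J e1 1 0" using Jc[of e1 1] e1 zd by simp
 also have "\<dots> = J 1 1 0" by (rule J0(1))
 finally show False using J11 by simp
qed

section \<open>Separation of the types A_n and E6\<close>

corollary germ_A_even_not_equiv_E6: "\<not> top_equiv_germ (germ_A (2 * k)) germ_E6"
proof
 assume eq: "top_equiv_germ (germ_A (2 * k)) germ_E6"
 have "germ_A (2 * k) = {q. bg 2 (2 * k+1) q = 0}" "germ_E6 = {q. bg 3 4 q = 0}"
  unfolding germ_A_def germ_E6_def bg_def by auto
 moreover have "coprime (3::nat) 4" using coprime_Suc_right_nat[of 3] by simp
 moreover have "\<not> 4 dvd 2*(2 * k+1)" by presburger
 ultimately show False using brieskorn_germs_not_equiv[of 2 "2 * k+1" 3 4] eq by simp
qed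

corollary germ_A2_A4_not_equiv_A6:
 assumes "k = 1 \<or> k = 2" shows "\<not> top_equiv_germ (germ_A (2 * k)) (germ_A 6)"
proof
 assume eq: "top_equiv_germ (germ_A (2 * k)) (germ_A 6)"
 have "germ_A (2 * k) = {q. bg 2 (2 * k+1) q = 0}" "germ_A 6 = {q. bg 2 7 q = 0}"
  unfolding germ_A_def bg_def by auto
 moreover have "coprime (2::nat) 7" by simp
 moreover have "\<not> 7 dvd 2*(2 * k+1)" using assms by auto
 ultimately show False using brieskorn_germs_not_equiv[of 2 "2 * k+1" 2 7] eq by simp
qed

lemma germ_A_parity:
 assumes "m \<ge> 1" "n \<ge> 1" "top_equiv_germ (germ_A m) (germ_A n)"
 shows "even m = even n"
proof (rule ccontr)
 have *: False if e: "even m" "odd n" "top_equiv_germ (germ_A m) (germ_A n)" for m n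
 proof -
  obtain k where "m = 2 * k" using e by blast
  moreover obtain j where j: "n = 2*j+1" using e by (blast elim: oddE)
  then have "n = 2*(j+1) - 1" by simp
  ultimately show False
   using unibranch_not_equiv_linked_branch[OF unibranch_germ_A linked_branch_germ_A[of "j+1"]] e(3) by simp
 qed
 assume "even m \<noteq> even n"
 then show False using *[of m n] *[of n m] assms(3) top_equiv_germ_sym by blast
qed

lemma germ_A_odd_dvd:
 assumes "m \<ge> 1" "j \<ge> 1" "top_equiv_germ (germ_A (2*j - 1)) (germ_A (2*m - 1))"
 shows "m dvd j"
 using linked_branch_dvd[OF linked_branch_germ_A[OF assms(2)] assms(3,1)] by simp

lemma germ_A_not_equiv_E6:
 assumes "n \<ge> 1" shows "\<not> top_equiv_germ (germ_A n) germ_E6"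
proof (cases "even n")
 case True
 then obtain k where "n = 2 * k" by blast
 then show ?thesis using germ_A_even_not_equiv_E6 by simp
next
 case False
 then obtain j where "n = 2*j+1" by (blast elim: oddE)
 then have n: "n = 2*(j+1) - 1" by simp
 show ?thesis
  using unibranch_not_equiv_linked_branch[OF unibranch_germ_E6 linked_branch_germ_A[of "j+1"]] top_equiv_germ_sym
  unfolding n by auto
qed

section \<open>Independence of a topological type of the projective chart\<close>

lemma smul3_simps: "smul3 c (a, b, e) = (c*a, c*b, c*e)"
 by (simp add: smul3_def)

lemma det3_simps: "det3 (a1, a2, a3) (b1, b2, b3) (c1, c2, c3) =
   a1*(b2 * c3 - b3 * c2) - a2*(b1 * c3 - b3 * c1)+a3*(b1 * c2 - b2 * c1)"
 by (simp add: det3_def)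

lemma aff3_simps: "aff3 (v1, v2, v3) s (u1, u2, u3) t (w1, w2, w3) =
   (v1 + s*u1+t*w1, v2 + s*u2+t*w2, v3 + s*u3+t*w3)"
 by (simp add: aff3_def)

text \<open>Since \<open>has_type\<close> asserts only that some chart exists, this lemma is what
  permits adapted coordinates. Expanding the new basis vectors in the old ones by Cramer's rule, the
  chart change is fractional linear with denominator \<open>l\<close>, equal to 1 at the origin, and
  homogeneity removes the factor l^4.\<close>

lemma has_type_chart:
 assumes hom: "\<And>c v. F (smul3 c v) = c^4*F v"
  and ht: "has_type F v T" and d': "det3 v u' w' \<noteq> 0"
 shows "top_equiv_germ {(s, t). F (aff3 v s u' t w') = 0} T"
proof -
 obtain u w where d: "det3 v u w \<noteq> 0" and te: "top_equiv_germ {(s, t). F (aff3 v s u t w) = 0} T"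
  using ht unfolding has_type_def by blast
 define \<Delta> where "\<Delta> = det3 v u w"
 define \<alpha> \<beta> \<gamma> where "\<alpha> = det3 u' u w/\<Delta>" and "\<beta> = det3 v u' w/\<Delta>" and "\<gamma> = det3 v u u'/\<Delta>"
 define \<alpha>' \<beta>' \<gamma>' where "\<alpha>' = det3 w' u w/\<Delta>" and "\<beta>' = det3 v w' w/\<Delta>" and "\<gamma>' = det3 v u w'/\<Delta>"
 obtain v1 v2 v3 u1 u2 u3 w1 w2 w3 where c: "v = (v1, v2, v3)" "u = (u1, u2, u3)" "w = (w1, w2, w3)"
  by (metis prod_cases3)
 obtain a1 a2 a3 b1 b2 b3 where c': "u' = (a1, a2, a3)" "w' = (b1, b2, b3)" by (metis prod_cases3)
 have D: "\<Delta> \<noteq> 0" using d unfolding \<Delta>_def .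
 have cr: "u' = (\<alpha> * v1+\<beta>*u1+\<gamma>*w1, \<alpha> * v2+\<beta>*u2+\<gamma>*w2, \<alpha> * v3+\<beta>*u3+\<gamma>*w3)"
  "w' = (\<alpha>' * v1+\<beta>'*u1+\<gamma>'*w1, \<alpha>' * v2+\<beta>'*u2+\<gamma>'*w2, \<alpha>' * v3+\<beta>'*u3+\<gamma>'*w3)"
 proof -
  have *: "x = (det3 x u w/\<Delta> * v1+det3 v x w/\<Delta>*u1+det3 v u x/\<Delta>*w1,
    det3 x u w/\<Delta> * v2+det3 v x w/\<Delta>*u2+det3 v u x/\<Delta>*w2,
    det3 x u w/\<Delta> * v3+det3 v x w/\<Delta>*u3+det3 v u x/\<Delta>*w3)" for x
  proof -
   obtain x1 x2 x3 where x: "x = (x1, x2, x3)" by (metis prod_cases3)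
   have "x1*\<Delta> = det3 x u w * v1+det3 v x w*u1+det3 v u x*w1"
    "x2*\<Delta> = det3 x u w * v2+det3 v x w*u2+det3 v u x*w2"
    "x3*\<Delta> = det3 x u w * v3+det3 v x w*u3+det3 v u x*w3"
    unfolding \<Delta>_def c x det3_simps by algebra+
   then have "x1 = (det3 x u w * v1+det3 v x w*u1+det3 v u x*w1)/\<Delta>"
    "x2 = (det3 x u w * v2+det3 v x w*u2+det3 v u x*w2)/\<Delta>"
    "x3 = (det3 x u w * v3+det3 v x w*u3+det3 v u x*w3)/\<Delta>"
    using D by (simp_all add: eq_divide_eq)
   then show ?thesis unfolding x by (simp add: add_divide_distrib)
  qed
  show "u' = (\<alpha> * v1+\<beta>*u1+\<gamma>*w1, \<alpha> * v2+\<beta>*u2+\<gamma>*w2, \<alpha> * v3+\<beta>*u3+\<gamma>*w3)"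
   using *[of u'] unfolding \<alpha>_def \<beta>_def \<gamma>_def .
  show "w' = (\<alpha>' * v1+\<beta>'*u1+\<gamma>'*w1, \<alpha>' * v2+\<beta>'*u2+\<gamma>'*w2, \<alpha>' * v3+\<beta>'*u3+\<gamma>'*w3)"
   using *[of w'] unfolding \<alpha>'_def \<beta>'_def \<gamma>'_def .
 qed
 have dd: "det3 v u' w' = (\<beta>*\<gamma>' - \<beta>'*\<gamma>)*\<Delta>"
  unfolding \<Delta>_def c cr det3_simps by algebra
 then have bg: "\<beta>*\<gamma>' - \<beta>'*\<gamma> \<noteq> 0" using d' by auto
 define l where "l = (%z::complex \<times> complex. 1+(\<alpha>*fst z+\<alpha>' * snd z))"
 have sl: "sd l" unfolding l_def by (intro sd_intros)
 have l0: "l 0 = 1" unfolding l_def by simp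
 obtain la lb where il: "sdiff (%z. inverse (l z)) la lb" using sd_inverse[OF sl] l0 unfolding sd_def by auto
 have lin: "sdiff (%z. x*fst z+y * snd z) x y" for x y
  using sdiff_add[OF sdiff_cmult[OF sdiff_fst, of x] sdiff_cmult[OF sdiff_snd, of y]] by simp
 have X: "sdiff (%z. (\<beta>*fst z+\<beta>' * snd z)*inverse (l z)) \<beta> \<beta>'"
  using sdiff_mult[OF lin[of \<beta> \<beta>'] il] l0 by simp
 have Y: "sdiff (%z. (\<gamma>*fst z+\<gamma>' * snd z)*inverse (l z)) \<gamma> \<gamma>'"
  using sdiff_mult[OF lin[of \<gamma> \<gamma>'] il] l0 by simp
 define N where "N = {z. l z \<noteq> 0}"
 have N: "open N" "0 \<in> N" unfolding N_def using l0 by (auto simp: l_def intro!: open_Collect_neq continuous_intros)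
 have "z \<in> {(s, t). F (aff3 v s u' t w') = 0} \<longleftrightarrow>
   ((\<beta>*fst z+\<beta>' * snd z)*inverse (l z), (\<gamma>*fst z+\<gamma>' * snd z)*inverse (l z)) \<in> {(s, t). F (aff3 v s u t w) = 0}"
  if z: "z \<in> N" for z
 proof -
  have lz: "l z \<noteq> 0" using z unfolding N_def by simp
  obtain s t where st: "z = (s, t)" by (cases z)
  define s1 where "s1 = (\<beta> * s+\<beta>'*t)*inverse (l z)"
  define t1 where "t1 = (\<gamma> * s+\<gamma>'*t)*inverse (l z)"
  have ls: "l z * s1 = \<beta> * s+\<beta>'*t" "l z*t1 = \<gamma> * s+\<gamma>'*t" unfolding s1_def t1_def using lz by simp_all
  have lv: "l z = 1+\<alpha> * s+\<alpha>'*t" unfolding l_def st by simp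
  have *: "x + s*(\<alpha>*x+\<beta>*y+\<gamma>*q)+t*(\<alpha>'*x+\<beta>'*y+\<gamma>'*q) = l z*(x + s1*y+t1*q)" for x y q
  proof -
   have "l z*(x + s1*y+t1*q) = l z*x+(l z * s1)*y+(l z*t1)*q" by (simp add: algebra_simps)
   then show ?thesis unfolding ls unfolding lv by (simp add: algebra_simps)
  qed
  have "aff3 v s u' t w' = smul3 (l z) (aff3 v s1 u t1 w)"
   unfolding c cr aff3_simps smul3_simps * ..
  then have "F (aff3 v s u' t w') = l z^4*F (aff3 v s1 u t1 w)" using hom by simp
  then show ?thesis unfolding st using lz unfolding s1_def t1_def st by simp
 qed
 then have "top_equiv_germ {(s, t). F (aff3 v s u' t w') = 0} {(s, t). F (aff3 v s u t w) = 0}"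
  using top_equiv_germ_chart[OF X Y bg _ _ N] by simp
 then show ?thesis using te top_equiv_germ_trans by blast
qed

lemma has_type_smul3:
 assumes hom: "\<And>c v. F (smul3 c v) = c^4*F v" and ht: "has_type F v T" and c: "c \<noteq> 0"
 shows "has_type F (smul3 c v) T"
proof -
 obtain u w where d: "det3 v u w \<noteq> 0" and te: "top_equiv_germ {(s, t). F (aff3 v s u t w) = 0} T"
  using ht unfolding has_type_def by blast
 have "det3 (smul3 c v) (smul3 c u) (smul3 c w) = c^3*det3 v u w"
  by (cases v, cases u, cases w) (simp add: smul3_def det3_def power3_eq_cube algebra_simps)
 moreover have "aff3 (smul3 c v) s (smul3 c u) t (smul3 c w) = smul3 c (aff3 v s u t w)" for s t
  by (cases v, cases u, cases w) (simp add: smul3_def aff3_def algebra_simps)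
 ultimately show ?thesis unfolding has_type_def
  by (intro exI[of _ "smul3 c u"] exI[of _ "smul3 c w"]) (use d te c hom in simp)
qed

section \<open>Total degree and homogeneous forms\<close>

lemma eval2_poly: "eval2 p x y = poly (poly p [:y:]) x"
 unfolding eval2_def by (induction p) (auto simp: map_poly_pCons)

lemma eval2_add: "eval2 (p+q) x y = eval2 p x y+eval2 q x y"
 and eval2_mult: "eval2 (p*q) x y = eval2 p x y*eval2 q x y"
 and eval2_diff: "eval2 (p - q) x y = eval2 p x y - eval2 q x y"
 and eval2_uminus: "eval2 (- p) x y = - eval2 p x y"
 and eval2_power: "eval2 (p^n) x y = eval2 p x y^n"
 and eval2_0: "eval2 0 x y = 0"
 and eval2_1: "eval2 1 x y = 1"
 and eval2_cpoly2: "eval2 (cpoly2 c) x y = c"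
 by (simp_all add: eval2_poly poly_power cpoly2_def)

lemmas eval2_simps = eval2_add eval2_mult eval2_diff eval2_uminus eval2_power eval2_0 eval2_1 eval2_cpoly2

lemma eval2_inject:
 assumes "\<And>x y. eval2 p x y = eval2 q x y" shows "p = q"
proof -
 define r where "r = p - q"
 have "poly (poly r [:y:]) x = 0" for x y
  using assms unfolding r_def by (simp add: eval2_poly)
 then have z: "poly r [:y:] = 0" for y using poly_all_0_iff_0 by blast
 have "r = 0"
 proof (rule ccontr)
  assume "r \<noteq> 0"
  then have "finite {z. poly r z = 0}" by (rule poly_roots_finite)
  moreover have "range (%y::complex. [:y:]) \<subseteq> {z. poly r z = 0}" using z by auto
  ultimately have "finite (range (%y::complex. [:y:]))" using finite_subset by blast
  moreover have "inj (%y::complex. [:y:])" by (auto simp: inj_on_def)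
  ultimately have "finite (UNIV :: complex set)" using finite_imageD by blast
  then show False using infinite_UNIV_char_0 by blast
 qed
 then show ?thesis unfolding r_def by simp
qed

lemma totdeg_le_iff: "totdeg p \<le> d \<longleftrightarrow> (\<forall>i j. d < i+j --> coeff (coeff p j) i = 0)"
proof -
 define S where "S = {i+degree (coeff p i) | i. coeff p i \<noteq> 0}"
 have "S \<subseteq> (%i. i+degree (coeff p i)) ` {..degree p}" unfolding S_def using le_degree by blast
 then have fin: "finite ({0} \<union> S)" by (simp add: finite_subset)
 have "totdeg p \<le> d \<longleftrightarrow> (\<forall>s\<in>S. s \<le> d)"
  unfolding totdeg_def S_def[symmetric] using fin by (subst Max_le_iff) auto
 also have "\<dots> \<longleftrightarrow> (\<forall>i j. d < i+j --> coeff (coeff p j) i = 0)"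
 proof
  assume a: "\<forall>s\<in>S. s \<le> d"
  show "\<forall>i j. d < i+j --> coeff (coeff p j) i = 0"
  proof (intro allI impI)
   fix i j assume ij: "d < i+j"
   show "coeff (coeff p j) i = 0"
   proof (cases "coeff p j = 0")
    case False
    then have "j+degree (coeff p j) \<le> d" using a unfolding S_def by blast
    then show ?thesis using ij by (intro coeff_eq_0) simp
   qed simp
  qed
 next
  assume a: "\<forall>i j. d < i+j --> coeff (coeff p j) i = 0"
  show "\<forall>s\<in>S. s \<le> d"
  proof
   fix s assume "s \<in> S"
   then obtain j where j: "s = j+degree (coeff p j)" "coeff p j \<noteq> 0" unfolding S_def by blast
   then have "coeff (coeff p j) (degree (coeff p j)) \<noteq> 0" by simp
   then show "s \<le> d" using a j by (metis add.commute not_le)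
  qed
 qed
 finally show ?thesis .
qed

lemma totdeg_leD: "totdeg p \<le> d ==> d < i+j ==> coeff (coeff p j) i = 0"
 using totdeg_le_iff by blast

lemma totdeg_add_le: "totdeg p \<le> d ==> totdeg q \<le> d ==> totdeg (p+q) \<le> d"
 and totdeg_diff_le: "totdeg p \<le> d ==> totdeg q \<le> d ==> totdeg (p - q) \<le> d"
 and totdeg_uminus_le: "totdeg p \<le> d ==> totdeg (- p) \<le> d"
 unfolding totdeg_le_iff by auto

lemma totdeg_mult_le:
 assumes "totdeg p \<le> d" "totdeg q \<le> e" shows "totdeg (p*q) \<le> d+e"
 unfolding totdeg_le_iff
proof (intro allI impI)
 fix i j assume ij: "d+e < i+j"
 have "coeff (coeff (p*q) j) i = (\<Sum>k\<le>j. \<Sum>l\<le>i. coeff (coeff p k) l * coeff (coeff q (j - k)) (i - l))"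
  by (simp add: coeff_mult coeff_sum)
 also have "\<dots> = 0"
 proof (intro sum.neutral ballI)
  fix k l assume kl: "k \<in> {..j}" "l \<in> {..i}"
  have "d < l + k \<or> e < (i - l)+(j - k)" using ij kl by auto
  then show "coeff (coeff p k) l * coeff (coeff q (j - k)) (i - l) = 0"
   using totdeg_leD[OF assms(1)] totdeg_leD[OF assms(2)] by auto
 qed
 finally show "coeff (coeff (p*q) j) i = 0" .
qed

lemma totdeg_cpoly2: "totdeg (cpoly2 c) = 0"
proof -
 have "totdeg (cpoly2 c) \<le> 0" unfolding totdeg_le_iff cpoly2_def
  by (auto simp: coeff_pCons split: nat.splits)
 then show ?thesis by simp
qed

lemma totdeg_0_imp_const:
 assumes "totdeg p = 0" shows "p = cpoly2 (coeff (coeff p 0) 0)"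
proof -
 have "coeff (coeff p j) i = 0" if "0 < i+j" for i j using totdeg_leD[of p 0] assms that by simp
 then show ?thesis unfolding cpoly2_def
  by (intro poly_eqI) (auto simp: coeff_pCons split: nat.splits intro!: poly_eqI)
qed

lemma totdeg_power_le: "totdeg p \<le> d ==> totdeg (p^n) \<le> n*d"
proof (induction n)
 case 0 then show ?case using totdeg_cpoly2[of 1] by (simp add: cpoly2_def one_pCons)
next
 case (Suc n) then show ?case using totdeg_mult_le[of p d "p^n" "n*d"] by simp
qed

lemma poly_sum_le:
 fixes p :: "complex poly"
 assumes "degree p \<le> n" shows "poly p x = (\<Sum>i\<le>n. coeff p i*x^i)"
proof -
 have "poly p x = (\<Sum>i\<le>degree p. coeff p i*x^i)" by (rule poly_altdef)
 also have "\<dots> = (\<Sum>i\<le>n. coeff p i*x^i)"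
  using assms by (intro sum.mono_neutral_left) (auto simp: coeff_eq_0)
 finally show ?thesis .
qed

lemma eval2_sum_coeff:
 assumes "totdeg p \<le> d"
 shows "eval2 p x y = (\<Sum>j\<le>d. \<Sum>i\<le>d - j. coeff (coeff p j) i*x^i*y^j)"
proof -
 have dp: "degree p \<le> d"
 proof (rule degree_le, intro allI impI)
  fix j assume "d < j"
  then have "coeff (coeff p j) i = 0" for i using totdeg_leD[OF assms, of i j] by simp
  then show "coeff p j = 0" by (intro poly_eqI) simp
 qed
 have dc: "degree (coeff p j) \<le> d - j" if "j \<le> d" for j
  by (rule degree_le) (use totdeg_leD[OF assms, of _ j] that in auto)
 have "eval2 p x y = poly (map_poly (%q. poly q x) p) y" unfolding eval2_def ..
 also have "\<dots> = (\<Sum>j\<le>d. coeff (map_poly (%q. poly q x) p) j*y^j)"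
 proof (rule poly_sum_le)
  show "degree (map_poly (%q. poly q x) p) \<le> d"
   by (rule degree_le) (use dp in \<open>auto simp: coeff_map_poly coeff_eq_0\<close>)
 qed
 also have "\<dots> = (\<Sum>j\<le>d. (\<Sum>i\<le>d - j. coeff (coeff p j) i*x^i)*y^j)"
 proof (intro sum.cong refl)
  fix j assume "j \<in> {..d}"
  then have "poly (coeff p j) x = (\<Sum>i\<le>d - j. coeff (coeff p j) i*x^i)"
   using dc by (intro poly_sum_le) auto
  then show "coeff (map_poly (%q. poly q x) p) j*y^j = (\<Sum>i\<le>d - j. coeff (coeff p j) i*x^i)*y^j"
   by (simp add: coeff_map_poly)
 qed
 finally show ?thesis by (simp add: sum_distrib_right)
qed

lemma homog_at_1:
 assumes "totdeg p \<le> d" shows "homog d p (x, y, 1) = eval2 p x y"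
 unfolding eval2_sum_coeff[OF assms] homog_def by simp

lemma homog_smul:
 "homog d p (smul3 c v) = c^d*homog d p v"
proof -
 obtain x y z where v: "v = (x, y, z)" by (metis prod_cases3)
 have *: "coeff (coeff p j) i*(c*x)^i*(c*y)^j*(c*z)^(d - i - j) =
   c^d*(coeff (coeff p j) i*x^i*y^j*z^(d - i - j))" if "j \<le> d" "i \<le> d - j" for i j
 proof -
  have "c^d = c^i * c^j * c^(d - i - j)" using that by (simp flip: power_add)
  then show ?thesis by (simp add: power_mult_distrib)
 qed
 show ?thesis unfolding v homog_def smul3_def prod.case sum_distrib_left
  by (intro sum.cong refl *) auto
qed

lemma homog_eval2:
 assumes "totdeg p \<le> d" "z \<noteq> 0" shows "homog d p (x, y, z) = z^d*eval2 p (x/z) (y/z)"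
 using homog_smul[of d p z "(x/z, y/z, 1)"] homog_at_1[OF assms(1)] assms(2) by (simp add: smul3_def)

lemma continuous_homog: "continuous_on A (%q. homog d p (f q, g q, h q))"
 if "continuous_on A f" "continuous_on A g" "continuous_on A h"
 unfolding homog_def by (auto intro!: continuous_intros that)

lemma eq_at_0_by_continuity:
 fixes f g :: "complex => complex"
 assumes "continuous_on UNIV f" "continuous_on UNIV g" "\<And>z. z \<noteq> 0 ==> f z = g z"
 shows "f 0 = g 0"
proof -
 have "(f \<longlongrightarrow> f 0) (at 0)" "(g \<longlongrightarrow> g 0) (at 0)"
  using assms(1,2) by (simp_all add: continuous_on_def)
 moreover have "eventually (%z. f z = g z) (at 0)"
  unfolding eventually_at_filter using assms(3) by simp
 ultimately have "(g \<longlongrightarrow> f 0) (at 0)" using tendsto_cong by blast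
 then show ?thesis using \<open>(g \<longlongrightarrow> g 0) (at 0)\<close> tendsto_unique trivial_limit_at by blast
qed

text \<open>Off the line at infinity homogenisation is z^d times evaluation, where the rule is
  obvious; both sides are continuous in z, so it persists at z = 0.\<close>

lemma homog_mult:
 assumes "totdeg p \<le> d" "totdeg q \<le> e"
 shows "homog (d+e) (p*q) v = homog d p v * homog e q v"
proof -
 obtain x y z where v: "v = (x, y, z)" by (metis prod_cases3)
 have nz: "homog (d+e) (p*q) (x, y, z) = homog d p (x, y, z)*homog e q (x, y, z)" if "z \<noteq> 0" for z
  unfolding homog_eval2[OF totdeg_mult_le[OF assms] that] homog_eval2[OF assms(1) that] homog_eval2[OF assms(2) that]
  by (simp add: eval2_mult power_add)
 have "homog (d+e) (p*q) (x, y, 0) = homog d p (x, y, 0)*homog e q (x, y, 0)"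
  by (rule eq_at_0_by_continuity[of "%z. homog (d+e) (p*q) (x, y, z)"])
   (auto intro!: continuous_intros continuous_homog nz)
 then show ?thesis unfolding v using nz by (cases "z = 0") auto
qed

lemma homog_inject:
 assumes "totdeg p \<le> d" "totdeg q \<le> d" "\<And>v. homog d p v = homog d q v" shows "p = q"
 by (rule eval2_inject) (metis assms homog_at_1)

text \<open>The leading form of degree d on the line at infinity, dehomogenised at X = 1. It
  vanishes exactly when the degree drops below d, and it is multiplicative, which yields additivity
  of \<open>totdeg\<close>.\<close>

definition top_poly :: "nat => complex poly poly => complex poly" where
 "top_poly d p = (\<Sum>j\<le>d. monom (coeff (coeff p j) (d - j)) j)"

lemma homog_at_infinity:
 "homog d p (x, y, 0) = (\<Sum>j\<le>d. coeff (coeff p j) (d - j)*x^(d - j)*y^j)"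
proof -
 have "(\<Sum>i\<le>d - j. coeff (coeff p j) i*x^i*y^j*0^(d - i - j)) =
   coeff (coeff p j) (d - j)*x^(d - j)*y^j" if "j \<le> d" for j
 proof -
  have "(\<Sum>i\<le>d - j. coeff (coeff p j) i*x^i*y^j*0^(d - i - j)) =
   (\<Sum>i\<le>d - j. if i = d - j then coeff (coeff p j) (d - j)*x^(d - j)*y^j else 0)"
   using that by (intro sum.cong) (auto simp: power_0_left)
  then show ?thesis by simp
 qed
 then show ?thesis unfolding homog_def by simp
qed

lemma poly_top_poly: "poly (top_poly d p) m = homog d p (1, m, 0)"
 unfolding top_poly_def homog_at_infinity by (simp add: poly_sum poly_monom)

lemma coeff_top_poly: "j \<le> d ==> coeff (top_poly d p) j = coeff (coeff p j) (d - j)"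
 unfolding top_poly_def by (simp add: coeff_sum sum.delta)

lemma top_poly_eq_0_iff:
 assumes "totdeg p \<le> Suc d" shows "top_poly (Suc d) p = 0 \<longleftrightarrow> totdeg p \<le> d"
proof
 assume z: "top_poly (Suc d) p = 0"
 have "coeff (coeff p j) i = 0" if "i+j > d" for i j
 proof (cases "i+j = Suc d")
  case True
  then have "i = Suc d - j" "j \<le> Suc d" by auto
  then show ?thesis using coeff_top_poly[of j "Suc d" p] z by simp
 next
  case False then show ?thesis using totdeg_leD[OF assms, of i j] that by simp
 qed
 then show "totdeg p \<le> d" unfolding totdeg_le_iff by blast
next
 assume "totdeg p \<le> d"
 then show "top_poly (Suc d) p = 0" unfolding top_poly_def
  by (intro sum.neutral ballI) (simp add: totdeg_leD)
qed

lemma top_poly_totdeg_nz: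
 assumes "p \<noteq> 0" shows "top_poly (totdeg p) p \<noteq> 0"
proof (cases "totdeg p")
 case 0
 then have "p = cpoly2 (coeff (coeff p 0) 0)" by (rule totdeg_0_imp_const)
 then have "coeff (coeff p 0) 0 \<noteq> 0" using assms unfolding cpoly2_def by auto
 then show ?thesis using coeff_top_poly[of 0 0 p] 0 by auto
next
 case (Suc d)
 then show ?thesis using top_poly_eq_0_iff[of p d] by auto
qed

lemma totdeg_mult:
 assumes "p \<noteq> 0" "q \<noteq> 0" shows "totdeg (p*q) = totdeg p+totdeg q"
proof -
 have "top_poly (totdeg p+totdeg q) (p*q) = top_poly (totdeg p) p*top_poly (totdeg q) q"
  by (rule poly_ext) (simp add: poly_top_poly homog_mult)
 then have nz: "top_poly (totdeg p+totdeg q) (p*q) \<noteq> 0"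
  using top_poly_totdeg_nz assms by simp
 have le: "totdeg (p*q) \<le> totdeg p+totdeg q" by (rule totdeg_mult_le) auto
 show ?thesis
 proof (cases "totdeg p+totdeg q")
  case 0 then show ?thesis using le by simp
 next
  case (Suc d)
  then have "\<not> totdeg (p*q) \<le> d" using top_poly_eq_0_iff[of "p*q" d] nz le by auto
  then show ?thesis using le Suc by simp
 qed
qed

lemma totdeg_cmult: "c \<noteq> 0 ==> totdeg (cpoly2 c*p) = totdeg p"
proof (cases "p = 0")
 case False
 assume "c \<noteq> 0"
 then have "cpoly2 c \<noteq> 0" unfolding cpoly2_def by simp
 then show ?thesis using totdeg_mult[of "cpoly2 c" p] False by (simp add: totdeg_cpoly2)
qed simp

text \<open>Forms are treated as functions on \<open>pt3\<close>, so that linear substitutions are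
  compositions and factorisations can be checked pointwise, without computing in nested
  polynomials.\<close>

definition form :: "nat => (pt3 => complex) => bool" where
 "form d G \<longleftrightarrow> (\<exists>p. totdeg p \<le> d \<and> G = homog d p)"

lemma form_homog: "totdeg p \<le> d ==> form d (homog d p)"
 unfolding form_def by blast

lemma homog_add: "homog d (p+q) v = homog d p v + homog d q v"
 unfolding homog_def by (cases v) (simp add: sum.distrib algebra_simps)

lemma form_add: assumes "form d G" "form d H" shows "form d (%v. G v + H v)"
proof -
 obtain p q where "totdeg p \<le> d" "G = homog d p" "totdeg q \<le> d" "H = homog d q"
  using assms unfolding form_def by blast
 then show ?thesis unfolding form_def by (intro exI[of _ "p+q"]) (auto simp: totdeg_add_le homog_add)
qed

lemma form_mult: assumes "form d G" "form e H" shows "form (d+e) (%v. G v * H v)"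
proof -
 obtain p q where "totdeg p \<le> d" "G = homog d p" "totdeg q \<le> e" "H = homog e q"
  using assms unfolding form_def by blast
 then show ?thesis unfolding form_def by (intro exI[of _ "p*q"]) (auto simp: totdeg_mult_le homog_mult)
qed

lemma form_const: "form 0 (%_. c)"
 unfolding form_def by (intro exI[of _ "cpoly2 c"]) (simp add: totdeg_cpoly2, simp add: homog_def fun_eq_iff cpoly2_def)

lemma form_cmult: "form d G ==> form d (%v. c*G v)"
 using form_mult[OF form_const[of c], of d G] by simp

lemma form_power: "form d G ==> form (n*d) (%v. G v ^ n)"
proof (induction n)
 case 0 then show ?case using form_const[of 1] by simp
next
 case (Suc n) then show ?case using form_mult[of d G "n*d" "%v. G v ^ n"] by simp
qed

lemma form_zero: "form d (%_. 0)"
 unfolding form_def by (intro exI[of _ 0]) (auto simp: totdeg_le_iff homog_def)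

lemma form_sum: "finite I ==> (\<And>i. i \<in> I ==> form d (G i)) ==> form d (%v. \<Sum>i\<in>I. G i v)"
proof (induction I rule: finite_induct)
 case empty then show ?case using form_zero by simp
next
 case (insert i I)
 then have "form d (%v. G i v + (\<Sum>i\<in>I. G i v))" by (intro form_add) auto
 then show ?case using insert(1,2) by simp
qed

lemma form_linear: "form 1 (%v. a*fst v + b*fst (snd v) + c * snd (snd v))"
proof -
 have "form 1 fst" unfolding form_def
  by (intro exI[of _ "[:[:0, 1:]:]"])
   (auto simp: totdeg_le_iff homog_def coeff_pCons fun_eq_iff split: nat.splits)
 moreover have "form 1 (%v. fst (snd v))" unfolding form_def
  by (intro exI[of _ "[:0, 1:]"])
   (auto simp: totdeg_le_iff homog_def coeff_pCons fun_eq_iff split: nat.splits)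
 moreover have "form 1 (%v. snd (snd v))" unfolding form_def
  by (intro exI[of _ "[:[:1:]:]"])
   (auto simp: totdeg_le_iff homog_def coeff_pCons fun_eq_iff split: nat.splits)
 ultimately show ?thesis by (intro form_add form_cmult) auto
qed

lemma form_compose:
 assumes G: "form d G" and l: "form 1 l1" "form 1 l2" "form 1 l3"
 shows "form d (%v. G (l1 v, l2 v, l3 v))"
proof -
 obtain p where p: "totdeg p \<le> d" "G = homog d p" using G unfolding form_def by blast
 have "form d (%v. coeff (coeff p j) i*l1 v ^ i*l2 v ^ j*l3 v ^ (d - i - j))" if "j \<le> d" "i \<le> d - j" for i j
 proof -
  have "form (0+i*1+j*1+(d - i - j)*1) (%v. coeff (coeff p j) i*l1 v ^ i*l2 v ^ j*l3 v ^ (d - i - j))"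
   by (intro form_mult form_const form_power l)
  then show ?thesis using that by simp
 qed
 then have "form d (%v. \<Sum>j\<le>d. \<Sum>i\<le>d - j. coeff (coeff p j) i*l1 v ^ i*l2 v ^ j*l3 v ^ (d - i - j))"
  by (intro form_sum) auto
 then show ?thesis unfolding p homog_def by simp
qed

lemma form_1E:
 assumes "form 1 G" obtains a b c where "\<And>x y z. G (x, y, z) = a*x+b*y + c*z"
proof -
 obtain p where p: "G = homog 1 p" using assms unfolding form_def by blast
 show ?thesis
  by (rule that[of "coeff (coeff p 0) 1" "coeff (coeff p 1) 0" "coeff (coeff p 0) 0"]) (simp add: p homog_def)
qed

lemma form_2E:
 assumes "form 2 G" obtains a b c d e f where
  "\<And>x y z. G (x, y, z) = a*x^2+b*x*y + c*y^2+d*x*z+e*y*z+f*z^2"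
proof -
 obtain p where p: "G = homog 2 p" using assms unfolding form_def by blast
 define k where "k = (%i j. coeff (coeff p j) i)"
 show ?thesis
  by (rule that[of "k 2 0" "k 1 1" "k 0 2" "k 1 0" "k 0 1" "k 0 0"])
   (simp add: p homog_def eval_nat_numeral k_def algebra_simps)
qed

lemma form_4E:
 assumes "form 4 G" obtains k :: "nat => nat => complex" where
  "\<And>x y z. G (x, y, z) = k 4 0*x^4 + k 3 1*x^3*y + k 2 2*x^2*y^2 + k 1 3*x*y^3 + k 0 4*y^4
   +z*(k 3 0*x^3 + k 2 1*x^2*y + k 1 2*x*y^2 + k 0 3*y^3)
   +z^2*(k 2 0*x^2 + k 1 1*x*y + k 0 2*y^2)+z^3*(k 1 0*x + k 0 1*y) + k 0 0*z^4"
proof -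
 obtain p where p: "G = homog 4 p" using assms unfolding form_def by blast
 define k where "k = (%i j. coeff (coeff p j) i)"
 show ?thesis
  by (rule that[of k]) (simp add: p homog_def eval_nat_numeral k_def algebra_simps)
qed

lemma form_dehomog:
 assumes "form d G" obtains p where "totdeg p \<le> d" "\<And>x y. eval2 p x y = G (x, y, 1)"
proof -
 obtain p where p: "totdeg p \<le> d" "G = homog d p" using assms unfolding form_def by blast
 show ?thesis by (rule that[OF p(1)]) (simp add: p(2) homog_at_1[OF p(1)])
qed

lemma irreducible_no_form_factor:
 assumes f: "totdeg f = 4" "irreducible f" and G: "form d G" and H: "form e H"
  and de: "d+e = 4" "d > 0" "e > 0" and eq: "\<And>v. homog 4 f v = G v * H v"
 shows False
proof -
 obtain p q where pq: "totdeg p \<le> d" "G = homog d p" "totdeg q \<le> e" "H = homog e q"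
  using G H unfolding form_def by blast
 have fpq: "f = p*q"
 proof (rule homog_inject[of _ 4])
  show "totdeg (p*q) \<le> 4" using totdeg_mult_le[OF pq(1,3)] de by simp
  show "homog 4 f v = homog 4 (p*q) v" for v
   using homog_mult[OF pq(1,3), of v] eq[of v] pq de by simp
 qed (use f in simp)
 have nz: "p \<noteq> 0" "q \<noteq> 0" using f(2) fpq by auto
 have unit: "totdeg r = 0" if u: "is_unit r" for r :: "complex poly poly"
 proof -
  obtain s where s: "1 = r * s" using u by (elim dvdE)
  then have "r \<noteq> 0" "s \<noteq> 0" by auto
  then have "totdeg r+totdeg s = totdeg (1 :: complex poly poly)" using totdeg_mult s by metis
  also have "\<dots> = 0" using totdeg_cpoly2[of 1] by (simp add: cpoly2_def one_pCons)
  finally show ?thesis by simp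
 qed
 have "is_unit p \<or> is_unit q" by (rule irreducibleD[OF f(2) fpq])
 then have "totdeg p = 0 \<or> totdeg q = 0" by (elim disjE) (simp_all only: unit simp_thms)
 moreover have "totdeg p+totdeg q = 4" using totdeg_mult[OF nz] f(1) fpq by simp
 ultimately show False using pq(1,3) de by auto
qed

section \<open>Comparing torus decompositions\<close>

lemma cpoly2_add: "cpoly2 (a+b) = cpoly2 a + cpoly2 b"
 and cpoly2_diff: "cpoly2 (a - b) = cpoly2 a - cpoly2 b"
 and cpoly2_mult: "cpoly2 (a*b) = cpoly2 a * cpoly2 b"
 and cpoly2_uminus: "cpoly2 (- a) = - cpoly2 a"
 and cpoly2_0: "cpoly2 0 = 0"
 and cpoly2_1: "cpoly2 1 = 1"
 by (simp_all add: cpoly2_def one_pCons)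

lemma cpoly2_power: "cpoly2 (a^n) = cpoly2 a^n"
 by (induction n) (simp_all add: cpoly2_1 cpoly2_mult)

lemma cpoly2_eq_0_iff: "cpoly2 c = 0 \<longleftrightarrow> c = 0"
 by (simp add: cpoly2_def)

lemma totdeg_0: "totdeg 0 = 0" using totdeg_cpoly2[of 0] by (simp add: cpoly2_0)

lemma totdeg_unit: "is_unit r ==> totdeg r = 0"
proof -
 assume "is_unit r"
 then obtain s where s: "1 = r * s" by (elim dvdE)
 then have "r \<noteq> 0" "s \<noteq> 0" by auto
 then have "totdeg r+totdeg s = totdeg (1 :: complex poly poly)" using totdeg_mult s by metis
 then show ?thesis using totdeg_cpoly2[of 1] by (simp add: cpoly2_1)
qed

lemma irreducible_factor_totdeg:
 assumes "irreducible (f :: complex poly poly)" "f = p*q" shows "totdeg p = 0 \<or> totdeg q = 0"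
proof -
 have "is_unit p \<or> is_unit q" by (rule irreducibleD[OF assms])
 then show ?thesis by (elim disjE) (simp_all only: totdeg_unit simp_thms)
qed

lemma totdeg_0_unit: "totdeg p = 0 ==> p \<noteq> 0 ==> is_unit p"
proof -
 assume a: "totdeg p = 0" "p \<noteq> 0"
 obtain c where c: "p = cpoly2 c" using totdeg_0_imp_const[OF a(1)] by blast
 then have "c \<noteq> 0" using a by (simp add: cpoly2_eq_0_iff)
 then have "1 = p * cpoly2 (1 / c)" unfolding c by (simp flip: cpoly2_mult add: cpoly2_1)
 then show ?thesis by (rule dvdI)
qed

lemma totdeg_1_prime:
 fixes p :: "complex poly poly"
 assumes "totdeg p = 1" shows "prime_elem p"
proof (rule irreducible_imp_prime_elem, rule irreducibleI)
 show "p \<noteq> 0" using assms totdeg_0 by auto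
 show "\<not> is_unit p" using totdeg_unit[of p] assms by auto
 fix a b assume ab: "p = a*b"
 then have nz: "a \<noteq> 0" "b \<noteq> 0" using \<open>p \<noteq> 0\<close> by auto
 then have "totdeg a+totdeg b = 1" using totdeg_mult ab assms by metis
 then have "totdeg a = 0 \<or> totdeg b = 0" by arith
 then show "is_unit a \<or> is_unit b"
  by (elim disjE) (rule disjI1, rule totdeg_0_unit, assumption, rule nz, rule disjI2, rule totdeg_0_unit, assumption, rule nz)
qed

definition poly_in :: "complex poly => complex poly poly => complex poly poly" where
 "poly_in P l = poly (map_poly cpoly2 P) l"

lemma poly_in_pCons: "poly_in (pCons a P) l = cpoly2 a+l*poly_in P l"
 unfolding poly_in_def by (cases "a = 0 \<and> P = 0") (auto simp: map_poly_pCons cpoly2_0)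

lemma eval2_poly_in: "eval2 (poly_in P l) x y = poly P (eval2 l x y)"
proof (induction P)
 case 0 then show ?case by (simp add: poly_in_def eval2_0)
qed (simp add: poly_in_pCons eval2_simps)

text \<open>A root of \<open>P\<close> splits off a linear factor: such a quartic is a union of
  parallel lines. This disposes of every case below in which two linear polynomials turn out to be
  dependent.\<close>

lemma not_poly_in_linear:
 assumes f: "totdeg f = 4" "irreducible f" and l: "totdeg l \<le> 1"
  and P: "\<And>x y. eval2 f x y = poly P (eval2 l x y)"
 shows False
proof -
 have fP: "f = poly_in P l" by (rule eval2_inject) (simp add: P eval2_poly_in)
 have "\<not> constant (poly P)"
 proof
  assume "constant (poly P)"
  then have "poly P z = poly P 0" for z unfolding constant_def by blast
  then have "f = cpoly2 (poly P 0)" by (intro eval2_inject) (simp add: P eval2_cpoly2)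
  then show False using f(1) totdeg_cpoly2 by simp
 qed
 then obtain \<rho> where "poly P \<rho> = 0" using fundamental_theorem_of_algebra by blast
 then obtain P' where P': "P = [:- \<rho>, 1:]*P'" using poly_eq_0_iff_dvd by (metis dvdE)
 have fac: "f = (l - cpoly2 \<rho>)*poly_in P' l"
  by (rule eval2_inject) (simp add: P P' eval2_poly_in eval2_simps algebra_simps)
 have nz: "l - cpoly2 \<rho> \<noteq> 0" "poly_in P' l \<noteq> 0" using fac f(1) totdeg_0 by auto
 have "totdeg (l - cpoly2 \<rho>) \<le> 1" by (rule totdeg_diff_le) (use l totdeg_cpoly2 in auto)
 moreover have "totdeg (l - cpoly2 \<rho>)+totdeg (poly_in P' l) = 4" using totdeg_mult[OF nz] fac f(1) by simp
 ultimately have "totdeg (l - cpoly2 \<rho>) = 0" "totdeg (poly_in P' l) = 4"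
  using irreducible_factor_totdeg[OF f(2) fac] by auto
 then obtain c where "l - cpoly2 \<rho> = cpoly2 c" using totdeg_0_imp_const by blast
 then have "l = cpoly2 (c+\<rho>)" by (simp add: cpoly2_add algebra_simps)
 then have "f = cpoly2 (poly P (c+\<rho>))" by (intro eval2_inject) (simp add: P eval2_cpoly2)
 then show False using f(1) totdeg_cpoly2 by simp
qed

definition ldet :: "complex poly poly => complex poly poly => complex" where
 "ldet p q = coeff (coeff p 0) 1 * coeff (coeff q 1) 0 - coeff (coeff p 1) 0 * coeff (coeff q 0) 1"

lemma eval2_linear:
 assumes "totdeg p \<le> 1"
 shows "eval2 p x y = coeff (coeff p 0) 0 + coeff (coeff p 0) 1*x + coeff (coeff p 1) 0*y"
 using eval2_sum_coeff[OF assms, of x y] by (simp add: algebra_simps)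

lemma ldet_0_dependent:
 assumes pq: "totdeg p \<le> 1" "totdeg q \<le> 1" and d: "ldet p q = 0"
 obtains l \<alpha> \<beta> \<gamma> \<delta> where "totdeg l \<le> 1"
  "\<And>x y. eval2 p x y = \<alpha>+\<beta>*eval2 l x y" "\<And>x y. eval2 q x y = \<gamma>+\<delta>*eval2 l x y"
proof -
 define a b a' b' where "a = coeff (coeff p 0) 1" and "b = coeff (coeff p 1) 0"
  and "a' = coeff (coeff q 0) 1" and "b' = coeff (coeff q 1) 0"
 have ep: "eval2 p x y = coeff (coeff p 0) 0+a*x+b*y" for x y
  unfolding a_def b_def by (rule eval2_linear[OF pq(1)])
 have eq: "eval2 q x y = coeff (coeff q 0) 0+a'*x+b'*y" for x y
  unfolding a'_def b'_def by (rule eval2_linear[OF pq(2)])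
 have dd: "a*b' = b*a'" using d unfolding ldet_def a_def b_def a'_def b'_def by simp
 show ?thesis
 proof (cases "a = 0 \<and> b = 0")
  case True
  then show ?thesis using that[OF pq(2), of "coeff (coeff p 0) 0" 0 0 1] ep by simp
 next
  case False
  define t where "t = (if a = 0 then b'/b else a'/a)"
  have t: "a' = t*a" "b' = t*b" using False dd unfolding t_def by (auto simp: field_simps)
  show ?thesis
  proof (rule that[OF pq(1), of 0 1 "coeff (coeff q 0) 0 - t * coeff (coeff p 0) 0" t])
   show "eval2 q x y = coeff (coeff q 0) 0 - t * coeff (coeff p 0) 0+t*eval2 p x y" for x y
    unfolding eq ep t by (simp add: algebra_simps)
  qed simp
 qed
qed

lemma ldet_solve:
 assumes pq: "totdeg p \<le> 1" "totdeg q \<le> 1" and d: "ldet p q \<noteq> 0"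
 obtains x y where "eval2 p x y = u" "eval2 q x y = v"
proof -
 define a b a' b' where "a = coeff (coeff p 0) 1" and "b = coeff (coeff p 1) 0"
  and "a' = coeff (coeff q 0) 1" and "b' = coeff (coeff q 1) 0"
 define e e' where "e = u - coeff (coeff p 0) 0" and "e' = v - coeff (coeff q 0) 0"
 define D where "D = a*b' - b*a'"
 have D: "D \<noteq> 0" using d unfolding ldet_def D_def a_def b_def a'_def b'_def by simp
 define x where "x = (e*b' - b*e')/D"
 define y where "y = (a*e' - e*a')/D"
 have "a*x+b*y = e"
 proof -
  have "a*x+b*y = (a*(e*b' - b*e')+b*(a*e' - e*a'))/D"
   unfolding x_def y_def by (simp add: add_divide_distrib)
  also have "a*(e*b' - b*e')+b*(a*e' - e*a') = e*D" unfolding D_def by (simp add: algebra_simps)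
  finally show ?thesis using D by simp
 qed
 moreover have "a'*x+b'*y = e'"
 proof -
  have "a'*x+b'*y = (a'*(e*b' - b*e')+b'*(a*e' - e*a'))/D"
   unfolding x_def y_def by (simp add: add_divide_distrib)
  also have "a'*(e*b' - b*e')+b'*(a*e' - e*a') = e'*D" unfolding D_def by (simp add: algebra_simps)
  finally show ?thesis using D by simp
 qed
 ultimately have "eval2 p x y = u" "eval2 q x y = v"
  unfolding eval2_linear[OF pq(1)] eval2_linear[OF pq(2)] a_def[symmetric] b_def[symmetric] a'_def[symmetric] b'_def[symmetric]
  unfolding e_def e'_def by (simp_all add: algebra_simps)
 then show ?thesis using that by blast
qed

text \<open>The primitive cube root of unity exp (2 pi i/3), in coordinates.\<close>

definition cubert :: complex where "cubert = Complex (- 1/2) (sqrt 3/2)"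

lemma cubert_sum: "1 + cubert + cubert^2 = 0"
 unfolding cubert_def by (simp add: complex_eq_iff power2_eq_square)

lemma cubert_cube: "cubert^3 = 1"
proof -
 have "cubert^3 - 1 = (cubert - 1)*(1 + cubert + cubert^2)" by (simp add: algebra_simps power2_eq_square power3_eq_cube)
 then show ?thesis using cubert_sum by simp
qed

lemma cubert_ne: "cubert \<noteq> 1" "cubert \<noteq> 0"
 unfolding cubert_def by (auto simp: complex_eq_iff)

lemma cube_diff_factor:
 fixes a b :: "complex poly poly"
 shows "a^3 - b^3 = (a - b)*((a - cpoly2 cubert*b)*(a - cpoly2 (cubert^2)*b))"
proof (rule eval2_inject)
 fix x y
 define u v where "u = eval2 a x y" and "v = eval2 b x y"
 have "u^3 - v ^ 3 = (u - v)*((u - cubert * v)*(u - cubert^2 * v))"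
  using cubert_sum cubert_cube by algebra
 then show "eval2 (a^3 - b^3) x y = eval2 ((a - b)*((a - cpoly2 cubert*b)*(a - cpoly2 (cubert^2)*b))) x y"
  unfolding u_def v_def by (simp add: eval2_simps)
qed

text \<open>The scalar in front of f is normalised to 1, and the arguments are in the order q, l,
  opposite to the pairs in \<open>torus_decs\<close>.\<close>

definition visible_dec :: "complex poly poly => complex poly poly => complex poly poly => bool" where
 "visible_dec f q l \<longleftrightarrow> totdeg q \<le> 2 \<and> totdeg l \<le> 1 \<and> f = q^2+l^3"

text \<open>Normal form of a quartic with two different visible decompositions; it is the tricuspidal
 quartic with its bitangent at infinity.\<close>

definition tri_form :: "complex poly poly => complex poly poly => complex poly poly => complex => complex poly poly => bool" where
 "tri_form f q l \<kappa> l' \<longleftrightarrow> visible_dec f q l \<and> totdeg l' \<le> 1 \<and> ldet l l' \<noteq> 0 \<and> \<kappa> \<noteq> 0 \<and>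
   q = cpoly2 (1/(2*\<kappa>))*(l^2+l*l'+l'^2) - cpoly2 (\<kappa>/2)*(l - l')"

lemma visible_dec_q:
 assumes "totdeg f = 4" "visible_dec f q l" shows "totdeg q = 2"
proof (rule ccontr)
 assume "totdeg q \<noteq> 2"
 then have "totdeg q \<le> 1" using assms(2) unfolding visible_dec_def by simp
 then have "totdeg (q^2) \<le> 2" using totdeg_power_le[of q 1 2] by simp
 moreover have "totdeg (l^3) \<le> 3" using assms(2) totdeg_power_le[of l 1 3] unfolding visible_dec_def by simp
 ultimately have "totdeg f \<le> 3" using assms(2) totdeg_add_le[of "q^2" 3 "l^3"] unfolding visible_dec_def by simp
 then show False using assms(1) by simp
qed

lemma visible_dec_uminus: "visible_dec f q l ==> visible_dec f (- q) l"
 unfolding visible_dec_def by (auto simp: totdeg_uminus_le)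

text \<open>From q^2 + l^3 = q'^2 + l'^3 one gets (q' - q)(q' + q) = l^3 - l'^3, a product of three
  polynomials l - \<open>\<omega>\<close> l' of degree at most 1. Up to the sign of q' the
  difference m = q' - q has degree at most 1. If m = 0 the lines agree up to a cube root of unity;
  if m is linear it is prime and divides one of the factors, and \<open>\<kappa>\<close> is the
  constant of proportionality.\<close>

theorem visible_dec_compare:
 assumes f: "totdeg f = 4" "irreducible f" and v: "visible_dec f q l" "visible_dec f q' l'"
 shows "(\<exists>\<omega>. \<omega>^3 = 1 \<and> l' = cpoly2 \<omega>*l \<and> (q' = q \<or> q' = - q)) \<or>
   (\<exists>\<omega> \<kappa>. \<omega>^3 = 1 \<and> tri_form f q l \<kappa> (cpoly2 \<omega>*l') \<and> (q' = q + cpoly2 \<kappa>*(l - cpoly2 \<omega>*l') \<or> q' = - (q + cpoly2 \<kappa>*(l - cpoly2 \<omega>*l'))))"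
proof -
 have main: "(\<exists>\<omega>. \<omega>^3 = 1 \<and> l' = cpoly2 \<omega>*l \<and> q' = q) \<or>
   (\<exists>\<omega> \<kappa>. \<omega>^3 = 1 \<and> tri_form f q l \<kappa> (cpoly2 \<omega>*l') \<and> q' = q + cpoly2 \<kappa>*(l - cpoly2 \<omega>*l'))"
  if v': "visible_dec f q' l'" and m1: "totdeg (q' - q) \<le> 1" for q'
 proof -
  define m where "m = q' - q"
  have eq: "m*(2*q+m) = l^3 - l'^3"
  proof -
   have "q^2+l^3 = q'^2+l'^3" using v(1) v' unfolding visible_dec_def by simp
   then show ?thesis unfolding m_def by (simp add: algebra_simps power2_eq_square)
  qed
  have tl: "totdeg l \<le> 1" "totdeg l' \<le> 1" using v unfolding visible_dec_def by auto
  define D where "D = (%\<omega>. l - cpoly2 \<omega>*l')"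
  have D3: "l^3 - l'^3 = D 1*(D cubert*D (cubert^2))"
   using cube_diff_factor[of l l'] unfolding D_def by (simp add: cpoly2_1)
  have cub: "(1::complex)^3 = 1" "cubert^3 = 1" "(cubert^2)^3 = 1"
  proof -
   have "(cubert^2)^3 = (cubert^3)^2" by (simp flip: power_mult)
   then show "(cubert^2)^3 = 1" unfolding cubert_cube by simp
  qed (simp_all add: cubert_cube)
  have Dd: "totdeg (D \<omega>) \<le> 1" for \<omega> unfolding D_def
   by (intro totdeg_diff_le tl) (use totdeg_mult_le[of "cpoly2 \<omega>" 0 l' 1] tl totdeg_cpoly2 in auto)
  have qq: "totdeg q = 2" using visible_dec_q[OF f(1) v(1)] .
  have two: "(2 :: complex poly poly) = cpoly2 2" by (simp add: cpoly2_def numeral_poly)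
  have t2: "totdeg (2*q+m) = 2"
  proof (rule ccontr)
   assume "totdeg (2*q+m) \<noteq> 2"
   moreover have "totdeg (2*q) = 2" unfolding two by (subst totdeg_cmult) (use qq in auto)
   moreover have "totdeg (2*q+m) \<le> 2" by (rule totdeg_add_le) (use calculation m1 m_def in auto)
   ultimately have "totdeg (2*q+m) \<le> 1" by simp
   then have "totdeg ((2*q+m) - m) \<le> 1" by (rule totdeg_diff_le) (use m1 m_def in auto)
   then show False using \<open>totdeg (2 * q) = 2\<close> by simp
  qed
  show ?thesis
  proof (cases "m = 0")
   case True
   then have "D 1*(D cubert*D (cubert^2)) = 0" using eq D3 by simp
   then have "D 1 = 0 \<or> D cubert = 0 \<or> D (cubert^2) = 0" by simp
   then have "\<exists>\<omega>. \<omega>^3 = 1 \<and> D \<omega> = 0" by (elim disjE) (use cub in blast)+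
   then obtain \<omega> where w: "\<omega>^3 = 1" "D \<omega> = 0" by blast
   have wn: "\<omega> \<noteq> 0" using w(1) by auto
   have "l = cpoly2 \<omega>*l'" using w unfolding D_def by simp
   then have "cpoly2 (1/\<omega>)*l = l'" using wn by (simp flip: cpoly2_mult mult.assoc add: cpoly2_1)
   moreover have "(1/\<omega>)^3 = 1" using w(1) by (simp add: power_divide)
   ultimately show ?thesis using True unfolding m_def by auto
  next
   case False
   have nz: "2*q+m \<noteq> 0" using t2 totdeg_0 by auto
   have Dnz: "D 1 \<noteq> 0" "D cubert \<noteq> 0" "D (cubert^2) \<noteq> 0" using eq D3 False nz by auto
   have sum: "totdeg m+2 = totdeg (D 1)+(totdeg (D cubert)+totdeg (D (cubert^2)))"
   proof -
    have "totdeg m+totdeg (2*q+m) = totdeg (D 1*(D cubert*D (cubert^2)))"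
     unfolding totdeg_mult[OF False nz, symmetric] eq D3 ..
    then show ?thesis using t2 Dnz by (simp add: totdeg_mult)
   qed
   have qeval: "eval2 f x y = (eval2 q x y)^2+(eval2 l x y)^3" for x y
    using v(1) unfolding visible_dec_def by (simp add: eval2_simps)
   show ?thesis
   proof (cases "totdeg m = 0")
    \<comment> \<open>For m a nonzero constant, counting degrees leaves one factor l -
      \<open>\<omega>\<close> l' constant; then q, and with it f, is a polynomial in l
      alone.\<close>
    case True
    then obtain \<omega> where w: "\<omega>^3 = 1" "totdeg (D \<omega>) = 0"
    proof -
     have "totdeg (D 1) = 0 \<or> totdeg (D cubert) = 0 \<or> totdeg (D (cubert^2)) = 0"
      using sum Dd[of 1] Dd[of cubert] Dd[of "cubert^2"] True by linarith
     then have "\<exists>\<omega>. \<omega>^3 = 1 \<and> totdeg (D \<omega>) = 0" by (elim disjE) (use cub in blast)+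
     then show ?thesis using that by blast
    qed
    obtain c where c: "D \<omega> = cpoly2 c" using totdeg_0_imp_const[OF w(2)] by blast
    obtain k where k: "m = cpoly2 k" using totdeg_0_imp_const[OF True] by blast
    have kn: "k \<noteq> 0" using False k by (simp add: cpoly2_eq_0_iff)
    have e: "k*(2*eval2 q x y + k) = (eval2 l x y)^3 - (eval2 l x y - c)^3" for x y
    proof -
     have "eval2 (m*(2*q+m)) x y = eval2 (l^3 - l'^3) x y" using eq by simp
     then have 1: "k*(2*eval2 q x y + k) = (eval2 l x y)^3 - (eval2 l' x y)^3"
      unfolding k two by (simp add: eval2_simps)
     have "eval2 (D \<omega>) x y = c" unfolding c by (simp add: eval2_simps)
     then have "\<omega>*eval2 l' x y = eval2 l x y - c" unfolding D_def by (simp add: eval2_simps algebra_simps)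
     then have "(eval2 l' x y)^3 = (eval2 l x y - c)^3" using w(1) by (metis mult_1 power_mult_distrib)
     then show ?thesis using 1 by simp
    qed
    have "2*eval2 q x y = (3 * c*(eval2 l x y)^2 - 3 * c^2*eval2 l x y + c^3) / k - k" for x y
     using e[of x y] kn by (simp add: field_simps power2_eq_square power3_eq_cube)
    then have qL: "eval2 q x y = ((3 * c*(eval2 l x y)^2 - 3 * c^2*eval2 l x y + c^3) / k - k)/2" for x y
     by (metis nonzero_mult_div_cancel_left zero_neq_numeral)
    define P0 where "P0 = smult (1/2) [:c^3 / k - k, - (3 * c^2 / k), 3 * c / k:]"
    have "eval2 q x y = poly P0 (eval2 l x y)" for x y
     unfolding qL P0_def by (simp add: algebra_simps add_divide_distrib diff_divide_distrib power2_eq_square)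
    then have "eval2 f x y = poly (P0^2+[:0, 0, 0, 1:]) (eval2 l x y)" for x y
     unfolding qeval by (simp add: power3_eq_cube)
    then show ?thesis using not_poly_in_linear[OF f tl(1)] by blast
   next
    case tm: False
    then have tm1: "totdeg m = 1" using m1 unfolding m_def by simp
    have pm: "prime_elem m" using totdeg_1_prime[OF tm1] .
    have "m dvd D 1*(D cubert*D (cubert^2))" unfolding D3[symmetric] eq[symmetric] by simp
    then obtain \<omega> where w: "\<omega>^3 = 1" "m dvd D \<omega>" "D \<omega> \<noteq> 0"
     using prime_elem_dvd_mult_iff[OF pm] cub Dnz by metis
    obtain k where k: "D \<omega> = m * k" using w(2) by (elim dvdE)
    then have "k \<noteq> 0" using w(3) by auto
    then have "totdeg k = 0" using totdeg_mult[OF False, of k] k Dd[of \<omega>] tm1 by simp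
    then obtain c where c: "k = cpoly2 c" using totdeg_0_imp_const by blast
    have cn: "c \<noteq> 0" using \<open>k \<noteq> 0\<close> c by (simp add: cpoly2_eq_0_iff)
    \<comment> \<open>The prime m divides l - \<open>\<omega>\<close> l' with constant quotient c,
      so m is \<open>\<kappa>\<close> times that difference.\<close>
    define \<kappa> where "\<kappa> = 1 / c"
    have \<kappa>: "\<kappa> \<noteq> 0" unfolding \<kappa>_def using cn by simp
    define l2 where "l2 = cpoly2 \<omega>*l'"
    have mk: "m = cpoly2 \<kappa>*(l - l2)"
     using k cn unfolding D_def l2_def[symmetric] c \<kappa>_def
     by (metis cpoly2_1 cpoly2_mult mult.commute mult.left_commute mult_1 nonzero_eq_divide_eq)
    have l23: "l2^3 = l'^3" unfolding l2_def power_mult_distrib using w(1) by (simp flip: cpoly2_power add: cpoly2_1)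
    have "m*(2*q+m) = (l - l2)*(l^2+l*l2+l2^2)"
     unfolding eq l23[symmetric] by (simp add: algebra_simps power2_eq_square power3_eq_cube)
    then have "(l - l2)*(cpoly2 \<kappa>*(2*q+m)) = (l - l2)*(l^2+l*l2+l2^2)"
     unfolding mk by (simp add: algebra_simps)
    moreover have "l - l2 \<noteq> 0" using w(3) unfolding D_def l2_def .
    ultimately have q1: "cpoly2 \<kappa>*(2*q+m) = l^2+l*l2+l2^2" by simp
    have qf: "q = cpoly2 (1/(2*\<kappa>))*(l^2+l*l2+l2^2) - cpoly2 (\<kappa>/2)*(l - l2)"
    proof (rule eval2_inject)
     fix x y
     define a b e where "a = eval2 l x y" and "b = eval2 l2 x y" and "e = eval2 q x y"
     have "\<kappa>*(2*e+\<kappa>*(a - b)) = a^2+a*b+b^2"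
      using arg_cong[OF q1, of "%p. eval2 p x y"] unfolding mk two a_def b_def e_def by (simp add: eval2_simps)
     then have "e = 1/(2*\<kappa>)*(a^2+a*b+b^2) - \<kappa>/2*(a - b)"
     proof -
      assume S: "\<kappa>*(2*e+\<kappa>*(a - b)) = a^2+a*b+b^2"
      have "2*e+\<kappa>*(a - b) = (a^2+a*b+b^2)/\<kappa>"
       unfolding S[symmetric] using \<kappa> by simp
      then have "e = ((a^2+a*b+b^2)/\<kappa> - \<kappa>*(a - b))/2" by (simp add: eq_diff_eq[symmetric] mult.commute)
      then show ?thesis using \<kappa> by (simp add: diff_divide_distrib)
     qed
     then show "eval2 q x y = eval2 (cpoly2 (1/(2*\<kappa>))*(l^2+l*l2+l2^2) - cpoly2 (\<kappa>/2)*(l - l2)) x y"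
      unfolding a_def b_def e_def by (simp add: eval2_simps)
    qed
    have tl2: "totdeg l2 \<le> 1" unfolding l2_def
     using totdeg_mult_le[of "cpoly2 \<omega>" 0 l' 1] tl totdeg_cpoly2 by auto
    have "ldet l l2 \<noteq> 0"
    proof
     assume "ldet l l2 = 0"
     then obtain p \<alpha> \<beta> \<gamma> \<delta> where p: "totdeg p \<le> 1" "\<And>x y. eval2 l x y = \<alpha>+\<beta>*eval2 p x y"
      "\<And>x y. eval2 l2 x y = \<gamma>+\<delta>*eval2 p x y" using ldet_0_dependent[OF tl(1) tl2] by blast
     define A B where "A = [:\<alpha>, \<beta>:]" and "B = [:\<gamma>, \<delta>:]"
     have AB: "eval2 l x y = poly A (eval2 p x y)" "eval2 l2 x y = poly B (eval2 p x y)" for x y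
      unfolding A_def B_def p by (simp_all add: mult.commute)
     have "eval2 f x y = poly ((smult (1/(2*\<kappa>)) (A^2+A*B+B^2) - smult (\<kappa>/2) (A - B))^2+A^3) (eval2 p x y)" for x y
      unfolding qeval qf by (simp add: eval2_simps AB)
     then show False using not_poly_in_linear[OF f p(1)] by blast
    qed
    then have "tri_form f q l \<kappa> l2" unfolding tri_form_def using v(1) tl2 \<kappa> qf by simp
    moreover have "q' = q + cpoly2 \<kappa>*(l - l2)" using mk unfolding m_def by (simp add: algebra_simps)
    ultimately show ?thesis using w(1) unfolding l2_def by blast
   qed
  qed
 qed
 \<comment> \<open>If neither sign gave degree at most 1, the product (q' - q)(q' + q) would have
   degree at least 4, but it equals a difference of cubes of linear polynomials.\<close>
 have "totdeg (q' - q) \<le> 1 \<or> totdeg (- q' - q) \<le> 1"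
 proof (rule ccontr)
  assume c: "\<not> ?thesis"
  have q2: "totdeg q \<le> 2" "totdeg q' \<le> 2" "totdeg l \<le> 1" "totdeg l' \<le> 1" using v unfolding visible_dec_def by auto
  have nz: "q' - q \<noteq> 0" "q'+q \<noteq> 0" using c totdeg_0 by (auto simp: add_eq_0_iff)
  have m2: "totdeg (q'+q) \<ge> 2"
  proof -
   have "- q' - q = cpoly2 (- 1)*(q'+q)" by (simp add: cpoly2_uminus cpoly2_1)
   then have "totdeg (- q' - q) = totdeg (q'+q)" by (simp add: totdeg_cmult)
   then show ?thesis using c by simp
  qed
  have "(q' - q)*(q'+q) = l^3 - l'^3"
  proof -
   have "q^2+l^3 = q'^2+l'^3" using v unfolding visible_dec_def by simp
   then show ?thesis by (simp add: algebra_simps power2_eq_square)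
  qed
  moreover have "totdeg (l^3 - l'^3) \<le> 3"
   using totdeg_diff_le totdeg_power_le[OF q2(3), of 3] totdeg_power_le[OF q2(4), of 3] by simp
  moreover have "totdeg ((q' - q)*(q'+q)) \<ge> 4" using totdeg_mult[OF nz] m2 c by simp
  ultimately show False by simp
 qed
 then show ?thesis
 proof
  assume "totdeg (q' - q) \<le> 1"
  then show ?thesis using main[OF v(2)] by blast
 next
  assume "totdeg (- q' - q) \<le> 1"
  then show ?thesis using main[OF visible_dec_uminus[OF v(2)]] by (metis add.inverse_inverse)
 qed
qed

lemma top_poly_add: "top_poly d (p+q) = top_poly d p+top_poly d q"
 by (rule poly_ext) (simp add: poly_top_poly homog_add)

lemma top_poly_mult:
 "totdeg p \<le> d ==> totdeg q \<le> e ==> top_poly (d+e) (p*q) = top_poly d p*top_poly e q"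
 by (rule poly_ext) (simp add: poly_top_poly homog_mult)

lemma top_poly_power:
 assumes "totdeg p \<le> d" shows "top_poly (n*d) (p^n) = top_poly d p^n"
proof (induction n)
 case 0
 have "poly (top_poly 0 (1 :: complex poly poly)) m = 1" for m
  unfolding poly_top_poly by (simp add: homog_def)
 then show ?case by (intro poly_ext) simp
next
 case (Suc n)
 then show ?case using top_poly_mult[OF assms totdeg_power_le[OF assms, of n]] by simp
qed

lemma degree_top_poly: "degree (top_poly d p) \<le> d"
 unfolding top_poly_def by (rule degree_sum_le) (auto intro: order_trans[OF degree_monom_le])

text \<open>The exponents 2 and 3 force every root of \<open>T2\<close> to have even multiplicity:
  dividing repeatedly by the linear factor of one root shows that it divides \<open>T2\<close>
  twice, and degree at most 2 leaves a constant.\<close>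

lemma square_eq_minus_cube:
 fixes T2 T3 :: "complex poly"
 assumes eq: "T2^3+T3^2 = 0" and d: "degree T2 \<le> 2" and nz: "T2 \<noteq> 0"
 obtains S where "degree S \<le> 1" "T2 = - (S^2)" "T3 = S^3"
proof -
 have "\<exists>S. degree S \<le> 1 \<and> T2 = - (S^2)"
 proof (cases "degree T2 = 0")
  case True
  then obtain a where a: "T2 = [:a:]" using degree_eq_zeroE by blast
  have "[:csqrt (- a):]^2 = [:- a:]" by (metis poly_const_pow power2_csqrt)
  then show ?thesis using a by (intro exI[of _ "[:csqrt (- a):]"]) auto
 next
  case False
  then have "\<not> constant (poly T2)" by (simp add: constant_degree)
  then obtain r where "poly T2 r = 0" using fundamental_theorem_of_algebra by blast
  define u where "u = [:- r, 1:]"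
  have un: "u \<noteq> 0" unfolding u_def by simp
  have rt: "poly p r = 0 \<longleftrightarrow> u dvd p" for p unfolding u_def by (rule poly_eq_0_iff_dvd)
  obtain A where A: "T2 = u*A" using \<open>poly T2 r = 0\<close> rt by (metis dvdE)
  have "poly T3 r^2 = 0" using arg_cong[OF eq, of "%p. poly p r"] \<open>poly T2 r = 0\<close> by simp
  then obtain B where B: "T3 = u*B" using rt by (metis dvdE power_eq_0_iff)
  have "u^2*(u*A^3+B^2) = 0" using eq unfolding A B by (simp add: algebra_simps power2_eq_square power3_eq_cube)
  then have e1: "u*A^3+B^2 = 0" using un by simp
  have "poly u r = 0" unfolding u_def by simp
  then have "poly B r^2 = 0" using arg_cong[OF e1, of "%p. poly p r"] by simp
  then obtain C where C: "B = u*C" using rt by (metis dvdE power_eq_0_iff)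
  have "u*(A^3+u*C^2) = 0" using e1 unfolding C by (simp add: algebra_simps power2_eq_square)
  then have "A^3+u*C^2 = 0" using un by simp
  then have "poly A r^3 = 0" using \<open>poly u r = 0\<close> by (metis add_0_right mult_zero_left poly_0 poly_add poly_mult poly_power)
  then obtain A' where A': "A = u*A'" using rt by (metis dvdE power_eq_0_iff)
  have T2: "T2 = u^2*A'" unfolding A A' by (simp add: power2_eq_square)
  have "A' \<noteq> 0" using nz T2 by auto
  moreover have "degree (u^2) = 2" unfolding u_def by (simp add: degree_power_eq)
  ultimately have "degree A' = 0" using d T2 un by (simp add: degree_mult_eq)
  then obtain a where a: "A' = [:a:]" using degree_eq_zeroE by blast
  have c: "csqrt (- a) * csqrt (- a) = - a" by (metis power2_csqrt power2_eq_square)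
  have "(smult (csqrt (- a)) u)^2 = smult (- a) (u^2)" by (simp add: power2_eq_square c)
  moreover have "degree (smult (csqrt (- a)) u) \<le> 1" unfolding u_def by simp
  ultimately show ?thesis using T2 a by (intro exI[of _ "smult (csqrt (- a)) u"]) (auto simp: mult.commute)
 qed
 then obtain S where S: "degree S \<le> 1" "T2 = - (S^2)" by blast
 have "T3^2 = (S^3)^2"
 proof -
  have "(- (S^2))^3 = - ((S^3)^2)" by (simp flip: power_mult)
  then show ?thesis using eq unfolding S(2) by simp
 qed
 then have "T3 = S^3 \<or> T3 = - (S^3)" using power2_eq_iff by blast
 then show ?thesis
 proof
  assume "T3 = - (S^3)"
  then show ?thesis using that[of "- S"] S by simp
 qed (use that[of S] S in simp)
qed

lemma homogeneous_zero:
 assumes hom: "\<And>t x y. eval2 e (t*x) (t*y) = t^4*eval2 e x y" and d: "totdeg e \<le> 3"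
 shows "e = 0"
proof (rule eval2_inject)
 fix x y
 have d4: "totdeg e \<le> 4" using d by simp
 have "homog 4 e (x, y, z) = eval2 e x y" if "z \<noteq> 0" for z
  using homog_eval2[OF d4 that, of x y] hom[of "1/z" x y] that by (simp add: power_divide)
 then have "homog 4 e (x, y, 0) = eval2 e x y"
  by (intro eq_at_0_by_continuity[of "%z. homog 4 e (x, y, z)" "%_. eval2 e x y"]) (auto intro!: continuous_homog continuous_intros)
 moreover have "homog 4 e (x, y, 0) = 0"
  unfolding homog_at_infinity by (intro sum.neutral ballI) (simp add: totdeg_leD[OF d])
 ultimately show "eval2 e x y = eval2 0 x y" by (simp add: eval2_0)
qed

text \<open>The coefficient 3/2 is the one for which x^4 y cancels along with x^6, so that linear x
  and y give a polynomial of degree at most 4.\<close>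

definition invisible_form :: "complex poly poly => complex poly poly => complex poly poly => complex => bool" where
 "invisible_form f x y \<epsilon> \<longleftrightarrow> totdeg x \<le> 1 \<and> totdeg y \<le> 1 \<and> ldet x y \<noteq> 0 \<and> \<epsilon> \<noteq> 0 \<and>
   f = (y - x^2)^3+(x^3 - cpoly2 (3/2)*x*y + cpoly2 \<epsilon>)^2"

text \<open>The leading forms of g2 and g3 are -S^2 and S^3 for a linear form S, represented by
  \<open>\<Lambda>\<close>. Cancellation in degree 5 determines the quadratic part of g3, and in
  degree 4 the square at infinity gives an equation between linear forms which is solved by
  factoring over the complex numbers. A final translation removes the remaining parameter.\<close>

theorem invisible_normal_form:
 assumes f: "totdeg f = 4" "irreducible f"
  and h: "totdeg h \<le> 2" "totdeg (f - h^2) \<le> 3"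
  and g: "f = g2^3+g3^2" "totdeg g2 = 2" "totdeg g3 \<le> 3"
 obtains x y \<epsilon> where "invisible_form f x y \<epsilon>" "g2 = y - x^2" "g3 = x^3 - cpoly2 (3/2)*x*y + cpoly2 \<epsilon>"
proof -
 have g2n: "g2 \<noteq> 0" using g(2) totdeg_0 by auto
 have t6: "totdeg (g2^3) \<le> 6" "totdeg (g3^2) \<le> 6"
  using totdeg_power_le[of g2 2 3] totdeg_power_le[of g3 3 2] g by auto
 have "top_poly 2 g2^3+top_poly 3 g3^2 = top_poly 6 f"
  using top_poly_power[of g2 2 3] top_poly_power[of g3 3 2] g by (simp add: top_poly_add)
 also have "\<dots> = 0" using top_poly_eq_0_iff[of f 5] f(1) by simp
 finally have "top_poly 2 g2^3+top_poly 3 g3^2 = 0" .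
 then obtain S where S: "degree S \<le> 1" "top_poly 2 g2 = - (S^2)" "top_poly 3 g3 = S^3"
  using square_eq_minus_cube[OF _ degree_top_poly] top_poly_totdeg_nz[OF g2n] g(2) by metis
 define \<Lambda> where "\<Lambda> = [:[:0, coeff S 0:], [:coeff S 1:]:]"
 have l1: "totdeg \<Lambda> \<le> 1" unfolding totdeg_le_iff \<Lambda>_def by (auto simp: coeff_pCons split: nat.splits)
 have tl: "top_poly 1 \<Lambda> = S"
 proof (rule poly_eqI)
  fix n show "coeff (top_poly 1 \<Lambda>) n = coeff S n"
  proof (cases "n \<le> 1")
   case True
   then show ?thesis using coeff_top_poly[of n 1 \<Lambda>] unfolding \<Lambda>_def by (cases n) auto
  next
   case False
   then show ?thesis using S(1) degree_top_poly[of 1 \<Lambda>] by (simp add: coeff_eq_0)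
  qed
 qed
 have Sn: "S \<noteq> 0" using S(2) top_poly_totdeg_nz[OF g2n] g(2) by auto
 have ln: "\<Lambda> \<noteq> 0" using Sn tl unfolding top_poly_def by auto
 have l1': "totdeg \<Lambda> = 1" using top_poly_eq_0_iff[of \<Lambda> 0] l1 tl Sn by (auto simp: le_Suc_eq)
 have homl: "eval2 \<Lambda> (t*x) (t*y) = t*eval2 \<Lambda> x y" for t x y
  unfolding eval2_linear[OF l1] unfolding \<Lambda>_def by (simp add: algebra_simps)
 define m where "m = g2+\<Lambda>^2"
 have m1: "totdeg m \<le> 1"
 proof -
  have "totdeg m \<le> 2" unfolding m_def using totdeg_add_le[of g2 2 "\<Lambda>^2"] totdeg_power_le[OF l1, of 2] g by simp
  moreover have "top_poly 2 m = 0"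
   unfolding m_def top_poly_add S(2) using top_poly_power[OF l1, of 2] tl by simp
  ultimately show ?thesis using top_poly_eq_0_iff[of m 1] by (simp add: numeral_2_eq_2)
 qed
 define p where "p = g3 - \<Lambda>^3"
 have p2: "totdeg p \<le> 2"
 proof -
  have "totdeg p \<le> 3" unfolding p_def using totdeg_diff_le[of g3 3 "\<Lambda>^3"] totdeg_power_le[OF l1, of 3] g by simp
  moreover have "g3 = p+\<Lambda>^3" unfolding p_def by simp
  then have "top_poly 3 p = 0" using S(3) top_poly_add[of 3 p "\<Lambda>^3"] top_poly_power[OF l1, of 3] tl by simp
  ultimately show ?thesis using top_poly_eq_0_iff[of p 2] by (simp add: numeral_3_eq_3 numeral_2_eq_2)
 qed
 \<comment> \<open>The part of degree 5 of g2^3 + g3^2 comes from 2 \<open>\<Lambda>\<close>^3 n;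
   since f has degree 4, n must have degree at most 1.\<close>
 define n where "n = p + cpoly2 (3/2)*\<Lambda>*m"
 have lm: "totdeg (\<Lambda>*m) \<le> 2" using totdeg_mult_le[OF l1 m1] by simp
 have ev: "eval2 g2 x y = eval2 m x y - eval2 \<Lambda> x y^2" "eval2 g3 x y = eval2 \<Lambda> x y^3+eval2 p x y"
  "eval2 p x y = eval2 n x y - 3/2*eval2 \<Lambda> x y*eval2 m x y"
  "eval2 f x y = eval2 g2 x y^3+eval2 g3 x y^2" for x y
  using arg_cong[OF g(1), of "%p. eval2 p x y"] unfolding m_def p_def n_def
  by (simp_all only: eval2_simps) (simp_all add: algebra_simps)
 have n1: "totdeg n \<le> 1"
 proof -
  have e: "cpoly2 2*(\<Lambda>^3*n) = f + cpoly2 3*(\<Lambda>*m)^2 - m^3 - p^2"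
   by (rule eval2_inject) (unfold eval2_simps ev, algebra)
  have "totdeg (f + cpoly2 3*(\<Lambda>*m)^2 - m^3 - p^2) \<le> 4"
   using f(1) totdeg_power_le[OF lm, of 2] totdeg_power_le[OF m1, of 3] totdeg_power_le[OF p2, of 2]
   by (intro totdeg_diff_le totdeg_add_le) (auto simp: totdeg_cmult)
  then have t: "totdeg (\<Lambda>^3*n) \<le> 4" unfolding e[symmetric] by (simp add: totdeg_cmult)
  show ?thesis
  proof (cases "n = 0")
   case False
   have "totdeg (\<Lambda>^3) = 3" using ln l1' by (simp add: power3_eq_cube totdeg_mult)
   then show ?thesis using t totdeg_mult[of "\<Lambda>^3" n] ln False by simp
  qed (simp add: totdeg_0)
 qed
 define m0 n0 where "m0 = coeff (coeff m 0) 0" and "n0 = coeff (coeff n 0) 0"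
 define ml nl where "ml = m - cpoly2 m0" and "nl = n - cpoly2 n0"
 have ml1: "totdeg ml \<le> 1" "totdeg nl \<le> 1" unfolding ml_def nl_def
  using m1 n1 totdeg_cpoly2 by (auto intro!: totdeg_diff_le)
 have homm: "eval2 ml (t*x) (t*y) = t*eval2 ml x y" "eval2 nl (t*x) (t*y) = t*eval2 nl x y" for t x y
  unfolding ml_def nl_def m0_def n0_def eval2_simps eval2_linear[OF m1] eval2_linear[OF n1] by (simp_all add: algebra_simps)
 define h2 where "h2 = [:[:0, 0, coeff (coeff h 0) 2:], [:0, coeff (coeff h 1) 1:], [:coeff (coeff h 2) 0:]:]"
 have h22: "totdeg h2 \<le> 2" unfolding totdeg_le_iff h2_def by (auto simp: coeff_pCons split: nat.splits)
 have homh: "eval2 h2 (t*x) (t*y) = t^2*eval2 h2 x y" for t x y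
  unfolding h2_def eval2_poly by (simp add: algebra_simps power2_eq_square)
 have hh: "totdeg (h - h2) \<le> 1"
  unfolding totdeg_le_iff
 proof (intro allI impI)
  fix i j :: nat assume ij: "1 < i+j"
  show "coeff (coeff (h - h2) j) i = 0"
  proof (cases "i+j = 2")
   case True
   then have "(i = 0 \<and> j = 2) \<or> (i = 1 \<and> j = 1) \<or> (i = 2 \<and> j = 0)" by auto
   then show ?thesis unfolding h2_def by (auto simp: numeral_2_eq_2)
  next
   case False
   then show ?thesis using totdeg_leD[OF totdeg_diff_le[OF h(1) h22], of i j] ij by auto
  qed
 qed
 \<comment> \<open>The homogeneous part of degree 4 of f minus the square of the quadratic part of
   h. Modulo degree 3 it equals f - h^2, so it has degree at most 3 and therefore vanishes.\<close>
 define e4 where "e4 = \<Lambda>^2*(cpoly2 2*\<Lambda>*nl - cpoly2 (3/4)*ml^2) - h2^2"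
 have "e4 = 0"
 proof (rule homogeneous_zero)
  show "eval2 e4 (t*x) (t*y) = t^4*eval2 e4 x y" for t x y
   unfolding e4_def eval2_simps homl homm homh by (simp add: algebra_simps power2_eq_square power4_eq_xxxx)
  have e: "e4 = (f - h^2) - (m^3 - cpoly2 3*((\<Lambda>*m)*n)+n^2) - \<Lambda>^2*(cpoly2 (2*n0)*\<Lambda> - cpoly2 (3/4)*(cpoly2 m0*(m+ml)))
    +(h - h2)*(h+h2)"
   by (rule eval2_inject) (unfold e4_def ml_def nl_def eval2_simps ev, algebra)
  have mm: "totdeg (m+ml) \<le> 1" using m1 ml1 totdeg_add_le by blast
  have lin: "totdeg (cpoly2 c*q) \<le> 1" if "totdeg q \<le> 1" for c q
   using totdeg_mult_le[of "cpoly2 c" 0 q 1] that totdeg_cpoly2 by auto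
  have t1: "totdeg (m^3 - cpoly2 3*((\<Lambda>*m)*n)+n^2) \<le> 3"
   using totdeg_power_le[OF m1, of 3] totdeg_mult_le[OF lm n1] totdeg_power_le[OF n1, of 2]
   by (intro totdeg_add_le totdeg_diff_le) (auto simp: totdeg_cmult)
  have t2: "totdeg (\<Lambda>^2*(cpoly2 (2*n0)*\<Lambda> - cpoly2 (3/4)*(cpoly2 m0*(m+ml)))) \<le> 2+1"
   using totdeg_power_le[OF l1, of 2] by (intro totdeg_mult_le totdeg_diff_le lin l1 mm) auto
  have t3: "totdeg ((h - h2)*(h+h2)) \<le> 1+2"
   by (intro totdeg_mult_le hh totdeg_add_le h h22)
  have "totdeg (\<Lambda>^2*(cpoly2 (2*n0)*\<Lambda> - cpoly2 (3/4)*(cpoly2 m0*(m+ml)))) \<le> 3"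
   "totdeg ((h - h2)*(h+h2)) \<le> 3" using t2 t3 by linarith+
  then show "totdeg e4 \<le> 3" unfolding e by (intro totdeg_add_le totdeg_diff_le h(2) t1)
 qed
 then have key: "\<Lambda>^2*(cpoly2 2*\<Lambda>*nl - cpoly2 (3/4)*ml^2) = h2^2" unfolding e4_def by simp
 have pl: "prime_elem \<Lambda>" using totdeg_1_prime[OF l1'] .
 have "\<Lambda> dvd h2^2" unfolding key[symmetric] by (simp add: power2_eq_square)
 then have "\<Lambda> dvd h2" using prime_elem_dvd_power[OF pl] by blast
 then obtain k where k: "h2 = \<Lambda> * k" by (elim dvdE)
 have k1: "totdeg k \<le> 1"
 proof (cases "k = 0")
  case False then show ?thesis using totdeg_mult[OF ln False] k h22 l1' by simp
 qed (simp add: totdeg_0)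
 have "\<Lambda>^2*(cpoly2 2*\<Lambda>*nl - cpoly2 (3/4)*ml^2) = \<Lambda>^2 * k^2"
  unfolding key k by (simp add: power_mult_distrib)
 then have kk: "cpoly2 2*\<Lambda>*nl - cpoly2 (3/4)*ml^2 = k^2" using ln by simp
 \<comment> \<open>A square root of -3/4, which splits k^2 + (3/4) ml^2 into two linear factors; the
   prime \<open>\<Lambda>\<close> divides one of them.\<close>
 define j where "j = Complex 0 (sqrt 3/2)"
 have j2: "j^2 = - 3/4" unfolding j_def by (simp add: complex_eq_iff power2_eq_square)
 have fac: "(k - cpoly2 j*ml)*(k - cpoly2 (- j)*ml) = \<Lambda>*(cpoly2 2*nl)"
 proof (rule eval2_inject)
  fix x y
  have "2*eval2 \<Lambda> x y*eval2 nl x y - 3/4*eval2 ml x y^2 = eval2 k x y^2"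
   using arg_cong[OF kk, of "%p. eval2 p x y"] by (simp add: eval2_simps)
  then show "eval2 ((k - cpoly2 j*ml)*(k - cpoly2 (- j)*ml)) x y = eval2 (\<Lambda>*(cpoly2 2*nl)) x y"
   unfolding eval2_simps using j2 by algebra
 qed
 have "\<Lambda> dvd (k - cpoly2 j*ml)*(k - cpoly2 (- j)*ml)" unfolding fac by simp
 then have "\<exists>i. i^2 = - 3/4 \<and> \<Lambda> dvd k - cpoly2 i*ml"
  using prime_elem_dvd_mult_iff[OF pl] j2 by (metis power2_minus)
 then obtain i where i: "i^2 = - 3/4" "\<Lambda> dvd k - cpoly2 i*ml" by blast
 obtain u where u: "k - cpoly2 i*ml = \<Lambda>*u" using i(2) by (elim dvdE)
 have "totdeg u = 0"
 proof (cases "u = 0")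
  case False
  have "totdeg (k - cpoly2 i*ml) \<le> 1"
   using totdeg_mult_le[of "cpoly2 i" 0 ml 1] ml1 totdeg_cpoly2 k1 by (intro totdeg_diff_le) auto
  then show ?thesis using totdeg_mult[OF ln False] u l1' by simp
 qed (simp add: totdeg_0)
 then obtain \<mu> where \<mu>: "u = cpoly2 \<mu>" using totdeg_0_imp_const by blast
 \<comment> \<open>With this parameter the linear part of n becomes \<open>\<rho>\<close> ml - (2/3)
   \<open>\<rho>\<close>^2 \<open>\<Lambda>\<close>, the change produced by translating
   \<open>\<Lambda>\<close> by a multiple of \<open>\<rho>\<close>.\<close>
 define \<rho> where "\<rho> = i*\<mu>"
 have r2: "\<mu>^2/2 = - 2/3*\<rho>^2" unfolding \<rho>_def power_mult_distrib i(1) by simp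
 have "\<Lambda>*(cpoly2 2*nl) = \<Lambda>*(cpoly2 (2*\<rho>)*ml + cpoly2 (\<mu>^2)*\<Lambda>)"
 proof (rule eval2_inject)
  fix x y
  have 1: "2*eval2 \<Lambda> x y*eval2 nl x y - 3/4*eval2 ml x y^2 = eval2 k x y^2"
   using arg_cong[OF kk, of "%p. eval2 p x y"] by (simp add: eval2_simps)
  have 2: "eval2 k x y = i*eval2 ml x y+\<mu>*eval2 \<Lambda> x y"
   using arg_cong[OF u, of "%p. eval2 p x y"] unfolding \<mu> by (simp add: eval2_simps algebra_simps)
  have "2*eval2 \<Lambda> x y*eval2 nl x y = 2*i*\<mu>*eval2 ml x y*eval2 \<Lambda> x y+\<mu>^2*eval2 \<Lambda> x y^2"
   using 1 i(1) unfolding 2 by algebra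
  then show "eval2 (\<Lambda>*(cpoly2 2*nl)) x y = eval2 (\<Lambda>*(cpoly2 (2*\<rho>)*ml + cpoly2 (\<mu>^2)*\<Lambda>)) x y"
   unfolding eval2_simps \<rho>_def by (simp add: algebra_simps power2_eq_square)
 qed
 then have nl2: "cpoly2 2*nl = cpoly2 (2*\<rho>)*ml + cpoly2 (\<mu>^2)*\<Lambda>" using ln by simp
 have nle: "eval2 nl x y = \<rho>*eval2 ml x y - 2/3*\<rho>^2*eval2 \<Lambda> x y" for x y
 proof -
  have "2*eval2 nl x y = 2*\<rho>*eval2 ml x y+\<mu>^2*eval2 \<Lambda> x y"
   using arg_cong[OF nl2, of "%p. eval2 p x y"] by (simp add: eval2_simps)
  then have "eval2 nl x y = \<rho>*eval2 ml x y+\<mu>^2/2*eval2 \<Lambda> x y" by (simp add: field_simps)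
  then show ?thesis unfolding r2 by simp
 qed
 \<comment> \<open>The translation \<open>\<Lambda>\<close> - 2 \<open>\<rho>\<close>/3 absorbs
   \<open>\<rho>\<close>; \<open>Y\<close> is then dictated by g2 = Y - X^2 and
   \<open>\<epsilon>\<close> collects the constants left in g3.\<close>
 define X Y \<epsilon> where "X = \<Lambda> - cpoly2 (2*\<rho>/3)" and "Y = m - cpoly2 (4*\<rho>/3)*\<Lambda> + cpoly2 (4*\<rho>^2/9)"
  and "\<epsilon> = n0 - \<rho>*m0 - 4/27*\<rho>^3"
 have X1: "totdeg X \<le> 1" unfolding X_def using l1 totdeg_cpoly2 by (intro totdeg_diff_le) auto
 have Y1: "totdeg Y \<le> 1" unfolding Y_def
  using m1 l1 totdeg_cpoly2 totdeg_mult_le[of "cpoly2 (4*\<rho>/3)" 0 \<Lambda> 1] by (intro totdeg_diff_le totdeg_add_le) auto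
 have G2: "g2 = Y - X^2"
  by (rule eval2_inject) (simp only: X_def Y_def eval2_simps ev(1), simp add: field_simps power2_eq_square)
 have G3: "g3 = X^3 - cpoly2 (3/2)*X*Y + cpoly2 \<epsilon>"
 proof (rule eval2_inject)
  fix x y
  have "eval2 n x y = eval2 nl x y+n0" "eval2 ml x y = eval2 m x y - m0" unfolding nl_def ml_def by (simp_all add: eval2_simps)
  then have 1: "eval2 n x y = \<rho>*(eval2 m x y - m0) - 2/3*\<rho>^2*eval2 \<Lambda> x y+n0" using nle[of x y] by simp
  show "eval2 g3 x y = eval2 (X^3 - cpoly2 (3/2)*X*Y + cpoly2 \<epsilon>) x y"
   unfolding ev(2,3) 1 X_def Y_def \<epsilon>_def eval2_simps by (simp add: field_simps power2_eq_square power3_eq_cube)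
 qed
 have fe: "eval2 f x y = (eval2 Y x y - eval2 X x y^2)^3+(eval2 X x y^3 - 3/2*eval2 X x y*eval2 Y x y+\<epsilon>)^2" for x y
  unfolding ev(4) unfolding G2 G3 by (simp add: eval2_simps)
 \<comment> \<open>Without the constant term f would be Y^2 (Y - (3/4) X^2), against
   irreducibility.\<close>
 have e0: "\<epsilon> \<noteq> 0"
 proof
  assume "\<epsilon> = 0"
  have fac: "f = Y*(Y*(Y - cpoly2 (3/4)*X^2))"
  proof (rule eval2_inject)
   fix x y
   show "eval2 f x y = eval2 (Y*(Y*(Y - cpoly2 (3/4)*X^2))) x y"
    unfolding fe \<open>\<epsilon> = 0\<close> eval2_simps by (simp add: field_simps power2_eq_square power3_eq_cube)
  qed
  have nz: "Y \<noteq> 0" "Y*(Y - cpoly2 (3/4)*X^2) \<noteq> 0" using fac f(1) totdeg_0 by auto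
  have s: "totdeg Y+totdeg (Y*(Y - cpoly2 (3/4)*X^2)) = 4" using totdeg_mult[OF nz] fac f(1) by simp
  have "totdeg (Y*(Y - cpoly2 (3/4)*X^2)) \<le> 3"
  proof -
   have "totdeg (Y - cpoly2 (3/4)*X^2) \<le> 2"
    using Y1 totdeg_power_le[OF X1, of 2] by (intro totdeg_diff_le) (auto simp: totdeg_cmult)
   then show ?thesis using totdeg_mult_le[OF Y1] by fastforce
  qed
  then show False using irreducible_factor_totdeg[OF f(2) fac] s Y1 by auto
 qed
 have "ldet X Y \<noteq> 0"
 proof
  assume "ldet X Y = 0"
  then obtain q \<alpha> \<beta> \<gamma> \<delta> where q: "totdeg q \<le> 1" "\<And>x y. eval2 X x y = \<alpha>+\<beta>*eval2 q x y"
   "\<And>x y. eval2 Y x y = \<gamma>+\<delta>*eval2 q x y" using ldet_0_dependent[OF X1 Y1] by blast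
  define A B where "A = [:\<alpha>, \<beta>:]" and "B = [:\<gamma>, \<delta>:]"
  have AB: "eval2 X x y = poly A (eval2 q x y)" "eval2 Y x y = poly B (eval2 q x y)" for x y
   unfolding A_def B_def q by (simp_all add: mult.commute)
  have "eval2 f x y = poly ((B - A^2)^3+(A^3 - smult (3/2) (A*B)+[:\<epsilon>:])^2) (eval2 q x y)" for x y
   unfolding fe AB by (simp add: mult.assoc)
  then show False using not_poly_in_linear[OF f q(1)] by blast
 qed
 then have "invisible_form f X Y \<epsilon>" unfolding invisible_form_def using X1 Y1 e0 g(1) G2 G3 by simp
 then show ?thesis using that G2 G3 by blast
qed

section \<open>The three affine cusps of both normal forms\<close>

lemma homog_differentiable: "homog d p differentiable (at v)"
proof -
 have "homog d p = (%v. \<Sum>j\<le>d. \<Sum>i\<le>d - j. coeff (coeff p j) i*fst v ^ i*fst (snd v)^j * snd (snd v)^(d - i - j))"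
  unfolding homog_def by (auto simp: fun_eq_iff split: prod.splits)
 moreover have "fst differentiable (at v)" "(%v. fst (snd v)) differentiable (at v)" "(%v. snd (snd v)) differentiable (at v)" for v :: pt3
  by (auto intro!: bounded_linear_imp_differentiable bounded_linear_intros)
 ultimately show ?thesis
  by (auto intro!: differentiable_sum differentiable_mult differentiable_power differentiable_const)
qed

definition affine_cusp :: "complex poly poly => complex \<times> complex => bool" where
 "affine_cusp f P \<longleftrightarrow> sing_pt (homog 4 f) (fst P, snd P, 1) \<and> has_type (homog 4 f) (fst P, snd P, 1) (germ_A 2)"

text \<open>At a transversal common zero, g3 and g2 are themselves local coordinates, in which f is
  the standard cusp equation u^2 + v^3.\<close>

lemma affine_cuspI:
 assumes f: "totdeg f \<le> 4" "f = g2^3+g3^2" and t: "totdeg g2 \<le> 2" "totdeg g3 \<le> 3"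
  and z: "eval2 g2 x0 y0 = 0" "eval2 g3 x0 y0 = 0"
  and s: "sdiff (%z. eval2 g2 (x0+fst z) (y0 + snd z)) a b" "sdiff (%z. eval2 g3 (x0+fst z) (y0 + snd z)) c d"
  and det: "a*d - b * c \<noteq> 0"
 shows "affine_cusp f (x0, y0)"
proof -
 define v where "v = (x0, y0, 1::complex)"
 define A B where "A = homog 2 g2" and "B = homog 3 g3"
 have fe: "eval2 f x y = eval2 g2 x y^3+eval2 g3 x y^2" for x y unfolding f(2) by (simp add: eval2_simps)
 \<comment> \<open>The sum of cube and square of the homogenised pair has degree 6, hence the
   division by z^2. It vanishes to second order at v, so the full derivative of the quartic is zero
   there.\<close>
 have F: "homog 4 f u = (A u^3+B u^2)*inverse (snd (snd u)^2)" if "snd (snd u) \<noteq> 0" for u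
 proof -
  obtain x y z where u: "u = (x, y, z)" by (metis prod_cases3)
  then have zn: "z \<noteq> 0" using that by simp
  have "A u^3+B u^2 = z^6*eval2 f (x/z) (y/z)"
   unfolding A_def B_def u homog_eval2[OF t(1) zn] homog_eval2[OF t(2) zn] fe
   by (simp add: power_mult_distrib algebra_simps flip: power_mult)
  moreover have "homog 4 f u = z^4*eval2 f (x/z) (y/z)" unfolding u by (rule homog_eval2[OF f(1) zn])
  moreover have "z^6*inverse (z^2) = z^4" using zn by (simp add: field_simps flip: power_add)
  ultimately show ?thesis unfolding u by (metis mult.assoc mult.commute snd_conv)
 qed
 have AB0: "A v = 0" "B v = 0" unfolding A_def B_def v_def using homog_at_1 t z by auto
 obtain A' where A': "(A has_derivative A') (at v)" using homog_differentiable unfolding A_def differentiable_def by blast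
 obtain B' where B': "(B has_derivative B') (at v)" using homog_differentiable unfolding B_def differentiable_def by blast
 have K: "((%u. A u^3+B u^2) has_derivative (%_. 0)) (at v)"
  by (rule has_derivative_eq_rhs[OF has_derivative_add[OF has_derivative_power[OF A'] has_derivative_power[OF B']]])
   (simp add: AB0)
 have "(%u::pt3. inverse (snd (snd u)^2)) differentiable (at v)"
  by (intro differentiable_inverse differentiable_power) (auto simp: v_def intro!: bounded_linear_imp_differentiable bounded_linear_intros)
 then obtain M where M: "((%u::pt3. inverse (snd (snd u)^2)) has_derivative M) (at v)" unfolding differentiable_def by blast
 have KM: "((%u. (A u^3+B u^2)*inverse (snd (snd u)^2)) has_derivative (%_. 0)) (at v)"
  by (rule has_derivative_eq_rhs[OF has_derivative_mult[OF K M]]) (simp add: AB0)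
 have oS: "open {u::pt3. snd (snd u) \<noteq> 0}" by (intro open_Collect_neq continuous_intros)
 have der: "(homog 4 f has_derivative (%_. 0)) (at v)"
  by (rule has_derivative_transform_within_open[OF KM oS]) (use F in \<open>auto simp: v_def\<close>)
 have "homog 4 f v = 0" using F[of v] AB0 by (simp add: v_def)
 moreover have "v \<noteq> 0" unfolding v_def by (simp add: zero_prod_def)
 ultimately have sing: "sing_pt (homog 4 f) v" unfolding sing_pt_def on_curve_def using der by simp
 have chart: "homog 4 f (aff3 v s (1, 0, 0) t (0, 1, 0)) = eval2 g3 (x0 + s) (y0+t)^2+eval2 g2 (x0 + s) (y0+t)^3" for s t
  unfolding v_def aff3_simps using homog_at_1[OF f(1)] by (simp add: fe add.commute)
 have "top_equiv_germ {(s, t). homog 4 f (aff3 v s (1, 0, 0) t (0, 1, 0)) = 0} (germ_A 2)"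
 proof (rule top_equiv_germ_chart[OF s(2,1), of UNIV])
  show "c*b - d*a \<noteq> 0" using det by (simp add: algebra_simps)
  show "z \<in> {(s, t). homog 4 f (aff3 v s (1, 0, 0) t (0, 1, 0)) = 0} \<longleftrightarrow>
    (eval2 g3 (x0+fst z) (y0 + snd z), eval2 g2 (x0+fst z) (y0 + snd z)) \<in> germ_A 2" for z
   by (cases z) (simp add: chart germ_A_def)
 qed (use z in auto)
 moreover have "det3 v (1, 0, 0) (0, 1, 0) \<noteq> 0" unfolding v_def det3_simps by simp
 ultimately have "has_type (homog 4 f) v (germ_A 2)" unfolding has_type_def by blast
 then show ?thesis using sing unfolding affine_cusp_def v_def by simp
qed

definition three_cusps :: "complex poly poly => bool" where
 "three_cusps f \<longleftrightarrow> (\<exists>P1 P2 P3. P1 \<noteq> P2 \<and> P1 \<noteq> P3 \<and> P2 \<noteq> P3 \<and> affine_cusp f P1 \<and> affine_cusp f P2 \<and> affine_cusp f P3)"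

lemma sdiff_linear_shift:
 assumes "totdeg l \<le> 1"
 shows "sdiff (%z. eval2 l (x0+fst z) (y0 + snd z)) (coeff (coeff l 0) 1) (coeff (coeff l 1) 0)"
proof -
 have "(%z. eval2 l (x0+fst z) (y0 + snd z)) =
   (%z. eval2 l x0 y0+(coeff (coeff l 0) 1*fst z + coeff (coeff l 1) 0 * snd z))"
  by (rule ext) (simp add: eval2_linear[OF assms] algebra_simps)
 then show ?thesis
  using sdiff_add[OF sdiff_const[of "eval2 l x0 y0"] sdiff_add[OF sdiff_cmult[OF sdiff_fst, of "coeff (coeff l 0) 1"]
   sdiff_cmult[OF sdiff_snd, of "coeff (coeff l 1) 0"]]] by simp
qed

lemma sdiff_eq: "sdiff g a b ==> g = h ==> a = c ==> b = d ==> sdiff h c d"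
 by simp

lemma sdiff_power2: "sdiff g a b ==> sdiff (%z. g z^2) (2*g 0*a) (2*g 0*b)"
 by (rule sdiff_eq[OF sdiff_mult[of g a b g a b]]) (auto simp: power2_eq_square algebra_simps)

lemma sdiff_power3: "sdiff g a b ==> sdiff (%z. g z^3) (3*g 0^2*a) (3*g 0^2*b)"
 by (rule sdiff_eq[OF sdiff_mult[OF sdiff_power2[of g a b], of g a b]])
  (auto simp: power2_eq_square power3_eq_cube algebra_simps)

lemma sdiff_diff: "sdiff g a b ==> sdiff h c d ==> sdiff (%z. g z - h z) (a - c) (b - d)"
 by (rule sdiff_eq[OF sdiff_add[OF _ sdiff_cmult[of h c d "-1"], of g a b]]) auto

text \<open>The formula for q is equivalent to \<open>\<kappa>\<close> (2q + \<open>\<kappa>\<close>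
  (l - l')) = l^2 + l l' + l'^2; multiplied by l - l' this says that q'^2 - q^2 = l^3 -
  l'^3.\<close>

lemma tri_form_second:
 assumes "tri_form f q l \<kappa> l'"
 shows "visible_dec f (q + cpoly2 \<kappa>*(l - l')) l'"
proof -
 have k: "\<kappa> \<noteq> 0" and v: "visible_dec f q l" and l1: "totdeg l' \<le> 1"
  and q: "q = cpoly2 (1/(2*\<kappa>))*(l^2+l*l'+l'^2) - cpoly2 (\<kappa>/2)*(l - l')"
  using assms unfolding tri_form_def by blast+
 have tl: "totdeg l \<le> 1" "totdeg q \<le> 2" "f = q^2+l^3" using v unfolding visible_dec_def by auto
 have "f = (q + cpoly2 \<kappa>*(l - l'))^2+l'^3"
 proof (rule eval2_inject)
  fix x y
  define a b e where "a = eval2 l x y" and "b = eval2 l' x y" and "e = eval2 q x y"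
  have e: "e = 1/(2*\<kappa>)*(a^2+a*b+b^2) - \<kappa>/2*(a - b)"
   using arg_cong[OF q, of "%p. eval2 p x y"] unfolding a_def b_def e_def by (simp add: eval2_simps)
  have "\<kappa>*(2*e+\<kappa>*(a - b)) = a^2+a*b+b^2"
   unfolding e using k by (simp add: field_simps power2_eq_square)
  then have "e^2+a^3 = (e+\<kappa>*(a - b))^2+b^3" by algebra
  then show "eval2 f x y = eval2 ((q + cpoly2 \<kappa>*(l - l'))^2+l'^3) x y"
   unfolding tl(3) a_def b_def e_def by (simp add: eval2_simps)
 qed
 moreover have "totdeg (q + cpoly2 \<kappa>*(l - l')) \<le> 2"
  using totdeg_mult_le[of "cpoly2 \<kappa>" 0 "l - l'" 1] totdeg_diff_le[OF tl(1) l1] totdeg_cpoly2 tl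
  by (intro totdeg_add_le) auto
 ultimately show ?thesis unfolding visible_dec_def using l1 by blast
qed

text \<open>In the coordinates (l, l') the cusps are (0, 0), (0, -\<open>\<kappa>\<close>^2) and
  (-\<open>\<kappa>\<close>^2, 0). On l = 0 the quadratic q is l' (l' + \<open>\<kappa>\<close>^2) /
  (2 \<open>\<kappa>\<close>), which gives the first two; the third comes from the second
  decomposition, on l' = 0.\<close>

lemma tri_form_three_cusps:
 assumes f: "totdeg f = 4" and t: "tri_form f q l \<kappa> l'"
 shows "three_cusps f"
proof -
 have k: "\<kappa> \<noteq> 0" and v: "visible_dec f q l" and l1': "totdeg l' \<le> 1" and d: "ldet l l' \<noteq> 0"
  and q: "q = cpoly2 (1/(2*\<kappa>))*(l^2+l*l'+l'^2) - cpoly2 (\<kappa>/2)*(l - l')"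
  using t unfolding tri_form_def by blast+
 have l1: "totdeg l \<le> 1" "totdeg q \<le> 2" "f = q^2+l^3" using v unfolding visible_dec_def by auto
 define q' where "q' = q + cpoly2 \<kappa>*(l - l')"
 have v': "totdeg q' \<le> 2" "f = q'^2+l'^3"
  using tri_form_second[OF t] unfolding q'_def visible_dec_def by auto
 have qe: "eval2 q x y = 1/(2*\<kappa>)*(eval2 l x y^2+eval2 l x y*eval2 l' x y+eval2 l' x y^2) - \<kappa>/2*(eval2 l x y - eval2 l' x y)" for x y
  unfolding q by (simp add: eval2_simps)
 have qe': "eval2 q' x y = 1/(2*\<kappa>)*(eval2 l x y^2+eval2 l x y*eval2 l' x y+eval2 l' x y^2)+\<kappa>/2*(eval2 l x y - eval2 l' x y)" for x y
  unfolding q'_def eval2_simps qe by (simp add: field_simps)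
 define a b a' b' where "a = coeff (coeff l 0) 1" and "b = coeff (coeff l 1) 0"
  and "a' = coeff (coeff l' 0) 1" and "b' = coeff (coeff l' 1) 0"
 have D: "a*b' - b*a' \<noteq> 0" using d unfolding ldet_def a_def b_def a'_def b'_def .
 have sl: "sdiff (%z. eval2 l (x0+fst z) (y0 + snd z)) a b" "sdiff (%z. eval2 l' (x0+fst z) (y0 + snd z)) a' b'" for x0 y0
  unfolding a_def b_def a'_def b'_def using sdiff_linear_shift l1 l1' by auto
 have sq: "sdiff (%z. 1/(2*\<kappa>)*(eval2 l (x0+fst z) (y0 + snd z)^2+eval2 l (x0+fst z) (y0 + snd z)*eval2 l' (x0+fst z) (y0 + snd z)+eval2 l' (x0+fst z) (y0 + snd z)^2)+e*(eval2 l (x0+fst z) (y0 + snd z) - eval2 l' (x0+fst z) (y0 + snd z)))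
   (1/(2*\<kappa>)*(2*eval2 l x0 y0*a+(a*eval2 l' x0 y0+eval2 l x0 y0*a')+2*eval2 l' x0 y0*a')+e*(a - a'))
   (1/(2*\<kappa>)*(2*eval2 l x0 y0*b+(b*eval2 l' x0 y0+eval2 l x0 y0*b')+2*eval2 l' x0 y0*b')+e*(b - b'))" for x0 y0 e
  using sdiff_add[OF sdiff_cmult[OF sdiff_add[OF sdiff_add[OF sdiff_power2[OF sl(1)[of x0 y0]] sdiff_mult[OF sl(1)[of x0 y0] sl(2)[of x0 y0]]] sdiff_power2[OF sl(2)[of x0 y0]]], of "1/(2*\<kappa>)"]
    sdiff_cmult[OF sdiff_diff[OF sl[of x0 y0]], of e]] by simp
 have det1: "a*(c*(b*u+2*u*b') - e*(b - b')) - b*(c*(a*u+2*u*a') - e*(a - a')) = (a*b' - b*a')*(2*u * c+e)" for c e u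
  by algebra
 have det2: "a'*(c*(2*u*b+u*b')+e*(b - b')) - b'*(c*(2*u*a+u*a')+e*(a - a')) = (b*a' - a*b')*(2*u * c+e)" for c e u
  by algebra
 \<comment> \<open>This factor of the Jacobian equals \<open>\<kappa>\<close>/2 at u = 0 and
   -\<open>\<kappa>\<close>/2 at u = -\<open>\<kappa>\<close>^2, so both intersections are
   transversal.\<close>
 have nz: "2*u*(1/(2*\<kappa>))+\<kappa>/2 \<noteq> 0" if u: "u = 0 \<or> u = - (\<kappa>^2)" for u
 proof -
  have e: "2*(- (\<kappa>^2))*(1/(2*\<kappa>)) = - \<kappa>" using k by (simp add: power2_eq_square)
  have "- \<kappa>+\<kappa>/2 = - (\<kappa>/2)" by (simp add: field_simps)
  then have "- \<kappa>+\<kappa>/2 \<noteq> 0" using k by simp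
  then show ?thesis using u
  proof (elim disjE)
   assume "u = - (\<kappa>^2)"
   then show ?thesis using \<open>- \<kappa> + \<kappa> / 2 \<noteq> 0\<close> e by simp
  qed (use k in simp)
 qed
 have c1: "affine_cusp f (x0, y0)" if l0: "eval2 l x0 y0 = 0" and l0': "eval2 l' x0 y0 = u" and u: "u = 0 \<or> u = - (\<kappa>^2)" for x0 y0 u
 proof (rule affine_cuspI[of f l q x0 y0 a b])
  show "totdeg f \<le> 4" "f = l^3+q^2" "totdeg l \<le> 2" "totdeg q \<le> 3" using f l1 by (auto simp: add.commute)
  show "eval2 l x0 y0 = 0" by (rule l0)
  show "eval2 q x0 y0 = 0" unfolding qe l0 l0' using u k by (auto simp: field_simps power2_eq_square)
  show "sdiff (%z. eval2 l (x0+fst z) (y0 + snd z)) a b" by (rule sl)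
  show "sdiff (%z. eval2 q (x0+fst z) (y0 + snd z))
    (1/(2*\<kappa>)*(a*u+2*u*a') - \<kappa>/2*(a - a')) (1/(2*\<kappa>)*(b*u+2*u*b') - \<kappa>/2*(b - b'))"
   unfolding qe by (rule sdiff_eq[OF sq[of x0 y0 "- \<kappa>/2"]]) (auto simp: l0 l0' algebra_simps)
  have "a*(1/(2*\<kappa>)*(b*u+2*u*b') - \<kappa>/2*(b - b')) - b*(1/(2*\<kappa>)*(a*u+2*u*a') - \<kappa>/2*(a - a'))
    = (a*b' - b*a')*(2*u*(1/(2*\<kappa>))+\<kappa>/2)" by (rule det1)
  moreover have "2*u*(1/(2*\<kappa>))+\<kappa>/2 \<noteq> 0" using u by (rule nz)
  ultimately show "a*(1/(2*\<kappa>)*(b*u+2*u*b') - \<kappa>/2*(b - b')) - b*(1/(2*\<kappa>)*(a*u+2*u*a') - \<kappa>/2*(a - a')) \<noteq> 0"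
   using D by (metis mult_eq_0_iff right_minus_eq)
 qed
 have c2: "affine_cusp f (x0, y0)" if l0: "eval2 l x0 y0 = u" and l0': "eval2 l' x0 y0 = 0" and u: "u = 0 \<or> u = - (\<kappa>^2)" for x0 y0 u
 proof (rule affine_cuspI[of f l' q' x0 y0 a' b'])
  show "totdeg f \<le> 4" "f = l'^3+q'^2" "totdeg l' \<le> 2" "totdeg q' \<le> 3" using f l1' v' by (auto simp: add.commute)
  show "eval2 l' x0 y0 = 0" by (rule l0')
  show "eval2 q' x0 y0 = 0" unfolding qe' l0 l0' using u k by (auto simp: field_simps power2_eq_square)
  show "sdiff (%z. eval2 l' (x0+fst z) (y0 + snd z)) a' b'" by (rule sl)
  show "sdiff (%z. eval2 q' (x0+fst z) (y0 + snd z))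
    (1/(2*\<kappa>)*(2*u*a+u*a')+\<kappa>/2*(a - a')) (1/(2*\<kappa>)*(2*u*b+u*b')+\<kappa>/2*(b - b'))"
   unfolding qe' by (rule sdiff_eq[OF sq[of x0 y0 "\<kappa>/2"]]) (auto simp: l0 l0' algebra_simps)
  have "a'*(1/(2*\<kappa>)*(2*u*b+u*b')+\<kappa>/2*(b - b')) - b'*(1/(2*\<kappa>)*(2*u*a+u*a')+\<kappa>/2*(a - a'))
    = (b*a' - a*b')*(2*u*(1/(2*\<kappa>))+\<kappa>/2)" by (rule det2)
  moreover have "2*u*(1/(2*\<kappa>))+\<kappa>/2 \<noteq> 0" using u by (rule nz)
  ultimately show "a'*(1/(2*\<kappa>)*(2*u*b+u*b')+\<kappa>/2*(b - b')) - b'*(1/(2*\<kappa>)*(2*u*a+u*a')+\<kappa>/2*(a - a')) \<noteq> 0"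
   using D by (metis mult_eq_0_iff right_minus_eq)
 qed
 obtain x1 y1 where p1: "eval2 l x1 y1 = 0" "eval2 l' x1 y1 = 0" using ldet_solve[OF l1(1) l1' d] by blast
 obtain x2 y2 where p2: "eval2 l x2 y2 = 0" "eval2 l' x2 y2 = - (\<kappa>^2)" using ldet_solve[OF l1(1) l1' d] by blast
 obtain x3 y3 where p3: "eval2 l x3 y3 = - (\<kappa>^2)" "eval2 l' x3 y3 = 0" using ldet_solve[OF l1(1) l1' d] by blast
 have k2: "- (\<kappa>^2) \<noteq> 0" using k by simp
 show ?thesis unfolding three_cusps_def
  by (intro exI[of _ "(x1, y1)"] exI[of _ "(x2, y2)"] exI[of _ "(x3, y3)"] conjI)
   (use c1[OF p1 disjI1[OF refl]] c1[OF p2 disjI2[OF refl]] c2[OF p3 disjI2[OF refl]] p1 p2 p3 k2 in auto)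
qed

text \<open>The two summands vanish together where y = x^2 and x^3 = 2 \<open>\<epsilon>\<close>:
  three points, because \<open>\<epsilon>\<close> is nonzero. There the Jacobian is a nonzero
  multiple of x^2.\<close>

lemma invisible_form_three_cusps:
 assumes f: "totdeg f = 4" and t: "invisible_form f x y \<epsilon>"
 shows "three_cusps f"
proof -
 have x1: "totdeg x \<le> 1" "totdeg y \<le> 1" and d: "ldet x y \<noteq> 0" and e: "\<epsilon> \<noteq> 0"
  and fe: "f = (y - x^2)^3+(x^3 - cpoly2 (3/2)*x*y + cpoly2 \<epsilon>)^2"
  using t unfolding invisible_form_def by blast+
 define a b a' b' where "a = coeff (coeff x 0) 1" and "b = coeff (coeff x 1) 0"
  and "a' = coeff (coeff y 0) 1" and "b' = coeff (coeff y 1) 0"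
 have D: "a*b' - b*a' \<noteq> 0" using d unfolding ldet_def a_def b_def a'_def b'_def .
 have sl: "sdiff (%z. eval2 x (x0+fst z) (y0 + snd z)) a b" "sdiff (%z. eval2 y (x0+fst z) (y0 + snd z)) a' b'" for x0 y0
  unfolding a_def b_def a'_def b'_def using sdiff_linear_shift x1 by auto
 define g2 g3 where "g2 = y - x^2" and "g3 = x^3 - cpoly2 (3/2)*x*y + cpoly2 \<epsilon>"
 have ge: "eval2 g2 p r = eval2 y p r - eval2 x p r^2"
  "eval2 g3 p r = eval2 x p r^3 - 3/2*(eval2 x p r*eval2 y p r)+\<epsilon>" for p r
  unfolding g2_def g3_def by (simp_all add: eval2_simps)
 have tg: "totdeg g2 \<le> 2" "totdeg g3 \<le> 3"
  using x1 totdeg_power_le[OF x1(1), of 2] totdeg_power_le[OF x1(1), of 3] totdeg_cpoly2[of \<epsilon>]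
   totdeg_mult_le[OF totdeg_mult_le[of "cpoly2 (3/2)" 0 x 1] x1(2)] totdeg_cpoly2[of "3/2"]
  unfolding g2_def g3_def by (auto intro!: totdeg_diff_le totdeg_add_le)
 have c: "affine_cusp f (x0, y0)" if X: "eval2 x x0 y0 = u" and Y: "eval2 y x0 y0 = u^2" and u: "u^3 = 2*\<epsilon>" for x0 y0 u
 proof (rule affine_cuspI[of f g2 g3 x0 y0])
  show "totdeg f \<le> 4" "f = g2^3+g3^2" using f fe unfolding g2_def g3_def by auto
  show "totdeg g2 \<le> 2" "totdeg g3 \<le> 3" by (rule tg)+
  show "eval2 g2 x0 y0 = 0" "eval2 g3 x0 y0 = 0" unfolding ge X Y using u by (auto simp: power2_eq_square power3_eq_cube field_simps)
  show "sdiff (%z. eval2 g2 (x0+fst z) (y0 + snd z)) (a' - 2*u*a) (b' - 2*u*b)"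
   unfolding ge by (rule sdiff_eq[OF sdiff_diff[OF sl(2)[of x0 y0] sdiff_power2[OF sl(1)[of x0 y0]]]]) (auto simp: X)
  show "sdiff (%z. eval2 g3 (x0+fst z) (y0 + snd z)) (3*u^2*a - 3/2*(a*u^2+u*a')) (3*u^2*b - 3/2*(b*u^2+u*b'))"
   unfolding ge by (rule sdiff_eq[OF sdiff_add[OF sdiff_diff[OF sdiff_power3[OF sl(1)[of x0 y0]] sdiff_cmult[OF sdiff_mult[OF sl[of x0 y0]], of "3/2"]] sdiff_const[of \<epsilon>]]])
    (auto simp: X Y)
  have "(a' - 2*u*a)*(3*u^2*b - 3/2*(b*u^2+u*b')) - (b' - 2*u*b)*(3*u^2*a - 3/2*(a*u^2+u*a'))
    = (a*b' - b*a')*(3/2*u^2)" by (simp add: field_simps power2_eq_square)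
  moreover have "3/2*u^2 \<noteq> 0" using u e by auto
  ultimately show "(a' - 2*u*a)*(3*u^2*b - 3/2*(b*u^2+u*b')) - (b' - 2*u*b)*(3*u^2*a - 3/2*(a*u^2+u*a')) \<noteq> 0"
   using D by (metis mult_eq_0_iff right_minus_eq)
 qed
 define \<tau> where "\<tau> = exp (Ln (2*\<epsilon>) / of_nat 3)"
 have t3: "\<tau>^3 = 2*\<epsilon>" unfolding \<tau>_def using e by (simp flip: exp_of_nat_mult)
 have t0: "\<tau> \<noteq> 0" unfolding \<tau>_def by simp
 have "(cubert^2)^3 = (cubert^3)^2" by (simp flip: power_mult)
 then have c6: "(cubert^2)^3 = 1" using cubert_cube by simp
 have cub: "(\<tau> * cubert)^3 = 2*\<epsilon>" "(\<tau> * cubert^2)^3 = 2*\<epsilon>"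
  using t3 c6 cubert_cube by (simp_all add: power_mult_distrib)
 obtain x1' y1' where p1: "eval2 x x1' y1' = \<tau>" "eval2 y x1' y1' = \<tau>^2" using ldet_solve[OF x1 d] by blast
 obtain x2' y2' where p2: "eval2 x x2' y2' = \<tau> * cubert" "eval2 y x2' y2' = (\<tau> * cubert)^2" using ldet_solve[OF x1 d] by blast
 obtain x3' y3' where p3: "eval2 x x3' y3' = \<tau> * cubert^2" "eval2 y x3' y3' = (\<tau> * cubert^2)^2" using ldet_solve[OF x1 d] by blast
 have ne: "cubert \<noteq> 1" "cubert^2 \<noteq> 1" "cubert^2 \<noteq> cubert"
  using cubert_ne cubert_cube by (auto simp: power2_eq_square power3_eq_cube)
 show ?thesis unfolding three_cusps_def
  by (intro exI[of _ "(x1', y1')"] exI[of _ "(x2', y2')"] exI[of _ "(x3', y3')"] conjI)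
   (use c[OF p1 t3] c[OF p2 cub(1)] c[OF p3 cub(2)] p1 p2 p3 ne t0 in auto)
qed

section \<open>Cusps against prescribed lists of singular points\<close>

lemma homog4_hom: "homog 4 f (smul3 c v) = c^4*homog 4 f v"
 by (rule homog_smul)

definition sing_pts :: "complex poly poly => ((complex \<times> complex) set \<times> bool) list => pt3 list => bool" where
 "sing_pts f L vs \<longleftrightarrow> length vs = length L \<and>
   (\<forall>k < length L. sing_pt (homog 4 f) (vs ! k) \<and> has_type (homog 4 f) (vs ! k) (fst (L ! k)) \<and>
    (zcoord (vs ! k) = 0 \<longleftrightarrow> snd (L ! k))) \<and>
   (\<forall>k < length L. \<forall>l < length L. k \<noteq> l --> \<not> proj_same (vs ! k) (vs ! l)) \<and>
   (\<forall>v. sing_pt (homog 4 f) v --> (\<exists>k < length L. proj_same (vs ! k) v))"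

lemma sing_list_iff: "sing_list f L \<longleftrightarrow> (\<exists>vs. sing_pts f L vs)"
 unfolding sing_list_def sing_pts_def Let_def ..

lemma sing_ptsD:
 assumes "sing_pts f L vs"
 shows "k < length L ==> sing_pt (homog 4 f) (vs ! k)"
  and "k < length L ==> has_type (homog 4 f) (vs ! k) (fst (L ! k))"
  and "k < length L ==> zcoord (vs ! k) = 0 \<longleftrightarrow> snd (L ! k)"
  and "k < length L ==> l < length L ==> k \<noteq> l ==> \<not> proj_same (vs ! k) (vs ! l)"
  and "sing_pt (homog 4 f) v ==> \<exists>k < length L. proj_same (vs ! k) v"
proof -
 note a = assms[unfolded sing_pts_def, THEN conjunct2]
 show "k < length L ==> sing_pt (homog 4 f) (vs ! k)" "k < length L ==> has_type (homog 4 f) (vs ! k) (fst (L ! k))"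
  "k < length L ==> zcoord (vs ! k) = 0 \<longleftrightarrow> snd (L ! k)"
  using a[THEN conjunct1, rule_format, of k] by blast+
 show "k < length L ==> l < length L ==> k \<noteq> l ==> \<not> proj_same (vs ! k) (vs ! l)"
  by (rule a[THEN conjunct2, THEN conjunct1, rule_format])
 show "sing_pt (homog 4 f) v ==> \<exists>k < length L. proj_same (vs ! k) v"
  by (rule a[THEN conjunct2, THEN conjunct2, rule_format])
qed

lemma has_type_unique:
 assumes "has_type (homog 4 f) v T" "has_type (homog 4 f) v T'"
 shows "top_equiv_germ T T'"
proof -
 obtain u w where uw: "det3 v u w \<noteq> 0" using assms(1) unfolding has_type_def by blast
 show ?thesis
  by (rule top_equiv_germ_trans[OF top_equiv_germ_sym])
   (rule has_type_chart[OF homog4_hom assms(1) uw], rule has_type_chart[OF homog4_hom assms(2) uw])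
qed

text \<open>Distinct affine points belong to distinct list entries, as the last coordinate 1 fixes
  the scalar. Three cusps thus need three entries; with exactly three, every entry is hit, and a
  node in third place would be equivalent to a cusp.\<close>

lemma sing_list_three_cusps:
 assumes sl: "sing_list f L" and tc: "three_cusps f"
 shows "length L \<ge> 3" and "length L = 3 ==> fst (L ! 2) \<noteq> germ_A 1"
proof -
 define F where "F = homog 4 f"
 obtain vs where sp: "sing_pts f L vs" using sl unfolding sing_list_iff ..
 note vs = sing_ptsD(1,2,5)[OF sp, folded F_def]
 obtain P where P: "card P = 3" "\<And>p. p \<in> P ==> affine_cusp f p"
 proof -
  obtain P1 P2 P3 where "P1 \<noteq> P2" "P1 \<noteq> P3" "P2 \<noteq> P3" "affine_cusp f P1" "affine_cusp f P2" "affine_cusp f P3"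
   using tc unfolding three_cusps_def by blast
  then show ?thesis using that[of "{P1, P2, P3}"] by auto
 qed
 define K where "K = (%p. SOME k. k < length L \<and> proj_same (vs ! k) (fst p, snd p, 1))"
 have K: "K p < length L" "proj_same (vs ! K p) (fst p, snd p, 1)" if "p \<in> P" for p
 proof -
  have "\<exists>k. k < length L \<and> proj_same (vs ! k) (fst p, snd p, 1)"
   using vs(3) P(2)[OF that] unfolding affine_cusp_def F_def by blast
  from someI_ex[OF this] show "K p < length L" "proj_same (vs ! K p) (fst p, snd p, 1)" unfolding K_def by auto
 qed
 have inj: "inj_on K P"
 proof (rule inj_onI)
  fix p r assume pr: "p \<in> P" "r \<in> P" "K p = K r"
  obtain x y z where v: "vs ! K p = (x, y, z)" by (metis prod_cases3)
  obtain c where c: "(fst p, snd p, 1) = smul3 c (x, y, z)" using K(2)[OF pr(1)] v unfolding proj_same_def by auto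
  obtain c' where c': "(fst r, snd r, 1) = smul3 c' (x, y, z)" using K(2)[OF pr(2)] pr(3) v unfolding proj_same_def by auto
  have "c*z = 1" "c'*z = 1" using c c' by (auto simp: smul3_simps)
  then have "c = c'" by (metis mult_cancel_right mult_eq_0_iff zero_neq_one)
  then show "p = r" using c c' by (auto simp: smul3_simps prod_eq_iff)
 qed
 have fin: "finite P" using P(1) card.infinite by fastforce
 have sub: "K ` P \<subseteq> {..<length L}" using K by auto
 have cK: "card (K ` P) = 3" using card_image[OF inj] P(1) by simp
 show len: "length L \<ge> 3" using card_mono[OF _ sub] cK by simp
 assume l3: "length L = 3"
 have "K ` P = {..<length L}" by (rule card_subset_eq[OF _ sub]) (use cK l3 in auto)
 then have "2 \<in> K ` P" using l3 by auto
 then obtain p where p: "p \<in> P" "K p = 2" by auto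
 show "fst (L ! 2) \<noteq> germ_A 1"
 proof
  assume a: "fst (L ! 2) = germ_A 1"
  obtain c where c: "c \<noteq> 0" "(fst p, snd p, 1) = smul3 c (vs ! 2)" using K(2)[OF p(1)] p(2) unfolding proj_same_def by auto
  have "has_type F (vs ! 2) (germ_A 1)" using vs(2)[of 2] l3 a by simp
  then have h1: "has_type F (fst p, snd p, 1) (germ_A 1)"
   using has_type_smul3[OF homog4_hom[of f, folded F_def] _ c(1)] c(2) by simp
  have "has_type F (fst p, snd p, 1) (germ_A 2)" using P(2)[OF p(1)] unfolding affine_cusp_def F_def by simp
  then have "top_equiv_germ (germ_A 2) (germ_A 1)" using h1 has_type_unique[of f] unfolding F_def by blast
  then show False using germ_A_parity[of 2 1] by simp
 qed
qed

section \<open>Equivalence classes of torus decompositions\<close>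

lemma dec_equivI:
 "\<alpha> \<noteq> 0 ==> \<beta> \<noteq> 0 ==> a' = cpoly2 \<alpha>*a ==> b' = cpoly2 \<beta>*b ==> ((a, b), (a', b')) \<in> dec_equiv"
 unfolding dec_equiv_def by auto

lemma dec_equivE:
 assumes "((a, b), (a', b')) \<in> dec_equiv"
 obtains \<alpha> \<beta> where "\<alpha> \<noteq> 0" "\<beta> \<noteq> 0" "a' = cpoly2 \<alpha>*a" "b' = cpoly2 \<beta>*b"
 using assms unfolding dec_equiv_def by auto

lemma equiv_dec_equiv: "equiv UNIV dec_equiv"
proof (rule equivI)
 show "refl dec_equiv" unfolding refl_on_def dec_equiv_def by (auto intro!: exI[of _ 1] simp: cpoly2_1)
 show "sym dec_equiv"
 proof (rule symI)
  fix d d' assume "(d, d') \<in> dec_equiv"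
  then obtain a b \<alpha> \<beta> where e: "d = (a, b)" "\<alpha> \<noteq> 0" "\<beta> \<noteq> 0" "d' = (cpoly2 \<alpha>*a, cpoly2 \<beta>*b)"
   unfolding dec_equiv_def by auto
  have "a = cpoly2 (1/\<alpha>)*(cpoly2 \<alpha>*a)" "b = cpoly2 (1/\<beta>)*(cpoly2 \<beta>*b)"
   using e by (simp_all add: mult.assoc[symmetric] cpoly2_mult[symmetric] cpoly2_1)
  then show "(d', d) \<in> dec_equiv" unfolding e(1,4) using e(2,3)
   by (intro dec_equivI[of "1/\<alpha>" "1/\<beta>"]) auto
 qed
 show "trans dec_equiv"
 proof (rule transI)
  fix d d' d'' assume "(d, d') \<in> dec_equiv" "(d', d'') \<in> dec_equiv"
  then obtain a b \<alpha> \<beta> \<alpha>' \<beta>' where e: "d = (a, b)" "\<alpha> \<noteq> 0" "\<beta> \<noteq> 0" "\<alpha>' \<noteq> 0" "\<beta>' \<noteq> 0"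
   "d'' = (cpoly2 \<alpha>'*(cpoly2 \<alpha>*a), cpoly2 \<beta>'*(cpoly2 \<beta>*b))"
   unfolding dec_equiv_def by auto
  then have "d'' = (cpoly2 (\<alpha>'*\<alpha>)*a, cpoly2 (\<beta>'*\<beta>)*b)" by (simp add: cpoly2_mult mult.assoc)
  then show "(d, d'') \<in> dec_equiv" unfolding e(1) using e(2-5)
   by (simp only:) (rule dec_equivI[of "\<alpha>'*\<alpha>" "\<beta>'*\<beta>"], simp_all)
 qed
qed auto

lemma card_quotient_representatives:
 assumes r: "equiv UNIV r" and D: "D \<subseteq> S" "\<And>d d'. d \<in> D ==> d' \<in> D ==> (d, d') \<in> r ==> d = d'"
  and S: "\<And>s. s \<in> S ==> \<exists>d\<in>D. (d, s) \<in> r"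
 shows "card (S // r) = card D"
proof -
 have "S // r = (%d. r `` {d}) ` D"
 proof (rule antisym)
  show "S // r \<subseteq> (%d. r `` {d}) ` D"
  proof
   fix X assume "X \<in> S // r"
   then obtain s where s: "s \<in> S" "X = r `` {s}" by (rule quotientE)
   then obtain d where d: "d \<in> D" "(d, s) \<in> r" using S by blast
   then show "X \<in> (%d. r `` {d}) ` D" using equiv_class_eq[OF r d(2)] s by auto
  qed
  show "(%d. r `` {d}) ` D \<subseteq> S // r" using D(1) by (auto intro!: quotientI)
 qed
 moreover have "inj_on (%d. r `` {d}) D"
  by (rule inj_onI, rule D(2)) (auto dest: eq_equiv_class[OF _ r UNIV_I])
 ultimately show ?thesis by (simp add: card_image)
qed

text \<open>A common factor d makes f divisible by d^2, so irreducibility leaves only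
  constants.\<close>

lemma torus_sum_coprime:
 fixes f :: "complex poly poly"
 assumes f: "irreducible f" "f = g2^3+g3^2"
 shows "coprime g2 g3"
proof (rule coprimeI)
 fix d assume "d dvd g2" "d dvd g3"
 then obtain a b where ab: "g2 = d*a" "g3 = d*b" by (auto elim!: dvdE)
 have fd: "f = d*(d*(d*a^3+b^2))"
  unfolding f(2) ab by (simp add: power2_eq_square power3_eq_cube algebra_simps)
 have "f \<noteq> 0" using f(1) by auto
 then have nz: "d \<noteq> 0" "d*a^3+b^2 \<noteq> 0" using fd by auto
 have "totdeg d = 0 \<or> totdeg (d*(d*a^3+b^2)) = 0" by (rule irreducible_factor_totdeg[OF f(1) fd])
 then have "totdeg d = 0" using totdeg_mult[OF nz] by auto
 then show "is_unit d" using totdeg_0_unit nz by blast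
qed

lemma complex_root: obtains r :: complex where "r^Suc n = c"
proof (cases "c = 0")
 case True then show ?thesis using that[of 0] by simp
next
 case False
 have "exp (Ln c / of_nat (Suc n))^Suc n = exp (of_nat (Suc n)*(Ln c / of_nat (Suc n)))"
  by (simp only: exp_of_nat_mult)
 also have "\<dots> = c" using False by (simp add: exp_Ln del: of_nat_Suc)
 finally show ?thesis using that by blast
qed

text \<open>A constant l would make f a square plus a constant, which splits as a difference of
  squares.\<close>

lemma visible_dec_torus:
 assumes f: "totdeg f = 4" "irreducible f" and v: "visible_dec f q l"
 shows "(l, q) \<in> torus_decs f" and "totdeg l = 1"
proof -
 have q2: "totdeg q = 2" by (rule visible_dec_q[OF f(1) v])
 have l: "totdeg l \<le> 1" "f = l^3+q^2" using v unfolding visible_dec_def by auto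
 show l1: "totdeg l = 1"
 proof (rule ccontr)
  assume "totdeg l \<noteq> 1"
  then have "totdeg l = 0" using l by simp
  then obtain c where c: "l = cpoly2 c" using totdeg_0_imp_const by blast
  obtain d where d: "d^Suc 1 = - (c^3)" by (rule complex_root)
  have e: "f = (q - cpoly2 d)*(q + cpoly2 d)"
  proof (rule eval2_inject)
   fix x y
   show "eval2 f x y = eval2 ((q - cpoly2 d)*(q + cpoly2 d)) x y"
    unfolding l(2) c eval2_simps using d by (simp add: algebra_simps power2_eq_square)
  qed
  have "totdeg (q - cpoly2 d) = 0 \<or> totdeg (q + cpoly2 d) = 0" by (rule irreducible_factor_totdeg[OF f(2) e])
  then have "totdeg q \<le> 0"
   using totdeg_add_le[of "q - cpoly2 d" 0 "cpoly2 d"] totdeg_diff_le[of "q + cpoly2 d" 0 "cpoly2 d"] totdeg_cpoly2 by auto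
  then show False using q2 by simp
 qed
 have "cpoly2 1*f = l^3+q^2" using l by (simp add: cpoly2_1)
 then show "(l, q) \<in> torus_decs f" unfolding torus_decs_def
  using torus_sum_coprime[OF f(2) l(2)] l1 q2 by (auto intro!: exI[of _ 1])
qed

text \<open>With \<open>\<gamma>\<close> a sixth root of the scalar, dividing g2 by
  \<open>\<gamma>\<close>^2 and g3 by \<open>\<gamma>\<close>^3 makes the scalar 1. If g2 has degree
  at most 1, then g3^2 = f - g2^3 has degree at most 4, so g3 is at most quadratic.\<close>

lemma torus_dec_cases:
 assumes f: "totdeg f = 4" and d: "(g2, g3) \<in> torus_decs f"
 obtains (visible) q l where "visible_dec f q l" "((l, q), (g2, g3)) \<in> dec_equiv" "totdeg g2 \<le> 1"
 | (invisible) g2' g3' where "f = g2'^3+g3'^2" "totdeg g2' = 2" "totdeg g3' \<le> 3"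
   "((g2', g3'), (g2, g3)) \<in> dec_equiv" "totdeg g2 = 2"
proof -
 obtain c where c: "c \<noteq> 0" "cpoly2 c*f = g2^3+g3^2" and t: "totdeg g2 \<le> 2" "totdeg g3 \<le> 3"
  using d unfolding torus_decs_def by auto
 obtain \<gamma> where "\<gamma>^Suc 5 = c" by (rule complex_root)
 then have g: "\<gamma>^6 = c" by (simp add: eval_nat_numeral)
 then have g0: "\<gamma> \<noteq> 0" using c(1) by auto
 define h2 h3 where "h2 = cpoly2 (1/\<gamma>^2)*g2" and "h3 = cpoly2 (1/\<gamma>^3)*g3"
 have e: "((h2, h3), (g2, g3)) \<in> dec_equiv" unfolding h2_def h3_def using g0
  by (intro dec_equivI[of "\<gamma>^2" "\<gamma>^3"]) (simp_all add: mult.assoc[symmetric] cpoly2_mult[symmetric] cpoly2_1)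
 have fe: "f = h2^3+h3^2"
 proof (rule eval2_inject)
  fix x y
  have "c*eval2 f x y = eval2 g2 x y^3+eval2 g3 x y^2"
   using arg_cong[OF c(2), of "%p. eval2 p x y"] by (simp add: eval2_simps)
  then have "eval2 f x y = (eval2 g2 x y^3+eval2 g3 x y^2)/\<gamma>^6" using c(1) g by (simp add: field_simps)
  then show "eval2 f x y = eval2 (h2^3+h3^2) x y"
   unfolding h2_def h3_def eval2_simps by (simp add: power_mult_distrib power_divide add_divide_distrib flip: power_mult)
 qed
 have th: "totdeg h2 = totdeg g2" "totdeg h3 = totdeg g3" unfolding h2_def h3_def using g0 by (simp_all add: totdeg_cmult)
 show thesis
 proof (cases "totdeg g2 \<le> 1")
  case True
  have "h3^2 = f - h2^3" using fe by simp
  moreover have "totdeg (f - h2^3) \<le> 4"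
   using totdeg_diff_le[of f 4 "h2^3"] totdeg_power_le[of h2 1 3] f th True by simp
  ultimately have "totdeg (h3*h3) \<le> 4" by (simp add: power2_eq_square)
  then have "totdeg h3 \<le> 2" using totdeg_mult[of h3 h3] totdeg_0 by (cases "h3 = 0") auto
  then have "visible_dec f h3 h2" unfolding visible_dec_def using th True fe by simp
  then show thesis using visible e True by blast
 next
  case False
  then have "totdeg g2 = 2" using t by simp
  then show thesis using invisible[OF fe] th e t by simp
 qed
qed

lemma dec_equiv_visible_same:
 assumes "\<omega>^3 = 1" "l' = cpoly2 \<omega>*l" "q' = q \<or> q' = - q"
 shows "((l, q), (l', q')) \<in> dec_equiv"
proof -
 have "\<omega> \<noteq> 0" using assms(1) by auto
 moreover have "\<exists>\<beta>. \<beta> \<noteq> 0 \<and> q' = cpoly2 \<beta>*q" using assms(3)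
 proof (elim disjE)
  assume "q' = q" then show ?thesis by (intro exI[of _ 1]) (simp add: cpoly2_1)
 next
  assume "q' = - q" then show ?thesis by (intro exI[of _ "- 1"]) (simp add: cpoly2_1 cpoly2_uminus)
 qed
 ultimately show ?thesis unfolding dec_equiv_def using assms(2) by auto
qed

text \<open>An inequivalent visible decomposition would produce \<open>tri_form\<close>, an
  invisible one \<open>invisible_form\<close>; both have three cusps. The square needed at infinity
  is q itself, since f - q^2 = l^3 is cubic.\<close>

lemma dec_unique:
 assumes f: "totdeg f = 4" "irreducible f" and v: "visible_dec f q l" and nc: "\<not> three_cusps f"
 shows "card (torus_decs f // dec_equiv) = 1"
proof -
 have "((l, q), d) \<in> dec_equiv" if "d \<in> torus_decs f" for d
 proof -
  obtain g2 g3 where d: "d = (g2, g3)" by (cases d)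
  from that[unfolded d] show ?thesis
  proof (cases rule: torus_dec_cases[OF f(1), consumes 1, case_names visible invisible])
   case (visible q' l')
   from visible_dec_compare[OF f v visible(1)] have "((l, q), (l', q')) \<in> dec_equiv"
   proof (elim disjE exE conjE)
    fix \<omega> assume "\<omega>^3 = 1" "l' = cpoly2 \<omega>*l" "q' = q"
    then show ?thesis using dec_equiv_visible_same by blast
   next
    fix \<omega> assume "\<omega>^3 = 1" "l' = cpoly2 \<omega>*l" "q' = - q"
    then show ?thesis using dec_equiv_visible_same by blast
   qed (use tri_form_three_cusps[OF f(1)] nc in blast)+
   then show ?thesis unfolding d using visible(2) equiv_dec_equiv by (meson equivE transD)
  next
   case (invisible g2' g3')
   have "totdeg q \<le> 2" "totdeg (f - q^2) \<le> 3"
    using v totdeg_power_le[of l 1 3] unfolding visible_dec_def by auto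
   from invisible_normal_form[OF f this invisible(1,2,3)] have False
    using invisible_form_three_cusps[OF f(1)] nc by metis
   then show ?thesis ..
  qed
 qed
 then have "card (torus_decs f // dec_equiv) = card {(l, q)}"
  using visible_dec_torus(1)[OF f v] by (intro card_quotient_representatives[OF equiv_dec_equiv]) auto
 then show ?thesis by simp
qed

lemma no_decs:
 assumes f: "totdeg f = 4" "irreducible f" and v: "\<And>q l. \<not> visible_dec f q l" and nc: "\<not> three_cusps f"
  and h: "totdeg h \<le> 2" "totdeg (f - h^2) \<le> 3"
 shows "torus_decs f = {}"
proof (rule ccontr)
 assume "torus_decs f \<noteq> {}"
 then obtain g2 g3 where "(g2, g3) \<in> torus_decs f" by auto
 then show False
 proof (cases rule: torus_dec_cases[OF f(1), consumes 1, case_names visible invisible])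
  case (visible q l) then show False using v by blast
 next
  case (invisible g2' g3')
  from invisible_normal_form[OF f h invisible(1,2,3)] show False
   using invisible_form_three_cusps[OF f(1)] nc by metis
 qed
qed

section \<open>Counting the decompositions of the tricuspidal normal form\<close>

lemma ldet_span:
 assumes "totdeg p \<le> 1" "totdeg q \<le> 1" "totdeg r \<le> 1" and d: "ldet p q \<noteq> 0"
 obtains \<alpha> \<beta> \<gamma> where "\<And>x y. eval2 r x y = \<alpha>*eval2 p x y+\<beta>*eval2 q x y+\<gamma>"
proof -
 define c where "c = (%p i j. coeff (coeff (p :: complex poly poly) j) i)"
 define \<alpha> \<beta> where "\<alpha> = ldet r q/ldet p q" and "\<beta> = ldet p r/ldet p q"
 have ev: "eval2 p x y = c p 0 0 + c p 1 0*x + c p 0 1*y" "eval2 q x y = c q 0 0 + c q 1 0*x + c q 0 1*y"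
  "eval2 r x y = c r 0 0 + c r 1 0*x + c r 0 1*y" for x y
  using eval2_linear[OF assms(1)] eval2_linear[OF assms(2)] eval2_linear[OF assms(3)] unfolding c_def by auto
 have "ldet r q * c p 1 0+ldet p r * c q 1 0 = ldet p q * c r 1 0" "ldet r q * c p 0 1+ldet p r * c q 0 1 = ldet p q * c r 0 1"
  unfolding ldet_def c_def by algebra+
 then have 1: "\<alpha> * c p 1 0+\<beta> * c q 1 0 = c r 1 0" "\<alpha> * c p 0 1+\<beta> * c q 0 1 = c r 0 1"
  unfolding \<alpha>_def \<beta>_def using d by (simp_all add: field_simps)
 have "eval2 r x y = \<alpha>*eval2 p x y+\<beta>*eval2 q x y+(c r 0 0 - \<alpha> * c p 0 0 - \<beta> * c q 0 0)" for x y
  unfolding ev 1[symmetric] by (simp add: algebra_simps)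
 then show thesis by (rule that)
qed

lemma poly_coeffs_eq:
 fixes a b :: "nat => complex"
 assumes "\<And>t. a 0+a 1*t+a 2*t^2+a 3*t^3+a 4*t^4 = b 0+b 1*t+b 2*t^2+b 3*t^3+b 4*t^4"
 shows "a 0 = b 0 \<and> a 1 = b 1 \<and> a 2 = b 2 \<and> a 3 = b 3 \<and> a 4 = b 4"
proof -
 have "poly [:a 0, a 1, a 2, a 3, a 4:] t = poly [:b 0, b 1, b 2, b 3, b 4:] t" for t
  using assms[of t] by (simp add: algebra_simps power2_eq_square power3_eq_cube power4_eq_xxxx)
 then have "[:a 0, a 1, a 2, a 3, a 4:] = [:b 0, b 1, b 2, b 3, b 4:]" by (intro poly_eq_poly_eq_iff[THEN iffD1]) (rule ext)
 then show ?thesis by simp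
qed

lemma quartic_eq_0:
 fixes a b c d e :: complex
 assumes "\<And>t. a+b*t + c*t^2+d*t^3+e*t^4 = 0"
 shows "a = 0" "b = 0" "c = 0" "d = 0" "e = 0"
 using poly_coeffs_eq[of "%i. [a, b, c, d, e] ! i" "%_. 0"] assms by (auto simp: numeral_eq_Suc)

lemma quartic_eq:
 fixes a b c d e :: complex
 assumes "\<And>t. a+b*t + c*t^2+d*t^3+e*t^4 = a'+b'*t + c'*t^2+d'*t^3+e'*t^4"
 shows "a = a'" "b = b'" "c = c'" "d = d'" "e = e'"
proof -
 have "(a - a')+(b - b')*t+(c - c')*t^2+(d - d')*t^3+(e - e')*t^4 = 0" for t
  using assms[of t] by (simp add: algebra_simps)
 from quartic_eq_0[OF this] show "a = a'" "b = b'" "c = c'" "d = d'" "e = e'" by simp_all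
qed

lemma quadric_eq_0:
 fixes a b c d e g :: complex
 assumes "\<And>u v. a*u^2+b*u * v + c * v ^ 2+d*u+e * v + g = 0"
 shows "a = 0" "b = 0" "c = 0" "d = 0" "e = 0" "g = 0"
proof -
 have 1: "g+d*t+a*t^2+0*t^3+0*t^4 = 0" for t using assms[of t 0] by (simp add: algebra_simps)
 have 2: "g+e*t + c*t^2+0*t^3+0*t^4 = 0" for t using assms[of 0 t] by (simp add: algebra_simps)
 show z: "g = 0" "d = 0" "a = 0" "e = 0" "c = 0" using quartic_eq_0[OF 1] quartic_eq_0[OF 2] by auto
 show "b = 0" using assms[of 1 1] z by simp
qed

text \<open>In the coordinates u = l, v = l' the second line is an affine combination
  \<open>\<alpha>\<close> u + \<open>\<beta>\<close> v + \<open>\<gamma>\<close>. Equating the two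
  expressions for q gives \<open>\<beta>\<close> = 1 + 2 \<open>\<alpha>\<close> and
  \<open>\<alpha>\<close> (\<open>\<alpha>\<close> + 1) = 0; the two roots are l' and the third
  line, and the linear terms fix \<open>\<gamma>\<close>.\<close>

lemma tri_form_compare:
 assumes t: "tri_form f q l \<kappa> l'" "tri_form f q l \<mu> m"
 shows "\<mu> = \<kappa> \<and> (m = l' \<or> m = - (l+l' + cpoly2 (\<kappa>^2)))"
proof -
 have k: "\<kappa> \<noteq> 0" "\<mu> \<noteq> 0" and l1: "totdeg l \<le> 1" "totdeg l' \<le> 1" "totdeg m \<le> 1" and d: "ldet l l' \<noteq> 0"
  and q: "q = cpoly2 (1/(2*\<kappa>))*(l^2+l*l'+l'^2) - cpoly2 (\<kappa>/2)*(l - l')"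
   "q = cpoly2 (1/(2*\<mu>))*(l^2+l*m+m^2) - cpoly2 (\<mu>/2)*(l - m)"
  using t unfolding tri_form_def visible_dec_def by blast+
 obtain \<alpha> \<beta> \<gamma> where m: "\<And>x y. eval2 m x y = \<alpha>*eval2 l x y+\<beta>*eval2 l' x y+\<gamma>"
  using ldet_span[OF l1 d] by blast
 have id: "\<mu>*(u^2+u * v + v ^ 2) - \<mu>*\<kappa>^2*(u - v)
   - (\<kappa>*(u^2+u*(\<alpha>*u+\<beta> * v + \<gamma>)+(\<alpha>*u+\<beta> * v + \<gamma>)^2) - \<kappa>*\<mu>^2*(u - (\<alpha>*u+\<beta> * v + \<gamma>))) = 0" for u v
 proof -
  obtain x y where xy: "eval2 l x y = u" "eval2 l' x y = v" using ldet_solve[OF l1(1,2) d] by blast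
  have "1/(2*\<kappa>)*(u^2+u * v + v ^ 2) - \<kappa>/2*(u - v) =
   1/(2*\<mu>)*(u^2+u*(\<alpha>*u+\<beta> * v + \<gamma>)+(\<alpha>*u+\<beta> * v + \<gamma>)^2) - \<mu>/2*(u - (\<alpha>*u+\<beta> * v + \<gamma>))" (is "?L = ?R")
   using arg_cong[OF trans[OF q(1)[symmetric] q(2)], of "%p. eval2 p x y"] xy m[of x y] by (simp add: eval2_simps)
  then have 1: "2*\<kappa>*\<mu>*?L = 2*\<kappa>*\<mu>*?R" by simp
  have 2: "2*\<kappa>*\<mu>*?L = \<mu>*(u^2+u * v + v ^ 2) - \<mu>*\<kappa>^2*(u - v)"
   using k by (simp add: right_diff_distrib power2_eq_square)
  have 3: "2*\<kappa>*\<mu>*?R = \<kappa>*(u^2+u*(\<alpha>*u+\<beta> * v + \<gamma>)+(\<alpha>*u+\<beta> * v + \<gamma>)^2) - \<kappa>*\<mu>^2*(u - (\<alpha>*u+\<beta> * v + \<gamma>))"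
   using k by (simp add: right_diff_distrib power2_eq_square)
  show ?thesis using 1 unfolding 2 3 by simp
 qed
 have "(\<mu> - \<kappa>*(1+\<alpha>+\<alpha>^2))*u^2+(\<mu> - \<kappa>*(\<beta>+2*\<alpha>*\<beta>))*u * v + (\<mu> - \<kappa>*\<beta>^2) * v ^ 2
  +(- \<mu>*\<kappa>^2 - \<kappa>*(\<gamma>+2*\<alpha>*\<gamma>)+\<kappa>*\<mu>^2*(1 - \<alpha>))*u
  +(\<mu>*\<kappa>^2 - \<kappa>*(2*\<beta>*\<gamma>) - \<kappa>*\<mu>^2*\<beta>) * v + (- \<kappa>*\<gamma>^2 - \<kappa>*\<mu>^2*\<gamma>) = 0" for u v
  using id[of u v] by algebra
 note c = quadric_eq_0[OF this]
 have m2: "\<mu> = \<kappa>*\<beta>^2" using c(3) by simp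
 have b0: "\<beta> \<noteq> 0" using m2 k by auto
 have "\<kappa>*\<beta>*(\<beta> - (1+2*\<alpha>)) = 0" using c(2) unfolding m2 by algebra
 then have b: "\<beta> = 1+2*\<alpha>" using k b0 by simp
 have "3*\<kappa>*(\<alpha>*(\<alpha>+1)) = 0" using c(1) unfolding m2 b by algebra
 then have a: "\<alpha> = 0 \<or> \<alpha> = - 1" using k by (simp add: eq_neg_iff_add_eq_0)
 then have mk: "\<mu> = \<kappa>" unfolding m2 b by auto
 have g: "\<kappa>*(\<kappa>^2*(1 - \<beta>) - 2*\<beta>*\<gamma>) = 0" using c(5) unfolding mk by algebra
 then have g': "\<kappa>^2*(1 - \<beta>) = 2*\<beta>*\<gamma>" using k by simp
 from a have "m = l' \<or> m = - (l+l' + cpoly2 (\<kappa>^2))"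
 proof (elim disjE)
  assume a: "\<alpha> = 0"
  then have "\<gamma> = 0" using g' b by simp
  then have "m = l'" using m a b by (intro eval2_inject) simp
  then show ?thesis ..
 next
  assume a: "\<alpha> = - 1"
  then have "\<gamma> = - (\<kappa>^2)" using g' b by simp
  then have "m = - (l+l' + cpoly2 (\<kappa>^2))" using m a b by (intro eval2_inject) (simp add: eval2_simps)
  then show ?thesis ..
 qed
 then show ?thesis using mk by simp
qed

lemma ldet_cmult: "ldet p (cpoly2 c*p) = 0"
 unfolding ldet_def cpoly2_def by simp

text \<open>Expanding an invisible form gives \<open>y\<^sup>3 - 3/4 x\<^sup>2y\<^sup>2 + 2\<epsilon>x\<^sup>3 - 3\<epsilon>xy + \<epsilon>\<^sup>2\<close>;
 its leading part determines the two lines \<open>x\<close> and \<open>y\<close> up to order.\<close>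
lemma invisible_form_compare:
 assumes t: "invisible_form f x y \<epsilon>" "invisible_form f x' y' \<epsilon>'"
 shows "(\<exists>s. s^6 = 1 \<and> x' = cpoly2 s*x \<and> y' = cpoly2 (s^2)*y \<and> \<epsilon>' = \<epsilon> * s^3) \<or>
   (\<exists>a. a \<noteq> 0 \<and> x' = cpoly2 a*y)"
proof -
 have l1: "totdeg x \<le> 1" "totdeg y \<le> 1" "totdeg x' \<le> 1" "totdeg y' \<le> 1" and d: "ldet x y \<noteq> 0" and e: "\<epsilon> \<noteq> 0" "\<epsilon>' \<noteq> 0"
  and f: "f = (y - x^2)^3+(x^3 - cpoly2 (3/2)*x*y + cpoly2 \<epsilon>)^2"
   "f = (y' - x'^2)^3+(x'^3 - cpoly2 (3/2)*x'*y' + cpoly2 \<epsilon>')^2"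
  using t unfolding invisible_form_def by blast+
 obtain \<alpha> \<beta> \<gamma> where m: "\<And>p r. eval2 x' p r = \<alpha>*eval2 x p r+\<beta>*eval2 y p r+\<gamma>"
  using ldet_span[OF l1(1,2,3) d] by blast
 obtain \<alpha>' \<beta>' \<gamma>' where m': "\<And>p r. eval2 y' p r = \<alpha>'*eval2 x p r+\<beta>'*eval2 y p r+\<gamma>'"
  using ldet_span[OF l1(1,2,4) d] by blast
 \<comment> \<open>Four times the expanded invisible form, which clears the denominators.\<close>
 define g where "g = (%x y \<epsilon>. 4*y^3 - 3*x^2*y^2+8*\<epsilon>*x^3 - 12*\<epsilon>*x*y+4*\<epsilon>^2 :: complex)"
 have ex: "4*((y - x^2)^3+(x^3 - 3/2*x*y+\<epsilon>)^2) = g x y \<epsilon>"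
  for x y \<epsilon> :: complex unfolding g_def by (simp add: field_simps power2_eq_square power3_eq_cube)
 have id: "g u v \<epsilon> = g (\<alpha>*u+\<beta> * v + \<gamma>) (\<alpha>'*u+\<beta>' * v + \<gamma>') \<epsilon>'" for u v
 proof -
  obtain p r where xy: "eval2 x p r = u" "eval2 y p r = v" using ldet_solve[OF l1(1,2) d] by blast
  show ?thesis
   using arg_cong[OF trans[OF f(1)[symmetric] f(2)], of "%q. 4*eval2 q p r"]
   unfolding eval2_simps m[of p r] m'[of p r] xy ex .
 qed
 \<comment> \<open>Along rays the coefficient of t^4 is -3 (u v)^2, so the products of the leading
   parts of the two pairs of lines agree up to sign.\<close>
 have lead: "u * v = (\<alpha>*u+\<beta> * v)*(\<alpha>'*u+\<beta>' * v) \<or> u * v = - ((\<alpha>*u+\<beta> * v)*(\<alpha>'*u+\<beta>' * v))" for u v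
 proof -
  define A B where "A = \<alpha>*u+\<beta> * v" and "B = \<alpha>'*u+\<beta>' * v"
  have e1: "4*\<epsilon>^2+0*t+(- 12*\<epsilon>*u * v)*t^2+(4 * v ^ 3+8*\<epsilon>*u^3)*t^3+(- 3*u^2 * v ^ 2)*t^4 = g (t*u) (t * v) \<epsilon>" for t
   unfolding g_def by algebra
  have e2: "g (t*A+\<gamma>) (t*B+\<gamma>') \<epsilon>' = g \<gamma> \<gamma>' \<epsilon>'+(12*B*\<gamma>'^2 - 3*(2*A*\<gamma>*\<gamma>'^2+2*B*\<gamma>'*\<gamma>^2)+24*\<epsilon>'*A*\<gamma>^2 - 12*\<epsilon>'*(A*\<gamma>'+B*\<gamma>))*t
   +(12*B^2*\<gamma>' - 3*(A^2*\<gamma>'^2+B^2*\<gamma>^2+4*A*B*\<gamma>*\<gamma>')+24*\<epsilon>'*A^2*\<gamma> - 12*\<epsilon>'*A*B)*t^2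
   +(4*B^3 - 3*(2*A^2*B*\<gamma>'+2*A*B^2*\<gamma>)+8*\<epsilon>'*A^3)*t^3+(- 3*A^2*B^2)*t^4" for t
   unfolding g_def by algebra
  have e3: "g (t*u) (t * v) \<epsilon> = g (t*A+\<gamma>) (t*B+\<gamma>') \<epsilon>'" for t
   using id[of "t*u" "t * v"] unfolding A_def B_def by (simp add: algebra_simps)
  from quartic_eq(5)[OF trans[OF trans[OF e1 e3] e2]] have "(u * v)^2 = (A*B)^2" by (simp add: power_mult_distrib)
  then show ?thesis unfolding power2_eq_iff A_def B_def .
 qed
 have aa: "\<alpha>*\<alpha>' = 0" "\<beta>*\<beta>' = 0" using lead[of 1 0] lead[of 0 1] by auto
 have ab: "(\<alpha>+\<beta>)*(\<alpha>'+\<beta>') \<noteq> 0" using lead[of 1 1] by auto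
 have cases: "(\<alpha>' = 0 \<and> \<beta> = 0 \<and> \<alpha> \<noteq> 0 \<and> \<beta>' \<noteq> 0) \<or> (\<alpha> = 0 \<and> \<beta>' = 0 \<and> \<alpha>' \<noteq> 0 \<and> \<beta> \<noteq> 0)"
  using aa ab by auto
 from cases show ?thesis
 proof (elim disjE conjE)
  assume z: "\<alpha>' = 0" "\<beta> = 0" "\<alpha> \<noteq> 0" "\<beta>' \<noteq> 0"
  have G: "g u v \<epsilon> = g (\<alpha>*u+\<gamma>) (\<beta>' * v + \<gamma>') \<epsilon>'" for u v using id[of u v] z by simp
  have "(4*\<epsilon>^2 - g (\<alpha>*u+\<gamma>) \<gamma>' \<epsilon>'+8*\<epsilon>*u^3)+(- 12*\<epsilon>*u - (12*\<beta>'*\<gamma>'^2 - 6*(\<alpha>*u+\<gamma>)^2*\<beta>'*\<gamma>' - 12*\<epsilon>'*(\<alpha>*u+\<gamma>)*\<beta>')) * v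
   +(- 3*u^2 - (12*\<beta>'^2*\<gamma>' - 3*(\<alpha>*u+\<gamma>)^2*\<beta>'^2)) * v ^ 2+(4 - 4*\<beta>'^3) * v ^ 3+0 * v ^ 4 = 0" for u v
   using G[of u v] unfolding g_def by algebra
  note c = quartic_eq_0[OF this]
  have b3: "\<beta>'^3 = 1" using c(4) by simp
  have "(- (12*\<beta>'^2*\<gamma>' - 3*\<gamma>^2*\<beta>'^2))+(6*\<alpha>*\<gamma>*\<beta>'^2)*u+(- 3+3*\<alpha>^2*\<beta>'^2)*u^2+0*u^3+0*u^4 = 0" for u
   using c(3)[of u] by algebra
  note c' = quartic_eq_0[OF this]
  have g0: "\<gamma> = 0" using c'(2) z by simp
  have g0': "\<gamma>' = 0" using c'(1) z g0 by simp
  have ee: "\<epsilon> = \<epsilon>'*\<alpha>*\<beta>'" using c(2)[of 1] g0 g0' by (simp add: algebra_simps)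
  have "4*\<epsilon>^2 - 4*\<epsilon>'^2+0*u+0*u^2+(8*\<epsilon> - 8*\<epsilon>'*\<alpha>^3)*u^3+0*u^4 = 0" for u
   using c(1)[of u] unfolding g_def g0 g0' by (simp add: algebra_simps power_mult_distrib)
  note c'' = quartic_eq_0[OF this]
  have e3: "\<epsilon> = \<epsilon>'*\<alpha>^3" using c''(4) by simp
  have "\<epsilon>'*\<alpha>*(\<beta>' - \<alpha>^2) = 0" using ee e3 by algebra
  then have b: "\<beta>' = \<alpha>^2" using e z by simp
  have a6: "\<alpha>^6 = 1" using b3 unfolding b by (simp flip: power_mult)
  have "\<epsilon>*\<alpha>^3 = \<epsilon>'*\<alpha>^6" unfolding e3 by (simp add: mult.assoc flip: power_add)
  then have "\<epsilon>' = \<epsilon>*\<alpha>^3" using a6 by simp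
  moreover have "x' = cpoly2 \<alpha>*x" "y' = cpoly2 (\<alpha>^2)*y"
   using m m' z g0 g0' b by (auto intro!: eval2_inject simp: eval2_simps)
  ultimately show ?thesis using a6 by blast
 next
  assume z: "\<alpha> = 0" "\<beta>' = 0" "\<alpha>' \<noteq> 0" "\<beta> \<noteq> 0"
  have G: "g u v \<epsilon> = g (\<beta> * v + \<gamma>) (\<alpha>'*u+\<gamma>') \<epsilon>'" for u v using id[of u v] z by simp
  have "(4 * v ^ 3+4*\<epsilon>^2 - g (\<beta> * v + \<gamma>) \<gamma>' \<epsilon>')+(- 12*\<epsilon> * v - (12*\<alpha>'*\<gamma>'^2 - 6*(\<beta> * v + \<gamma>)^2*\<alpha>'*\<gamma>' - 12*\<epsilon>'*(\<beta> * v + \<gamma>)*\<alpha>'))*u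
   +(- 3 * v ^ 2 - (12*\<alpha>'^2*\<gamma>' - 3*(\<beta> * v + \<gamma>)^2*\<alpha>'^2))*u^2+(8*\<epsilon> - 4*\<alpha>'^3)*u^3+0*u^4 = 0" for u v
   using G[of u v] unfolding g_def by algebra
  note c = quartic_eq_0[OF this]
  have "(- (12*\<alpha>'^2*\<gamma>' - 3*\<gamma>^2*\<alpha>'^2))+(6*\<beta>*\<gamma>*\<alpha>'^2)*u+(- 3+3*\<beta>^2*\<alpha>'^2)*u^2+0*u^3+0*u^4 = 0" for u
   using c(3)[of u] by algebra
  note c' = quartic_eq_0[OF this]
  have g0: "\<gamma> = 0" using c'(2) z by simp
  have "x' = cpoly2 \<beta>*y" using m z g0 by (auto intro!: eval2_inject simp: eval2_simps)
  then show ?thesis using z by blast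
 qed
qed

lemma coeff2_cmult: "coeff (coeff (cpoly2 c*p) j) i = c * coeff (coeff p j) i"
 unfolding cpoly2_def by simp

lemma coeff2_cpoly2: "coeff (coeff (cpoly2 c) j) i = (if i = 0 \<and> j = 0 then c else 0)"
 unfolding cpoly2_def by (auto simp: coeff_pCons split: nat.splits)

lemma ldet_proportional:
 assumes "cpoly2 a*p = cpoly2 b*q" "a \<noteq> 0"
 shows "ldet p q = 0"
proof -
 have "a * coeff (coeff p j) i = b * coeff (coeff q j) i" for i j
  using arg_cong[OF assms(1), of "%p. coeff (coeff p j) i"] by (simp add: coeff2_cmult)
 from this[of 0 1] this[of 1 0] have "a*ldet p q = 0" unfolding ldet_def by algebra
 then show ?thesis using assms(2) by simp
qed

lemma invisible_form_torus:
 assumes f: "totdeg f = 4" "irreducible f" and t: "invisible_form f x y \<epsilon>"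
 shows "(y - x^2, x^3 - cpoly2 (3/2)*x*y + cpoly2 \<epsilon>) \<in> invisible_decs f" (is "(?g2, ?g3) \<in> _")
proof -
 have l1: "totdeg x \<le> 1" "totdeg y \<le> 1" and d: "ldet x y \<noteq> 0" and fe: "f = ?g2^3+?g3^2"
  using t unfolding invisible_form_def by blast+
 have "totdeg x \<noteq> 0"
 proof
  assume "totdeg x = 0"
  then have "coeff (coeff x 0) 1 = 0" "coeff (coeff x 1) 0 = 0" using totdeg_leD[of x 0] by auto
  then show False using d unfolding ldet_def by simp
 qed
 then have x1: "totdeg x = 1" using l1 by simp
 then have x0: "x \<noteq> 0" using totdeg_0 by auto
 have x2: "totdeg (x^2) = 2" using totdeg_mult[OF x0 x0] x1 by (simp add: power2_eq_square)
 have g2: "totdeg ?g2 = 2"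
 proof (rule antisym)
  show "totdeg ?g2 \<le> 2" using x2 l1 by (intro totdeg_diff_le) auto
  show "2 \<le> totdeg ?g2"
  proof (rule ccontr)
   assume "\<not> 2 \<le> totdeg ?g2"
   then have "totdeg ?g2 \<le> 1" by simp
   from totdeg_diff_le[OF l1(2) this] show False using x2 by simp
  qed
 qed
 have g3: "totdeg ?g3 \<le> 3"
  using l1 totdeg_power_le[OF l1(1), of 3] totdeg_cpoly2[of \<epsilon>]
   totdeg_mult_le[OF totdeg_mult_le[of "cpoly2 (3/2)" 0 x 1] l1(2)] totdeg_cpoly2[of "3/2"]
  by (auto intro!: totdeg_diff_le totdeg_add_le)
 have g30: "totdeg ?g3 \<noteq> 0"
 proof
  assume "totdeg ?g3 = 0"
  then have "totdeg (?g3^2) \<le> 0" using totdeg_power_le[of ?g3 0 2] by simp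
  then have "totdeg (f - ?g3^2) \<le> 4" using f by (intro totdeg_diff_le) auto
  then have 1: "totdeg (?g2^3) \<le> 4" using fe by simp
  have n: "?g2 \<noteq> 0" using g2 totdeg_0 by auto
  have "totdeg (?g2^3) = 6" using totdeg_mult[OF n n] totdeg_mult[of ?g2 "?g2*?g2"] n g2 by (simp add: power3_eq_cube mult.assoc)
  then show False using 1 by simp
 qed
 have "cpoly2 1*f = ?g2^3+?g3^2" unfolding cpoly2_1 using fe by simp
 then have "\<exists>c. c \<noteq> 0 \<and> cpoly2 c*f = ?g2^3+?g3^2" by (intro exI[of _ 1]) simp
 then show ?thesis unfolding invisible_decs_def torus_decs_def
  using torus_sum_coprime[OF f(2) fe] g2 g3 g30 by simp
qed

text \<open>For fixed l, the formula for 2 \<open>\<kappa>\<close> q is a monic quadratic in l' with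
  linear coefficient l + \<open>\<kappa>\<close>^2. By Vieta the other root is -(l + l' +
  \<open>\<kappa>\<close>^2).\<close>

lemma tri_form_third:
 assumes "tri_form f q l \<kappa> l'"
 shows "tri_form f q l \<kappa> (- (l+l' + cpoly2 (\<kappa>^2)))" (is "tri_form _ _ _ _ ?m")
proof -
 have k: "\<kappa> \<noteq> 0" and v: "visible_dec f q l" and l1: "totdeg l' \<le> 1" and d: "ldet l l' \<noteq> 0"
  and q: "q = cpoly2 (1/(2*\<kappa>))*(l^2+l*l'+l'^2) - cpoly2 (\<kappa>/2)*(l - l')"
  using assms unfolding tri_form_def by blast+
 have "totdeg l \<le> 1" using v unfolding visible_dec_def by blast
 then have m1: "totdeg ?m \<le> 1" using l1 totdeg_cpoly2 by (intro totdeg_uminus_le totdeg_add_le) auto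
 have "ldet l ?m = - ldet l l'" unfolding ldet_def by (simp add: coeff2_cpoly2 algebra_simps)
 then have "ldet l ?m \<noteq> 0" using d by simp
 moreover have "q = cpoly2 (1/(2*\<kappa>))*(l^2+l*?m+?m^2) - cpoly2 (\<kappa>/2)*(l - ?m)"
 proof (rule eval2_inject)
  fix x y
  define c where "c = 1/(2*\<kappa>)"
  have c: "2 * c*\<kappa> = 1" unfolding c_def using k by simp
  show "eval2 q x y = eval2 (cpoly2 (1/(2*\<kappa>))*(l^2+l*?m+?m^2) - cpoly2 (\<kappa>/2)*(l - ?m)) x y"
   unfolding q eval2_simps c_def[symmetric] using c by algebra
 qed
 ultimately show ?thesis unfolding tri_form_def using k v m1 by blast
qed

text \<open>The representatives have the lines l, l' and -(l + l' + \<open>\<kappa>\<close>^2).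
  Their linear parts are pairwise independent, whereas equivalent decompositions have proportional
  lines.\<close>

lemma tri_form_visible_card:
 assumes f: "totdeg f = 4" "irreducible f" and t: "tri_form f q l \<kappa> l'"
 obtains D where "D \<subseteq> visible_decs f" "card D = 3"
  "\<And>d d'. d \<in> D ==> d' \<in> D ==> (d, d') \<in> dec_equiv ==> d = d'"
  "\<And>s. s \<in> visible_decs f ==> \<exists>d\<in>D. (d, s) \<in> dec_equiv"
proof -
 define m where "m = - (l+l' + cpoly2 (\<kappa>^2))"
 define q1 q2 where "q1 = q + cpoly2 \<kappa>*(l - l')" and "q2 = q + cpoly2 \<kappa>*(l - m)"
 have v: "visible_dec f q l" and d: "ldet l l' \<noteq> 0" using t unfolding tri_form_def by auto
 have t3: "tri_form f q l \<kappa> m" unfolding m_def by (rule tri_form_third[OF t])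
 have v1: "visible_dec f q1 l'" "visible_dec f q2 m" unfolding q1_def q2_def by (rule tri_form_second[OF t] tri_form_second[OF t3])+
 define D where "D = {(l, q), (l', q1), (m, q2)}"
 have anti: "ldet a b = - ldet b a" for a b unfolding ldet_def by simp
 have d3: "ldet l m \<noteq> 0" using t3 unfolding tri_form_def by blast
 have "ldet l' m = ldet l l'" unfolding m_def ldet_def by (simp add: coeff2_cpoly2 algebra_simps)
 then have d2: "ldet l' m \<noteq> 0" using d by simp
 have dz: "ldet a a' = 0" if "((a, b), (a', b')) \<in> dec_equiv" for a b a' b'
  using that by (rule dec_equivE) (simp add: ldet_cmult)
 have ne: "ldet a b \<noteq> 0" "ldet b a \<noteq> 0" if "(a, b) \<in> {(l, l'), (l, m), (l', m)}" for a b
  using that d d2 d3 anti[of b a] by auto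
 have neq: "l \<noteq> l'" "l \<noteq> m" "l' \<noteq> m" using d d2 d3 unfolding ldet_def by auto
 have tv: "p \<in> visible_decs f" if "visible_dec f b a" "p = (a, b)" for a b p
  unfolding visible_decs_def that(2) using visible_dec_torus[OF f that(1)] by simp
 show thesis
 proof (rule that[of D])
  show "D \<subseteq> visible_decs f" unfolding D_def using tv[OF v refl] tv[OF v1(1) refl] tv[OF v1(2) refl] by blast
  show "card D = 3" unfolding D_def using neq by simp
  show "d = d'" if dd: "d \<in> D" "d' \<in> D" "(d, d') \<in> dec_equiv" for d d'
  proof (rule ccontr)
   assume "d \<noteq> d'"
   obtain a b a' b' where ab: "d = (a, b)" "d' = (a', b')" by (metis surj_pair)
   have "(a, a') \<in> {(l, l'), (l, m), (l', m)} \<or> (a', a) \<in> {(l, l'), (l, m), (l', m)}"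
    using dd(1,2) \<open>d \<noteq> d'\<close> unfolding ab D_def by auto
   then have "ldet a a' \<noteq> 0" using ne by blast
   then show False using dz dd(3) unfolding ab by blast
  qed
  fix s assume s: "s \<in> visible_decs f"
  obtain g2 g3 where g: "s = (g2, g3)" by (cases s)
  have st: "(g2, g3) \<in> torus_decs f" "totdeg g2 \<le> 1" using s unfolding g visible_decs_def by auto
  have tr: "(p, r) \<in> dec_equiv ==> (r, s) \<in> dec_equiv ==> (p, s) \<in> dec_equiv" for p r
   using equiv_dec_equiv by (meson equivE transD)
  from st(1) show "\<exists>d\<in>D. (d, s) \<in> dec_equiv"
  proof (cases rule: torus_dec_cases[OF f(1), consumes 1, case_names visible invisible])
   case (visible q' n)
   have third: "\<exists>d\<in>D. (d, (n, q')) \<in> dec_equiv" if w: "\<omega>^3 = 1" and tf: "tri_form f q l \<mu> (cpoly2 \<omega>*n)"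
    and q': "q' = q + cpoly2 \<mu>*(l - cpoly2 \<omega>*n) \<or> q' = - (q + cpoly2 \<mu>*(l - cpoly2 \<omega>*n))" for \<omega> \<mu>
   proof -
    have mu: "\<mu> = \<kappa>" "cpoly2 \<omega>*n = l' \<or> cpoly2 \<omega>*n = m"
     using tri_form_compare[OF t tf] unfolding m_def by auto
    have "(\<omega>^2)^3 = (\<omega>^3)^2" by (simp flip: power_mult)
    then have w2: "(\<omega>^2)^3 = 1" using w by simp
    have "\<omega>^2*\<omega> = 1" using w by (simp add: power2_eq_square power3_eq_cube)
    then have n: "n = cpoly2 (\<omega>^2)*(cpoly2 \<omega>*n)" by (simp add: mult.assoc[symmetric] cpoly2_mult[symmetric] cpoly2_1)
    from mu(2) show ?thesis
    proof (elim disjE)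
     assume e: "cpoly2 \<omega>*n = l'"
     have "((l', q1), (n, q')) \<in> dec_equiv"
      by (rule dec_equiv_visible_same[OF w2 n[unfolded e] q'[unfolded e mu(1) q1_def[symmetric]]])
     then show ?thesis unfolding D_def by blast
    next
     assume e: "cpoly2 \<omega>*n = m"
     have "((m, q2), (n, q')) \<in> dec_equiv"
      by (rule dec_equiv_visible_same[OF w2 n[unfolded e] q'[unfolded e mu(1) q2_def[symmetric]]])
     then show ?thesis unfolding D_def by blast
    qed
   qed
   have "\<exists>d\<in>D. (d, (n, q')) \<in> dec_equiv"
    using visible_dec_compare[OF f v visible(1)]
   proof (elim disjE[of "\<exists>\<omega>. \<omega>^3 = 1 \<and> n = cpoly2 \<omega>*l \<and> (q' = q \<or> q' = - q)"] exE conjE)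
    fix \<omega> assume "\<omega>^3 = 1" "n = cpoly2 \<omega>*l" "q' = q \<or> q' = - q"
    then have "((l, q), (n, q')) \<in> dec_equiv" by (rule dec_equiv_visible_same)
    then show ?thesis unfolding D_def by blast
   qed (rule third)
   then show ?thesis using tr visible(2) unfolding g by blast
  next
   case (invisible g2' g3')
   then show ?thesis using st(2) by simp
  qed
 qed
qed

text \<open>The affine functions x and y interpolate: at the cusps (0, 0), (0,
  -\<open>\<kappa>\<close>^2), (-\<open>\<kappa>\<close>^2, 0) in the coordinates (l, l'), x takes
  the values 1, \<open>\<omega>\<close>, \<open>\<omega>\<close>^2 and y their squares. That is
  where an invisible form has its cusps, up to the scale \<open>\<gamma>\<close>. Exchanging x and y
  exchanges the last two values and gives the second form.\<close>

lemma tri_form_invisible_forms: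
 assumes t: "tri_form f q l \<kappa> l'"
 obtains x y \<gamma> where "\<gamma> \<noteq> 0" "invisible_form f (cpoly2 \<gamma>*x) (cpoly2 (\<gamma>^2)*y) (\<gamma>^3/2)"
  "invisible_form f (cpoly2 \<gamma>*y) (cpoly2 (\<gamma>^2)*x) (\<gamma>^3/2)" "ldet x y \<noteq> 0" "totdeg x \<le> 1" "totdeg y \<le> 1"
proof -
 have k: "\<kappa> \<noteq> 0" and v: "visible_dec f q l" and l1': "totdeg l' \<le> 1" and d: "ldet l l' \<noteq> 0"
  and q: "q = cpoly2 (1/(2*\<kappa>))*(l^2+l*l'+l'^2) - cpoly2 (\<kappa>/2)*(l - l')"
  using t unfolding tri_form_def by blast+
 have l1: "totdeg l \<le> 1" "f = q^2+l^3" using v unfolding visible_dec_def by auto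
 define \<omega> where "\<omega> = cubert"
 have w: "\<omega>^2 = - 1 - \<omega>" using cubert_sum unfolding \<omega>_def by algebra
 define a b where "a = (1 - \<omega>)/\<kappa>^2" and "b = (1 - \<omega>^2)/\<kappa>^2"
 define x y where "x = cpoly2 1 + cpoly2 a*l' + cpoly2 b*l" and "y = cpoly2 1 + cpoly2 b*l' + cpoly2 a*l"
 define \<theta> where "\<theta> = Complex 0 (1 / sqrt 3)"
 have th: "\<theta>^2 = - 1/3" unfolding \<theta>_def by (simp add: complex_eq_iff power2_eq_square)
 \<comment> \<open>The scale must satisfy 27 \<open>\<gamma>\<close>^6 = -\<open>\<kappa>\<close>^6
   for the expanded forms to agree; \<open>\<theta>\<close>^2 = -1/3 achieves this.\<close>
 define \<gamma> where "\<gamma> = \<kappa>*\<theta>"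
 have g0: "\<gamma> \<noteq> 0" unfolding \<gamma>_def using k th by auto
 have "\<gamma>^6 = \<kappa>^6*(\<theta>^2)^3" unfolding \<gamma>_def by (simp add: power_mult_distrib flip: power_mult)
 then have g6: "27*\<gamma>^6 = - (\<kappa>^6)" unfolding th by (simp add: power3_eq_cube)
 have cm: "totdeg (cpoly2 c*p) \<le> 1" if "totdeg p \<le> 1" for c p
  using totdeg_mult_le[of "cpoly2 c" 0 p 1] that totdeg_cpoly2 by auto
 have xy1: "totdeg x \<le> 1" "totdeg y \<le> 1" unfolding x_def y_def
  using cm l1 l1' totdeg_cpoly2 by (auto intro!: totdeg_add_le)
 have "ldet x y = (b^2 - a^2)*ldet l l'" unfolding x_def y_def ldet_def coeff_add coeff2_cmult coeff2_cpoly2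
  by (simp add: algebra_simps power2_eq_square)
 moreover have "b^2 - a^2 \<noteq> 0"
 proof -
  have "b+a = 3/\<kappa>^2" "b - a = \<omega>*(1 - \<omega>)/\<kappa>^2"
   unfolding a_def b_def add_divide_distrib[symmetric] diff_divide_distrib[symmetric] w
   by (simp_all add: algebra_simps flip: power2_eq_square) (simp add: w)
  then have "(b+a)*(b - a) \<noteq> 0" using k cubert_ne unfolding \<omega>_def by auto
  then show ?thesis by (simp add: algebra_simps power2_eq_square)
 qed
 ultimately have dxy: "ldet x y \<noteq> 0" using d by simp
 have key: "4*eval2 f p r = \<gamma>^6*(4*Y^3 - 3*X^2*Y^2+4*X^3 - 6*X*Y+1)"
  if XY: "X = eval2 x p r" "Y = eval2 y p r" for p r X Y
 proof -
  define u v where "u = eval2 l p r/\<kappa>^2" and "v = eval2 l' p r/\<kappa>^2"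
  have uv: "eval2 l p r = \<kappa>^2*u" "eval2 l' p r = \<kappa>^2 * v" unfolding u_def v_def using k by auto
  have X: "X = 1+(1 - \<omega>) * v + (1 - \<omega>^2)*u" "Y = 1+(1 - \<omega>^2) * v + (1 - \<omega>)*u"
   unfolding XY x_def y_def a_def b_def eval2_simps uv using k by simp_all
  have "1/(2*\<kappa>)*((\<kappa>^2*u)^2+\<kappa>^2*u*(\<kappa>^2 * v)+(\<kappa>^2 * v)^2) = \<kappa>^3/2*(u^2+u * v + v ^ 2)"
   using k by (simp add: field_simps power2_eq_square power3_eq_cube)
  then have qe: "2*eval2 q p r = \<kappa>^3*(u^2+u * v + v ^ 2 - (u - v))"
   unfolding q eval2_simps uv by (simp add: algebra_simps power2_eq_square power3_eq_cube)
  have f4: "4*eval2 f p r = (2*eval2 q p r)^2+4*eval2 l p r^3" unfolding l1(2) eval2_simps by (simp add: algebra_simps power2_eq_square)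
  have 1: "4*eval2 f p r = \<kappa>^6*((u^2+u * v + v ^ 2 - (u - v))^2+4*u^3)"
   unfolding f4 qe uv by algebra
  have 2: "27*((u^2+u * v + v ^ 2 - (u - v))^2+4*u^3) = - (4*Y^3 - 3*X^2*Y^2+4*X^3 - 6*X*Y+1)"
   unfolding X using w by algebra
  show ?thesis using 1 2 g6 by algebra
 qed
 have ex: "(\<gamma>^2*y - (\<gamma>*x)^2)^3+((\<gamma>*x)^3 - 3/2*(\<gamma>*x)*(\<gamma>^2*y)+\<gamma>^3/2)^2 =
   \<gamma>^6*(4*y^3 - 3*x^2*y^2+4*x^3 - 6*x*y+1)/4" for x y
  by (simp add: field_simps power2_eq_square power3_eq_cube power_mult_distrib numeral_eq_Suc)
 have inv: "invisible_form f (cpoly2 \<gamma>*x') (cpoly2 (\<gamma>^2)*y') (\<gamma>^3/2)"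
  if xy: "totdeg x' \<le> 1" "totdeg y' \<le> 1" "ldet x' y' \<noteq> 0"
   and K: "\<And>p r. 4*eval2 f p r = \<gamma>^6*(4*eval2 y' p r^3 - 3*eval2 x' p r^2*eval2 y' p r^2+4*eval2 x' p r^3 - 6*eval2 x' p r*eval2 y' p r+1)" for x' y'
  unfolding invisible_form_def
 proof (intro conjI)
  have "ldet (cpoly2 \<gamma>*x') (cpoly2 (\<gamma>^2)*y') = \<gamma>^3*ldet x' y'"
   unfolding ldet_def coeff2_cmult by algebra
  then show "ldet (cpoly2 \<gamma>*x') (cpoly2 (\<gamma>^2)*y') \<noteq> 0" using g0 xy by simp
  show "f = (cpoly2 (\<gamma>^2)*y' - (cpoly2 \<gamma>*x')^2)^3 +
   ((cpoly2 \<gamma>*x')^3 - cpoly2 (3/2)*(cpoly2 \<gamma>*x')*(cpoly2 (\<gamma>^2)*y') + cpoly2 (\<gamma>^3/2))^2"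
  proof (rule eval2_inject, unfold eval2_simps ex)
   fix p r
   show "eval2 f p r = \<gamma>^6*(4*eval2 y' p r^3 - 3*(eval2 x' p r)\<^sup>2*(eval2 y' p r)\<^sup>2+4*eval2 x' p r^3 - 6*eval2 x' p r*eval2 y' p r+1)/4"
    unfolding K[of p r, symmetric] by simp
  qed
 qed (use cm xy g0 in auto)
 have "ldet y x \<noteq> 0" using dxy unfolding ldet_def by (auto simp: algebra_simps)
 have K2: "4*eval2 f p r = \<gamma>^6*(4*eval2 x p r^3 - 3*eval2 y p r^2*eval2 x p r^2+4*eval2 y p r^3 - 6*eval2 y p r*eval2 x p r+1)" for p r
  unfolding key[OF refl refl] by (simp add: algebra_simps)
 show thesis
  by (rule that[OF g0 inv[OF xy1 dxy key[OF refl refl]] inv[OF xy1(2,1) \<open>ldet y x \<noteq> 0\<close> K2] dxy xy1])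
qed

text \<open>The polynomials y - x^2 and x - y^2 are not proportional, so the two forms are
  inequivalent. A decomposition equivalent to neither would, by comparison with each, have its first
  line proportional to both y and x.\<close>

lemma tri_form_invisible_card:
 assumes f: "totdeg f = 4" "irreducible f" and t: "tri_form f q l \<kappa> l'"
 obtains D where "D \<subseteq> invisible_decs f" "card D = 2"
  "\<And>d d'. d \<in> D ==> d' \<in> D ==> (d, d') \<in> dec_equiv ==> d = d'"
  "\<And>s. s \<in> invisible_decs f ==> \<exists>d\<in>D. (d, s) \<in> dec_equiv"
proof -
 obtain x y \<gamma> where g0: "\<gamma> \<noteq> 0" and i: "invisible_form f (cpoly2 \<gamma>*x) (cpoly2 (\<gamma>^2)*y) (\<gamma>^3/2)"
  "invisible_form f (cpoly2 \<gamma>*y) (cpoly2 (\<gamma>^2)*x) (\<gamma>^3/2)" and d: "ldet x y \<noteq> 0" and xy1: "totdeg x \<le> 1" "totdeg y \<le> 1"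
  by (rule tri_form_invisible_forms[OF t])
 have v: "visible_dec f q l" using t unfolding tri_form_def by blast
 define dec where "dec = (%x y \<epsilon>. (y - x^2, x^3 - cpoly2 (3/2)*x*y + cpoly2 \<epsilon>) :: complex poly poly \<times> complex poly poly)"
 define d1 d2 where "d1 = dec (cpoly2 \<gamma>*x) (cpoly2 (\<gamma>^2)*y) (\<gamma>^3/2)" and "d2 = dec (cpoly2 \<gamma>*y) (cpoly2 (\<gamma>^2)*x) (\<gamma>^3/2)"
 have n12: "(d1, d2) \<notin> dec_equiv"
 proof
  assume "(d1, d2) \<in> dec_equiv"
  then obtain c where c: "cpoly2 (\<gamma>^2)*x - (cpoly2 \<gamma>*y)^2 = cpoly2 c*(cpoly2 (\<gamma>^2)*y - (cpoly2 \<gamma>*x)^2)"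
   unfolding d1_def d2_def dec_def by (auto elim: dec_equivE)
  have E: "\<gamma>^2*(u - w^2) = \<gamma>^2*(c*(w - u^2))" for u w
  proof -
   obtain p r where pr: "eval2 x p r = u" "eval2 y p r = w" using ldet_solve[OF xy1 d] by blast
   show ?thesis using arg_cong[OF c, of "%q. eval2 q p r"] unfolding eval2_simps pr by (simp add: algebra_simps power_mult_distrib)
  qed
  have e: "u - w^2 = c*(w - u^2)" for u w using E[of u w] power_not_zero[OF g0, of 2] by (simp only: mult_cancel_left) blast
  have "1 = - c" using e[of 1 0] by simp
  then have "c = - 1" by (metis minus_minus)
  then show False using e[of 2 0] by simp
 qed
 then have n21: "(d2, d1) \<notin> dec_equiv" using equiv_dec_equiv by (meson equivE symD)
 have refl: "(p, p) \<in> dec_equiv" for p using equiv_dec_equiv by (meson equivE refl_onD UNIV_I)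
 show thesis
 proof (rule that[of "{d1, d2}"])
  show "{d1, d2} \<subseteq> invisible_decs f" unfolding d1_def d2_def dec_def using invisible_form_torus[OF f] i by blast
  show "card {d1, d2} = 2" using n12 refl[of d1] by (metis card_2_iff)
  show "d = d'" if "d \<in> {d1, d2}" "d' \<in> {d1, d2}" "(d, d') \<in> dec_equiv" for d d'
   using that n12 n21 by blast
  fix s assume s: "s \<in> invisible_decs f"
  obtain g2 g3 where g: "s = (g2, g3)" by (cases s)
  have st: "(g2, g3) \<in> torus_decs f" "\<not> totdeg g2 \<le> 1" using s unfolding g invisible_decs_def by auto
  from st(1) show "\<exists>d\<in>{d1, d2}. (d, s) \<in> dec_equiv"
  proof (cases rule: torus_dec_cases[OF f(1), consumes 1, case_names visible invisible])
   case (visible q' n)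
   then show ?thesis using st(2) by simp
  next
   case (invisible g2' g3')
   have "totdeg q \<le> 2" "totdeg (f - q^2) \<le> 3" using v totdeg_power_le[of l 1 3] unfolding visible_dec_def by auto
   then obtain x' y' \<epsilon> where I: "invisible_form f x' y' \<epsilon>" and G: "g2' = y' - x'^2" "g3' = x'^3 - cpoly2 (3/2)*x'*y' + cpoly2 \<epsilon>"
    using invisible_normal_form[OF f _ _ invisible(1,2,3)] by metis
   have same: "(dec X Y e, (g2', g3')) \<in> dec_equiv"
    if s: "s^6 = 1" "x' = cpoly2 s*X" "y' = cpoly2 (s^2)*Y" "\<epsilon> = e * s^3" for X Y e s
    unfolding dec_def
   proof (rule dec_equivI[of "s^2" "s^3"])
    show "s^2 \<noteq> 0" "s^3 \<noteq> 0" using s(1) by auto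
    show "g2' = cpoly2 (s^2)*(Y - X^2)" unfolding G s
     by (rule eval2_inject) (simp add: eval2_simps algebra_simps power_mult_distrib)
    show "g3' = cpoly2 (s^3)*(X^3 - cpoly2 (3/2)*X*Y + cpoly2 e)" unfolding G s
     by (rule eval2_inject) (simp add: eval2_simps algebra_simps power_mult_distrib power2_eq_square power3_eq_cube)
   qed
   have "\<exists>d\<in>{d1, d2}. (d, (g2', g3')) \<in> dec_equiv"
    using invisible_form_compare[OF i(1) I]
   proof (elim disjE exE conjE)
    fix s assume "s^6 = 1" "x' = cpoly2 s*(cpoly2 \<gamma>*x)" "y' = cpoly2 (s^2)*(cpoly2 (\<gamma>^2)*y)" "\<epsilon> = \<gamma>^3/2 * s^3"
    from same[OF this] show ?thesis unfolding d1_def by blast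
   next
    fix a assume a: "a \<noteq> 0" "x' = cpoly2 a*(cpoly2 (\<gamma>^2)*y)"
    from invisible_form_compare[OF i(2) I] show ?thesis
    proof (elim disjE exE conjE)
     fix s assume "s^6 = 1" "x' = cpoly2 s*(cpoly2 \<gamma>*y)" "y' = cpoly2 (s^2)*(cpoly2 (\<gamma>^2)*x)" "\<epsilon> = \<gamma>^3/2 * s^3"
     from same[OF this] show ?thesis unfolding d2_def by blast
    next
     fix b assume b: "b \<noteq> 0" "x' = cpoly2 b*(cpoly2 (\<gamma>^2)*x)"
     have "cpoly2 (b*\<gamma>^2)*x = cpoly2 (a*\<gamma>^2)*y" using a b by (simp add: cpoly2_mult mult.assoc)
     then have "ldet x y = 0" by (rule ldet_proportional) (use b g0 in simp)
     then show ?thesis using d by simp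
    qed
   qed
   then show ?thesis using invisible(4) equiv_dec_equiv unfolding g by (meson equivE transD)
  qed
 qed
qed

lemma tri_form_card:
 assumes f: "totdeg f = 4" "irreducible f" and t: "tri_form f q l \<kappa> l'"
 shows "card (torus_decs f // dec_equiv) = 5" "card (visible_decs f // dec_equiv) = 3" "card (invisible_decs f // dec_equiv) = 2"
proof -
 obtain D where D: "D \<subseteq> visible_decs f" "card D = 3"
  "\<And>d d'. d \<in> D ==> d' \<in> D ==> (d, d') \<in> dec_equiv ==> d = d'"
  "\<And>s. s \<in> visible_decs f ==> \<exists>d\<in>D. (d, s) \<in> dec_equiv"
  by (rule tri_form_visible_card[OF f t]) blast
 obtain E where E: "E \<subseteq> invisible_decs f" "card E = 2"
  "\<And>d d'. d \<in> E ==> d' \<in> E ==> (d, d') \<in> dec_equiv ==> d = d'"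
  "\<And>s. s \<in> invisible_decs f ==> \<exists>d\<in>E. (d, s) \<in> dec_equiv"
  by (rule tri_form_invisible_card[OF f t]) blast
 show "card (visible_decs f // dec_equiv) = 3" "card (invisible_decs f // dec_equiv) = 2"
  using card_quotient_representatives[OF equiv_dec_equiv D(1,3,4)] D(2)
   card_quotient_representatives[OF equiv_dec_equiv E(1,3,4)] E(2) by auto
 have split: "torus_decs f = visible_decs f \<union> invisible_decs f" "visible_decs f \<inter> invisible_decs f = {}"
  unfolding visible_decs_def invisible_decs_def by auto
 have td: "totdeg (fst d) = totdeg (fst d')" if "(d, d') \<in> dec_equiv" for d d'
  using that unfolding dec_equiv_def by (auto simp: totdeg_cmult)
 have sep: "\<not> (d \<in> D \<and> e \<in> E)" if "(d, e) \<in> dec_equiv \<or> (e, d) \<in> dec_equiv" for d e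
 proof
  assume "d \<in> D \<and> e \<in> E"
  then have "totdeg (fst d) \<le> 1" "\<not> totdeg (fst e) \<le> 1" using D(1) E(1) unfolding visible_decs_def invisible_decs_def by auto
  moreover have "totdeg (fst d) = totdeg (fst e)" using td[of d e] td[of e d] that by auto
  ultimately show False by simp
 qed
 have "card (torus_decs f // dec_equiv) = card (D \<union> E)"
 proof (rule card_quotient_representatives[OF equiv_dec_equiv])
  show "D \<union> E \<subseteq> torus_decs f" using D(1) E(1) split by blast
  show "d = d'" if dd: "d \<in> D \<union> E" "d' \<in> D \<union> E" "(d, d') \<in> dec_equiv" for d d'
  proof (cases "d \<in> D")
   case True
   then have "d' \<in> D" using sep[of d d'] dd by blast
   then show ?thesis using D(3) True dd by blast
  next
   case False
   then have "d \<in> E" "d' \<in> E" using sep[of d' d] dd by blast+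
   then show ?thesis using E(3) dd by blast
  qed
  show "\<exists>d\<in>D \<union> E. (d, s) \<in> dec_equiv" if "s \<in> torus_decs f" for s
   using that D(4)[of s] E(4)[of s] unfolding split by blast
 qed
 moreover have "card (D \<union> E) = card D + card E"
  by (rule card_Un_disjoint) (use D(1,2) E(1,2) split card.infinite in \<open>fastforce+\<close>)
 ultimately show "card (torus_decs f // dec_equiv) = 5" using D(2) E(2) by simp
qed

section \<open>Adapted coordinates and existence of visible decompositions\<close>

definition comb :: "pt3 => pt3 => pt3 => pt3 => pt3" where
 "comb u v w p = (case p of (s, t, r) => case u of (u1, u2, u3) => case v of (v1, v2, v3) => case w of (w1, w2, w3) =>
   (s*u1+t * v1+r*w1, s*u2+t * v2+r*w2, s*u3+t * v3+r*w3))"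

lemma comb_simps: "comb (u1, u2, u3) (v1, v2, v3) (w1, w2, w3) (s, t, r) =
  (s*u1+t * v1+r*w1, s*u2+t * v2+r*w2, s*u3+t * v3+r*w3)"
 by (simp add: comb_def)

lemma comb_unit: "comb u v w (1, 0, 0) = u" "comb u v w (0, 1, 0) = v" "comb u v w (0, 0, 1) = w"
 by (cases u; cases v; cases w; simp add: comb_simps)+

lemma comb_swap: "comb v u w (t, s, r) = comb u v w (s, t, r)"
 by (cases u; cases v; cases w) (simp add: comb_simps add.commute)

lemma zcoord_comb: "zcoord (comb u v w (s, t, r)) = s*zcoord u+t*zcoord v + r*zcoord w"
 by (cases u; cases v; cases w) (simp add: comb_simps zcoord_def)

lemma det3_swap: "det3 v u w = - det3 u v w"
 by (cases u; cases v; cases w) (simp add: det3_simps algebra_simps)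

lemma det3_rotate: "det3 v w u = det3 u v w"
 by (cases u; cases v; cases w) (simp add: det3_simps algebra_simps)

lemma comb_coords:
 assumes "det3 u v w \<noteq> 0"
 obtains S T R where "form 1 S" "form 1 T" "form 1 R" "\<And>p. comb u v w (S p, T p, R p) = p"
  "\<And>s t r. S (comb u v w (s, t, r)) = s" "\<And>s t r. T (comb u v w (s, t, r)) = t" "\<And>s t r. R (comb u v w (s, t, r)) = r"
proof -
 obtain u1 u2 u3 v1 v2 v3 w1 w2 w3 where uvw: "u = (u1, u2, u3)" "v = (v1, v2, v3)" "w = (w1, w2, w3)"
  by (metis prod_cases3)
 define D where "D = det3 u v w"
 have D: "D \<noteq> 0" "D = u1*(v2*w3 - v3*w2) - u2*(v1*w3 - v3*w1)+u3*(v1*w2 - v2*w1)"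
  using assms unfolding D_def uvw det3_simps by auto
 define S where "S = (%p :: pt3. (v2*w3 - v3*w2)/D*fst p+(v3*w1 - v1*w3)/D*fst (snd p)+(v1*w2 - v2*w1)/D * snd (snd p))"
 define T where "T = (%p :: pt3. (u3*w2 - u2*w3)/D*fst p+(u1*w3 - u3*w1)/D*fst (snd p)+(u2*w1 - u1*w2)/D * snd (snd p))"
 define R where "R = (%p :: pt3. (u2 * v3 - u3 * v2)/D*fst p+(u3 * v1 - u1 * v3)/D*fst (snd p)+(u1 * v2 - u2 * v1)/D * snd (snd p))"
 have e: "D*S (x, y, z) = (v2*w3 - v3*w2)*x+(v3*w1 - v1*w3)*y+(v1*w2 - v2*w1)*z"
  "D*T (x, y, z) = (u3*w2 - u2*w3)*x+(u1*w3 - u3*w1)*y+(u2*w1 - u1*w2)*z"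
  "D * R (x, y, z) = (u2 * v3 - u3 * v2)*x+(u3 * v1 - u1 * v3)*y+(u1 * v2 - u2 * v1)*z" for x y z
  unfolding S_def T_def R_def using D(1) by (simp_all add: distrib_left)
 have c: "D*a = D*b ==> a = b" for a b using D(1) by simp
 show thesis
 proof (rule that[of S T R])
  show "form 1 S" "form 1 T" "form 1 R" unfolding S_def T_def R_def by (rule form_linear)+
  fix p :: pt3 and s t r
  obtain x y z where p: "p = (x, y, z)" by (metis prod_cases3)
  show "comb u v w (S p, T p, R p) = p"
   unfolding p uvw comb_simps prod.inject
  proof (intro conjI; rule c)
   have x: "D*(S (x, y, z)*a+T (x, y, z)*b + R (x, y, z)*e) = (D*S (x, y, z))*a+(D*T (x, y, z))*b+(D * R (x, y, z))*e" for a b e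
    by (simp add: algebra_simps)
   show "D*(S (x, y, z)*u1+T (x, y, z) * v1 + R (x, y, z)*w1) = D*x" unfolding x e unfolding D(2) by algebra
   show "D*(S (x, y, z)*u2+T (x, y, z) * v2 + R (x, y, z)*w2) = D*y" unfolding x e unfolding D(2) by algebra
   show "D*(S (x, y, z)*u3+T (x, y, z) * v3 + R (x, y, z)*w3) = D*z" unfolding x e unfolding D(2) by algebra
  qed
  show "S (comb u v w (s, t, r)) = s" "T (comb u v w (s, t, r)) = t" "R (comb u v w (s, t, r)) = r"
   unfolding uvw comb_simps by (rule c, unfold e, unfold D(2), algebra)+
 qed
qed

text \<open>The general quartic, indexed so that \<open>k i j\<close> multiplies x^i y^j
  z^(4-i-j).\<close>

definition quart :: "(nat => nat => complex) => complex => complex => complex => complex" where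
 "quart k x y z = k 4 0*x^4 + k 3 1*x^3*y + k 2 2*x^2*y^2 + k 1 3*x*y^3 + k 0 4*y^4
   +z*(k 3 0*x^3 + k 2 1*x^2*y + k 1 2*x*y^2 + k 0 3*y^3)
   +z^2*(k 2 0*x^2 + k 1 1*x*y + k 0 2*y^2)+z^3*(k 1 0*x + k 0 1*y) + k 0 0*z^4"

definition coords4 :: "complex poly poly => pt3 => pt3 => pt3 => (nat => nat => complex) => bool" where
 "coords4 f u v w k \<longleftrightarrow> (\<forall>s t r. homog 4 f (comb u v w (s, t, r)) = quart k s t r)"

lemma coords4_ex:
 assumes "totdeg f \<le> 4" obtains k where "coords4 f u v w k"
proof -
 obtain u1 u2 u3 v1 v2 v3 w1 w2 w3 where uvw: "u = (u1, u2, u3)" "v = (v1, v2, v3)" "w = (w1, w2, w3)"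
  by (metis prod_cases3)
 have "form 4 (%p. homog 4 f (u1*fst p + v1*fst (snd p)+w1 * snd (snd p), u2*fst p + v2*fst (snd p)+w2 * snd (snd p), u3*fst p + v3*fst (snd p)+w3 * snd (snd p)))"
  by (rule form_compose[OF form_homog[OF assms] form_linear form_linear form_linear])
 then obtain k where "\<And>x y z. homog 4 f (u1*x + v1*y+w1*z, u2*x + v2*y+w2*z, u3*x + v3*y+w3*z) = quart k x y z"
  unfolding quart_def by (rule form_4E) simp
 then have "coords4 f u v w k" unfolding coords4_def uvw comb_simps by (simp add: mult.commute)
 then show thesis by (rule that)
qed

lemma coords4_swap: "coords4 f u v w k ==> coords4 f v u w (%i j. k j i)"
 unfolding coords4_def comb_swap by (simp add: quart_def algebra_simps)

lemma sing_direction: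
 assumes "sing_pt F u"
 shows "((%t. F (comb u v w (1, t, 0))) has_field_derivative 0) (at 0)"
proof -
 obtain u1 u2 u3 v1 v2 v3 w1 w2 w3 where uvw: "u = (u1, u2, u3)" "v = (v1, v2, v3)" "w = (w1, w2, w3)"
  by (metis prod_cases3)
 have "((%t. comb u v w (1, t, 0)) has_derivative (%t. (t * v1, t * v2, t * v3))) (at 0)"
  unfolding uvw comb_simps by (auto intro!: derivative_eq_intros)
 moreover have "(F has_derivative (%_. 0)) (at (comb u v w (1, 0, 0)))"
  using assms unfolding comb_unit sing_pt_def by blast
 ultimately have "((%t. F (comb u v w (1, t, 0))) has_derivative (%_. 0)) (at 0)"
  by (rule has_derivative_compose)
 then show ?thesis unfolding has_field_derivative_def by (simp add: lambda_zero)
qed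

lemma quart_deriv: "((%t. quart k 1 t 0) has_field_derivative k 3 1) (at 0)"
 unfolding quart_def by (auto intro!: derivative_eq_intros)

lemma coords4_sing:
 assumes c: "coords4 f u v w k" and s: "sing_pt (homog 4 f) u"
 shows "k 4 0 = 0" "k 3 1 = 0" "k 3 0 = 0"
proof -
 have "homog 4 f (comb u v w (1, 0, 0)) = 0" using s unfolding comb_unit sing_pt_def on_curve_def by blast
 then show "k 4 0 = 0" using c unfolding coords4_def quart_def by simp
 have "((%t. quart k 1 t 0) has_field_derivative 0) (at 0)"
  using sing_direction[OF s, of v w] c unfolding coords4_def by simp
 then show "k 3 1 = 0" using quart_deriv DERIV_unique by blast
 have "comb u w v (1, t, 0) = comb u v w (1, 0, t)" for t by (cases u; cases v; cases w) (simp add: comb_simps)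
 then have "((%t. quart k 1 0 t) has_field_derivative 0) (at 0)"
  using sing_direction[OF s, of w v] c unfolding coords4_def by simp
 moreover have "((%t. quart k 1 0 t) has_field_derivative k 3 0) (at 0)"
  unfolding quart_def by (auto intro!: derivative_eq_intros)
 ultimately show "k 3 0 = 0" using DERIV_unique by blast
qed

lemma coords4_type:
 assumes d: "det3 u v w \<noteq> 0" and c: "coords4 f u v w k" and h: "has_type (homog 4 f) u T"
 shows "top_equiv_germ {z. quart k 1 (fst z) (snd z) = 0} T"
proof -
 have "aff3 u s v t w = comb u v w (1, s, t)" for s t by (cases u; cases v; cases w) (simp add: comb_simps aff3_simps)
 then have "{(s, t). homog 4 f (aff3 u s v t w) = 0} = {z. quart k 1 (fst z) (snd z) = 0}"
  using c unfolding coords4_def by auto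
 then show ?thesis using has_type_chart[OF homog4_hom h d] by simp
qed

text \<open>The means of eliminating coefficients: a nonzero one would put the equation in a normal
  form whose type is excluded at this point.\<close>

lemma coords4_excluded:
 assumes "det3 u v w \<noteq> 0" "coords4 f u v w k" "has_type (homog 4 f) u T" "\<not> top_equiv_germ G T"
 shows "\<not> top_equiv_germ {z. quart k 1 (fst z) (snd z) = 0} G"
 using coords4_type[OF assms(1-3)] assms(4) top_equiv_germ_sym top_equiv_germ_trans by blast

lemma form_prod2: "form 1 a ==> form 1 b ==> form 2 (%v. a v * b v)"
 using form_mult[of 1 a 1 b] by (simp add: numeral_2_eq_2)

lemma form_prod3: "form 1 a ==> form 1 b ==> form 1 c ==> form 3 (%v. a v * b v * c v)"
 using form_mult[of 2 "%v. a v * b v" 1 c] form_prod2 by (simp add: numeral_3_eq_3 numeral_2_eq_2)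

text \<open>In coordinates where the line is r = 0, all terms without r vanish, so the linear form r
  divides the quartic with a cubic cofactor.\<close>

lemma irreducible_contains_no_line:
 assumes f: "totdeg f = 4" "irreducible f" and d: "det3 u v w \<noteq> 0"
 shows "\<not> (\<forall>s t. homog 4 f (comb u v w (s, t, 0)) = 0)"
proof
 assume z: "\<forall>s t. homog 4 f (comb u v w (s, t, 0)) = 0"
 obtain k where k: "coords4 f u v w k" using coords4_ex[OF eq_imp_le[OF f(1)]] by blast
 have q0: "quart k s t 0 = 0" for s t using z k unfolding coords4_def by simp
 obtain S T R where S: "form 1 S" "form 1 T" "form 1 R" "\<And>p. comb u v w (S p, T p, R p) = p"
  using comb_coords[OF d] by metis
 define H where "H = (%p. k 3 0*(S p*S p*S p) + k 2 1*(S p*S p*T p) + k 1 2*(S p*T p*T p) + k 0 3*(T p*T p*T p)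
  + k 2 0*(S p*S p * R p) + k 1 1*(S p*T p * R p) + k 0 2*(T p*T p * R p) + k 1 0*(S p * R p * R p) + k 0 1*(T p * R p * R p) + k 0 0*(R p * R p * R p))"
 have "form 3 H" unfolding H_def by (intro form_add form_cmult form_prod3 S)
 moreover have "homog 4 f p = R p*H p" for p
 proof -
  have "homog 4 f p = quart k (S p) (T p) (R p)" using k S(4)[of p] unfolding coords4_def by metis
  also have "\<dots> = quart k (S p) (T p) (R p) - quart k (S p) (T p) 0" using q0 by simp
  also have "\<dots> = R p*H p" unfolding quart_def H_def by (simp add: algebra_simps power2_eq_square power3_eq_cube power4_eq_xxxx)
  finally show ?thesis .
 qed
 ultimately show False using irreducible_no_form_factor[OF f S(3), of 3 H] by auto
qed

text \<open>The target shape of all existence proofs: a square of a quadratic form plus a cube of a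
  linear form times Z. The last factor is 1 on the affine plane, and the scalars \<open>c\<close>
  and \<open>e\<close> are absorbed by a square root and a cube root.\<close>

lemma visible_from_coords:
 assumes f: "totdeg f = 4" and d: "det3 u v w \<noteq> 0" and k: "coords4 f u v w k"
  and id: "\<And>s t r. quart k s t r = c*(q1 * s^2+q2 * s*t+q3*t^2+q4 * s*r+q5*t*r+q6*r^2)^2
   +e*(l1 * s+l2*t+l3*r)^3*(zcoord u * s+zcoord v * t+zcoord w*r)"
 obtains q l \<beta> where "visible_dec f q l" "\<beta>^3 = e"
  "\<And>s t r x y. comb u v w (s, t, r) = (x, y, 1) ==> eval2 l x y = \<beta>*(l1 * s+l2*t+l3*r)"
proof -
 obtain S T R where S: "form 1 S" "form 1 T" "form 1 R" "\<And>p. comb u v w (S p, T p, R p) = p"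
  and S': "\<And>s t r. S (comb u v w (s, t, r)) = s" "\<And>s t r. T (comb u v w (s, t, r)) = t" "\<And>s t r. R (comb u v w (s, t, r)) = r"
  using comb_coords[OF d] by metis
 obtain \<gamma> where "\<gamma>^Suc 1 = c" by (rule complex_root)
 then have \<gamma>: "\<gamma>^2 = c" by (simp add: power2_eq_square)
 obtain \<beta> where "\<beta>^Suc 2 = e" by (rule complex_root)
 then have \<beta>: "\<beta>^3 = e" by (simp add: numeral_eq_Suc)
 define Q where "Q = (%p. q1*(S p*S p)+q2*(S p*T p)+q3*(T p*T p)+q4*(S p * R p)+q5*(T p * R p)+q6*(R p * R p))"
 define L where "L = (%p. l1*S p+l2*T p+l3 * R p)"
 have "form 2 Q" unfolding Q_def by (intro form_add form_cmult form_prod2 S)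
 then obtain q where q: "totdeg q \<le> 2" "\<And>x y. eval2 q x y = Q (x, y, 1)" using form_dehomog by blast
 have "form 1 L" unfolding L_def by (intro form_add form_cmult S)
 then obtain l where l: "totdeg l \<le> 1" "\<And>x y. eval2 l x y = L (x, y, 1)" using form_dehomog by blast
 have "f = (cpoly2 \<gamma>*q)^2+(cpoly2 \<beta>*l)^3"
 proof (rule eval2_inject)
  fix x y
  define s t r where "s = S (x, y, 1)" and "t = T (x, y, 1)" and "r = R (x, y, 1)"
  have c1: "comb u v w (s, t, r) = (x, y, 1)" unfolding s_def t_def r_def by (rule S(4))
  have z: "zcoord u * s+zcoord v * t+zcoord w*r = 1"
   using zcoord_comb[of u v w s t r] unfolding c1 by (simp add: zcoord_def mult.commute)
  have "homog 4 f (comb u v w (s, t, r)) = quart k s t r" using k unfolding coords4_def by blast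
  then have "eval2 f x y = quart k s t r" unfolding c1 homog_at_1[OF eq_imp_le[OF f]] .
  then show "eval2 f x y = eval2 ((cpoly2 \<gamma>*q)^2+(cpoly2 \<beta>*l)^3) x y"
   unfolding id z eval2_simps q l Q_def L_def s_def[symmetric] t_def[symmetric] r_def[symmetric] \<gamma>[symmetric] \<beta>[symmetric]
   by (simp add: power_mult_distrib power2_eq_square mult.assoc)
 qed
 moreover have "totdeg (cpoly2 \<gamma>*q) \<le> 2" "totdeg (cpoly2 \<beta>*l) \<le> 1"
  using totdeg_mult_le[of "cpoly2 \<gamma>" 0 q 2] totdeg_mult_le[of "cpoly2 \<beta>" 0 l 1] q l totdeg_cpoly2 by auto
 ultimately have "visible_dec f (cpoly2 \<gamma>*q) (cpoly2 \<beta>*l)" unfolding visible_dec_def by blast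
 moreover have "eval2 (cpoly2 \<beta>*l) x y = \<beta>*(l1 * s+l2*t+l3*r)" if "comb u v w (s, t, r) = (x, y, 1)" for s t r x y
  unfolding eval2_simps l L_def that[symmetric] S' ..
 ultimately show thesis using that \<beta> by blast
qed

section \<open>Coefficient criteria for A_n germs\<close>

lemma germ_A_criterion:
 assumes sd: "sd A" "sd B" "sd C" "sd a" "sd b" and nz: "a 0 \<noteq> 0" "A 0 \<noteq> 0" and pk: "1 \<le> p" "1 \<le> k" "p \<le> 2 * k"
  and disc: "4*A 0*C 0 \<noteq> B 0^2*0^(2 * k - p)" and N: "open N" "0 \<in> N"
  and eq: "\<And>z. z \<in> N ==> \<phi> z = A z*(fst z*a z + snd z*b z)^2+B z * snd z ^ k*(fst z*a z + snd z*b z)+C z * snd z^p"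
 shows "top_equiv_germ {z. \<phi> z = 0} (germ_A (p - 1))"
proof -
 obtain a1 a2 b1 b2 where "sdiff a a1 a2" "sdiff b b1 b2" using sd(4,5) unfolding sd_def by blast
 from sdiff_add[OF sdiff_mult[OF sdiff_fst this(1)] sdiff_mult[OF sdiff_snd this(2)]] have w: "sdiff (%z. fst z*a z + snd z*b z) (a 0) (b 0)" by simp
 show ?thesis
  by (rule germ_A_normal_form[where w = "%z. fst z*a z + snd z*b z", OF sd(1-3) w]) (use nz pk disc N eq in auto)
qed

lemma germ_A_criterion_simple:
 assumes sd: "sd A" "sd B" "sd C" and nz: "A 0 \<noteq> 0" and pk: "1 \<le> p" "1 \<le> k" "p \<le> 2 * k"
  and disc: "4*A 0*C 0 \<noteq> B 0^2*0^(2 * k - p)"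
  and eq: "\<And>x y. \<phi> (x, y) = A (x, y)*x^2+B (x, y)*y ^ k*x+C (x, y)*y^p"
 shows "top_equiv_germ {z. \<phi> z = 0} (germ_A (p - 1))"
proof (rule germ_A_criterion[OF sd sd_const[of 1] sd_const[of 0] _ nz pk disc open_UNIV])
 show "\<phi> z = A z*(fst z*1 + snd z*0)^2+B z * snd z ^ k*(fst z*1 + snd z*0)+C z * snd z^p" for z
  using eq[of "fst z" "snd z"] by simp
qed auto

lemma coeffs_node:
 assumes "k 4 0 = 0" "k 3 1 = 0" "k 3 0 = 0" "k 2 2 \<noteq> 0" "k 2 1^2 \<noteq> 4 * k 2 2 * k 2 0"
 shows "top_equiv_germ {z. quart k 1 (fst z) (snd z) = 0} (germ_A 1)"
proof -
 have "top_equiv_germ {z. quart k 1 (fst z) (snd z) = 0} (germ_A (2 - 1))"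
 proof (rule germ_A_criterion_simple[where k = 1 and
   A = "%z. k 2 2 + k 1 3*fst z + k 0 4*fst z^2 + k 1 2 * snd z + k 0 3*fst z * snd z + k 0 2 * snd z^2" and
   B = "%z. k 2 1 + k 1 1 * snd z + k 0 1 * snd z^2" and C = "%z. k 2 0 + k 1 0 * snd z + k 0 0 * snd z^2"])
  show "quart k 1 (fst (x, y)) (snd (x, y)) = (k 2 2 + k 1 3*fst (x, y) + k 0 4*fst (x, y)^2 + k 1 2 * snd (x, y) + k 0 3*fst (x, y) * snd (x, y) + k 0 2 * snd (x, y)^2)*x^2
   +(k 2 1 + k 1 1 * snd (x, y) + k 0 1 * snd (x, y)^2)*y^1*x+(k 2 0 + k 1 0 * snd (x, y) + k 0 0 * snd (x, y)^2)*y^2" for x y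
   unfolding quart_def assms(1-3) by (simp add: algebra_simps power2_eq_square power3_eq_cube power4_eq_xxxx)
 qed (use assms in \<open>auto intro!: sd_intros\<close>)
 then show ?thesis by simp
qed

section \<open>The restriction of the quartic to the line at infinity\<close>

lemma imult_coords:
 assumes f: "totdeg f \<le> 4" and v: "v \<noteq> 0" "zcoord v = 0"
 obtains u where "zcoord u = 0" "det3 v u (0, 0, 1) \<noteq> 0"
  "\<And>k e i. coords4 f v u e k ==> i < imult_inf f v ==> coeff [:k 4 0, k 3 1, k 2 2, k 1 3, k 0 4:] i = 0"
  "\<And>w. zcoord w = 0 ==> \<exists>\<alpha> \<beta>. \<forall>e. w = comb v u e (\<alpha>, \<beta>, 0)"
proof -
 obtain a b where ab: "v = (a, b, 0)" using v(2) by (cases v) (auto simp: zcoord_def)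
 define c d :: complex where "c = (if a \<noteq> 0 then 0 else 1)" and "d = (if a \<noteq> 0 then 1 else 0)"
 have nz: "a \<noteq> 0 \<or> b \<noteq> 0" using v(1) unfolding ab by (auto simp: zero_prod_def)
 have P: "poly (linf_restr f v) t = homog 4 f (comb v (c, d, 0) e (1, t, 0))" for t e
  unfolding ab c_def d_def by (cases e) (simp add: linf_restr_def homog_at_infinity poly_sum comb_simps algebra_simps)
 show thesis
 proof (rule that[of "(c, d, 0)"])
  show "zcoord (c, d, 0) = 0" by (simp add: zcoord_def)
  show "det3 v (c, d, 0) (0, 0, 1) \<noteq> 0" using nz unfolding ab c_def d_def by (simp add: det3_simps)
  show "\<exists>\<alpha> \<beta>. \<forall>e. w = comb v (c, d, 0) e (\<alpha>, \<beta>, 0)" if zw: "zcoord w = 0" for w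
  proof -
   obtain w1 w2 where w: "w = (w1, w2, 0)" using zw by (cases w) (auto simp: zcoord_def)
   show ?thesis
   proof (cases "a = 0")
    case True
    then show ?thesis unfolding w ab c_def d_def using nz
     by (intro exI[of _ "w2/b"] exI[of _ w1]) (auto simp: comb_simps)
   next
    case False
    then show ?thesis unfolding w ab c_def d_def
     by (intro exI[of _ "w1/a"] exI[of _ "w2 - w1/a*b"]) (auto simp: comb_simps)
   qed
  qed
  fix k e i assume k: "coords4 f v (c, d, 0) e k" and i: "i < imult_inf f v"
  have "poly (linf_restr f v) t = poly [:k 4 0, k 3 1, k 2 2, k 1 3, k 0 4:] t" for t
   using P[of t e] k unfolding coords4_def by (simp add: quart_def algebra_simps power2_eq_square power3_eq_cube power4_eq_xxxx)
  then have eq: "linf_restr f v = [:k 4 0, k 3 1, k 2 2, k 1 3, k 0 4:]" by (intro poly_eq_poly_eq_iff[THEN iffD1]) (rule ext)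
  have "[:- 0, 1:]^imult_inf f v dvd linf_restr f v" unfolding imult_inf_def by (rule order_1)
  then obtain q where "linf_restr f v = monom 1 (imult_inf f v)*q"
   by (auto elim!: dvdE simp: monom_altdef)
  then have "coeff (linf_restr f v) i = 0" using i by (simp add: coeff_monom_mult)
  then show "coeff [:k 4 0, k 3 1, k 2 2, k 1 3, k 0 4:] i = 0" unfolding eq .
 qed
qed

lemma independent_at_infinity:
 assumes "v \<noteq> 0" "w \<noteq> 0" "zcoord v = 0" "zcoord w = 0" "\<not> proj_same v w"
 shows "det3 v w (0, 0, 1) \<noteq> 0"
proof
 obtain a b c d where vw: "v = (a, b, 0)" "w = (c, d, 0)" using assms(3,4) by (cases v; cases w) (auto simp: zcoord_def)
 assume "det3 v w (0, 0, 1) = 0"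
 then have e: "a*d = b * c" unfolding vw by (simp add: det3_simps)
 have "\<exists>m. w = smul3 m v"
 proof (cases "a = 0")
  case True
  then have "b \<noteq> 0" using assms(1) unfolding vw by (auto simp: zero_prod_def)
  then show ?thesis using True e unfolding vw by (intro exI[of _ "d/b"]) (auto simp: smul3_simps)
 next
  case False
  then show ?thesis using e unfolding vw by (intro exI[of _ "c/a"]) (auto simp: smul3_simps field_simps)
 qed
 then obtain m where m: "w = smul3 m v" by blast
 then have "m \<noteq> 0" using assms(2) unfolding vw by (auto simp: smul3_simps zero_prod_def)
 then show False using assms(5) m unfolding proj_same_def by blast
qed

lemma tangent_coeffs:
 assumes f: "totdeg f \<le> 4" and v: "v \<noteq> 0" "zcoord v = 0" "imult_inf f v \<ge> 2" and w: "zcoord w = 0"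
  and k: "coords4 f v w e k"
 shows "k 4 0 = 0" "k 3 1 = 0"
proof -
 obtain u where u: "\<And>k e i. coords4 f v u e k ==> i < imult_inf f v ==> coeff [:k 4 0, k 3 1, k 2 2, k 1 3, k 0 4:] i = 0"
  "\<And>w. zcoord w = 0 ==> \<exists>\<alpha> \<beta>. \<forall>e. w = comb v u e (\<alpha>, \<beta>, 0)"
  using imult_coords[OF f v(1,2)] by metis
 obtain \<alpha> \<beta> where ab: "\<And>e. w = comb v u e (\<alpha>, \<beta>, 0)" using u(2)[OF w] by blast
 obtain l where l: "coords4 f v u e l" using coords4_ex[OF f] by blast
 have z: "l 4 0 = 0" "l 3 1 = 0" using u(1)[OF l, of 0] u(1)[OF l, of 1] v(3) by auto
 have "comb v w e (1, t, 0) = comb v u e (1+t*\<alpha>, t*\<beta>, 0)" for t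
  unfolding ab[of e] by (cases v; cases u; cases e) (simp add: comb_simps algebra_simps)
 then have "quart k 1 t 0 = quart l (1+t*\<alpha>) (t*\<beta>) 0" for t using k l unfolding coords4_def by metis
 then have "k 4 0 + k 3 1*t + k 2 2*t^2 + k 1 3*t^3 + k 0 4*t^4 =
  0+0*t+(l 2 2*\<beta>^2)*t^2+(2*l 2 2*\<alpha>*\<beta>^2+l 1 3*\<beta>^3)*t^3+(l 2 2*\<alpha>^2*\<beta>^2+l 1 3*\<alpha>*\<beta>^3+l 0 4*\<beta>^4)*t^4" for t
  unfolding quart_def z by (simp add: algebra_simps power2_eq_square power3_eq_cube power4_eq_xxxx)
 from quartic_eq(1,2)[OF this] show "k 4 0 = 0" "k 3 1 = 0" by auto
qed

text \<open>Serves positions (i) and (ii) together: a point of tangency and a singular point both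
  give a double zero on the line at infinity.\<close>

definition inf_bitangent :: "complex poly poly => pt3 => pt3 => complex => bool" where
 "inf_bitangent f v w e \<longleftrightarrow> zcoord v = 0 \<and> zcoord w = 0 \<and> det3 v w (0, 0, 1) \<noteq> 0 \<and> e \<noteq> 0 \<and>
   (\<forall>a b c. homog 4 f (comb v w c (a, b, 0)) = e*a^2*b^2)"

text \<open>Serves positions (iv) and (v): \<open>v\<close> is the only point of the quartic at
  infinity, and \<open>w\<close> merely completes a basis.\<close>

definition inf_flex :: "complex poly poly => pt3 => pt3 => complex => bool" where
 "inf_flex f v w e \<longleftrightarrow> zcoord v = 0 \<and> zcoord w = 0 \<and> det3 v w (0, 0, 1) \<noteq> 0 \<and> e \<noteq> 0 \<and>
   (\<forall>a b c. homog 4 f (comb v w c (a, b, 0)) = e*b^4)"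

lemma comb_third_irrelevant: "comb v w c (a, b, 0) = comb v w c' (a, b, 0)"
 by (cases v; cases w; cases c; cases c') (simp add: comb_simps)

lemma pos_inf_bitangent:
 assumes f: "totdeg f = 4" "irreducible f" and v: "on_linf f v" "on_linf f w" "\<not> proj_same v w" "imult_inf f v \<ge> 2"
  and w: "imult_inf f w \<ge> 2 \<or> sing_pt (homog 4 f) w"
 obtains e where "inf_bitangent f v w e"
proof -
 have v0: "v \<noteq> 0" "w \<noteq> 0" "zcoord v = 0" "zcoord w = 0" using v(1,2) unfolding on_linf_def on_curve_def by auto
 have d: "det3 v w (0, 0, 1) \<noteq> 0" by (rule independent_at_infinity[OF v0 v(3)])
 have f4: "totdeg f \<le> 4" using f by simp
 obtain k where k: "coords4 f v w (0, 0, 1) k" using coords4_ex[OF f4] by blast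
 have z: "k 4 0 = 0" "k 3 1 = 0" by (rule tangent_coeffs[OF f4 v0(1,3) v(4) v0(4) k])+
 have z': "k 0 4 = 0" "k 1 3 = 0"
  using w tangent_coeffs[OF f4 v0(2,4) _ v0(3) coords4_swap[OF k]] coords4_sing[OF coords4_swap[OF k]] by auto
 have q: "homog 4 f (comb v w c (a, b, 0)) = k 2 2*a^2*b^2" for a b c
  using k z z' unfolding coords4_def comb_third_irrelevant[of v w c a b "(0, 0, 1)"] by (simp add: quart_def)
 have "k 2 2 \<noteq> 0" using irreducible_contains_no_line[OF f d] q by auto
 then have "inf_bitangent f v w (k 2 2)" unfolding inf_bitangent_def using v0 d q by auto
 then show thesis by (rule that)
qed

lemma pos_inf_flex:
 assumes f: "totdeg f = 4" "irreducible f" and v: "on_linf f v" "imult_inf f v = 4"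
 obtains u e where "inf_flex f v u e"
proof -
 have v0: "v \<noteq> 0" "zcoord v = 0" using v(1) unfolding on_linf_def on_curve_def by auto
 have f4: "totdeg f \<le> 4" using f by simp
 obtain u where u: "zcoord u = 0" "det3 v u (0, 0, 1) \<noteq> 0"
  "\<And>k e i. coords4 f v u e k ==> i < imult_inf f v ==> coeff [:k 4 0, k 3 1, k 2 2, k 1 3, k 0 4:] i = 0"
  using imult_coords[OF f4 v0] by metis
 obtain k where k: "coords4 f v u (0, 0, 1) k" using coords4_ex[OF f4] by blast
 have z: "k 4 0 = 0" "k 3 1 = 0" "k 2 2 = 0" "k 1 3 = 0"
  using u(3)[OF k, of 0] u(3)[OF k, of 1] u(3)[OF k, of 2] u(3)[OF k, of 3] v(2) by (auto simp: numeral_eq_Suc)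
 have q: "homog 4 f (comb v u c (a, b, 0)) = k 0 4*b^4" for a b c
  using k z unfolding coords4_def comb_third_irrelevant[of v u c a b "(0, 0, 1)"] by (simp add: quart_def)
 have "k 0 4 \<noteq> 0" using irreducible_contains_no_line[OF f u(2)] q by auto
 then have "inf_flex f v u (k 0 4)" unfolding inf_flex_def using v0 u q by auto
 then show thesis by (rule that)
qed

definition inf_square :: "complex poly poly => bool" where
 "inf_square f \<longleftrightarrow> (\<exists>h0 h1 h2. \<forall>x y. homog 4 f (x, y, 0) = (h0*x^2+h1*x*y+h2*y^2)^2)"

lemma inf_squareI:
 assumes z: "zcoord v = 0" "zcoord w = 0" "det3 v w (0, 0, 1) \<noteq> 0"
  and q: "\<And>a b. homog 4 f (comb v w (0, 0, 1) (a, b, 0)) = e*(m*a*b+n*b^2)^2"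
 shows "inf_square f"
proof -
 obtain a b c d where vw: "v = (a, b, 0)" "w = (c, d, 0)" using z(1,2) by (cases v; cases w) (auto simp: zcoord_def)
 define D where "D = a*d - b * c"
 have D: "D \<noteq> 0" using z(3) unfolding vw D_def by (simp add: det3_simps)
 obtain \<gamma> where "\<gamma>^Suc 1 = e" by (rule complex_root)
 then have g: "\<gamma>^2 = e" by (simp add: power2_eq_square)
 define g' where "g' = \<gamma>/D^2"
 have "homog 4 f (x, y, 0) = ((g'*(n*b^2 - m*d*b))*x^2+(g'*(m*(a*d+b * c) - 2*n*a*b))*x*y+(g'*(n*a^2 - m*a * c))*y^2)^2" for x y
 proof -
  define A B where "A = (d*x - c*y)/D" and "B = (a*y - b*x)/D"
  have e: "(d*x - c*y)*a+(a*y - b*x) * c = D*x" "(d*x - c*y)*b+(a*y - b*x)*d = D*y"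
   unfolding D_def by algebra+
  have "A*a+B * c = x" "A*b+B*d = y"
   unfolding A_def B_def times_divide_eq_left add_divide_distrib[symmetric] e using D by simp_all
  then have "comb v w (0, 0, 1) (A, B, 0) = (x, y, 0)" unfolding vw comb_simps by simp
  then have "homog 4 f (x, y, 0) = (\<gamma>*(m*A*B+n*B^2))^2" using q[of A B] g by (simp add: power_mult_distrib)
  also have "\<gamma>*(m*A*B+n*B^2) = g'*(m*(d*x - c*y)*(a*y - b*x)+n*(a*y - b*x)^2)"
   unfolding A_def B_def g'_def using D by (simp add: field_simps power2_eq_square)
  also have "\<dots> = (g'*(n*b^2 - m*d*b))*x^2+(g'*(m*(a*d+b * c) - 2*n*a*b))*x*y+(g'*(n*a^2 - m*a * c))*y^2"
   by algebra
  finally show ?thesis .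
 qed
 then show ?thesis unfolding inf_square_def by blast
qed

lemma inf_bitangent_square: "inf_bitangent f v w e ==> inf_square f"
 unfolding inf_bitangent_def by (rule inf_squareI[of v w f e 1 0]) (auto simp: power_mult_distrib)

lemma inf_flex_square: "inf_flex f v w e ==> inf_square f"
 unfolding inf_flex_def by (rule inf_squareI[of v w f e 0 1]) (auto simp flip: power_mult)

lemma inf_square_poly:
 assumes f: "totdeg f = 4" and s: "inf_square f"
 obtains h where "totdeg h \<le> 2" "totdeg (f - h^2) \<le> 3"
proof -
 obtain h0 h1 h2 where h: "\<And>x y. homog 4 f (x, y, 0) = (h0*x^2+h1*x*y+h2*y^2)^2"
  using s unfolding inf_square_def by blast
 define p where "p = [:[:0, 0, h0:], [:0, h1:], [:h2:]:]"
 have p2: "totdeg p \<le> 2" unfolding totdeg_le_iff p_def by (auto simp: coeff_pCons split: nat.splits)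
 have "homog 2 p (x, y, 0) = h0*x^2+h1*x*y+h2*y^2" for x y
  unfolding homog_at_infinity p_def by (simp add: numeral_eq_Suc)
 then have e: "homog 4 (p^2) (x, y, 0) = homog 4 f (x, y, 0)" for x y
  using homog_mult[OF p2 p2, of "(x, y, 0)"] h by (simp add: power2_eq_square)
 have t: "totdeg (f - p^2) \<le> Suc 3" using f totdeg_power_le[OF p2, of 2] by (intro totdeg_diff_le) auto
 have hd: "homog 4 (f - p^2) v = homog 4 f v - homog 4 (p^2) v" for v
  using homog_add[of 4 "f - p^2" "p^2" v] by simp
 have "poly (top_poly 4 (f - p^2)) m = 0" for m unfolding poly_top_poly hd e by simp
 then have "top_poly (Suc 3) (f - p^2) = 0" using poly_all_0_iff_0[of "top_poly 4 (f - p^2)"] by (simp add: numeral_eq_Suc)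
 then have "totdeg (f - p^2) \<le> 3" using top_poly_eq_0_iff[OF t] by simp
 then show thesis using that p2 by blast
qed

text \<open>Neither point is a node, so both tangent cones are perfect squares: (2b)^2 = 4 A
  \<open>k 2 0\<close> and (2c)^2 = 4 A \<open>k 0 2\<close>. All terms not divisible by r^3 then
  fit into one square. The coefficient A of s^2 t^2 is nonzero because the line through the points
  is not a component.\<close>

lemma two_points_normal_form:
 assumes f: "totdeg f = 4" "irreducible f" and d: "det3 u v w \<noteq> 0" and k: "coords4 f u v w k"
  and s: "sing_pt (homog 4 f) u" "sing_pt (homog 4 f) v"
  and T: "has_type (homog 4 f) u T" "\<not> top_equiv_germ (germ_A 1) T" "has_type (homog 4 f) v T'" "\<not> top_equiv_germ (germ_A 1) T'"
 obtains A b c e m1 m2 m3 where "A \<noteq> 0"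
  "\<And>s t r. quart k s t r = 1/A*(A * s*t+b * s*r + c*t*r+e*r^2)^2+r^3*(m1 * s+m2*t+m3*r)"
proof -
 have z: "k 4 0 = 0" "k 3 1 = 0" "k 3 0 = 0" by (rule coords4_sing[OF k s(1)])+
 have z': "k 0 4 = 0" "k 1 3 = 0" "k 0 3 = 0" using coords4_sing[OF coords4_swap[OF k] s(2)] by auto
 have A0: "k 2 2 \<noteq> 0"
 proof
  assume "k 2 2 = 0"
  then have "homog 4 f (comb u v w (s, t, 0)) = 0" for s t using k z z' unfolding coords4_def quart_def by simp
  then show False using irreducible_contains_no_line[OF f d] by blast
 qed
 define A B C where "A = k 2 2" and "B = k 2 1" and "C = k 1 2"
 have 1: "B^2 = 4*A * k 2 0"
  using coeffs_node[OF z A0] coords4_excluded[OF d k T(1,2)] unfolding A_def B_def by blast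
 have d': "det3 v u w \<noteq> 0" using d det3_swap[of v u w] by simp
 have 2: "C^2 = 4*A * k 0 2"
  using coeffs_node[of "%i j. k j i"] coords4_excluded[OF d' coords4_swap[OF k] T(3,4)] z' A0 unfolding A_def C_def by blast
 have A: "A \<noteq> 0" using A0 unfolding A_def .
 \<comment> \<open>Chosen so that the square accounts for the whole coefficient of s t r^2.\<close>
 define e where "e = (k 1 1 - B*C/(2*A))/2"
 have k20: "k 2 0 = B^2/(4*A)" "k 0 2 = C^2/(4*A)" "k 1 1 = 2*e+B*C/(2*A)"
  using 1 2 A unfolding e_def by (simp_all add: field_simps)
 define b c where "b = B/2" and "c = C/2"
 define i where "i = 1/A"
 have i: "i*A = 1" unfolding i_def using A by simp
 have kk: "k 2 0 = b^2*i" "k 0 2 = c^2*i" "k 1 1 = 2*e+2*b * c*i"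
  unfolding k20 b_def c_def i_def using A by (simp_all add: field_simps power2_eq_square)
 have k22: "k 2 2 = A" "k 2 1 = 2*b" "k 1 2 = 2 * c" unfolding A_def b_def B_def c_def C_def by simp_all
 show thesis
 proof (rule that[OF A])
  fix s t r
  define x y zz where "x = k 1 0" and "y = k 0 1" and "zz = k 0 0"
  have q: "quart k s t r = A * s^2*t^2+r*(2*b * s^2*t+2 * c * s*t^2)+r^2*(b^2*i * s^2+(2*e+2*b * c*i) * s*t + c^2*i*t^2)+r^3*(x * s+y*t)+zz*r^4"
   unfolding quart_def z z' kk k22 x_def y_def zz_def by simp
  show "quart k s t r = 1/A*(A * s*t+b * s*r + c*t*r+e*r^2)^2+r^3*((x - 2*b*e*i) * s+(y - 2 * c*e*i)*t+(zz - e^2*i)*r)"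
   unfolding q i_def[symmetric] using i by algebra
 qed
qed

text \<open>In the normal form for two points it remains to show that the linear cofactor of r^3 is
  a multiple of Z. On the line at infinity the quartic is a square, and so is its main part;
  comparing them makes the cofactor vanish there. The line r = 0 joins the two cusps and meets the
  quartic nowhere else, which identifies the pair.\<close>

lemma cusp_pair_visible:
 assumes f: "totdeg f = 4" "irreducible f" and sq: "inf_square f"
  and s: "sing_pt (homog 4 f) u" "sing_pt (homog 4 f) v" "\<not> proj_same u v" and fin: "zcoord u \<noteq> 0" "zcoord v \<noteq> 0"
  and T: "has_type (homog 4 f) u (germ_A 2)" "has_type (homog 4 f) v (germ_A 2)"
 obtains q l where "visible_dec f q l" "\<And>x y c. smul3 c u = (x, y, 1) \<or> smul3 c v = (x, y, 1) ==> eval2 l x y = 0"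
  "\<And>x y. homog 4 f (x, y, 1) = 0 ==> eval2 l x y = 0 ==> \<exists>c. (x, y, 1) = smul3 c u \<or> (x, y, 1) = smul3 c v"
proof -
 obtain u1 u2 z1 v1 v2 z2 where uv: "u = (u1, u2, z1)" "v = (v1, v2, z2)" by (metis prod_cases3)
 have zn: "z1 \<noteq> 0" "z2 \<noteq> 0" using fin unfolding uv zcoord_def by auto
 have "\<exists>w1 w2. det3 u v (w1, w2, 0) \<noteq> 0"
 proof (rule ccontr)
  assume "\<not> ?thesis"
  then have "det3 u v (1, 0, 0) = 0" "det3 u v (0, 1, 0) = 0" by auto
  then have "u2*z2 = z1 * v2" "u1*z2 = z1 * v1" unfolding uv by (auto simp: det3_simps algebra_simps)
  then have "v = smul3 (z2/z1) u" unfolding uv using zn by (auto simp: smul3_simps field_simps)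
  then show False using s(3) zn unfolding proj_same_def by (metis divide_eq_0_iff)
 qed
 then obtain w1 w2 where d: "det3 u v (w1, w2, 0) \<noteq> 0" by blast
 define w where "w = (w1, w2, 0 :: complex)"
 note d = d[folded w_def]
 obtain k where k: "coords4 f u v w k" using coords4_ex[OF eq_imp_le[OF f(1)]] by blast
 have nA: "\<not> top_equiv_germ (germ_A 1) (germ_A 2)" using germ_A_parity[of 1 2] by auto
 obtain A b c e m1 m2 m3 where A: "A \<noteq> 0" and Q: "\<And>s t r. quart k s t r = 1/A*(A * s*t+b * s*r + c*t*r+e*r^2)^2+r^3*(m1 * s+m2*t+m3*r)"
  using two_points_normal_form[OF f d k s(1,2) T(1) nA T(2) nA] by metis
 obtain h0 h1 h2 where h: "\<And>x y. homog 4 f (x, y, 0) = (h0*x^2+h1*x*y+h2*y^2)^2"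
  using sq unfolding inf_square_def by blast
 define p1 p2 where "p1 = z2*u1 - z1 * v1" and "p2 = z2*u2 - z1 * v2"
 define H0 H1 H2 where "H0 = h0*p1^2+h1*p1*p2+h2*p2^2"
  and "H1 = 2*h0*p1*w1+h1*(p1*w2+p2*w1)+2*h2*p2*w2" and "H2 = h0*w1^2+h1*w1*w2+h2*w2^2"
 define g0 g1 where "g0 = - A*z1*z2" and "g1 = b*z2 - c*z1"
 define n0 where "n0 = m1*z2 - m2*z1"
 \<comment> \<open>Since w lies at infinity, the points with coordinates (z2, -z1, t) run along the
   line at infinity.\<close>
 have "comb u v w (z2, - z1, t) = (p1+t*w1, p2+t*w2, 0)" for t
  unfolding uv w_def comb_simps p1_def p2_def by (simp add: algebra_simps)
 then have "quart k z2 (- z1) t = (h0*(p1+t*w1)^2+h1*(p1+t*w1)*(p2+t*w2)+h2*(p2+t*w2)^2)^2" for t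
  using k h unfolding coords4_def by metis
 moreover have "h0*(p1+t*w1)^2+h1*(p1+t*w1)*(p2+t*w2)+h2*(p2+t*w2)^2 = H0+H1*t+H2*t^2" for t
  unfolding H0_def H1_def H2_def by algebra
 moreover have "A*quart k z2 (- z1) t = (g0+g1*t+e*t^2)^2+A*t^3*(n0+m3*t)" for t
 proof -
  have "A*quart k z2 (- z1) t = (A*(1/A))*(A*z2*(- z1)+b*z2*t + c*(- z1)*t+e*t^2)^2+A*t^3*(m1*z2+m2*(- z1)+m3*t)"
   unfolding Q by (simp only: distrib_left mult.assoc)
  then show ?thesis using A unfolding g0_def g1_def n0_def by (simp add: algebra_simps)
 qed
 ultimately have E: "A*(H0+H1*t+H2*t^2)^2 = (g0+g1*t+e*t^2)^2+A*t^3*(n0+m3*t)" for t by metis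
 have "(A*H0^2)+(2*A*H0*H1)*t+(A*(H1^2+2*H0*H2))*t^2+(2*A*H1*H2)*t^3+(A*H2^2)*t^4
   = g0^2+(2*g0*g1)*t+(g1^2+2*g0*e)*t^2+(2*g1*e+A*n0)*t^3+(e^2+A*m3)*t^4" for t
  using E[of t] by algebra
 note C = quartic_eq[OF this]
 have g0: "g0 \<noteq> 0" using A zn unfolding g0_def by simp
 then have H0: "H0 \<noteq> 0" using C(1) by auto
 \<comment> \<open>The error term starts at t^3. The coefficients of 1, t and t^2 already show that
   the two quadratic polynomials are proportional by \<open>\<rho>\<close>, and those of t^3 and t^4
   then say that the error is zero.\<close>
 define \<rho> where "\<rho> = g0/H0"
 have r: "g0 = \<rho>*H0" unfolding \<rho>_def using H0 by simp
 have r0: "\<rho> \<noteq> 0" using g0 r by auto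
 have "H0^2*(A - \<rho>^2) = 0" using C(1) unfolding r by algebra
 then have Ar: "A = \<rho>^2" using H0 by simp
 have "2*\<rho>*H0*(\<rho>*H1 - g1) = 0" using C(2) unfolding r Ar by algebra
 then have G1: "g1 = \<rho>*H1" using r0 H0 by simp
 have "2*\<rho>*H0*(\<rho>*H2 - e) = 0" using C(3) unfolding r Ar G1 by algebra
 then have G2: "e = \<rho>*H2" using r0 H0 by simp
 have "\<rho>^2*n0 = 0" using C(4) unfolding Ar G1 G2 by algebra
 then have n0: "m1*z2 = m2*z1" using r0 unfolding n0_def by simp
 have "\<rho>^2*m3 = 0" using C(5) unfolding Ar G2 by algebra
 then have m3: "m3 = 0" using r0 by simp
 have m2: "m2 = m1/z1*z2" "m1 = m1/z1*z1" using n0 zn by (simp_all add: field_simps)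
 have "quart k s t r = 1/A*(0 * s^2+A * s*t+0*t^2+b * s*r + c*t*r+e*r^2)^2
   +m1/z1*(0 * s+0*t+1*r)^3*(zcoord u * s+zcoord v * t+zcoord w*r)" for s t r
 proof -
  have gen: "j*r^3*(z1 * s+z2*t) = r^3*(j*z1 * s+j*z2*t)" for j by algebra
  have "r^3*(m1 * s+m2*t+m3*r) = m1/z1*r^3*(z1 * s+z2*t)"
   using gen[of "m1/z1"] unfolding m2[symmetric] m3 by simp
  then show ?thesis unfolding Q uv w_def by (simp add: zcoord_def)
 qed
 from visible_from_coords[OF f(1) d k this] obtain q l \<beta> where v: "visible_dec f q l"
  and l: "\<And>s t r x y. comb u v w (s, t, r) = (x, y, 1) ==> eval2 l x y = \<beta>*(0 * s+0*t+1*r)" by metis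
 obtain S T' R where S: "\<And>p. comb u v w (S p, T' p, R p) = p" using comb_coords[OF d] by metis
 have b0: "\<beta> \<noteq> 0"
 proof
  assume "\<beta> = 0"
  then have "eval2 l x y = 0" for x y using l[OF S[of "(x, y, 1)"]] by simp
  then have "l = 0" by (intro eval2_inject) (simp add: eval2_simps)
  then show False using visible_dec_torus(2)[OF f v] totdeg_0 by simp
 qed
 have cs: "comb u v w (s, 0, 0) = smul3 s u" "comb u v w (0, t, 0) = smul3 t v" for s t
  unfolding uv w_def by (simp_all add: comb_simps smul3_simps)
 show thesis
 proof (rule that[OF v])
  show "eval2 l x y = 0" if "smul3 c u = (x, y, 1) \<or> smul3 c v = (x, y, 1)" for x y c
   using that l[of c 0 0 x y] l[of 0 c 0 x y] unfolding cs by auto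
  fix x y assume F: "homog 4 f (x, y, 1) = 0" and l0: "eval2 l x y = 0"
  obtain s t r where p: "comb u v w (s, t, r) = (x, y, 1)" using S by metis
  have r: "r = 0" using l[OF p] l0 b0 by simp
  have "quart k s t 0 = 0" using F p k unfolding coords4_def r by metis
  then have "s = 0 \<or> t = 0" unfolding Q using A by simp
  then show "\<exists>c. (x, y, 1) = smul3 c u \<or> (x, y, 1) = smul3 c v" using p unfolding r using cs by metis
 qed
qed

lemma det3_infinity:
 assumes "zcoord u = 0" "zcoord p = 0" "det3 p u (0, 0, 1) \<noteq> 0" "zcoord v \<noteq> 0"
 shows "det3 u v p \<noteq> 0" "det3 u p v \<noteq> 0" "det3 v u p \<noteq> 0"
proof -
 obtain a b c d where up: "u = (a, b, 0)" "p = (c, d, 0)" using assms(1,2) by (cases u; cases p) (auto simp: zcoord_def)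
 obtain x y z where v: "v = (x, y, z)" by (metis prod_cases3)
 have "det3 u v p = z*det3 p u (0, 0, 1)" unfolding up v by (simp add: det3_simps algebra_simps)
 then show 1: "det3 u v p \<noteq> 0" using assms(3,4) unfolding v by (simp add: zcoord_def)
 then show "det3 v u p \<noteq> 0" using det3_swap[of v u p] by simp
 then show "det3 u p v \<noteq> 0" using det3_rotate[of u p v] by simp
qed

text \<open>The line at infinity is t = 0, where the quartic is e s^2 r^2. A nonzero
  \<open>m1\<close> would make the point at infinity a cusp instead of a tacnode; the remaining
  comparison kills g and \<open>m3\<close> and leaves \<open>m2\<close> t r^3, with t a multiple of
  Z.\<close>

lemma cusp_tacnode_visible:
 assumes f: "totdeg f = 4" "irreducible f" and B: "inf_bitangent f p u e"
  and s: "sing_pt (homog 4 f) u" "sing_pt (homog 4 f) v" and fin: "zcoord v \<noteq> 0"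
  and T: "has_type (homog 4 f) u (germ_A 3)" "has_type (homog 4 f) v (germ_A 2)"
 shows "\<exists>q l. visible_dec f q l"
proof -
 have z: "zcoord p = 0" "zcoord u = 0" "det3 p u (0, 0, 1) \<noteq> 0" "e \<noteq> 0"
  and B': "\<And>a b c. homog 4 f (comb p u c (a, b, 0)) = e*a^2*b^2" using B unfolding inf_bitangent_def by auto
 have d: "det3 u v p \<noteq> 0" by (rule det3_infinity[OF z(2,1,3) fin])
 obtain k where k: "coords4 f u v p k" using coords4_ex[OF eq_imp_le[OF f(1)]] by blast
 have n: "\<not> top_equiv_germ (germ_A 1) (germ_A 3)" "\<not> top_equiv_germ (germ_A 1) (germ_A 2)" "\<not> top_equiv_germ (germ_A 2) (germ_A 3)"
  using germ_A_odd_dvd[of 2 1] germ_A_parity[of 1 2] germ_A_parity[of 2 3] by auto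
 obtain A b c g m1 m2 m3 where A: "A \<noteq> 0" and Q: "\<And>s t r. quart k s t r = 1/A*(A * s*t+b * s*r + c*t*r+g*r^2)^2+r^3*(m1 * s+m2*t+m3*r)"
  using two_points_normal_form[OF f d k s T(1) n(1) T(2) n(2)] by metis
 define i where "i = 1/A"
 have c1: "comb u v p (1, 0, r) = comb p u v (r, 1, 0)" for r by (cases u; cases v; cases p) (simp add: comb_simps algebra_simps)
 have "quart k 1 0 r = e*r^2" for r using k[unfolded coords4_def, rule_format, of 1 0 r] B'[of v r 1] unfolding c1 by simp
 then have E: "i*(b*r+g*r^2)^2+r^3*(m1+m3*r) = e*r^2" for r unfolding Q i_def by simp
 have "0+0*r+(i*b^2)*r^2+(2*i*b*g+m1)*r^3+(i*g^2+m3)*r^4 = 0+0*r+e*r^2+0*r^3+0*r^4" for r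
  using E[of r] by algebra
 note C = quartic_eq[OF this]
 have m1: "m1 = 0"
 proof (rule ccontr)
  assume m1: "m1 \<noteq> 0"
  have "top_equiv_germ {z. quart k 1 (fst z) (snd z) = 0} (germ_A (3 - 1))"
   by (rule germ_A_criterion[where A = "%_. 1/A" and B = "%_. 0" and C = "%z. m1+m2*fst z+m3 * snd z"
      and a = "%z. A + c * snd z" and b = "%z. b+g * snd z" and N = UNIV and k = 2])
    (use A m1 in \<open>auto intro!: sd_intros simp: Q algebra_simps power2_eq_square power3_eq_cube\<close>)
  then show False using coords4_excluded[OF d k T(1) n(3)] by simp
 qed
 have "b \<noteq> 0" "i \<noteq> 0" using C(3) z A unfolding i_def by auto
 then have g0: "g = 0" using C(4) m1 by simp
 then have m3: "m3 = 0" using C(5) by simp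
 have "quart k s t r = 1/A*(0 * s^2+A * s*t+0*t^2+b * s*r + c*t*r+g*r^2)^2
   +m2/zcoord v * (0 * s+0*t+1*r)^3*(zcoord u * s+zcoord v * t+zcoord p*r)" for s t r
  unfolding Q m1 m3 z using fin by simp
 from visible_from_coords[OF f(1) d k this] show ?thesis by metis
qed

text \<open>Here the restriction to t = 0 is e r^4, which kills b and \<open>m1\<close>. If
  \<open>m3\<close> were nonzero, the discriminant of the part with terms x^2, x y^2, y^4 would be
  nonzero and the point at infinity a tacnode.\<close>

lemma cusp_ramphoid_visible:
 assumes f: "totdeg f = 4" "irreducible f" and B: "inf_flex f u p e"
  and s: "sing_pt (homog 4 f) u" "sing_pt (homog 4 f) v" and fin: "zcoord v \<noteq> 0"
  and T: "has_type (homog 4 f) u (germ_A 4)" "has_type (homog 4 f) v (germ_A 2)"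
 shows "\<exists>q l. visible_dec f q l"
proof -
 have z: "zcoord p = 0" "zcoord u = 0" "det3 u p (0, 0, 1) \<noteq> 0" "e \<noteq> 0"
  and B': "\<And>a b c. homog 4 f (comb u p c (a, b, 0)) = e*b^4" using B unfolding inf_flex_def by auto
 have "det3 p u (0, 0, 1) \<noteq> 0" using z(3) det3_swap[of p u] by simp
 then have d: "det3 u v p \<noteq> 0" by (rule det3_infinity[OF z(2,1) _ fin])
 obtain k where k: "coords4 f u v p k" using coords4_ex[OF eq_imp_le[OF f(1)]] by blast
 have n: "\<not> top_equiv_germ (germ_A 1) (germ_A 4)" "\<not> top_equiv_germ (germ_A 1) (germ_A 2)" "\<not> top_equiv_germ (germ_A 3) (germ_A 4)"
  using germ_A_parity[of 1 4] germ_A_parity[of 1 2] germ_A_parity[of 3 4] by auto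
 obtain A b c g m1 m2 m3 where A: "A \<noteq> 0" and Q: "\<And>s t r. quart k s t r = 1/A*(A * s*t+b * s*r + c*t*r+g*r^2)^2+r^3*(m1 * s+m2*t+m3*r)"
  using two_points_normal_form[OF f d k s T(1) n(1) T(2) n(2)] by metis
 define i where "i = 1/A"
 have c1: "comb u v p (1, 0, r) = comb u p v (1, r, 0)" for r by (cases u; cases v; cases p) (simp add: comb_simps algebra_simps)
 have "quart k 1 0 r = e*r^4" for r using k[unfolded coords4_def, rule_format, of 1 0 r] B'[of v 1 r] unfolding c1 by simp
 then have E: "i*(b*r+g*r^2)^2+r^3*(m1+m3*r) = e*r^4" for r unfolding Q i_def by simp
 have "0+0*r+(i*b^2)*r^2+(2*i*b*g+m1)*r^3+(i*g^2+m3)*r^4 = 0+0*r+0*r^2+0*r^3+e*r^4" for r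
  using E[of r] by algebra
 note C = quartic_eq[OF this]
 have b0: "b = 0" using C(3) A unfolding i_def by simp
 have m1: "m1 = 0" using C(4) b0 by simp
 have m3: "m3 = 0"
 proof (rule ccontr)
  assume m3: "m3 \<noteq> 0"
  have "top_equiv_germ {z. quart k 1 (fst z) (snd z) = 0} (germ_A (4 - 1))"
  proof (rule germ_A_criterion_simple[where A = "%z. i*(A + c * snd z)^2" and
    B = "%z. 2*i*g*(A + c * snd z)+m2 * snd z" and C = "%z. i*g^2+m3" and k = 2])
   have i: "i*A = 1" unfolding i_def using A by simp
   have "4*(i*A^2)*(i*g^2+m3) - (2*i*g*A)^2*1 = 4*A*m3" using i by algebra
   then have "4*(i*A^2)*(i*g^2+m3) \<noteq> (2*i*g*A)^2" using A m3 by auto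
   then show "4*(i*(A + c * snd 0)^2)*(i*g^2+m3) \<noteq> (2*i*g*(A + c * snd 0)+m2 * snd 0)^2*0^(2*2 - 4)"
    by simp
   show "quart k 1 (fst (x, y)) (snd (x, y)) = i*(A + c * snd (x, y))^2*x^2+(2*i*g*(A + c * snd (x, y))+m2 * snd (x, y))*y^2*x+(i*g^2+m3)*y^4" for x y
    unfolding Q b0 m1 i_def[symmetric] by (simp add: algebra_simps power2_eq_square power3_eq_cube power4_eq_xxxx)
  qed (use A in \<open>auto intro!: sd_intros simp: i_def\<close>)
  then show False using coords4_excluded[OF d k T(1) n(3)] by simp
 qed
 have "quart k s t r = 1/A*(0 * s^2+A * s*t+0*t^2+b * s*r + c*t*r+g*r^2)^2
   +m2/zcoord v * (0 * s+0*t+1*r)^3*(zcoord u * s+zcoord v * t+zcoord p*r)" for s t r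
  unfolding Q m1 m3 z using fin by simp
 from visible_from_coords[OF f(1) d k this] show ?thesis by metis
qed

lemma form_comb:
 assumes "form d G" shows "form d (%p. G (comb u v w p))"
proof -
 obtain u1 u2 u3 v1 v2 v3 w1 w2 w3 where uvw: "u = (u1, u2, u3)" "v = (v1, v2, v3)" "w = (w1, w2, w3)"
  by (metis prod_cases3)
 have "(%p. G (comb u v w p)) = (%p. G (u1*fst p + v1*fst (snd p)+w1 * snd (snd p), u2*fst p + v2*fst (snd p)+w2 * snd (snd p), u3*fst p + v3*fst (snd p)+w3 * snd (snd p)))"
  unfolding uvw by (rule ext) (auto simp: comb_def mult.commute)
 then show ?thesis using form_compose[OF assms form_linear form_linear form_linear] by simp
qed

lemma visible_dec_homog:
 assumes "visible_dec f q l"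
 shows "homog 4 f v = homog 2 q v ^ 2+homog 1 l v ^ 3*zcoord v"
proof -
 have t: "totdeg q \<le> 2" "totdeg l \<le> 1" "f = q^2+l^3" using assms unfolding visible_dec_def by auto
 have q: "homog 4 (q^2) v = homog 2 q v ^ 2" using homog_mult[OF t(1,1), of v] by (simp add: power2_eq_square)
 have l2: "homog 2 (l*l) v = homog 1 l v * homog 1 l v" using homog_mult[OF t(2,2), of v] by (simp add: numeral_2_eq_2)
 have t2: "totdeg (l*l) \<le> 2" using totdeg_mult_le[OF t(2,2)] by simp
 have l3: "homog 3 (l*l*l) v = homog 2 (l*l) v * homog 1 l v" using homog_mult[OF t2 t(2), of v] by simp
 have t3: "totdeg (l*l*l) \<le> 3" using totdeg_mult_le[OF t2 t(2)] by simp
 have t1: "totdeg (cpoly2 1) \<le> 1" using totdeg_cpoly2 by simp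
 have "homog 4 (l*l*l * cpoly2 1) v = homog 3 (l*l*l) v * homog 1 (cpoly2 1) v" using homog_mult[OF t3 t1, of v] by simp
 moreover have "homog 1 (cpoly2 1) v = zcoord v" by (cases v) (simp add: homog_def cpoly2_def zcoord_def)
 ultimately have "homog 4 (l^3) v = homog 1 l v ^ 3*zcoord v" unfolding l2 l3 cpoly2_1 by (simp add: power3_eq_cube)
 then show ?thesis unfolding t(3) homog_add q by simp
qed

text \<open>In F = q^2 + l^3 Z the conic q and the line l both pass through the cusp u at infinity.
  Unless l is the tangent of q there, l^3 Z has order 4 along q = 0 and the point is a tacnode. If
  it is the tangent, singularity of the finite point v puts the whole line through u and v into the
  quartic.\<close>

lemma no_visible_dec_at_cusp:
 assumes f: "totdeg f = 4" "irreducible f" and B: "inf_bitangent f p u e"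
  and s: "sing_pt (homog 4 f) u" "sing_pt (homog 4 f) v" and fin: "zcoord v \<noteq> 0"
  and T: "has_type (homog 4 f) u (germ_A 2)"
 shows "\<not> visible_dec f q l"
proof
 assume vis: "visible_dec f q l"
 have z: "zcoord p = 0" "zcoord u = 0" "det3 p u (0, 0, 1) \<noteq> 0" "e \<noteq> 0"
  and B': "\<And>a b c. homog 4 f (comb p u c (a, b, 0)) = e*a^2*b^2" using B unfolding inf_bitangent_def by auto
 define w where "w = ((0, 0, 1) :: pt3)"
 have d: "det3 u p w \<noteq> 0" using z(3) det3_swap[of u p] unfolding w_def by simp
 obtain k where k: "coords4 f u p w k" using coords4_ex[OF eq_imp_le[OF f(1)]] by blast
 have t: "totdeg q \<le> 2" "totdeg l \<le> 1" using vis unfolding visible_dec_def by auto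
 obtain a1 a2 a3 a4 a5 a6 where Q: "\<And>s x y. homog 2 q (comb u p w (s, x, y)) = a1 * s^2+a2 * s*x+a3*x^2+a4 * s*y+a5*x*y+a6*y^2"
  using form_2E[OF form_comb[OF form_homog[OF t(1)]]] by metis
 obtain b1 b2 b3 where L: "\<And>s x y. homog 1 l (comb u p w (s, x, y)) = b1 * s+b2*x+b3*y"
  using form_1E[OF form_comb[OF form_homog[OF t(2)]]] by metis
 have F: "quart k s x y = (a1 * s^2+a2 * s*x+a3*x^2+a4 * s*y+a5*x*y+a6*y^2)^2+(b1 * s+b2*x+b3*y)^3*y" for s x y
  using k visible_dec_homog[OF vis, of "comb u p w (s, x, y)"] unfolding coords4_def Q L zcoord_comb z
  by (simp add: w_def zcoord_def)
 have E: "quart k 1 x 0 = e*x^2" for x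
  using k[unfolded coords4_def, rule_format, of 1 x 0] B'[of w x 1] unfolding comb_swap[of p u] by simp
 have "a1^2+(2*a1*a2)*x+(a2^2+2*a1*a3)*x^2+(2*a2*a3)*x^3+a3^2*x^4 = 0+0*x+e*x^2+0*x^3+0*x^4" for x
 proof -
  have "(a1+a2*x+a3*x^2)^2 = e*x^2" using E[of x] unfolding F by simp
  then show ?thesis by algebra
 qed
 note C = quartic_eq[OF this]
 have a1: "a1 = 0" "a3 = 0" "a2^2 = e" using C by auto
 then have a2: "a2 \<noteq> 0" using z by auto
 \<comment> \<open>The coefficient of s^3 y is \<open>b1\<close>^3; singularity at u makes it zero,
   so l passes through u.\<close>
 have G: "quart k 1 0 y = (a4*y+a6*y^2)^2+(b1+b3*y)^3*y" for y unfolding F a1 by simp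
 have "((%y. quart k 1 0 y) has_field_derivative k 3 0) (at 0)" unfolding quart_def by (auto intro!: derivative_eq_intros)
 moreover have "((%y. quart k 1 0 y) has_field_derivative b1^3) (at 0)" unfolding G by (auto intro!: derivative_eq_intros)
 ultimately have "b1^3 = k 3 0" using DERIV_unique by blast
 then have b1: "b1 = 0" using coords4_sing(3)[OF k s(1)] by simp
 \<comment> \<open>Otherwise q is a local coordinate W at u, and l = \<open>\<gamma>\<close> W +
   \<open>\<beta>\<close> y with \<open>\<beta>\<close> nonzero at the origin. The y^4 term of l^3 Z
   then has a unit coefficient and the criterion gives A3.\<close>
 have eq: "b3*a2 = b2*a4"
 proof (rule ccontr)
  assume ne: "b3*a2 \<noteq> b2*a4"
  define \<rho> where "\<rho> = (%z :: complex \<times> complex. 1/(a2+a5 * snd z))"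
  define \<beta> \<gamma> W where "\<beta> = (%z. b3 - b2*\<rho> z*(a4+a6 * snd z))" and "\<gamma> = (%z. b2*\<rho> z)"
   and "W = (%z. fst z*(a2+a5 * snd z) + snd z*(a4+a6 * snd z))"
  have sr: "sd \<rho>" unfolding \<rho>_def using a2 by (intro sd_intros) auto
  have sW: "sd W" unfolding W_def by (intro sd_intros)
  have sb: "sd \<beta>" "sd \<gamma>" unfolding \<beta>_def \<gamma>_def by (intro sd_intros sr)+
  have b0: "\<beta> 0 \<noteq> 0" unfolding \<beta>_def \<rho>_def using ne a2 by (simp add: field_simps)
  have "top_equiv_germ {z. quart k 1 (fst z) (snd z) = 0} (germ_A (4 - 1))"
  proof (rule germ_A_criterion[where A = "%z. 1 + snd z*(\<gamma> z^3*W z+3*\<gamma> z^2*\<beta> z * snd z)" and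
    B = "%z. 3*\<gamma> z*\<beta> z^2" and C = "%z. \<beta> z^3" and a = "%z. a2+a5 * snd z" and b = "%z. a4+a6 * snd z"
     and N = "{z. a2+a5 * snd z \<noteq> 0}" and k = 3])
   show "open {z :: complex \<times> complex. a2+a5 * snd z \<noteq> 0}" by (intro open_Collect_neq continuous_intros)
   fix z :: "complex \<times> complex" assume "z \<in> {z. a2+a5 * snd z \<noteq> 0}"
   then have r: "\<rho> z*(a2+a5 * snd z) = 1" unfolding \<rho>_def by simp
   obtain x y where xy: "z = (x, y)" by (cases z)
   have W: "fst z*(a2+a5 * snd z) + snd z*(a4+a6 * snd z) = W z" unfolding W_def ..
   have l: "b2*x+b3*y = \<gamma> z*W z+\<beta> z*y"
   proof -
    define j where "j = \<rho> z"
    show ?thesis using r unfolding \<gamma>_def \<beta>_def W_def j_def[symmetric] unfolding xy fst_conv snd_conv by algebra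
   qed
   have "quart k 1 (fst z) (snd z) = W z^2+(b2*x+b3*y)^3*y"
    unfolding F a1 b1 xy W_def by (simp add: algebra_simps power2_eq_square)
   then show "quart k 1 (fst z) (snd z) = (1 + snd z*(\<gamma> z^3*W z+3*\<gamma> z^2*\<beta> z * snd z))*(fst z*(a2+a5 * snd z) + snd z*(a4+a6 * snd z))^2
    +3*\<gamma> z*\<beta> z^2 * snd z^3*(fst z*(a2+a5 * snd z) + snd z*(a4+a6 * snd z))+\<beta> z^3 * snd z^4"
    unfolding W l by (simp add: xy algebra_simps power2_eq_square power3_eq_cube power4_eq_xxxx)
  qed (use a2 b0 in \<open>auto intro!: sd_intros sb sW\<close>)
  moreover have "\<not> top_equiv_germ (germ_A 3) (germ_A 2)" using germ_A_parity[of 3 2] by auto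
  ultimately show False using coords4_excluded[OF d k T] by simp
 qed
 have b2: "b2 \<noteq> 0"
 proof
  assume "b2 = 0"
  then have "b3 = 0" using eq a2 by simp
  then have "homog 1 l x = 0" for x using L b1 \<open>b2 = 0\<close> comb_coords[OF d] by (metis add_0_right mult_zero_left)
  then have "eval2 l x y = 0" for x y using homog_at_1[OF t(2)] by metis
  then have "l = 0" by (intro eval2_inject) (simp add: eval2_simps)
  then show False using visible_dec_torus(2)[OF f vis] totdeg_0 by simp
 qed
 obtain s0 x0 y0 where v: "comb u p w (s0, x0, y0) = v" using comb_coords[OF d] by metis
 have y0: "y0 \<noteq> 0" using fin zcoord_comb[of u p w s0 x0 y0] z unfolding v by auto
 define m where "m = a2*x0+a4*y0"
 define Q0 where "Q0 = s0*m+y0*(a5*x0+a6*y0)"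
 have Ft: "quart k (s0+t) x0 y0 = (Q0+t*m)^2+(b2*x0+b3*y0)^3*y0" for t
  unfolding F a1 b1 Q0_def m_def by (simp add: algebra_simps power2_eq_square)
 have cv: "comb v u p (1, t, 0) = comb u p w (s0+t, x0, y0)" for t
  unfolding v[symmetric] by (cases u; cases p; cases w) (simp add: comb_simps algebra_simps)
 \<comment> \<open>Moving from v towards u changes q linearly, with slope m, and leaves l and Z
   unchanged; the vanishing derivative gives 2 Q0 m = 0.\<close>
 have "((%t. (Q0+t*m)^2+(b2*x0+b3*y0)^3*y0) has_field_derivative 0) (at 0)"
  using sing_direction[OF s(2), of u p] unfolding cv k[unfolded coords4_def, rule_format] Ft .
 moreover have "((%t. (Q0+t*m)^2+(b2*x0+b3*y0)^3*y0) has_field_derivative 2*Q0*m) (at 0)"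
  by (auto intro!: derivative_eq_intros)
 ultimately have "2*Q0*m = 0" using DERIV_unique by blast
 then have Qm: "Q0 = 0 \<or> m = 0" by simp
 have l: "a2*(b2*x0+b3*y0) = b2*m" using eq unfolding m_def by algebra
 have "quart k s0 x0 y0 = 0" using s(2) k v unfolding sing_pt_def on_curve_def coords4_def by metis
 then have F0: "Q0^2+(b2*x0+b3*y0)^3*y0 = 0" using Ft[of 0] by simp
 \<comment> \<open>A nonzero m would force q, and then l, to vanish at v, while tangency makes l(v)
   a nonzero multiple of m.\<close>
 have m0: "m = 0"
 proof (rule ccontr)
  assume "m \<noteq> 0"
  then have "b2*x0+b3*y0 = 0" using Qm F0 y0 by auto
  then show False using l b2 \<open>m \<noteq> 0\<close> by auto
 qed
 then have l0: "b2*x0+b3*y0 = 0" using l a2 by auto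
 then have Q0: "Q0 = 0" using F0 by simp
 then have c0: "a5*x0+a6*y0 = 0" using m0 y0 unfolding Q0_def by simp
 have "homog 4 f (comb u v p (s, t, 0)) = 0" for s t
 proof -
  have "comb u v p (s, t, 0) = comb u p w (s+t * s0, t*x0, t*y0)"
   unfolding v[symmetric] by (cases u; cases p; cases w) (simp add: comb_simps algebra_simps)
  then have "homog 4 f (comb u v p (s, t, 0)) = quart k (s+t * s0) (t*x0) (t*y0)" using k unfolding coords4_def by simp
  also have "\<dots> = ((s+t * s0)*t*m+t^2*y0*(a5*x0+a6*y0))^2+(t*(b2*x0+b3*y0))^3*(t*y0)"
   unfolding F a1 b1 m_def by (simp add: algebra_simps power2_eq_square)
  also have "\<dots> = 0" unfolding m0 c0 l0 by simp
  finally show ?thesis .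
 qed
 then show False using irreducible_contains_no_line[OF f det3_infinity(1)[OF z(2,1,3) fin]] by blast
qed

lemma det3_swap23: "det3 u v w = - det3 u w v"
 by (cases u; cases v; cases w) (simp add: det3_simps algebra_simps)

text \<open>After normalising, the coefficients that would give A1, A2, A3, A4 and A5 are excluded
  one after the other. What survives is e (s x + D y^2)^2 + a x^3 y, where y is Z because
  \<open>zcoord w\<close> = 1.\<close>

lemma A6_visible:
 assumes f: "totdeg f = 4" "irreducible f" and B: "inf_bitangent f p u e"
  and s: "sing_pt (homog 4 f) u" and T: "has_type (homog 4 f) u (germ_A 6)"
 shows "\<exists>q l. visible_dec f q l"
proof -
 have z: "zcoord p = 0" "zcoord u = 0" "det3 p u (0, 0, 1) \<noteq> 0" "e \<noteq> 0"
  and B': "\<And>a b c. homog 4 f (comb p u c (a, b, 0)) = e*a^2*b^2" using B unfolding inf_bitangent_def by auto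
 have ex: "\<not> top_equiv_germ (germ_A n) (germ_A 6)" if "n = 1 \<or> n = 2 \<or> n = 3 \<or> n = 4 \<or> n = 5" for n
  using that germ_A_parity[of 1 6] germ_A_parity[of 3 6] germ_A_parity[of 5 6] germ_A2_A4_not_equiv_A6[of 1] germ_A2_A4_not_equiv_A6[of 2]
  by auto
 have inf: "k 4 0 = 0" "k 3 1 = 0" "k 3 0 = 0" "k 2 2 = e" "k 1 3 = 0" "k 0 4 = 0" if k: "coords4 f u p w k" for w k
 proof -
  show z: "k 4 0 = 0" "k 3 1 = 0" "k 3 0 = 0" by (rule coords4_sing[OF k s])+
  have "quart k 1 x 0 = e*x^2" for x
   using k[unfolded coords4_def, rule_format, of 1 x 0] B'[of w x 1] unfolding comb_swap[of p u] by simp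
  then have "0+0*x + k 2 2*x^2 + k 1 3*x^3 + k 0 4*x^4 = 0+0*x+e*x^2+0*x^3+0*x^4" for x
   unfolding quart_def z by simp
  from quartic_eq(3-5)[OF this] show "k 2 2 = e" "k 1 3 = 0" "k 0 4 = 0" .
 qed
 define w0 where "w0 = ((0, 0, 1) :: pt3)"
 have d0: "det3 u p w0 \<noteq> 0" using z(3) det3_swap[of u p] unfolding w0_def by simp
 obtain k0 where k0: "coords4 f u p w0 k0" using coords4_ex[OF eq_imp_le[OF f(1)]] by blast
 \<comment> \<open>Shifting the third basis vector by these amounts cancels the terms s x^2 y and
   s^2 x y against the y-linear part of e s^2 x^2.\<close>
 define \<sigma> \<tau> where "\<sigma> = k0 1 2/(2*e)" and "\<tau> = k0 2 1/(2*e)"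
 have st: "k0 1 2 = 2*e*\<sigma>" "k0 2 1 = 2*e*\<tau>" unfolding \<sigma>_def \<tau>_def using z by simp_all
 define w where "w = comb u p w0 (- \<sigma>, - \<tau>, 1)"
 have cw: "comb u p w (s, x, y) = comb u p w0 (s - \<sigma>*y, x - \<tau>*y, y)" for s x y
  unfolding w_def by (cases u; cases p; cases w0) (simp add: comb_simps algebra_simps)
 have "det3 u p w = det3 u p w0" unfolding w_def
  by (cases u; cases p; cases w0) (simp add: comb_simps det3_simps algebra_simps)
 then have d: "det3 u p w \<noteq> 0" using d0 by simp
 have zw: "zcoord w = 1" unfolding w_def zcoord_comb z by (simp add: w0_def zcoord_def)
 obtain k where k: "coords4 f u p w k" using coords4_ex[OF eq_imp_le[OF f(1)]] by blast
 have qq: "quart k s x y = quart k0 (s - \<sigma>*y) (x - \<tau>*y) y" for s x y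
  using k k0 unfolding coords4_def cw by metis
 note i0 = inf[OF k0] and i = inf[OF k]
 have der: "k 2 1*x + k 1 2*x^2 + k 0 3*x^3 = k0 0 3*x^3" for x
 proof -
  define k1 k2 k3 k4 k5 k6 where "k1 = k0 0 3" and "k2 = k0 2 0" and "k3 = k0 1 1" and "k4 = k0 0 2" and "k5 = k0 1 0" and "k6 = k0 0 1"
  define k7 where "k7 = k0 0 0"
  have "((%y. quart k 1 x y) has_field_derivative k 2 1*x + k 1 2*x^2 + k 0 3*x^3) (at 0)"
   unfolding quart_def i by (auto intro!: derivative_eq_intros)
  moreover have "((%y. quart k0 (1 - \<sigma>*y) (x - \<tau>*y) y) has_field_derivative k0 0 3*x^3) (at 0)"
   unfolding quart_def i0 st k1_def[symmetric] k2_def[symmetric] k3_def[symmetric] k4_def[symmetric] k5_def[symmetric] k6_def[symmetric] k7_def[symmetric]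
   by (auto intro!: derivative_eq_intros simp: algebra_simps power2_eq_square)
  ultimately show ?thesis unfolding qq using DERIV_unique by blast
 qed
 have "0 + k 2 1*x + k 1 2*x^2 + k 0 3*x^3+0*x^4 = 0+0*x+0*x^2 + k0 0 3*x^3+0*x^4" for x
  using der[of x] by simp
 from quartic_eq(2,3)[OF this] have k21: "k 2 1 = 0" "k 1 2 = 0" .
 have k20: "k 2 0 = 0"
 proof (rule ccontr)
  assume "k 2 0 \<noteq> 0"
  then have "k 2 1^2 \<noteq> 4 * k 2 2 * k 2 0" unfolding k21 i using z by simp
  moreover have "k 2 2 \<noteq> 0" unfolding i by (rule z)
  ultimately show False using coeffs_node[OF i(1-3)] coords4_excluded[OF d k T ex[of 1]] by blast
 qed
 define a g m h dl ep where "a = k 0 3" and "g = k 0 2" and "m = k 0 1" and "h = k 0 0" and "dl = k 1 1" and "ep = k 1 0"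
 have Q: "quart k s x y = e * s^2*x^2+a*x^3*y+y^2*(dl * s*x+g*x^2)+y^3*(ep * s+m*x)+h*y^4" for s x y
  unfolding quart_def i k21 k20 a_def g_def m_def h_def dl_def ep_def by simp
 have ep: "ep = 0"
 proof (rule ccontr)
  assume "ep \<noteq> 0"
  then have "top_equiv_germ {z. quart k 1 (fst z) (snd z) = 0} (germ_A (3 - 1))"
   by (intro germ_A_criterion_simple[where A = "%z. e+a*fst z * snd z+g * snd z^2" and
      B = "%z. dl+m * snd z" and C = "%z. ep+h * snd z" and k = 2])
    (use z in \<open>auto intro!: sd_intros simp: Q algebra_simps power2_eq_square power3_eq_cube power4_eq_xxxx\<close>)
  then show False using coords4_excluded[OF d k T ex[of 2]] by simp
 qed
 have h: "4*e*h = dl^2"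
 proof (rule ccontr)
  assume "4*e*h \<noteq> dl^2"
  then have "top_equiv_germ {z. quart k 1 (fst z) (snd z) = 0} (germ_A (4 - 1))"
   by (intro germ_A_criterion_simple[where A = "%z. e+a*fst z * snd z+g * snd z^2" and
      B = "%z. dl+m * snd z" and C = "%z. h" and k = 2])
    (use z in \<open>auto intro!: sd_intros simp: Q ep algebra_simps power2_eq_square power3_eq_cube power4_eq_xxxx\<close>)
  then show False using coords4_excluded[OF d k T ex[of 3]] by simp
 qed
 define D where "D = dl/(2*e)"
 have dl: "dl = 2*e*D" unfolding D_def using z by simp
 have "4*e*h = 4*e*(e*D^2)" using h unfolding dl by algebra
 then have hh: "h = e*D^2" using z by simp
 have Q1: "quart k s x y = e*(s*x+D*y^2)^2+y*(a*x^3+g*x^2*y+m*x*y^2)" for s x y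
  unfolding Q ep dl hh by (simp add: algebra_simps power2_eq_square power3_eq_cube power4_eq_xxxx)
 \<comment> \<open>For D = 0 every term contains x, and the line x = 0 would be a component.\<close>
 have D0: "D \<noteq> 0"
 proof
  assume "D = 0"
  have "comb u w p (s, t, 0) = comb u p w (s, 0, t)" for s t by (cases u; cases p; cases w) (simp add: comb_simps)
  then have "homog 4 f (comb u w p (s, t, 0)) = 0" for s t
   using k[unfolded coords4_def, rule_format, of s 0 t] unfolding Q1 \<open>D = 0\<close> by simp
  moreover have "det3 u w p \<noteq> 0" using d det3_swap23[of u p w] by simp
  ultimately show False using irreducible_contains_no_line[OF f] by blast
 qed
 \<comment> \<open>Substituting x = W - D y^2, the term m x y^3 contributes -m D y^5, the leading
   term of an A4 germ. In the next step g x^2 y^2 contributes g D^2 y^6 in the same way, an A5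
   germ.\<close>
 have m0: "m = 0"
 proof (rule ccontr)
  assume "m \<noteq> 0"
  then have "top_equiv_germ {z. quart k 1 (fst z) (snd z) = 0} (germ_A (5 - 1))"
   by (intro germ_A_criterion[where A = "%z. e+a * snd z*(fst z+D * snd z^2 - 3*D * snd z^2)+g * snd z^2" and
      B = "%z. m - 2*g*D * snd z+3*a*D^2 * snd z^2" and C = "%z. - m*D+g*D^2 * snd z - a*D^3 * snd z^2"
      and a = "%_. 1" and b = "%z. D * snd z" and N = UNIV and k = 3])
    (use z D0 in \<open>auto intro!: sd_intros simp: Q1 algebra_simps power2_eq_square power3_eq_cube power4_eq_xxxx eval_nat_numeral\<close>)
  then show False using coords4_excluded[OF d k T ex[of 4]] by simp
 qed
 have g0: "g = 0"
 proof (rule ccontr)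
  assume "g \<noteq> 0"
  then have "top_equiv_germ {z. quart k 1 (fst z) (snd z) = 0} (germ_A (6 - 1))"
   by (intro germ_A_criterion[where A = "%z. e+a * snd z*(fst z+D * snd z^2 - 3*D * snd z^2)+g * snd z^2" and
      B = "%z. - 2*g*D+3*a*D^2 * snd z" and C = "%z. g*D^2 - a*D^3 * snd z"
      and a = "%_. 1" and b = "%z. D * snd z" and N = UNIV and k = 4])
    (use z D0 in \<open>auto intro!: sd_intros simp: Q1 m0 algebra_simps power2_eq_square power3_eq_cube power4_eq_xxxx eval_nat_numeral\<close>)
  then show False using coords4_excluded[OF d k T ex[of 5]] by simp
 qed
 have "quart k s x y = e*(0 * s^2+1 * s*x+0*x^2+0 * s*y+0*x*y+D*y^2)^2
   +a*(0 * s+1*x+0*y)^3*(zcoord u * s+zcoord p*x+zcoord w*y)" for s x y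
  unfolding Q1 m0 g0 z zw by simp
 from visible_from_coords[OF f(1) d k this] show ?thesis by metis
qed

text \<open>Coordinates centred at a finite singular point \<open>pt\<close>, with \<open>v\<close> and \<open>w\<close> spanning the line at infinity,
 on which the quartic restricts to a square.\<close>
definition centred :: "complex poly poly => pt3 => pt3 => pt3 => (nat => nat => complex) => complex => complex => complex => bool" where
 "centred f pt v w k a b c \<longleftrightarrow> zcoord v = 0 \<and> zcoord w = 0 \<and> det3 pt v w \<noteq> 0 \<and> coords4 f pt v w k \<and>
   (\<forall>s t r. quart k s t r = s^2*(k 2 2*t^2 + k 2 1*t*r + k 2 0*r^2)
    + s*(k 1 3*t^3 + k 1 2*t^2*r + k 1 1*t*r^2 + k 1 0*r^3)+(a*t^2+b*t*r + c*r^2)^2)"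

section \<open>A single finite singular point: types A5 and E6\<close>

lemma quart_expand:
 "quart k s t r = quart k 0 t r+(k 1 3*t^3 + k 1 2*t^2*r + k 1 1*t*r^2 + k 1 0*r^3) * s
  +(k 2 2*t^2 + k 2 1*t*r + k 2 0*r^2) * s^2+(k 3 1*t + k 3 0*r) * s^3 + k 4 0 * s^4"
 unfolding quart_def by (simp add: algebra_simps)

lemma centredI:
 assumes f: "totdeg f = 4" and s: "sing_pt (homog 4 f) pt"
  and z: "zcoord v = 0" "zcoord w = 0" "det3 pt v w \<noteq> 0" and k: "coords4 f pt v w k"
  and sq: "\<And>t r. homog 4 f (comb pt v w (0, t, r)) = (a*t^2+b*t*r + c*r^2)^2"
 shows "centred f pt v w k a b c"
proof -
 have z0: "k 4 0 = 0" "k 3 1 = 0" "k 3 0 = 0" by (rule coords4_sing[OF k s])+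
 have q0: "quart k 0 t r = (a*t^2+b*t*r + c*r^2)^2" for t r using k sq unfolding coords4_def by simp
 show ?thesis unfolding centred_def
 proof (intro conjI allI)
  show "quart k s t r = s^2*(k 2 2*t^2 + k 2 1*t*r + k 2 0*r^2)
    + s*(k 1 3*t^3 + k 1 2*t^2*r + k 1 1*t*r^2 + k 1 0*r^3)+(a*t^2+b*t*r + c*r^2)^2" for s t r
   by (subst quart_expand, unfold q0 z0) simp
 qed (use z k in auto)
qed

lemma centred_ex:
 assumes f: "totdeg f = 4" and s: "sing_pt (homog 4 f) pt" "zcoord pt \<noteq> 0" and sq: "inf_square f"
 obtains v w k a b c where "centred f pt v w k a b c"
proof -
 obtain a b c where h: "\<And>x y. homog 4 f (x, y, 0) = (a*x^2+b*x*y + c*y^2)^2" using sq unfolding inf_square_def by blast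
 obtain k where k: "coords4 f pt (1, 0, 0) (0, 1, 0) k" using coords4_ex[OF eq_imp_le[OF f]] by blast
 have "comb pt (1, 0, 0) (0, 1, 0) (0, t, r) = (t, r, 0)" for t r by (cases pt) (simp add: comb_simps)
 then have "homog 4 f (comb pt (1, 0, 0) (0, 1, 0) (0, t, r)) = (a*t^2+b*t*r + c*r^2)^2" for t r using h by simp
 moreover have "det3 pt (1, 0, 0) (0, 1, 0) \<noteq> 0" using s(2) by (cases pt) (simp add: det3_simps zcoord_def)
 ultimately have "centred f pt (1, 0, 0) (0, 1, 0) k a b c" by (intro centredI[OF f s(1)] k) (auto simp: zcoord_def)
 then show thesis by (rule that)
qed

text \<open>A change of basis on the line at infinity keeps the square there and acts by
  substitution on the tangent cone and on the cubic part.\<close>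

lemma centred_change:
 assumes f: "totdeg f = 4" and s: "sing_pt (homog 4 f) pt" and c: "centred f pt v w k a b c" and D: "p1*q2 - p2*q1 \<noteq> 0"
 obtains v' w' k' a' b' c' where "centred f pt v' w' k' a' b' c'"
  "\<And>t r. k' 2 2*t^2 + k' 2 1*t*r + k' 2 0*r^2 =
    k 2 2*(p1*t+q1*r)^2 + k 2 1*(p1*t+q1*r)*(p2*t+q2*r) + k 2 0*(p2*t+q2*r)^2"
  "\<And>t r. k' 1 3*t^3 + k' 1 2*t^2*r + k' 1 1*t*r^2 + k' 1 0*r^3 =
    k 1 3*(p1*t+q1*r)^3 + k 1 2*(p1*t+q1*r)^2*(p2*t+q2*r) + k 1 1*(p1*t+q1*r)*(p2*t+q2*r)^2 + k 1 0*(p2*t+q2*r)^3"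
proof -
 have z: "zcoord v = 0" "zcoord w = 0" "det3 pt v w \<noteq> 0" and k: "coords4 f pt v w k"
  and Q: "\<And>s t r. quart k s t r = s^2*(k 2 2*t^2 + k 2 1*t*r + k 2 0*r^2)
    + s*(k 1 3*t^3 + k 1 2*t^2*r + k 1 1*t*r^2 + k 1 0*r^3)+(a*t^2+b*t*r + c*r^2)^2"
  using c unfolding centred_def by auto
 define v' w' where "v' = comb pt v w (0, p1, p2)" and "w' = comb pt v w (0, q1, q2)"
 have cc: "comb pt v' w' (s, t, r) = comb pt v w (s, p1*t+q1*r, p2*t+q2*r)" for s t r
  unfolding v'_def w'_def by (cases pt; cases v; cases w) (simp add: comb_simps algebra_simps)
 have "det3 pt v' w' = (p1*q2 - p2*q1)*det3 pt v w"
  unfolding v'_def w'_def by (cases pt; cases v; cases w) (simp add: comb_simps det3_simps algebra_simps)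
 then have d': "det3 pt v' w' \<noteq> 0" using D z by simp
 have z': "zcoord v' = 0" "zcoord w' = 0" unfolding v'_def w'_def zcoord_comb z by simp_all
 obtain k' where k': "coords4 f pt v' w' k'" using coords4_ex[OF eq_imp_le[OF f]] by blast
 have qq: "quart k' s t r = quart k s (p1*t+q1*r) (p2*t+q2*r)" for s t r
  using k k' unfolding coords4_def cc by metis
 define a' b' c' where "a' = a*p1^2+b*p1*p2 + c*p2^2" and "b' = 2*a*p1*q1+b*(p1*q2+p2*q1)+2 * c*p2*q2"
  and "c' = a*q1^2+b*q1*q2 + c*q2^2"
 have "a*(p1*t+q1*r)^2+b*(p1*t+q1*r)*(p2*t+q2*r) + c*(p2*t+q2*r)^2 = a'*t^2+b'*t*r + c'*r^2" for t r
  unfolding a'_def b'_def c'_def by algebra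
 then have sq: "homog 4 f (comb pt v' w' (0, t, r)) = (a'*t^2+b'*t*r + c'*r^2)^2" for t r
  using k' unfolding coords4_def qq Q by simp
 have c': "centred f pt v' w' k' a' b' c'" by (rule centredI[OF f s z' d' k' sq])
 have e: "quart k' 0 t r+(k' 1 3*t^3 + k' 1 2*t^2*r + k' 1 1*t*r^2 + k' 1 0*r^3) * s
  +(k' 2 2*t^2 + k' 2 1*t*r + k' 2 0*r^2) * s^2+(k' 3 1*t + k' 3 0*r) * s^3 + k' 4 0 * s^4 =
   quart k 0 (p1*t+q1*r) (p2*t+q2*r)+(k 1 3*(p1*t+q1*r)^3 + k 1 2*(p1*t+q1*r)^2*(p2*t+q2*r) + k 1 1*(p1*t+q1*r)*(p2*t+q2*r)^2 + k 1 0*(p2*t+q2*r)^3) * s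
  +(k 2 2*(p1*t+q1*r)^2 + k 2 1*(p1*t+q1*r)*(p2*t+q2*r) + k 2 0*(p2*t+q2*r)^2) * s^2+(k 3 1*(p1*t+q1*r) + k 3 0*(p2*t+q2*r)) * s^3 + k 4 0 * s^4" for s t r
  unfolding quart_expand[symmetric] by (rule qq)
 show thesis by (rule that[OF c' quartic_eq(3)[OF e] quartic_eq(2)[OF e]])
qed

lemma centred_no_line:
 assumes f: "totdeg f = 4" "irreducible f" and c: "centred f pt v w k a b c"
 shows "k 2 0 = 0 ==> k 1 0 = 0 ==> c \<noteq> 0" "k 2 2 = 0 ==> k 1 3 = 0 ==> a \<noteq> 0"
proof -
 have d: "det3 pt v w \<noteq> 0" and k: "coords4 f pt v w k"
  and Q: "\<And>s t r. quart k s t r = s^2*(k 2 2*t^2 + k 2 1*t*r + k 2 0*r^2)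
    + s*(k 1 3*t^3 + k 1 2*t^2*r + k 1 1*t*r^2 + k 1 0*r^3)+(a*t^2+b*t*r + c*r^2)^2"
  using c unfolding centred_def by auto
 have d': "det3 pt w v \<noteq> 0" using d det3_swap23[of pt v w] by simp
 have cs: "comb pt w v (s, t, 0) = comb pt v w (s, 0, t)" for s t by (cases pt; cases v; cases w) (simp add: comb_simps)
 show "c \<noteq> 0" if "k 2 0 = 0" "k 1 0 = 0"
 proof
  assume "c = 0"
  then have "homog 4 f (comb pt w v (s, t, 0)) = 0" for s t
   using k that unfolding cs coords4_def by (simp add: Q)
  then show False using irreducible_contains_no_line[OF f d'] by blast
 qed
 show "a \<noteq> 0" if "k 2 2 = 0" "k 1 3 = 0"
 proof
  assume "a = 0"
  then have "homog 4 f (comb pt v w (s, t, 0)) = 0" for s t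
   using k that unfolding coords4_def by (simp add: Q)
  then show False using irreducible_contains_no_line[OF f d] by blast
 qed
qed

text \<open>With tangent cone t^2 the exclusions of A1, A2, A3 and A4 kill \<open>k 2 0\<close>,
  then the r^3 term, then make A1 = 2c or -2c, then kill \<open>\<beta>\<close>. The result is (s t
  + h)^2 + \<open>\<alpha>\<close> s t^3 with h a square root of the form at infinity, and s is a
  multiple of Z.\<close>

lemma double_point_visible:
 assumes f: "totdeg f = 4" "irreducible f" and c: "centred f pt v w k a b c" and fin: "zcoord pt \<noteq> 0"
  and k22: "k 2 2 = 1" "k 2 1 = 0" and s: "sing_pt (homog 4 f) pt" and T: "has_type (homog 4 f) pt T"
  and ex: "\<And>n. n \<in> {1, 2, 3, 4} ==> \<not> top_equiv_germ (germ_A n) T"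
 shows "\<exists>q l. visible_dec f q l"
proof -
 have d: "det3 pt v w \<noteq> 0" and z: "zcoord v = 0" "zcoord w = 0" and k: "coords4 f pt v w k"
  and Q0: "\<And>s t r. quart k s t r = s^2*(k 2 2*t^2 + k 2 1*t*r + k 2 0*r^2)
    + s*(k 1 3*t^3 + k 1 2*t^2*r + k 1 1*t*r^2 + k 1 0*r^3)+(a*t^2+b*t*r + c*r^2)^2"
  using c unfolding centred_def by auto
 have xc: "\<not> top_equiv_germ {z. quart k 1 (fst z) (snd z) = 0} (germ_A n)" if "n \<in> {1, 2, 3, 4}" for n
  by (rule coords4_excluded[OF d k T ex[OF that]])
 have k20: "k 2 0 = 0"
  using coeffs_node[OF coords4_sing[OF k s]] xc[of 1] k22 by force
 define A3 A2 A1 A0 where "A3 = k 1 3" and "A2 = k 1 2" and "A1 = k 1 1" and "A0 = k 1 0"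
 have Q: "quart k s t r = s^2*t^2 + s*(A3*t^3+A2*t^2*r+A1*t*r^2+A0*r^3)+(a*t^2+b*t*r + c*r^2)^2" for s t r
  unfolding Q0 k22 k20 A3_def A2_def A1_def A0_def by simp
 have A0: "A0 = 0"
 proof (rule ccontr)
  assume "A0 \<noteq> 0"
  then have "top_equiv_germ {z. quart k 1 (fst z) (snd z) = 0} (germ_A (3 - 1))"
   by (intro germ_A_criterion_simple[where A = "%z. 1+A3*fst z+A2 * snd z+a^2*fst z^2+2*a*b*fst z * snd z+(b^2+2*a * c) * snd z^2" and
      B = "%z. A1+2*b * c * snd z" and C = "%z. A0 + c^2 * snd z" and k = 2])
    (auto intro!: sd_intros simp: Q algebra_simps power2_eq_square power3_eq_cube power4_eq_xxxx)
  then show False using xc[of 2] by simp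
 qed
 have A1: "4 * c^2 = A1^2"
 proof (rule ccontr)
  assume "4 * c^2 \<noteq> A1^2"
  then have "top_equiv_germ {z. quart k 1 (fst z) (snd z) = 0} (germ_A (4 - 1))"
   by (intro germ_A_criterion_simple[where A = "%z. 1+A3*fst z+A2 * snd z+a^2*fst z^2+2*a*b*fst z * snd z+(b^2+2*a * c) * snd z^2" and
      B = "%z. A1+2*b * c * snd z" and C = "%z. c^2" and k = 2])
    (auto intro!: sd_intros simp: Q A0 algebra_simps power2_eq_square power3_eq_cube power4_eq_xxxx)
  then show False using xc[of 3] by simp
 qed
 have c0: "c \<noteq> 0" using centred_no_line(1)[OF f c k20] A0 unfolding A0_def by simp
 have "(2 * c)^2 = A1^2" using A1 by (simp add: power_mult_distrib)
 then have "A1 = 2 * c \<or> A1 = 2*(- c)" unfolding power2_eq_iff by auto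
 \<comment> \<open>The form at infinity is known only through its square; this sign selects the root
   whose r^2 coefficient makes 2 s t r^2 complete the square.\<close>
 then obtain \<sigma> where \<sigma>: "\<sigma>^2 = 1" "A1 = 2*(\<sigma> * c)"
 proof (elim disjE)
  assume "A1 = 2 * c" then show thesis using that[of 1] by simp
 next
  assume "A1 = 2*(- c)" then show thesis using that[of "- 1"] by simp
 qed
 define h20 h11 h02 where "h20 = \<sigma>*a" and "h11 = \<sigma>*b" and "h02 = \<sigma> * c"
 have hs: "(a*t^2+b*t*r + c*r^2)^2 = (h20*t^2+h11*t*r+h02*r^2)^2" for t r
  unfolding h20_def h11_def h02_def using \<sigma>(1) by algebra
 have h0: "h02 \<noteq> 0" using c0 \<sigma>(1) unfolding h02_def by auto
 define \<alpha> \<beta> where "\<alpha> = A3 - 2*h20" and "\<beta> = A2 - 2*h11"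
 have A: "A3 = \<alpha>+2*h20" "A2 = \<beta>+2*h11" "A1 = 2*h02" unfolding \<alpha>_def \<beta>_def h02_def using \<sigma> by simp_all
 have Q1: "quart k s t r = (s*t+(h20*t^2+h11*t*r+h02*r^2))^2 + s*t^2*(\<alpha>*t+\<beta>*r)" for s t r
  unfolding Q hs A0 A by (simp add: algebra_simps power2_eq_square power3_eq_cube)
 \<comment> \<open>Take V = x + h(x, y) as first coordinate and solve for x, which to leading order
   is V - h02 y^2. The term \<open>\<beta>\<close> x^2 y then contributes \<open>\<beta>\<close>
   h02^2 y^5, so a nonzero \<open>\<beta>\<close> would give A4.\<close>
 have \<beta>: "\<beta> = 0"
 proof (rule ccontr)
  assume b0: "\<beta> \<noteq> 0"
  define e where "e = (%z :: complex \<times> complex. h11 * snd z+h20*fst z)"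
  define \<rho> where "\<rho> = (%z. 1/(1+e z))"
  define E where "E = (%z. \<rho> z*e z)"
  define G where "G = (%z. \<beta> - \<alpha>*\<rho> z*h02 * snd z)"
  define K where "K = (%z. \<alpha>*(1 - E z))"
  define W where "W = (%z. fst z*(1+e z) + snd z*(h02 * snd z))"
  have e0: "e 0 = 0" unfolding e_def by simp
  have se: "sd e" unfolding e_def by (intro sd_intros)
  have sr: "sd \<rho>" unfolding \<rho>_def by (intro sd_intros se) (simp add: e0)
  have sE: "sd E" unfolding E_def by (intro sd_intros sr se)
  have sG: "sd G" "sd K" unfolding G_def K_def by (intro sd_intros sr sE)+
  have sW: "sd W" unfolding W_def by (intro sd_intros se)
  have v0: "\<rho> 0 = 1" "E 0 = 0" "G 0 = \<beta>" "W 0 = 0" unfolding \<rho>_def E_def G_def W_def e0 by simp_all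
  have "top_equiv_germ {z. quart k 1 (fst z) (snd z) = 0} (germ_A (5 - 1))"
  proof (rule germ_A_criterion[where
    A = "%z. 1+(1 - E z)^2*(snd z*G z+K z*W z) - 2*(1 - E z)*(\<rho> z*h02 * snd z^2)*K z" and
    B = "%z. - 2*(1 - E z)*\<rho> z*h02*G z+\<rho> z^2*h02^2 * snd z*K z" and
    C = "%z. \<rho> z^2*h02^2*G z" and a = "%z. 1+e z" and b = "%z. h02 * snd z" and N = "{z. 1+e z \<noteq> 0}" and k = 3])
   show "open {z. 1+e z \<noteq> 0}" unfolding e_def by (intro open_Collect_neq continuous_intros)
   fix z assume "z \<in> {z. 1+e z \<noteq> 0}"
   then have r: "\<rho> z*(1+e z) = 1" unfolding \<rho>_def by simp
   define x y j i where "x = fst z" and "y = snd z" and "j = \<rho> z" and "i = e z"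
   have i: "i = h11*y+h20*x" unfolding i_def e_def x_def y_def ..
   have r': "j*(1+i) = 1" using r unfolding j_def i_def .
   define V where "V = x*(1+i)+y*(h02*y)"
   have xV: "x = (1 - j*i)*V - j*h02*y^2" using r' unfolding V_def by algebra
   have lam: "\<alpha>*x+\<beta>*y = y*(\<beta> - \<alpha>*j*h02*y)+\<alpha>*(1 - j*i)*V" unfolding xV by algebra
   have "quart k 1 x y = (x+(h20*x^2+h11*x*y+h02*y^2))^2+x^2*(\<alpha>*x+\<beta>*y)" unfolding Q1 by simp
   also have "\<dots> = V^2+x^2*(\<alpha>*x+\<beta>*y)" unfolding V_def i by algebra
   also have "\<dots> = V^2+((1 - j*i)*V - j*h02*y^2)^2*(y*(\<beta> - \<alpha>*j*h02*y)+\<alpha>*(1 - j*i)*V)"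
    unfolding lam using xV by simp
   also have "\<dots> = (1+(1 - j*i)^2*(y*(\<beta> - \<alpha>*j*h02*y)+\<alpha>*(1 - j*i)*V) - 2*(1 - j*i)*(j*h02*y^2)*(\<alpha>*(1 - j*i)))*V^2
    +(- 2*(1 - j*i)*j*h02*(\<beta> - \<alpha>*j*h02*y)+j^2*h02^2*y*(\<alpha>*(1 - j*i)))*y^3*V+j^2*h02^2*(\<beta> - \<alpha>*j*h02*y)*y^5"
    by algebra
   finally show "quart k 1 (fst z) (snd z) = (1+(1 - E z)^2*(snd z*G z+K z*W z) - 2*(1 - E z)*(\<rho> z*h02 * snd z^2)*K z)*(fst z*(1+e z) + snd z*(h02 * snd z))^2
    +(- 2*(1 - E z)*\<rho> z*h02*G z+\<rho> z^2*h02^2 * snd z*K z) * snd z^3*(fst z*(1+e z) + snd z*(h02 * snd z))+\<rho> z^2*h02^2*G z * snd z^5"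
    unfolding G_def K_def E_def W_def V_def x_def y_def j_def i_def .
  qed (use b0 h0 v0 e0 in \<open>auto intro!: sd_intros se sr sE sG sW\<close>)
  then show False using xc[of 4] by simp
 qed
 have "quart k s t r = 1*(0 * s^2+1 * s*t+h20*t^2+0 * s*r+h11*t*r+h02*r^2)^2
   +\<alpha>/zcoord pt*(0 * s+1*t+0*r)^3*(zcoord pt * s+zcoord v * t+zcoord w*r)" for s t r
  unfolding Q1 \<beta> z using fin by (simp add: algebra_simps power2_eq_square power3_eq_cube)
 from visible_from_coords[OF f(1) d k this] show ?thesis by metis
qed

lemma complex_poly_root:
 assumes "degree (p :: complex poly) \<noteq> 0" obtains x where "poly p x = 0"
proof -
 have "\<not> constant (poly p)" using assms by (simp add: constant_degree)
 then show thesis using that fundamental_theorem_of_algebra by blast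
qed

text \<open>If the cubic tangent cone is a cube, the equation is already a visible decomposition.
  Otherwise it has a simple root together with another root; moving both to the coordinate axes
  gives the shape of \<open>linked_branch_triple_point\<close>, which is excluded.\<close>

lemma triple_point_visible:
 assumes f: "totdeg f = 4" "irreducible f" and c: "centred f pt v w k a b c" and fin: "zcoord pt \<noteq> 0"
  and k2: "k 2 2 = 0" "k 2 1 = 0" "k 2 0 = 0" and s: "sing_pt (homog 4 f) pt" and T: "has_type (homog 4 f) pt T"
  and tri: "\<And>j V. j \<in> {1, 2} ==> linked_branch j V ==> \<not> top_equiv_germ V T"
 shows "\<exists>q l. visible_dec f q l"
proof -
 have cube: "\<exists>q l. visible_dec f q l" if c: "centred f pt v w k a b c"
  and k: "k 2 2 = 0" "k 2 1 = 0" "k 2 0 = 0" "k 1 2 = 0" "k 1 1 = 0" "k 1 0 = 0" for v w k a b c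
 proof -
  have d: "det3 pt v w \<noteq> 0" and z: "zcoord v = 0" "zcoord w = 0" and k4: "coords4 f pt v w k"
   and Q: "\<And>s t r. quart k s t r = s*(k 1 3*t^3)+(a*t^2+b*t*r + c*r^2)^2"
   using c unfolding centred_def k by auto
  have "quart k s t r = 1*(0 * s^2+0 * s*t+a*t^2+0 * s*r+b*t*r + c*r^2)^2
   + k 1 3/zcoord pt*(0 * s+1*t+0*r)^3*(zcoord pt * s+zcoord v * t+zcoord w*r)" for s t r
   unfolding Q z using fin by simp
  from visible_from_coords[OF f(1) d k4 this] show ?thesis by metis
 qed
 \<comment> \<open>The cone is t r (\<open>k 1 2\<close> t + \<open>k 1 1\<close> r) with r = 0 a
   simple root. The outer coefficients of the form at infinity are nonzero, since otherwise an axis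
   through the point would be a component.\<close>
 have distinct: False if c: "centred f pt v w k a b c"
  and k: "k 2 2 = 0" "k 2 1 = 0" "k 2 0 = 0" "k 1 3 = 0" "k 1 0 = 0" "k 1 2 \<noteq> 0" for v w k a b c
 proof -
  have d: "det3 pt v w \<noteq> 0" and k4: "coords4 f pt v w k"
   and Q: "\<And>s t r. quart k s t r = s*(k 1 2*t^2*r + k 1 1*t*r^2)+(a*t^2+b*t*r + c*r^2)^2"
   using c unfolding centred_def k by auto
  have ac: "a \<noteq> 0" "c \<noteq> 0" using centred_no_line[OF f c] k by auto
  have "{z. quart k 1 (fst z) (snd z) = 0} = {z. fst z * snd z*(k 1 2*fst z + k 1 1 * snd z)+(a*fst z^2+b*fst z * snd z + c * snd z^2)^2 = 0}"
   unfolding Q by (simp add: algebra_simps power2_eq_square)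
  then obtain j where "j \<in> {1, 2}" "linked_branch j {z. quart k 1 (fst z) (snd z) = 0}"
   using linked_branch_triple_point[OF k(6) ac, of "k 1 1" b] by metis
  then show False using tri coords4_type[OF d k4 T] by blast
 qed
 have quad0: "x = 0 \<and> y = 0 \<and> z = 0" if "\<And>t r. x*t^2+y*t*r+z*r^2 = 0" for x y z :: complex
  using that[of 1 0] that[of 0 1] that[of 1 1] by auto
 \<comment> \<open>A root of the binary cubic; making it the second basis vector kills the
   coefficient of r^3. A second root is later moved to the first basis vector.\<close>
 have "\<exists>q1 q2. (q1 \<noteq> 0 \<or> q2 \<noteq> 0) \<and> k 1 3*q1^3 + k 1 2*q1^2*q2 + k 1 1*q1*q2^2 + k 1 0*q2^3 = 0"
 proof (cases "k 1 0 = 0")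
  case True then show ?thesis by (intro exI[of _ 0] exI[of _ 1]) simp
 next
  case False
  then obtain y where "poly [:k 1 3, k 1 2, k 1 1, k 1 0:] y = 0"
   using complex_poly_root[of "[:k 1 3, k 1 2, k 1 1, k 1 0:]"] by auto
  then show ?thesis by (intro exI[of _ 1] exI[of _ y]) (simp add: algebra_simps power2_eq_square power3_eq_cube)
 qed
 then obtain q1 q2 where q: "q1 \<noteq> 0 \<or> q2 \<noteq> 0" "k 1 3*q1^3 + k 1 2*q1^2*q2 + k 1 1*q1*q2^2 + k 1 0*q2^3 = 0" by blast
 obtain p1 p2 where p: "p1*q2 - p2*q1 \<noteq> 0"
 proof (cases "q1 = 0")
  case True then show thesis using that[of 1 0] q by simp
 next
  case False then show thesis using that[of 0 1] by simp
 qed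
 obtain v1 w1 k1 a1 b1 c1 where c1: "centred f pt v1 w1 k1 a1 b1 c1"
  and e2: "\<And>t r. k1 2 2*t^2 + k1 2 1*t*r + k1 2 0*r^2 =
    k 2 2*(p1*t+q1*r)^2 + k 2 1*(p1*t+q1*r)*(p2*t+q2*r) + k 2 0*(p2*t+q2*r)^2"
  and e3: "\<And>t r. k1 1 3*t^3 + k1 1 2*t^2*r + k1 1 1*t*r^2 + k1 1 0*r^3 =
    k 1 3*(p1*t+q1*r)^3 + k 1 2*(p1*t+q1*r)^2*(p2*t+q2*r) + k 1 1*(p1*t+q1*r)*(p2*t+q2*r)^2 + k 1 0*(p2*t+q2*r)^3"
  using centred_change[OF f(1) s c p] by metis
 have z1: "k1 2 2 = 0" "k1 2 1 = 0" "k1 2 0 = 0" using quad0[of "k1 2 2" "k1 2 1" "k1 2 0"] e2 k2 by auto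
 have z10: "k1 1 0 = 0" using e3[of 0 1] q by simp
 show ?thesis
 proof (cases "k1 1 2 = 0 \<and> k1 1 1 = 0")
  case True then show ?thesis using cube[OF c1 z1] z10 by blast
 next
  case False
  then have "degree [:k1 1 3, k1 1 2, k1 1 1:] \<noteq> 0" by auto
  then obtain \<tau> where "poly [:k1 1 3, k1 1 2, k1 1 1:] \<tau> = 0" using complex_poly_root by blast
  then have tau: "k1 1 3 + k1 1 2*\<tau> + k1 1 1*\<tau>^2 = 0" by (simp add: algebra_simps power2_eq_square)
  have D: "1*1 - \<tau>*0 \<noteq> 0" by simp
  obtain v2 w2 k2 a2 b2 c2 where c2: "centred f pt v2 w2 k2 a2 b2 c2"
   and f2: "\<And>t r. k2 2 2*t^2 + k2 2 1*t*r + k2 2 0*r^2 =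
     k1 2 2*(1*t+0*r)^2 + k1 2 1*(1*t+0*r)*(\<tau>*t+1*r) + k1 2 0*(\<tau>*t+1*r)^2"
   and f3: "\<And>t r. k2 1 3*t^3 + k2 1 2*t^2*r + k2 1 1*t*r^2 + k2 1 0*r^3 =
     k1 1 3*(1*t+0*r)^3 + k1 1 2*(1*t+0*r)^2*(\<tau>*t+1*r) + k1 1 1*(1*t+0*r)*(\<tau>*t+1*r)^2 + k1 1 0*(\<tau>*t+1*r)^3"
   using centred_change[OF f(1) s c1 D] by metis
  have y: "k2 2 2 = 0" "k2 2 1 = 0" "k2 2 0 = 0" using quad0[of "k2 2 2" "k2 2 1" "k2 2 0"] f2 z1 by auto
  define x0 x1 x2 where "x0 = k1 1 3" and "x1 = k1 1 2" and "x2 = k1 1 1"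
  have y3: "k2 1 3 = 0" "k2 1 0 = 0" using f3[of 1 0] f3[of 0 1] tau z10 by (simp_all add: algebra_simps)
  have g1: "k2 1 2 + k2 1 1 = x0+x1*(\<tau>+1)+x2*(\<tau>+1)^2" using f3[of 1 1] y3 z10 unfolding x0_def x1_def x2_def by simp
  have g2: "- k2 1 2 + k2 1 1 = x0+x1*(\<tau> - 1)+x2*(\<tau> - 1)^2" using f3[of 1 "- 1"] y3 z10 unfolding x0_def x1_def x2_def by simp
  have tau': "x0+x1*\<tau>+x2*\<tau>^2 = 0" using tau unfolding x0_def x1_def x2_def .
  define y1 y2 where "y1 = k2 1 2" and "y2 = k2 1 1"
  have two: "2*a = 2*b ==> a = b" for a b :: complex by simp
  have G: "2*y2 = 2*x2" "2*y1 = 2*(x1+2*x2*\<tau>)"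
   using g1 g2 tau' unfolding y1_def[symmetric] y2_def[symmetric] by algebra+
  have y12: "y2 = x2" "y1 = x1+2*x2*\<tau>" by (rule two, rule G)+
  have False
  proof (cases "y1 = 0")
   case False then show False using distinct[OF c2 y y3] unfolding y1_def by blast
  next
   \<comment> \<open>Now r = 0 is a double root, so t = 0 is the simple one; exchanging the basis
     vectors puts it in the required place.\<close>
   case True
   have x2: "y2 \<noteq> 0" using y12 True \<open>\<not> (k1 1 2 = 0 \<and> k1 1 1 = 0)\<close> unfolding x1_def x2_def by auto
   have D: "0*0 - 1*1 \<noteq> (0 :: complex)" by simp
   obtain v3 w3 k3 a3 b3 c3 where c3: "centred f pt v3 w3 k3 a3 b3 c3"
    and h2: "\<And>t r. k3 2 2*t^2 + k3 2 1*t*r + k3 2 0*r^2 =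
      k2 2 2*(0*t+1*r)^2 + k2 2 1*(0*t+1*r)*(1*t+0*r) + k2 2 0*(1*t+0*r)^2"
    and h3: "\<And>t r. k3 1 3*t^3 + k3 1 2*t^2*r + k3 1 1*t*r^2 + k3 1 0*r^3 =
      k2 1 3*(0*t+1*r)^3 + k2 1 2*(0*t+1*r)^2*(1*t+0*r) + k2 1 1*(0*t+1*r)*(1*t+0*r)^2 + k2 1 0*(1*t+0*r)^3"
    using centred_change[OF f(1) s c2 D] by metis
   have u: "k3 2 2 = 0" "k3 2 1 = 0" "k3 2 0 = 0" using quad0[of "k3 2 2" "k3 2 1" "k3 2 0"] h2 y by auto
   have u3: "k3 1 3 = 0" "k3 1 0 = 0" using h3[of 1 0] h3[of 0 1] y3 by simp_all
   define n1 n2 where "n1 = k3 1 2" and "n2 = k3 1 1"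
   have N: "n1+n2 = y2" "- n1+n2 = - y2"
    using h3[of 1 1] h3[of 1 "- 1"] u3 y3 True unfolding y1_def y2_def n1_def n2_def by simp_all
   have "2*n1 = (n1+n2) - (- n1+n2)" by simp
   also have "\<dots> = 2*y2" unfolding N by simp
   finally have "k3 1 2 = y2" unfolding n1_def by simp
   then show False using distinct[OF c3 u u3] x2 by simp
  qed
  then show ?thesis ..
 qed
qed

text \<open>A nonzero binary quadratic form over the complex numbers represents 1 and can be
  diagonalised, which brings the tangent cone of a double point to t^2 + \<open>k 2 0\<close>
  r^2.\<close>

lemma single_point_visible:
 assumes f: "totdeg f = 4" "irreducible f" and sq: "inf_square f" and fin: "zcoord pt \<noteq> 0"
  and s: "sing_pt (homog 4 f) pt" and T: "has_type (homog 4 f) pt T"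
  and ex: "\<And>n. n \<in> {1, 2, 3, 4} ==> \<not> top_equiv_germ (germ_A n) T"
  and tri: "\<And>j V. j \<in> {1, 2} ==> linked_branch j V ==> \<not> top_equiv_germ V T"
 shows "\<exists>q l. visible_dec f q l"
proof -
 obtain v w k a b c where c: "centred f pt v w k a b c" using centred_ex[OF f(1) s fin sq] .
 show ?thesis
 proof (cases "k 2 2 = 0 \<and> k 2 1 = 0 \<and> k 2 0 = 0")
  case True show ?thesis by (rule triple_point_visible[OF f c fin _ _ _ s T]) (use True tri in blast)+
 next
  case False
  define A B C where "A = k 2 2" and "B = k 2 1" and "C = k 2 0"
  obtain x y where xy: "A*x^2+B*x*y+C*y^2 \<noteq> 0"
  proof (cases "A = 0 \<and> C = 0")
   case True then show thesis using that[of 1 1] False unfolding A_def B_def C_def by simp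
  next
   case False then show thesis using that[of 1 0] that[of 0 1] by auto
  qed
  obtain \<rho> where "\<rho>^Suc 1 = A*x^2+B*x*y+C*y^2" by (rule complex_root)
  then have r: "\<rho>^2 = A*x^2+B*x*y+C*y^2" by (simp add: power2_eq_square)
  then have r0: "\<rho> \<noteq> 0" using xy by auto
  define p1 p2 where "p1 = x/\<rho>" and "p2 = y/\<rho>"
  have x: "x = \<rho>*p1" "y = \<rho>*p2" unfolding p1_def p2_def using r0 by simp_all
  have "\<rho>^2*(A*p1^2+B*p1*p2+C*p2^2) = \<rho>^2*1" using r x by algebra
  then have p: "A*p1^2+B*p1*p2+C*p2^2 = 1" using r0 by simp
  obtain y1 y2 where y: "p1*y2 - p2*y1 \<noteq> 0"
  proof (cases "p1 = 0")
   case True then have "p2 \<noteq> 0" using p by auto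
   then show thesis using that[of 0 1] True by simp
  next
   case False then show thesis using that[of 1 0] by simp
  qed
  \<comment> \<open>The polar pairing of the unit vector p with y; subtracting half of it times p
    makes the new basis vector orthogonal to p and kills the mixed coefficient.\<close>
  define \<beta> where "\<beta> = 2*A*p1*y1+B*(p1*y2+p2*y1)+2*C*p2*y2"
  define \<eta> where "\<eta> = \<beta>/2"
  have eta: "\<beta> = 2*\<eta>" unfolding \<eta>_def by simp
  define q1 q2 where "q1 = y1 - \<eta>*p1" and "q2 = y2 - \<eta>*p2"
  have D: "p1*q2 - p2*q1 \<noteq> 0" using y unfolding q1_def q2_def by (simp add: algebra_simps)
  obtain v1 w1 k1 a1 b1 c1 where c1: "centred f pt v1 w1 k1 a1 b1 c1"
   and e2: "\<And>t r. k1 2 2*t^2 + k1 2 1*t*r + k1 2 0*r^2 =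
     k 2 2*(p1*t+q1*r)^2 + k 2 1*(p1*t+q1*r)*(p2*t+q2*r) + k 2 0*(p2*t+q2*r)^2"
   using centred_change[OF f(1) s c D] by metis
  note e2 = e2[folded A_def B_def C_def]
  have k22: "k1 2 2 = 1" using e2[of 1 0] p by simp
  have k20: "k1 2 0 = A*q1^2+B*q1*q2+C*q2^2" using e2[of 0 1] by simp
  have "1 + k1 2 1 + k1 2 0 = A*(p1+q1)^2+B*(p1+q1)*(p2+q2)+C*(p2+q2)^2" using e2[of 1 1] k22 by simp
  then have "k1 2 1 = (A*(p1+q1)^2+B*(p1+q1)*(p2+q2)+C*(p2+q2)^2) - (A*q1^2+B*q1*q2+C*q2^2) - 1"
   unfolding k20 by (simp add: algebra_simps)
  also have "\<dots> = 0" using p eta unfolding \<beta>_def q1_def q2_def by algebra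
  finally have k21: "k1 2 1 = 0" .
  show ?thesis by (rule double_point_visible[OF f c1 fin k22 k21 s T ex])
 qed
qed

text \<open>The pairs of cusps (0, 1) and (0, 2) give visible decompositions whose lines join the
  respective cusps. Were they equivalent, the third cusp would lie on the line of the first pair,
  which meets the quartic only in that pair.\<close>

lemma cusp_triple_tri_form:
 assumes f: "totdeg f = 4" "irreducible f" and sq: "inf_square f"
  and sp: "sing_pts f [(germ_A 2, False), (germ_A 2, False), (germ_A 2, False)] vs"
 obtains q l \<kappa> l' where "tri_form f q l \<kappa> l'"
proof -
 have s: "sing_pt (homog 4 f) (vs ! i)" "has_type (homog 4 f) (vs ! i) (germ_A 2)" "zcoord (vs ! i) \<noteq> 0" if "i < 3" for i
  using sing_ptsD(1-3)[OF sp, of i] that by (auto simp: less_Suc_eq numeral_3_eq_3)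
 have np: "\<not> proj_same (vs ! i) (vs ! j)" if "i < 3" "j < 3" "i \<noteq> j" for i j
  using sing_ptsD(4)[OF sp, of i j] that by simp
 have i: "0 < (3 :: nat)" "1 < (3 :: nat)" "2 < (3 :: nat)" "0 \<noteq> (2 :: nat)" "0 \<noteq> (1 :: nat)" by simp_all
 define c where "c = (%i. 1/zcoord (vs ! i))"
 have aff: "\<exists>x y. smul3 (c i) (vs ! i) = (x, y, 1)" if "i < 3" for i
  using s(3)[OF that] unfolding c_def by (cases "vs ! i") (simp add: smul3_simps zcoord_def)
 obtain q l where v: "visible_dec f q l" and z: "\<And>x y c. smul3 c (vs ! 0) = (x, y, 1) \<or> smul3 c (vs ! 1) = (x, y, 1) ==> eval2 l x y = 0"
  and nz: "\<And>x y. homog 4 f (x, y, 1) = 0 ==> eval2 l x y = 0 ==> \<exists>c. (x, y, 1) = smul3 c (vs ! 0) \<or> (x, y, 1) = smul3 c (vs ! 1)"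
  using cusp_pair_visible[OF f sq s(1)[OF i(1)] s(1)[OF i(2)] np[OF i(1,2) i(5)] s(3)[OF i(1)] s(3)[OF i(2)] s(2)[OF i(1)] s(2)[OF i(2)]] by metis
 obtain q' l' where v': "visible_dec f q' l'" and z': "\<And>x y c. smul3 c (vs ! 0) = (x, y, 1) \<or> smul3 c (vs ! 2) = (x, y, 1) ==> eval2 l' x y = 0"
  using cusp_pair_visible[OF f sq s(1)[OF i(1)] s(1)[OF i(3)] np[OF i(1,3) i(4)] s(3)[OF i(1)] s(3)[OF i(3)] s(2)[OF i(1)] s(2)[OF i(3)]] by metis
 have "\<not> (\<exists>\<omega>. \<omega>^3 = 1 \<and> l' = cpoly2 \<omega>*l \<and> (q' = q \<or> q' = - q))"
 proof
  assume "\<exists>\<omega>. \<omega>^3 = 1 \<and> l' = cpoly2 \<omega>*l \<and> (q' = q \<or> q' = - q)"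
  then obtain \<omega> where w: "\<omega>^3 = 1" "l' = cpoly2 \<omega>*l" by blast
  obtain x y where xy: "smul3 (c 2) (vs ! 2) = (x, y, 1)" using aff[of 2] by auto
  have "\<omega>*eval2 l x y = 0" using z'[of "c 2" x y] xy w by (simp add: eval2_simps)
  then have l0: "eval2 l x y = 0" using w(1) by auto
  have "homog 4 f (vs ! 2) = 0" using s(1)[of 2] unfolding sing_pt_def on_curve_def by simp
  then have "homog 4 f (x, y, 1) = 0" unfolding xy[symmetric] homog4_hom by simp
  then obtain d where d: "(x, y, 1) = smul3 d (vs ! 0) \<or> (x, y, 1) = smul3 d (vs ! 1)" using nz l0 by blast
  have ps: "proj_same (vs ! i) (vs ! 2)" if "(x, y, 1) = smul3 d (vs ! i)" for i
  proof -
   have c2: "c 2 \<noteq> 0" using s(3)[of 2] unfolding c_def by simp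
   have d0: "d \<noteq> 0" using that by (cases "vs ! i") (auto simp: smul3_simps)
   have "vs ! 2 = smul3 (d / c 2) (vs ! i)" using that[unfolded xy[symmetric]] c2
    by (cases "vs ! i"; cases "vs ! 2") (auto simp: smul3_simps field_simps)
   then show ?thesis unfolding proj_same_def using c2 d0 by (metis divide_eq_0_iff)
  qed
  show False using d ps[of 0] ps[of 1] np[of 0 2] np[of 1 2] by auto
 qed
 then show thesis using visible_dec_compare[OF f v v'] that by blast
qed

section \<open>Positions at infinity and assembly of the thirteen types\<close>

lemma pos_i_square: "totdeg f = 4 ==> irreducible f ==> pos_i f ==> inf_square f"
proof -
 assume f: "totdeg f = 4" "irreducible f" and "pos_i f"
 then obtain v w where a: "on_linf f v" "on_linf f w" "\<not> proj_same v w" "imult_inf f v = 2" "imult_inf f w = 2"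
  unfolding pos_i_def Let_def by auto
 have "2 \<le> imult_inf f v" "2 \<le> imult_inf f w \<or> sing_pt (homog 4 f) w" using a by auto
 from pos_inf_bitangent[OF f a(1-3) this] show ?thesis using inf_bitangent_square by metis
qed

lemma pos_iv_square: "totdeg f = 4 ==> irreducible f ==> pos_iv f ==> inf_square f"
proof -
 assume f: "totdeg f = 4" "irreducible f" and "pos_iv f"
 then obtain v where "on_linf f v" "imult_inf f v = 4" unfolding pos_iv_def Let_def by auto
 then show ?thesis using pos_inf_flex[OF f, of v] inf_flex_square by metis
qed

lemma pos_iiE:
 assumes f: "totdeg f = 4" "irreducible f" and p: "pos_ii f"
 obtains p u e where "inf_bitangent f p u e" "sing_pt (homog 4 f) u"
proof -
 obtain v w where "on_linf f v" "on_linf f w" "\<not> proj_same v w" "imult_inf f v \<ge> 2" "sing_pt (homog 4 f) w"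
  using p unfolding pos_ii_def Let_def by auto
 then show thesis using pos_inf_bitangent[OF f, of v w] that by blast
qed

lemma pos_vE:
 assumes f: "totdeg f = 4" "irreducible f" and p: "pos_v f"
 obtains u p e where "inf_flex f u p e" "sing_pt (homog 4 f) u"
proof -
 obtain v where "on_linf f v" "imult_inf f v = 4" "sing_pt (homog 4 f) v" using p unfolding pos_v_def Let_def by auto
 then show thesis using pos_inf_flex[OF f, of v] that by metis
qed

text \<open>The position hypothesis names a singular point at infinity on its own; this matches it
  with the entry of the list that carries the mark for infinity.\<close>

lemma type_at_infinity:
 assumes sp: "sing_pts f L vs" and u: "sing_pt (homog 4 f) u" "zcoord u = 0"
  and L: "\<And>j. j < length L ==> snd (L ! j) ==> fst (L ! j) = T"
 shows "has_type (homog 4 f) u T"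
proof -
 obtain j where j: "j < length L" "proj_same (vs ! j) u" using sing_ptsD(5)[OF sp u(1)] by blast
 then obtain c where c: "c \<noteq> 0" "u = smul3 c (vs ! j)" unfolding proj_same_def by blast
 have "zcoord (vs ! j) = 0" using u(2) c by (cases "vs ! j") (auto simp: smul3_simps zcoord_def)
 then have "fst (L ! j) = T" using sing_ptsD(3)[OF sp j(1)] L[OF j(1)] by blast
 then show ?thesis using has_type_smul3[OF homog4_hom sing_ptsD(2)[OF sp j(1)] c(1)] c(2) by simp
qed

text \<open>As A5 is \<open>germ_A\<close> (2*3 - 1), the number 3 would have to divide a linking
  number equal to 1 or 2; even indices fail by parity.\<close>

lemma A5_exclusions:
 "n \<in> {1, 2, 3, 4} ==> \<not> top_equiv_germ (germ_A n) (germ_A 5)"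
 "j \<in> {1, 2} ==> linked_branch j V ==> \<not> top_equiv_germ V (germ_A 5)"
proof -
 show "\<not> top_equiv_germ (germ_A n) (germ_A 5)" if "n \<in> {1, 2, 3, 4}"
  using that germ_A_odd_dvd[of 3 1] germ_A_odd_dvd[of 3 2] germ_A_parity[of 2 5] germ_A_parity[of 4 5] by auto
 show "\<not> top_equiv_germ V (germ_A 5)" if "j \<in> {1, 2}" "linked_branch j V"
  using linked_branch_dvd[OF that(2), of 3] that(1) by auto
qed

lemma E6_exclusions:
 "n \<in> {1, 2, 3, 4} ==> \<not> top_equiv_germ (germ_A n) germ_E6"
 "linked_branch j V ==> \<not> top_equiv_germ V germ_E6"
proof -
 show "n \<in> {1, 2, 3, 4} ==> \<not> top_equiv_germ (germ_A n) germ_E6" using germ_A_not_equiv_E6[of n] by auto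
 show "linked_branch j V ==> \<not> top_equiv_germ V germ_E6"
  using unibranch_not_equiv_linked_branch[OF unibranch_germ_E6, of j V] top_equiv_germ_sym by blast
qed

lemma two_cusps_visible:
 assumes f: "totdeg f = 4" "irreducible f" and sq: "inf_square f" and sp: "sing_pts f L vs"
  and L: "2 \<le> length L" "L ! 0 = (germ_A 2, False)" "L ! 1 = (germ_A 2, False)"
 shows "\<exists>q l. visible_dec f q l"
proof -
 have 0: "0 < length L" "1 < length L" using L by auto
 have s: "sing_pt (homog 4 f) (vs ! 0)" "sing_pt (homog 4 f) (vs ! 1)" "has_type (homog 4 f) (vs ! 0) (germ_A 2)"
  "has_type (homog 4 f) (vs ! 1) (germ_A 2)" "zcoord (vs ! 0) \<noteq> 0" "zcoord (vs ! 1) \<noteq> 0" "\<not> proj_same (vs ! 0) (vs ! 1)"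
  using sing_ptsD(1-3)[OF sp 0(1)] sing_ptsD(1-3)[OF sp 0(2)] sing_ptsD(4)[OF sp 0] L by auto
 show ?thesis using cusp_pair_visible[OF f sq s(1,2,7,5,6,3,4)] by metis
qed

lemma one_point_visible:
 assumes f: "totdeg f = 4" "irreducible f" and sq: "inf_square f" and sl: "sing_list f [(T, False)]"
  and T: "T = germ_A 5 \<or> T = germ_E6"
 shows "\<exists>q l. visible_dec f q l"
proof -
 obtain vs where sp: "sing_pts f [(T, False)] vs" using sl unfolding sing_list_iff ..
 have s: "sing_pt (homog 4 f) (vs ! 0)" "has_type (homog 4 f) (vs ! 0) T" "zcoord (vs ! 0) \<noteq> 0"
  using sing_ptsD(1-3)[OF sp, of 0] by auto
 show ?thesis by (rule single_point_visible[OF f sq s(3,1,2)]) (use T A5_exclusions E6_exclusions in blast)+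
qed

theorem theorem1:
  fixes f :: "complex poly poly" and k :: nat
  assumes "totdeg f = 4" and "irreducible f"
    and "k \<in> {1..13}" and "QL_config k f"
  shows "(k = 13 \<longrightarrow> torus_decs f = {}) \<and>
         (k = 5 \<longrightarrow> card (torus_decs f // dec_equiv) = 5 \<and>
                    card (visible_decs f // dec_equiv) = 3 \<and>
                    card (invisible_decs f // dec_equiv) = 2) \<and>
         (k \<notin> {5, 13} \<longrightarrow> card (torus_decs f // dec_equiv) = 1)"
proof -
 note f = assms(1,2) and Q = assms(4)
 have nc: "\<not> three_cusps f" if "sing_list f L" "length L \<le> 2 \<or> length L = 3 \<and> fst (L ! 2) = germ_A 1" for L
  using sing_list_three_cusps[OF that(1)] that(2) by auto
 have one: "card (torus_decs f // dec_equiv) = 1" if "\<exists>q l. visible_dec f q l" "\<not> three_cusps f"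
  using that dec_unique[OF f] by blast
 have inf13: "\<And>T T' vs u. sing_pts f [(T, b), (T', \<not> b)] vs ==> sing_pt (homog 4 f) u ==> zcoord u = 0 ==>
   has_type (homog 4 f) u (if b then T else T')" for b
  by (rule type_at_infinity) (auto simp: less_Suc_eq numeral_2_eq_2 split: if_splits)
 have "k = 13 ==> torus_decs f = {}"
 proof -
  assume "k = 13"
  then have sl: "sing_list f [(germ_A 4, False), (germ_A 2, True)]" and p: "pos_ii f" using Q by (auto simp: QL_config_def)
  obtain vs where sp: "sing_pts f [(germ_A 4, False), (germ_A 2, True)] vs" using sl unfolding sing_list_iff ..
  obtain p u e where b: "inf_bitangent f p u e" and u: "sing_pt (homog 4 f) u" using pos_iiE[OF f p] .
  have zu: "zcoord u = 0" using b unfolding inf_bitangent_def by blast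
  have t: "has_type (homog 4 f) u (germ_A 2)" using inf13[of "germ_A 4" False "germ_A 2" vs u] sp u zu by simp
  have v: "sing_pt (homog 4 f) (vs ! 0)" "zcoord (vs ! 0) \<noteq> 0" using sing_ptsD(1,3)[OF sp, of 0] by auto
  \<comment> \<open>No visible q is at hand here, so the square root at infinity needed against
    invisible decompositions is taken from the position (ii).\<close>
  obtain h where "totdeg h \<le> 2" "totdeg (f - h^2) \<le> 3" using inf_square_poly[OF f(1) inf_bitangent_square[OF b]] .
  then show "torus_decs f = {}" using no_decs[OF f no_visible_dec_at_cusp[OF f b u v t]] nc[OF sl] by simp
 qed
 moreover have "card (torus_decs f // dec_equiv) = 5 \<and> card (visible_decs f // dec_equiv) = 3 \<and> card (invisible_decs f // dec_equiv) = 2" if "k = 5"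
 proof -
  have sl: "sing_list f [(germ_A 2, False), (germ_A 2, False), (germ_A 2, False)]" and p: "pos_i f" using Q that by (auto simp: QL_config_def)
  obtain vs where "sing_pts f [(germ_A 2, False), (germ_A 2, False), (germ_A 2, False)] vs" using sl unfolding sing_list_iff ..
  then obtain q l \<kappa> l' where "tri_form f q l \<kappa> l'" using cusp_triple_tri_form[OF f pos_i_square[OF f p]] by blast
  then show ?thesis using tri_form_card[OF f] by blast
 qed
 moreover have "card (torus_decs f // dec_equiv) = 1" if "k \<notin> {5, 13}"
 proof -
  have sq: "pos_i f \<or> pos_iv f ==> inf_square f" using pos_i_square[OF f] pos_iv_square[OF f] by blast
  have "k \<in> {1, 2} \<or> k \<in> {3, 4} \<or> k \<in> {7, 8} \<or> k \<in> {11, 12} \<or> k = 6 \<or> k = 9 \<or> k = 10" using assms(3) that by (simp only: atLeastAtMost_iff insert_iff empty_iff) presburger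
  then show ?thesis
  proof (elim disjE)
   assume "k \<in> {1, 2}"
   then have sl: "sing_list f [(germ_A 2, False), (germ_A 2, False)]" and p: "pos_i f \<or> pos_iv f" using Q by (auto simp: QL_config_def)
   obtain vs where sp: "sing_pts f [(germ_A 2, False), (germ_A 2, False)] vs" using sl unfolding sing_list_iff ..
   show ?thesis by (rule one[OF two_cusps_visible[OF f sq[OF p] sp] nc[OF sl]]) auto
  next
   assume "k \<in> {3, 4}"
   then have sl: "sing_list f [(germ_A 2, False), (germ_A 2, False), (germ_A 1, False)]" and p: "pos_i f \<or> pos_iv f" using Q by (auto simp: QL_config_def)
   obtain vs where sp: "sing_pts f [(germ_A 2, False), (germ_A 2, False), (germ_A 1, False)] vs" using sl unfolding sing_list_iff ..
   show ?thesis by (rule one[OF two_cusps_visible[OF f sq[OF p] sp] nc[OF sl]]) auto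
  next
   assume "k \<in> {7, 8}"
   then have sl: "sing_list f [(germ_A 5, False)]" and p: "pos_i f \<or> pos_iv f" using Q by (auto simp: QL_config_def)
   show ?thesis by (rule one[OF one_point_visible[OF f sq[OF p] sl] nc[OF sl]]) auto
  next
   assume "k \<in> {11, 12}"
   then have sl: "sing_list f [(germ_E6, False)]" and p: "pos_i f \<or> pos_iv f" using Q by (auto simp: QL_config_def)
   show ?thesis by (rule one[OF one_point_visible[OF f sq[OF p] sl] nc[OF sl]]) auto
  next
   assume "k = 6"
   then have sl: "sing_list f [(germ_A 2, False), (germ_A 3, True)]" and p: "pos_ii f" using Q by (auto simp: QL_config_def)
   obtain vs where sp: "sing_pts f [(germ_A 2, False), (germ_A 3, True)] vs" using sl unfolding sing_list_iff ..
   obtain p u e where b: "inf_bitangent f p u e" and u: "sing_pt (homog 4 f) u" using pos_iiE[OF f p] .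
   have zu: "zcoord u = 0" using b unfolding inf_bitangent_def by blast
   have t: "has_type (homog 4 f) u (germ_A 3)" using inf13[of "germ_A 2" False "germ_A 3" vs u] sp u zu by simp
   have v: "sing_pt (homog 4 f) (vs ! 0)" "zcoord (vs ! 0) \<noteq> 0" "has_type (homog 4 f) (vs ! 0) (germ_A 2)"
    using sing_ptsD(1,3,2)[OF sp, of 0] by auto
   show ?thesis by (rule one[OF cusp_tacnode_visible[OF f b u v(1,2) t v(3)] nc[OF sl]]) auto
  next
   assume "k = 9"
   then have sl: "sing_list f [(germ_A 6, True)]" and p: "pos_ii f" using Q by (auto simp: QL_config_def)
   obtain vs where sp: "sing_pts f [(germ_A 6, True)] vs" using sl unfolding sing_list_iff ..
   obtain p u e where b: "inf_bitangent f p u e" and u: "sing_pt (homog 4 f) u" using pos_iiE[OF f p] .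
   have zu: "zcoord u = 0" using b unfolding inf_bitangent_def by blast
   have t: "has_type (homog 4 f) u (germ_A 6)" by (rule type_at_infinity[OF sp u zu]) auto
   show ?thesis by (rule one[OF A6_visible[OF f b u t] nc[OF sl]]) auto
  next
   assume "k = 10"
   then have sl: "sing_list f [(germ_A 4, True), (germ_A 2, False)]" and p: "pos_v f" using Q by (auto simp: QL_config_def)
   obtain vs where sp: "sing_pts f [(germ_A 4, True), (germ_A 2, False)] vs" using sl unfolding sing_list_iff ..
   obtain u p e where b: "inf_flex f u p e" and u: "sing_pt (homog 4 f) u" using pos_vE[OF f p] .
   have zu: "zcoord u = 0" using b unfolding inf_flex_def by blast
   have t: "has_type (homog 4 f) u (germ_A 4)" using inf13[of "germ_A 4" True "germ_A 2" vs u] sp u zu by simp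
   have v: "sing_pt (homog 4 f) (vs ! 1)" "zcoord (vs ! 1) \<noteq> 0" "has_type (homog 4 f) (vs ! 1) (germ_A 2)"
    using sing_ptsD(1,3,2)[OF sp, of 1] by auto
   show ?thesis by (rule one[OF cusp_ramphoid_visible[OF f b u v(1,2) t v(3)] nc[OF sl]]) auto
  qed
 qed
 ultimately show ?thesis by blast
qed

end
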